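(* Let $k$ be an algebraically closed field of characteristic zero and $G$ a finite group. Let $B\cong\mathrm{Hom}(G_{ab},\widehat G_{ab})$ be the subgroup of $\mathrm{Aut}_{Hopf}(DG)$ of automorphisms $e_g\times h\mapsto b(h)(g)\,e_g\times h$, and let $\mathrm Z^2_{inv}(G)=\mathrm Z^2_{inv}(G,k^\times)$ be the group of conjugation invariant 2-cocycles on $G$, regarded as lazy 2-cocycles on $DG^*$. (i) $B\times\mathrm Z^2_{inv}(G)$ is a subgroup of $\mathrm{Aut}_{Hopf}(DG)\ltimes\mathrm Z^2_L(DG^* )$. An element $(b,\beta)$ corresponds to the monoidal functor $\Psi(b,\beta)=(F_b,J^\beta)$ given on simple objects by $F_b(\mathcal O_g^\rho)=\mathcal O_g^{\rho*b(g)}$ (the product of $\rho$ with the restriction of the character $b(g)$ to $\mathrm{Cent}(g)$), with monoidal structure $$\mathcal O_g^{\rho*b(g)}\otimes\mathcal O_h^{\chi*b(h)}\to F_b(\mathcal O_g^\rho\otimes\mathcal O_h^\chi),\quad (s_m\otimes v)\otimes(r_n\otimes w)\mapsto\beta(g_m,h_n)\,(s_m\otimes v)\otimes(r_n\otimes w),$$ where $\{s_m\},\{r_n\}\subset G$ are choices of representatives of $G/\mathrm{Cent}(g)$ and $G/\mathrm{Cent}(h)$, and $g_m=s_mgs_m^{-1}$, $h_n=r_nhr_n^{-1}$. (ii) The subgroup $$\underline{\mathcal B}_L:=\Big\{(b,\beta)\in B\times\mathrm Z^2_{inv}(G)\ \Big|\ b(g)(h)=\frac{\beta(h,g)}{\beta(g,h)}\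 \ \forall g,h\in G\Big\}$$ of $B\times\mathrm Z^2_{inv}(G)$ consists of all elements $(b,\beta)\in B\times\mathrm Z^2_{inv}(G)$ such that $\Psi(b,\beta)$ is a braided autoequivalence. (iii) Let $B_{alt}\cong\widehat G_{ab}\wedge\widehat G_{ab}$ be the subgroup of alternating homomorphisms of $B$, i.e. those $b\in\mathrm{Hom}(G_{ab},\widehat G_{ab})$ with $b(g)(h)=b(h)(g)^{-1}$ and $b(g)(g)=1$ for all $g,h$. Then $$\underline{\mathcal B}_L\to B_{alt},\quad(b,\beta)\mapsto b$$ is a well-defined surjective group homomorphism. (iv) Let $\widetilde{\mathcal B}_L$ be the image of $\underline{\mathcal B}_L$ in $\mathrm{Out}_{Hopf}(DG)\ltimes\mathrm H^2_L(DG^* )$. Then there is a central extension $$1\to\mathrm H^2_{dist,inv}(G)\to\widetilde{\mathcal B}_L\to B_{alt}\to1,$$ where $\mathrm H^2_{dist,inv}(G)$ is the cohomology group of conjugation invariant and distinguished cocycles.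
   Context: **Basics.** $\widehat A=\mathrm{Hom}(A,k^\times)$; $G_{ab}=G/[G,G]$; $g^h=h^{-1}gh$, ${}^hg=hgh^{-1}$. $k^G=(kG)^*$ has basis $e_x$ ($e_x(y)=\delta_{x,y}$). $DG$ has basis $e_x\times y$, $(e_x\times y)(e_{x'}\times y')=e_x({}^yx')(e_x\times yy')$, $\Delta(e_x\times y)=\sum_{x_1x_2=x}(e_{x_1}\times y)\otimes(e_{x_2}\times y)$, $\epsilon(e_x\times y)=\delta_{x,1}$. $DG^*$ has dual basis $g\times e_x$ (dual to $e_g\times x$), $(x\times e_y)(x'\times e_{y'})=xx'\times e_ye_{y'}$, $\Delta(x\times e_y)=\sum_{y_1y_2=y}(x\times e_{y_1})\otimes(x^{y_1}\times e_{y_2})$. $DG\text{-mod}$ is braided by $c_{M,N}(m\otimes n)=R_2.n\otimes R_1.m$, $R=\sum_g(e_g\times1)\otimes(1\times g)$. **Simple objects.** $\mathcal O_g^\rho=kG\otimes_{k\mathrm{Cent}(g)}W$ for $g\in G$ and $\rho:\mathrm{Cent}(g)\to\mathrm{GL}(W)$ irreducible, with $(e_h\times t).(y\otimes w)=e_h((ty)g(ty)^{-1})\,(ty\otimes w)$. **Lazy cocycles.** A 2-cocycle on a Hopf algebra $K$ is a convolution invertible $\sigma:K\otimes K\to k$ with $\sigma(1,b)=\epsilon(b)=\sigma(b,1)$ and $\sigma(a_1,b_1)\sigma(a_2b_2,c)=\sigma(b_1,c_1)\sigma(a,b_2c_2)$; it is lazy if $\sigma(a_1,b_1)a_2b_2=a_1b_1\sigma(a_2,b_2)$.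 $\mathrm Z^2_L(K)$ is the group (under convolution) of lazy 2-cocycles. $\mathrm{Reg}^1_L(K)$ is the group of convolution invertible $\eta:K\to k$ with $\eta(1)=1$ and $\eta(a_1)a_2=a_1\eta(a_2)$; $\mathrm d\eta(a,b)=\eta(a_1)\eta(b_1)\eta^{-1}(a_2b_2)$; $\mathrm H^2_L(K)=\mathrm Z^2_L(K)/\mathrm d(\mathrm{Reg}^1_L(K))$. A cocycle $\sigma$ on $DG^*$ is identified with $\sigma_1\otimes\sigma_2=\sum\sigma(g\times e_x,h\times e_y)(e_g\times x)\otimes(e_h\times y)\in DG\otimes DG$. $\mathrm Z^2_{inv}(G,k^\times)$: normalized group 2-cocycles $\beta$ with $\beta(g^t,h^t)=\beta(g,h)$ for all $g,h,t\in G$; $\beta$ is regarded as the cocycle $(g\times e_x,h\times e_y)\mapsto\beta(g,h)\epsilon(e_x)\epsilon(e_y)$ on $DG^*$. **Distinguished classes.** A class $[\beta]\in\mathrm H^2(G,k^\times)$ (or a cocycle representing it) is distinguished if for all $x\in G$ and all $g\in\mathrm{Cent}(x)$ one has $\beta(g,x)=\beta(x,g)$ (independent of the representative). $\mathrm H^2_{dist,inv}(G)$ is the group of cohomology classes in $\mathrm H^2(G,k^\times)$ of cocycles that are conjugation invariant and distinguished. **Functors.** Every $\phi\in\mathrm{Aut}_{Hopf}(DG)$ is uniquely of the form $\phi(f\times g)=u(f_{(1)})b(g)\times a(f_{(2)})v(g)$ with $u\in\mathrm{End}_{Hopf}(k^G)$, Hopf maps $b:kG\to k^G$, $a:k^G\to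 kG$ and $v\in\mathrm{End}(G)$; put $\phi^\dagger(f\times g)=v^*(f_{(1)})b^*(g)\times a^*(f_{(2)})u^*(g)$ ($*$ = dual map). $\Psi(\phi,\sigma)=(F_\phi,J^\sigma)$, where $F_\phi(M)={}_\phi M$ is $M$ with $h\in DG$ acting by $\phi^\dagger(h)$, and $J^\sigma_{M,N}:{}_\phi M\otimes{}_\phi N\to{}_\phi(M\otimes N)$, $m\otimes n\mapsto\sigma_1.m\otimes\sigma_2.n$ (original actions). The group law on $\mathrm{Aut}_{Hopf}(DG)\ltimes\mathrm Z^2_L(DG^* )$ corresponds to composition of functors: $(\phi,\sigma)(\phi',\sigma')=(\phi\phi',\sigma'\cdot(\phi'^\dagger\otimes\phi'^\dagger)(\sigma))$, product in $DG\otimes DG$. $\mathrm{Out}_{Hopf}(DG)$ is $\mathrm{Aut}_{Hopf}(DG)$ modulo conjugations by group-like elements of $DG$. *)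

theory Defs
  imports
    "HOL-Computational_Algebra.Polynomial"
    "HOL-Algebra.Generated_Groups"
    "HOL-Algebra.Free_Abelian_Groups"
begin

section \<open>Coordinate spaces\<close>

text \<open>The vector space \<open>k^I\<close> on a finite set \<open>I\<close> of basis labels is the set of functions
  vanishing off \<open>I\<close>.  A linear map out of \<open>k^I\<close> is represented by the function on all of
  \<open>'i \<Rightarrow> 'k\<close> that ignores the coordinates outside \<open>I\<close>.  So linear maps have unique
  representatives and compose by \<open>\<circ>\<close>; the identity of \<open>k^I\<close> is the projection
  \<open>id_map I\<close>.\<close>

definition coords :: "'i set \<Rightarrow> ('i \<Rightarrow> 'k::zero) set" where
  "coords I = {v. \<forall>i. i \<notin> I \<longrightarrow> v i = 0}"

definition ket :: "'i \<Rightarrow> 'i \<Rightarrow> 'k::zero_neq_one" where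
  "ket i = (\<lambda>j. if j = i then 1 else 0)"

definition scl :: "'k::times \<Rightarrow> ('i \<Rightarrow> 'k) \<Rightarrow> 'i \<Rightarrow> 'k" where
  "scl c v = (\<lambda>i. c * v i)"

definition lin_ext :: "'i set \<Rightarrow> ('i \<Rightarrow> 'j \<Rightarrow> 'k::field) \<Rightarrow> ('i \<Rightarrow> 'k) \<Rightarrow> 'j \<Rightarrow> 'k" where
  "lin_ext I f = (\<lambda>v j. \<Sum>i\<in>I. v i * f i j)"

definition id_map :: "'i set \<Rightarrow> ('i \<Rightarrow> 'k::field) \<Rightarrow> 'i \<Rightarrow> 'k" where
  "id_map I = lin_ext I ket"

definition lin :: "'i set \<Rightarrow> 'j set \<Rightarrow> (('i \<Rightarrow> 'k::field) \<Rightarrow> 'j \<Rightarrow> 'k) set" where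
  "lin I J = {f. f = lin_ext I (\<lambda>i. f (ket i)) \<and> (\<forall>i\<in>I. f (ket i) \<in> coords J)}"

text \<open>Transpose \<open>k^J \<rightarrow> k^I\<close> of a linear map \<open>f : k^I \<rightarrow> k^J\<close>, where both duals carry the dual basis.\<close>

definition dual_map :: "'j set \<Rightarrow> (('i \<Rightarrow> 'k::field) \<Rightarrow> 'j \<Rightarrow> 'k) \<Rightarrow> ('j \<Rightarrow> 'k) \<Rightarrow> 'i \<Rightarrow> 'k" where
  "dual_map J f = lin_ext J (\<lambda>j i. f (ket i) j)"


section \<open>Finite-dimensional bialgebras given by structure constants\<close>

record ('i, 'k) bialg =
  basis :: "'i set"
  prd :: "'i \<Rightarrow> 'i \<Rightarrow> 'i \<Rightarrow> 'k"
  unt :: "'i \<Rightarrow> 'k"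
  cop :: "'i \<Rightarrow> 'i \<times> 'i \<Rightarrow> 'k"
  cou :: "'i \<Rightarrow> 'k"

definition bmult :: "('i, 'k::field) bialg \<Rightarrow> ('i \<Rightarrow> 'k) \<Rightarrow> ('i \<Rightarrow> 'k) \<Rightarrow> 'i \<Rightarrow> 'k" where
  "bmult H u v = (\<lambda>z. \<Sum>x\<in>basis H. \<Sum>y\<in>basis H. u x * v y * prd H x y z)"

definition bcomult :: "('i, 'k::field) bialg \<Rightarrow> ('i \<Rightarrow> 'k) \<Rightarrow> 'i \<times> 'i \<Rightarrow> 'k" where
  "bcomult H u = (\<lambda>p. \<Sum>x\<in>basis H. u x * cop H x p)"

definition bcounit :: "('i, 'k::field) bialg \<Rightarrow> ('i \<Rightarrow> 'k) \<Rightarrow> 'k" where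
  "bcounit H u = (\<Sum>x\<in>basis H. u x * cou H x)"

text \<open>The product of \<open>H \<otimes> H\<close>, and the tensor product of two linear maps on \<open>k^I\<close>.\<close>

definition tensor_mult ::
    "('i, 'k::field) bialg \<Rightarrow> ('i \<times> 'i \<Rightarrow> 'k) \<Rightarrow> ('i \<times> 'i \<Rightarrow> 'k) \<Rightarrow> 'i \<times> 'i \<Rightarrow> 'k" where
  "tensor_mult H s t = (\<lambda>(z, w). \<Sum>(x, y)\<in>basis H \<times> basis H. \<Sum>(x', y')\<in>basis H \<times> basis H.
      s (x, y) * t (x', y') * prd H x x' z * prd H y y' w)"

definition tensor_map ::
    "'i set \<Rightarrow> (('i \<Rightarrow> 'k::field) \<Rightarrow> 'j \<Rightarrow> 'k) \<Rightarrow> (('i \<Rightarrow> 'k) \<Rightarrow> 'j \<Rightarrow> 'k) \<Rightarrow>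
      ('i \<times> 'i \<Rightarrow> 'k) \<Rightarrow> 'j \<times> 'j \<Rightarrow> 'k" where
  "tensor_map I f g = lin_ext (I \<times> I) (\<lambda>(x, y) (z, w). f (ket x) z * g (ket y) w)"

text \<open>Bialgebra maps between Hopf algebras commute with the antipodes automatically.\<close>

definition hopf_map ::
    "('i, 'k::field) bialg \<Rightarrow> ('j, 'k) bialg \<Rightarrow> (('i \<Rightarrow> 'k) \<Rightarrow> 'j \<Rightarrow> 'k) \<Rightarrow> bool" where
  "hopf_map H K f \<longleftrightarrow>
     f \<in> lin (basis H) (basis K) \<and>
     f (unt H) = unt K \<and>
     (\<forall>u\<in>coords (basis H). \<forall>v\<in>coords (basis H). f (bmult H u v) = bmult K (f u) (f v)) \<and>
     (\<forall>u\<in>coords (basis H). bcounit K (f u) = bcounit H u) \<and>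
     (\<forall>u\<in>coords (basis H). bcomult K (f u) = tensor_map (basis H) f f (bcomult H u))"

definition Aut_Hopf :: "('i, 'k::field) bialg \<Rightarrow> (('i \<Rightarrow> 'k) \<Rightarrow> 'i \<Rightarrow> 'k) monoid" where
  "Aut_Hopf H =
    \<lparr>carrier = {f. hopf_map H H f \<and> bij_betw f (coords (basis H)) (coords (basis H))},
     mult = (\<circ>), one = id_map (basis H)\<rparr>"

definition group_like :: "('i, 'k::field) bialg \<Rightarrow> ('i \<Rightarrow> 'k) \<Rightarrow> bool" where
  "group_like H t \<longleftrightarrow> t \<in> coords (basis H) \<and> bcounit H t = 1 \<and>
     bcomult H t = (\<lambda>(x, y). t x * t y)"

definition Inn_Hopf :: "('i, 'k::field) bialg \<Rightarrow> (('i \<Rightarrow> 'k) \<Rightarrow> 'i \<Rightarrow> 'k) set" where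
  "Inn_Hopf H = {lin_ext (basis H) (\<lambda>i. bmult H (bmult H t (ket i)) t') | t t'.
     group_like H t \<and> t' \<in> coords (basis H) \<and> bmult H t t' = unt H \<and> bmult H t' t = unt H}"

definition Out_Hopf :: "('i, 'k::field) bialg \<Rightarrow> (('i \<Rightarrow> 'k) \<Rightarrow> 'i \<Rightarrow> 'k) set monoid" where
  "Out_Hopf H = Aut_Hopf H Mod Inn_Hopf H"


section \<open>Lazy cocycles\<close>

text \<open>Linear functionals on \<open>K\<close> and bilinear forms on \<open>K\<close> are given by their values on basis
  elements.  In particular a form on \<open>K\<close> is literally an element of \<open>K\<^sup>* \<otimes> K\<^sup>*\<close> in the dual basis.\<close>

definition conv1 :: "('i, 'k::field) bialg \<Rightarrow> ('i \<Rightarrow> 'k) \<Rightarrow> ('i \<Rightarrow> 'k) \<Rightarrow> 'i \<Rightarrow> 'k" where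
  "conv1 K \<eta> \<theta> = (\<lambda>a. if a \<in> basis K
     then \<Sum>(a1, a2)\<in>basis K \<times> basis K. cop K a (a1, a2) * \<eta> a1 * \<theta> a2 else 0)"

definition eps1 :: "('i, 'k::field) bialg \<Rightarrow> 'i \<Rightarrow> 'k" where
  "eps1 K = (\<lambda>a. if a \<in> basis K then cou K a else 0)"

definition conv2 ::
    "('i, 'k::field) bialg \<Rightarrow> ('i \<times> 'i \<Rightarrow> 'k) \<Rightarrow> ('i \<times> 'i \<Rightarrow> 'k) \<Rightarrow> 'i \<times> 'i \<Rightarrow> 'k" where
  "conv2 K \<sigma> \<tau> = (\<lambda>(a, b). if a \<in> basis K \<and> b \<in> basis K
     then \<Sum>(a1, a2)\<in>basis K \<times> basis K. \<Sum>(b1, b2)\<in>basis K \<times> basis K.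
        cop K a (a1, a2) * cop K b (b1, b2) * \<sigma> (a1, b1) * \<tau> (a2, b2)
     else 0)"

definition eps2 :: "('i, 'k::field) bialg \<Rightarrow> 'i \<times> 'i \<Rightarrow> 'k" where
  "eps2 K = (\<lambda>(a, b). eps1 K a * eps1 K b)"

definition form_at :: "('i, 'k::field) bialg \<Rightarrow> ('i \<times> 'i \<Rightarrow> 'k) \<Rightarrow> ('i \<Rightarrow> 'k) \<Rightarrow> ('i \<Rightarrow> 'k) \<Rightarrow> 'k" where
  "form_at K \<sigma> u v = (\<Sum>(x, y)\<in>basis K \<times> basis K. u x * v y * \<sigma> (x, y))"

definition cocycle2 :: "('i, 'k::field) bialg \<Rightarrow> ('i \<times> 'i \<Rightarrow> 'k) \<Rightarrow> bool" where
  "cocycle2 K \<sigma> \<longleftrightarrow>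
     \<sigma> \<in> coords (basis K \<times> basis K) \<and>
     (\<exists>\<tau>\<in>coords (basis K \<times> basis K). conv2 K \<sigma> \<tau> = eps2 K \<and> conv2 K \<tau> \<sigma> = eps2 K) \<and>
     (\<forall>b\<in>basis K. form_at K \<sigma> (unt K) (ket b) = cou K b \<and> form_at K \<sigma> (ket b) (unt K) = cou K b) \<and>
     (\<forall>a\<in>basis K. \<forall>b\<in>basis K. \<forall>c\<in>basis K.
        (\<Sum>(a1, a2)\<in>basis K \<times> basis K. \<Sum>(b1, b2)\<in>basis K \<times> basis K.
           cop K a (a1, a2) * cop K b (b1, b2) * \<sigma> (a1, b1) * form_at K \<sigma> (prd K a2 b2) (ket c))
      = (\<Sum>(b1, b2)\<in>basis K \<times> basis K. \<Sum>(c1, c2)\<in>basis K \<times> basis K.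
           cop K b (b1, b2) * cop K c (c1, c2) * \<sigma> (b1, c1) * form_at K \<sigma> (ket a) (prd K b2 c2)))"

definition lazy2 :: "('i, 'k::field) bialg \<Rightarrow> ('i \<times> 'i \<Rightarrow> 'k) \<Rightarrow> bool" where
  "lazy2 K \<sigma> \<longleftrightarrow> (\<forall>a\<in>basis K. \<forall>b\<in>basis K. \<forall>z\<in>basis K.
     (\<Sum>(a1, a2)\<in>basis K \<times> basis K. \<Sum>(b1, b2)\<in>basis K \<times> basis K.
        cop K a (a1, a2) * cop K b (b1, b2) * \<sigma> (a1, b1) * prd K a2 b2 z)
   = (\<Sum>(a1, a2)\<in>basis K \<times> basis K. \<Sum>(b1, b2)\<in>basis K \<times> basis K.
        cop K a (a1, a2) * cop K b (b1, b2) * prd K a1 b1 z * \<sigma> (a2, b2)))"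

definition Z2L :: "('i, 'k::field) bialg \<Rightarrow> ('i \<times> 'i \<Rightarrow> 'k) monoid" where
  "Z2L K = \<lparr>carrier = {\<sigma>. cocycle2 K \<sigma> \<and> lazy2 K \<sigma>}, mult = conv2 K, one = eps2 K\<rparr>"

definition conv_inverse :: "('i, 'k::field) bialg \<Rightarrow> ('i \<Rightarrow> 'k) \<Rightarrow> ('i \<Rightarrow> 'k) \<Rightarrow> bool" where
  "conv_inverse K \<eta> \<theta> \<longleftrightarrow>
     \<theta> \<in> coords (basis K) \<and> conv1 K \<eta> \<theta> = eps1 K \<and> conv1 K \<theta> \<eta> = eps1 K"

definition Reg1L :: "('i, 'k::field) bialg \<Rightarrow> ('i \<Rightarrow> 'k) set" where
  "Reg1L K = {\<eta>\<in>coords (basis K).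
     (\<exists>\<theta>. conv_inverse K \<eta> \<theta>) \<and>
     (\<Sum>x\<in>basis K. unt K x * \<eta> x) = 1 \<and>
     (\<forall>a\<in>basis K. \<forall>z\<in>basis K.
        (\<Sum>a1\<in>basis K. cop K a (a1, z) * \<eta> a1) = (\<Sum>a2\<in>basis K. cop K a (z, a2) * \<eta> a2))}"

definition lazy_coboundary :: "('i, 'k::field) bialg \<Rightarrow> ('i \<Rightarrow> 'k) \<Rightarrow> 'i \<times> 'i \<Rightarrow> 'k" where
  "lazy_coboundary K \<eta> = (\<lambda>(a, b). if a \<in> basis K \<and> b \<in> basis K
     then \<Sum>(a1, a2)\<in>basis K \<times> basis K. \<Sum>(b1, b2)\<in>basis K \<times> basis K.
        cop K a (a1, a2) * cop K b (b1, b2) * \<eta> a1 * \<eta> b1 *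
        (\<Sum>x\<in>basis K. prd K a2 b2 x * (THE \<theta>. conv_inverse K \<eta> \<theta>) x)
     else 0)"

definition B2L :: "('i, 'k::field) bialg \<Rightarrow> ('i \<times> 'i \<Rightarrow> 'k) set" where
  "B2L K = lazy_coboundary K ` Reg1L K"

definition H2L :: "('i, 'k::field) bialg \<Rightarrow> ('i \<times> 'i \<Rightarrow> 'k) set monoid" where
  "H2L K = Z2L K Mod B2L K"


section \<open>The Drinfeld double\<close>

definition kgrp :: "('g, 'm) monoid_scheme \<Rightarrow> ('g, 'k::field) bialg" where
  "kgrp G = \<lparr>basis = carrier G,
     prd = (\<lambda>x y. ket (x \<otimes>\<^bsub>G\<^esub> y)), unt = ket \<one>\<^bsub>G\<^esub>,
     cop = (\<lambda>x. ket (x, x)), cou = (\<lambda>x. 1)\<rparr>"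

text \<open>\<open>k^G\<close>: the label \<open>x\<close> stands for \<open>e_x\<close>.\<close>

definition kfun :: "('g, 'm) monoid_scheme \<Rightarrow> ('g, 'k::field) bialg" where
  "kfun G = \<lparr>basis = carrier G,
     prd = (\<lambda>x y. if x = y then ket x else (\<lambda>_. 0)),
     unt = (\<lambda>x. if x \<in> carrier G then 1 else 0),
     cop = (\<lambda>x (x1, x2). if x1 \<in> carrier G \<and> x2 \<in> carrier G \<and> x1 \<otimes>\<^bsub>G\<^esub> x2 = x then 1 else 0),
     cou = (\<lambda>x. if x = \<one>\<^bsub>G\<^esub> then 1 else 0)\<rparr>"

text \<open>\<open>DG\<close>: the label \<open>(x, y)\<close> stands for \<open>e_x \<times> y\<close>.\<close>

definition DG :: "('g, 'm) monoid_scheme \<Rightarrow> ('g \<times> 'g, 'k::field) bialg" where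
  "DG G = \<lparr>basis = carrier G \<times> carrier G,
     prd = (\<lambda>(x, y) (x', y'). if x = y \<otimes>\<^bsub>G\<^esub> x' \<otimes>\<^bsub>G\<^esub> inv\<^bsub>G\<^esub> y then ket (x, y \<otimes>\<^bsub>G\<^esub> y') else (\<lambda>_. 0)),
     unt = (\<lambda>(x, y). if x \<in> carrier G \<and> y = \<one>\<^bsub>G\<^esub> then 1 else 0),
     cop = (\<lambda>(x, y) ((x1, y1), (x2, y2)).
        if x1 \<in> carrier G \<and> x2 \<in> carrier G \<and> x1 \<otimes>\<^bsub>G\<^esub> x2 = x \<and> y1 = y \<and> y2 = y then 1 else 0),
     cou = (\<lambda>(x, y). if x = \<one>\<^bsub>G\<^esub> then 1 else 0)\<rparr>"

text \<open>\<open>DG\<^sup>*\<close>: the label \<open>(x, y)\<close> stands for \<open>x \<times> e_y\<close>, the basis element dual to \<open>e_x \<times> y\<close>.\<close>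

definition DGd :: "('g, 'm) monoid_scheme \<Rightarrow> ('g \<times> 'g, 'k::field) bialg" where
  "DGd G = \<lparr>basis = carrier G \<times> carrier G,
     prd = (\<lambda>(x, y) (x', y'). if y = y' then ket (x \<otimes>\<^bsub>G\<^esub> x', y) else (\<lambda>_. 0)),
     unt = (\<lambda>(x, y). if x = \<one>\<^bsub>G\<^esub> \<and> y \<in> carrier G then 1 else 0),
     cop = (\<lambda>(x, y) ((x1, y1), (x2, y2)).
        if y1 \<in> carrier G \<and> y2 \<in> carrier G \<and> y1 \<otimes>\<^bsub>G\<^esub> y2 = y \<and>
           x1 = x \<and> x2 = inv\<^bsub>G\<^esub> y1 \<otimes>\<^bsub>G\<^esub> x \<otimes>\<^bsub>G\<^esub> y1 then 1 else 0),
     cou = (\<lambda>(x, y). if y = \<one>\<^bsub>G\<^esub> then 1 else 0)\<rparr>"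

text \<open>\<open>R = \<Sum>\<^sub>g (e_g \<times> 1) \<otimes> (1 \<times> g)\<close> with \<open>1 \<times> g = \<Sum>\<^sub>x e_x \<times> g\<close>.\<close>

definition Rmat :: "('g, 'm) monoid_scheme \<Rightarrow> ('g \<times> 'g) \<times> ('g \<times> 'g) \<Rightarrow> 'k::field" where
  "Rmat G = (\<lambda>((g, y), (x, h)).
     if g \<in> carrier G \<and> x \<in> carrier G \<and> y = \<one>\<^bsub>G\<^esub> \<and> h = g then 1 else 0)"

text \<open>The map \<open>f \<times> g \<mapsto> u(f\<^sub>1) b(g) \<times> a(f\<^sub>2) v(g)\<close> on \<open>DG\<close>.\<close>

definition assemble ::
    "('g, 'm) monoid_scheme \<Rightarrow> (('g \<Rightarrow> 'k::field) \<Rightarrow> 'g \<Rightarrow> 'k) \<Rightarrow> (('g \<Rightarrow> 'k) \<Rightarrow> 'g \<Rightarrow> 'k) \<Rightarrow>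
     (('g \<Rightarrow> 'k) \<Rightarrow> 'g \<Rightarrow> 'k) \<Rightarrow> (('g \<Rightarrow> 'k) \<Rightarrow> 'g \<Rightarrow> 'k) \<Rightarrow> ('g \<times> 'g \<Rightarrow> 'k) \<Rightarrow> 'g \<times> 'g \<Rightarrow> 'k" where
  "assemble G u b a v = lin_ext (carrier G \<times> carrier G) (\<lambda>(x, g) (y, h).
     \<Sum>(x1, x2)\<in>carrier G \<times> carrier G. cop (kfun G) x (x1, x2) *
        bmult (kfun G) (u (ket x1)) (b (ket g)) y *
        bmult (kgrp G) (a (ket x2)) (v (ket g)) h)"

definition dagger ::
    "('g, 'm) monoid_scheme \<Rightarrow> (('g \<times> 'g \<Rightarrow> 'k::field) \<Rightarrow> 'g \<times> 'g \<Rightarrow> 'k) \<Rightarrow>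
     ('g \<times> 'g \<Rightarrow> 'k) \<Rightarrow> 'g \<times> 'g \<Rightarrow> 'k" where
  "dagger G \<phi> = (THE \<psi>. \<exists>u b a v0 v.
     hopf_map (kfun G) (kfun G) u \<and> hopf_map (kgrp G) (kfun G) b \<and>
     hopf_map (kfun G) (kgrp G) a \<and> v0 \<in> hom G G \<and>
     v = lin_ext (carrier G) (\<lambda>g. ket (v0 g)) \<and>
     \<phi> = assemble G u b a v \<and>
     \<psi> = assemble G (dual_map (carrier G) v) (dual_map (carrier G) b)
                    (dual_map (carrier G) a) (dual_map (carrier G) u))"

type_synonym ('g, 'k) dg_aut = "('g \<times> 'g \<Rightarrow> 'k) \<Rightarrow> 'g \<times> 'g \<Rightarrow> 'k"
type_synonym ('g, 'k) dg_form = "('g \<times> 'g) \<times> ('g \<times> 'g) \<Rightarrow> 'k"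

definition AutZ :: "('g, 'm) monoid_scheme \<Rightarrow> (('g, 'k::field) dg_aut \<times> ('g, 'k) dg_form) monoid" where
  "AutZ G = \<lparr>carrier = carrier (Aut_Hopf (DG G)) \<times> carrier (Z2L (DGd G)),
     mult = (\<lambda>(\<phi>, \<sigma>) (\<phi>', \<sigma>'). (\<phi> \<otimes>\<^bsub>Aut_Hopf (DG G)\<^esub> \<phi>',
        tensor_mult (DG G) \<sigma>'
          (tensor_map (carrier G \<times> carrier G) (dagger G \<phi>') (dagger G \<phi>') \<sigma>))),
     one = (\<one>\<^bsub>Aut_Hopf (DG G)\<^esub>, \<one>\<^bsub>Z2L (DGd G)\<^esub>)\<rparr>"

text \<open>\<open>Out \<ltimes> H\<^sup>2\<^sub>L\<close>: the multiplication of \<open>AutZ\<close> carried out on all representatives of the cosets,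
  as in \<^const>\<open>FactGroup\<close>.\<close>

definition OutH :: "('g, 'm) monoid_scheme \<Rightarrow>
    (('g, 'k::field) dg_aut set \<times> ('g, 'k) dg_form set) monoid" where
  "OutH G = \<lparr>carrier = carrier (Out_Hopf (DG G)) \<times> carrier (H2L (DGd G)),
     mult = (\<lambda>(\<Phi>, \<Sigma>) (\<Phi>', \<Sigma>'). (\<Phi> \<otimes>\<^bsub>Out_Hopf (DG G)\<^esub> \<Phi>',
        {tensor_mult (DG G) \<sigma>'
           (tensor_map (carrier G \<times> carrier G) (dagger G \<phi>') (dagger G \<phi>') \<sigma>) | \<phi>' \<sigma> \<sigma>'.
           \<phi>' \<in> \<Phi>' \<and> \<sigma> \<in> \<Sigma> \<and> \<sigma>' \<in> \<Sigma>'})),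
     one = (\<one>\<^bsub>Out_Hopf (DG G)\<^esub>, \<one>\<^bsub>H2L (DGd G)\<^esub>)\<rparr>"

definition to_OutH :: "('g, 'm) monoid_scheme \<Rightarrow> ('g, 'k::field) dg_aut \<times> ('g, 'k) dg_form \<Rightarrow>
    ('g, 'k) dg_aut set \<times> ('g, 'k) dg_form set" where
  "to_OutH G = (\<lambda>(\<phi>, \<sigma>).
     (Inn_Hopf (DG G) #>\<^bsub>Aut_Hopf (DG G)\<^esub> \<phi>, B2L (DGd G) #>\<^bsub>Z2L (DGd G)\<^esub> \<sigma>))"


section \<open>Braided monoidal categories and functors\<close>

text \<open>Only the data needed to say what a braided monoidal (auto)equivalence is.  The tensor
  product of morphisms takes the two source objects as additional arguments.\<close>

record ('o, 'a) bmcat =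
  Obj :: "'o set"
  Hom :: "'o \<Rightarrow> 'o \<Rightarrow> 'a set"
  Idm :: "'o \<Rightarrow> 'a"
  Cmp :: "'a \<Rightarrow> 'a \<Rightarrow> 'a"
  TUnit :: "'o"
  TObj :: "'o \<Rightarrow> 'o \<Rightarrow> 'o"
  TMor :: "'o \<Rightarrow> 'o \<Rightarrow> 'a \<Rightarrow> 'a \<Rightarrow> 'a"
  Assoc :: "'o \<Rightarrow> 'o \<Rightarrow> 'o \<Rightarrow> 'a"
  Braid :: "'o \<Rightarrow> 'o \<Rightarrow> 'a"

definition Iso :: "('o, 'a) bmcat \<Rightarrow> 'o \<Rightarrow> 'o \<Rightarrow> 'a set" where
  "Iso C A B = {f. A \<in> Obj C \<and> B \<in> Obj C \<and> f \<in> Hom C A B \<and>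
     (\<exists>g\<in>Hom C B A. Cmp C g f = Idm C A \<and> Cmp C f g = Idm C B)}"

text \<open>An endofunctor together with a tensor structure \<open>J\<^bsub>A,B\<^esub> : F A \<otimes> F B \<rightarrow> F (A \<otimes> B)\<close>.\<close>

record ('o, 'a) tfunctor =
  FObj :: "'o \<Rightarrow> 'o"
  FMor :: "'o \<Rightarrow> 'o \<Rightarrow> 'a \<Rightarrow> 'a"
  FTen :: "'o \<Rightarrow> 'o \<Rightarrow> 'a"

definition endofunctor :: "('o, 'a) bmcat \<Rightarrow> ('o, 'a) tfunctor \<Rightarrow> bool" where
  "endofunctor C F \<longleftrightarrow>
     (\<forall>A\<in>Obj C. FObj F A \<in> Obj C \<and> FMor F A A (Idm C A) = Idm C (FObj F A)) \<and>
     (\<forall>A\<in>Obj C. \<forall>B\<in>Obj C. \<forall>f\<in>Hom C A B. FMor F A B f \<in> Hom C (FObj F A) (FObj F B)) \<and>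
     (\<forall>A\<in>Obj C. \<forall>B\<in>Obj C. \<forall>D\<in>Obj C. \<forall>f\<in>Hom C A B. \<forall>g\<in>Hom C B D.
        FMor F A D (Cmp C g f) = Cmp C (FMor F B D g) (FMor F A B f))"

text \<open>The unit isomorphism is not part of the data: it is determined up to the choice of an
  isomorphism \<open>F 1 \<cong> 1\<close>, whose existence is required.\<close>

definition monoidal_functor :: "('o, 'a) bmcat \<Rightarrow> ('o, 'a) tfunctor \<Rightarrow> bool" where
  "monoidal_functor C F \<longleftrightarrow>
     endofunctor C F \<and>
     Iso C (TUnit C) (FObj F (TUnit C)) \<noteq> {} \<and>
     (\<forall>A\<in>Obj C. \<forall>B\<in>Obj C.
        FTen F A B \<in> Iso C (TObj C (FObj F A) (FObj F B)) (FObj F (TObj C A B))) \<and>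
     (\<forall>A\<in>Obj C. \<forall>A'\<in>Obj C. \<forall>B\<in>Obj C. \<forall>B'\<in>Obj C. \<forall>f\<in>Hom C A A'. \<forall>g\<in>Hom C B B'.
        Cmp C (FTen F A' B') (TMor C (FObj F A) (FObj F B) (FMor F A A' f) (FMor F B B' g)) =
        Cmp C (FMor F (TObj C A B) (TObj C A' B') (TMor C A B f g)) (FTen F A B)) \<and>
     (\<forall>A\<in>Obj C. \<forall>B\<in>Obj C. \<forall>D\<in>Obj C.
        Cmp C (FMor F (TObj C (TObj C A B) D) (TObj C A (TObj C B D)) (Assoc C A B D))
          (Cmp C (FTen F (TObj C A B) D)
            (TMor C (TObj C (FObj F A) (FObj F B)) (FObj F D) (FTen F A B) (Idm C (FObj F D)))) =
        Cmp C (FTen F A (TObj C B D))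
          (Cmp C
            (TMor C (FObj F A) (TObj C (FObj F B) (FObj F D)) (Idm C (FObj F A)) (FTen F B D))
            (Assoc C (FObj F A) (FObj F B) (FObj F D))))"

definition equivalence :: "('o, 'a) bmcat \<Rightarrow> ('o, 'a) tfunctor \<Rightarrow> bool" where
  "equivalence C F \<longleftrightarrow>
     (\<forall>A\<in>Obj C. \<forall>B\<in>Obj C. bij_betw (FMor F A B) (Hom C A B) (Hom C (FObj F A) (FObj F B))) \<and>
     (\<forall>B\<in>Obj C. \<exists>A\<in>Obj C. Iso C (FObj F A) B \<noteq> {})"

definition braided :: "('o, 'a) bmcat \<Rightarrow> ('o, 'a) tfunctor \<Rightarrow> bool" where
  "braided C F \<longleftrightarrow> (\<forall>A\<in>Obj C. \<forall>B\<in>Obj C.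
     Cmp C (FTen F B A) (Braid C (FObj F A) (FObj F B)) =
     Cmp C (FMor F (TObj C A B) (TObj C B A) (Braid C A B)) (FTen F A B))"

definition braided_autoequivalence :: "('o, 'a) bmcat \<Rightarrow> ('o, 'a) tfunctor \<Rightarrow> bool" where
  "braided_autoequivalence C F \<longleftrightarrow> monoidal_functor C F \<and> equivalence C F \<and> braided C F"


section \<open>The category of finite-dimensional modules\<close>

text \<open>The underlying space of a module is \<open>k^I\<close> for a finite set \<open>I\<close> of labels.  The
  labels come from a fixed infinite supply closed under pairing, so that the tensor product of
  \<open>k^I\<close> and \<open>k^J\<close> is \<open>k^(Tens ` (I \<times> J))\<close>; every finite-dimensional module is isomorphic to such
  a module.\<close>

datatype 'g label = Triv | Atom 'g nat | Tens "'g label" "'g label"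

record ('l, 'h, 'k) hmodule =
  labels :: "'l set"
  act :: "'h \<Rightarrow> ('l \<Rightarrow> 'k) \<Rightarrow> 'l \<Rightarrow> 'k"

type_synonym ('g, 'k) dgmod = "('g label, 'g \<times> 'g, 'k) hmodule"
type_synonym ('g, 'k) dgmor = "('g label \<Rightarrow> 'k) \<Rightarrow> 'g label \<Rightarrow> 'k"

text \<open>Action of an arbitrary element of \<open>H\<close>; the field \<^const>\<open>act\<close> gives the action of basis elements.\<close>

definition vact ::
    "('h, 'k::field) bialg \<Rightarrow> ('l, 'h, 'k) hmodule \<Rightarrow> ('h \<Rightarrow> 'k) \<Rightarrow> ('l \<Rightarrow> 'k) \<Rightarrow> 'l \<Rightarrow> 'k" where
  "vact H M h = (\<lambda>v l. \<Sum>p\<in>basis H. h p * act M p v l)"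

definition is_module :: "('h, 'k::field) bialg \<Rightarrow> ('l, 'h, 'k) hmodule \<Rightarrow> bool" where
  "is_module H M \<longleftrightarrow> finite (labels M) \<and>
     (\<forall>p\<in>basis H. act M p \<in> lin (labels M) (labels M)) \<and>
     vact H M (unt H) = id_map (labels M) \<and>
     (\<forall>p\<in>basis H. \<forall>q\<in>basis H. act M p \<circ> act M q = vact H M (prd H p q))"

definition pairs :: "'g label set \<Rightarrow> 'g label set \<Rightarrow> 'g label set" where
  "pairs I J = {Tens i j | i j. i \<in> I \<and> j \<in> J}"

definition tens :: "('g label \<Rightarrow> 'k::field) \<Rightarrow> ('g label \<Rightarrow> 'k) \<Rightarrow> 'g label \<Rightarrow> 'k" where
  "tens u v = (\<lambda>l. case l of Tens i j \<Rightarrow> u i * v j | _ \<Rightarrow> 0)"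

definition on_pairs :: "('g label \<Rightarrow> 'g label \<Rightarrow> 'l \<Rightarrow> 'k::field) \<Rightarrow> 'g label \<Rightarrow> 'l \<Rightarrow> 'k" where
  "on_pairs f = (\<lambda>l. case l of Tens i j \<Rightarrow> f i j | _ \<Rightarrow> (\<lambda>_. 0))"

text \<open>Action of an element of \<open>H \<otimes> H\<close> on \<open>M \<otimes> N\<close>.\<close>

definition act2 ::
    "('h, 'k::field) bialg \<Rightarrow> ('g label, 'h, 'k) hmodule \<Rightarrow> ('g label, 'h, 'k) hmodule \<Rightarrow>
     ('h \<times> 'h \<Rightarrow> 'k) \<Rightarrow> ('g label \<Rightarrow> 'k) \<Rightarrow> 'g label \<Rightarrow> 'k" where
  "act2 H M N \<sigma> = lin_ext (pairs (labels M) (labels N)) (on_pairs (\<lambda>i j l.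
     \<Sum>(p, q)\<in>basis H \<times> basis H. \<sigma> (p, q) * tens (act M p (ket i)) (act N q (ket j)) l))"

definition mod_cat :: "('h, 'k::field) bialg \<Rightarrow> ('h \<times> 'h \<Rightarrow> 'k) \<Rightarrow>
    (('g label, 'h, 'k) hmodule, ('g label \<Rightarrow> 'k) \<Rightarrow> 'g label \<Rightarrow> 'k) bmcat" where
  "mod_cat H R = \<lparr>
     Obj = {M. is_module H M},
     Hom = (\<lambda>M N. {f \<in> lin (labels M) (labels N). \<forall>p\<in>basis H. f \<circ> act M p = act N p \<circ> f}),
     Idm = (\<lambda>M. id_map (labels M)),
     Cmp = (\<circ>),
     TUnit = \<lparr>labels = {Triv}, act = (\<lambda>p. lin_ext {Triv} (\<lambda>l. scl (cou H p) (ket l)))\<rparr>,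
     TObj = (\<lambda>M N. \<lparr>labels = pairs (labels M) (labels N), act = (\<lambda>p. act2 H M N (cop H p))\<rparr>),
     TMor = (\<lambda>M N f g. lin_ext (pairs (labels M) (labels N))
        (on_pairs (\<lambda>i j. tens (f (ket i)) (g (ket j))))),
     Assoc = (\<lambda>L M N. lin_ext (pairs (pairs (labels L) (labels M)) (labels N))
        (on_pairs (\<lambda>l k. on_pairs (\<lambda>i j. ket (Tens i (Tens j k))) l))),
     Braid = (\<lambda>M N. lin_ext (pairs (labels M) (labels N)) (on_pairs (\<lambda>i j l.
        \<Sum>(p, q)\<in>basis H \<times> basis H. R (p, q) * tens (act N q (ket j)) (act M p (ket i)) l)))\<rparr>"

definition DGmod :: "('g, 'm) monoid_scheme \<Rightarrow> (('g, 'k::field) dgmod, ('g, 'k) dgmor) bmcat" where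
  "DGmod G = mod_cat (DG G) (Rmat G)"

definition Psi :: "('g, 'm) monoid_scheme \<Rightarrow> ('g, 'k::field) dg_aut \<times> ('g, 'k) dg_form \<Rightarrow>
    (('g, 'k) dgmod, ('g, 'k) dgmor) tfunctor" where
  "Psi G = (\<lambda>(\<phi>, \<sigma>). \<lparr>
     FObj = (\<lambda>M. \<lparr>labels = labels M, act = (\<lambda>p. vact (DG G) M (dagger G \<phi> (ket p)))\<rparr>),
     FMor = (\<lambda>M N f. f),
     FTen = (\<lambda>M N. act2 (DG G) M N \<sigma>)\<rparr>)"


section \<open>Simple objects\<close>

definition Cent :: "('g, 'm) monoid_scheme \<Rightarrow> 'g \<Rightarrow> 'g set" where
  "Cent G g = {t \<in> carrier G. t \<otimes>\<^bsub>G\<^esub> g = g \<otimes>\<^bsub>G\<^esub> t}"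

text \<open>Irreducible representations of a subgroup \<open>C\<close> on \<open>W = k^d\<close>.\<close>

definition irrep :: "('g, 'm) monoid_scheme \<Rightarrow> 'g set \<Rightarrow> nat \<Rightarrow>
    ('g \<Rightarrow> (nat \<Rightarrow> 'k::field) \<Rightarrow> nat \<Rightarrow> 'k) \<Rightarrow> bool" where
  "irrep G C d \<rho> \<longleftrightarrow>
     (\<forall>t\<in>C. \<rho> t \<in> lin {..<d} {..<d}) \<and>
     \<rho> \<one>\<^bsub>G\<^esub> = id_map {..<d} \<and>
     (\<forall>s\<in>C. \<forall>t\<in>C. \<rho> (s \<otimes>\<^bsub>G\<^esub> t) = \<rho> s \<circ> \<rho> t) \<and>
     d > 0 \<and>
     (\<forall>U. U \<subseteq> coords {..<d} \<and> (\<lambda>_. 0) \<in> U \<and>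
          (\<forall>u\<in>U. \<forall>v\<in>U. (\<lambda>i. u i + v i) \<in> U) \<and> (\<forall>c. \<forall>u\<in>U. scl c u \<in> U) \<and>
          (\<forall>t\<in>C. \<forall>u\<in>U. \<rho> t u \<in> U)
        \<longrightarrow> U = {\<lambda>_. 0} \<or> U = coords {..<d})"

definition coset_reps :: "('g, 'm) monoid_scheme \<Rightarrow> 'g set \<Rightarrow> 'g set \<Rightarrow> bool" where
  "coset_reps G C S \<longleftrightarrow> S \<subseteq> carrier G \<and>
     (\<forall>y\<in>carrier G. \<exists>!s. s \<in> S \<and> inv\<^bsub>G\<^esub> s \<otimes>\<^bsub>G\<^esub> y \<in> C)"

text \<open>With \<open>S\<close> representing \<open>G/Cent(g)\<close>, the space \<open>kG \<otimes>\<^bsub>kCent(g)\<^esub> k^d\<close> has the basis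
  \<open>s \<otimes> w_j\<close> (\<open>s \<in> S\<close>, \<open>j < d\<close>), labelled \<open>Atom s j\<close>; for general \<open>y = s c\<close> with \<open>c \<in> Cent(g)\<close> the
  vector \<open>y \<otimes> w\<close> is \<open>s \<otimes> \<rho>(c) w\<close>.\<close>

definition itens :: "('g, 'm) monoid_scheme \<Rightarrow> 'g \<Rightarrow> nat \<Rightarrow>
    ('g \<Rightarrow> (nat \<Rightarrow> 'k::field) \<Rightarrow> nat \<Rightarrow> 'k) \<Rightarrow> 'g set \<Rightarrow> 'g \<Rightarrow> (nat \<Rightarrow> 'k) \<Rightarrow> 'g label \<Rightarrow> 'k" where
  "itens G g d \<rho> S y w = (\<lambda>l. case l of
      Atom s j \<Rightarrow> if s \<in> S \<and> j < d \<and> inv\<^bsub>G\<^esub> s \<otimes>\<^bsub>G\<^esub> y \<in> Cent G g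
                  then \<rho> (inv\<^bsub>G\<^esub> s \<otimes>\<^bsub>G\<^esub> y) w j else 0
    | _ \<Rightarrow> 0)"

definition conj_by :: "('g, 'm) monoid_scheme \<Rightarrow> 'g \<Rightarrow> 'g \<Rightarrow> 'g" where
  "conj_by G s g = s \<otimes>\<^bsub>G\<^esub> g \<otimes>\<^bsub>G\<^esub> inv\<^bsub>G\<^esub> s"

definition simple_obj :: "('g, 'm) monoid_scheme \<Rightarrow> 'g \<Rightarrow> nat \<Rightarrow>
    ('g \<Rightarrow> (nat \<Rightarrow> 'k::field) \<Rightarrow> nat \<Rightarrow> 'k) \<Rightarrow> 'g set \<Rightarrow> ('g, 'k) dgmod" where
  "simple_obj G g d \<rho> S = \<lparr>
     labels = {Atom s j | s j. s \<in> S \<and> j < d},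
     act = (\<lambda>(h, t). lin_ext {Atom s j | s j. s \<in> S \<and> j < d} (\<lambda>l. case l of
        Atom y j \<Rightarrow> if h = conj_by G (t \<otimes>\<^bsub>G\<^esub> y) g then itens G g d \<rho> S (t \<otimes>\<^bsub>G\<^esub> y) (ket j) else (\<lambda>_. 0)
      | _ \<Rightarrow> (\<lambda>_. 0)))\<rparr>"


section \<open>Characters and group cohomology\<close>

definition kstar :: "'k::field monoid" where
  "kstar = \<lparr>carrier = UNIV - {0}, mult = (*), one = 1\<rparr>"

definition hom_group :: "('a, 'm) monoid_scheme \<Rightarrow> ('b, 'n) monoid_scheme \<Rightarrow> ('a \<Rightarrow> 'b) monoid" where
  "hom_group A C = \<lparr>carrier = hom A C \<inter> extensional (carrier A),
     mult = (\<lambda>f g. restrict (\<lambda>x. f x \<otimes>\<^bsub>C\<^esub> g x) (carrier A)),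
     one = restrict (\<lambda>x. \<one>\<^bsub>C\<^esub>) (carrier A)\<rparr>"

definition dual_group :: "('a, 'm) monoid_scheme \<Rightarrow> ('a \<Rightarrow> 'k::field) monoid" where
  "dual_group A = hom_group A kstar"

definition Gab :: "('g, 'm) monoid_scheme \<Rightarrow> 'g set monoid" where
  "Gab G = G Mod derived G (carrier G)"

text \<open>\<open>A \<wedge> A\<close> as the free abelian group on \<open>A \<times> A\<close> modulo bilinearity and \<open>a \<wedge> a = 0\<close>.\<close>

definition ext_square_rel :: "('a, 'm) monoid_scheme \<Rightarrow> ('a \<times> 'a \<Rightarrow>\<^sub>0 int) set" where
  "ext_square_rel A =
     {frag_of (a \<otimes>\<^bsub>A\<^esub> a', c) - frag_of (a, c) - frag_of (a', c) | a a' c.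
        a \<in> carrier A \<and> a' \<in> carrier A \<and> c \<in> carrier A} \<union>
     {frag_of (c, a \<otimes>\<^bsub>A\<^esub> a') - frag_of (c, a) - frag_of (c, a') | a a' c.
        a \<in> carrier A \<and> a' \<in> carrier A \<and> c \<in> carrier A} \<union>
     {frag_of (a, a) | a. a \<in> carrier A}"

definition ext_square :: "('a, 'm) monoid_scheme \<Rightarrow> ('a \<times> 'a \<Rightarrow>\<^sub>0 int) set monoid" where
  "ext_square A = (let F = free_Abelian_group (carrier A \<times> carrier A)
     in F Mod generate F (ext_square_rel A))"

definition Z2 :: "('g, 'm) monoid_scheme \<Rightarrow> ('g \<times> 'g \<Rightarrow> 'k::field) monoid" where
  "Z2 G = \<lparr>carrier = {\<beta> \<in> carrier G \<times> carrier G \<rightarrow>\<^sub>E UNIV - {0}.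
       (\<forall>g\<in>carrier G. \<beta> (\<one>\<^bsub>G\<^esub>, g) = 1 \<and> \<beta> (g, \<one>\<^bsub>G\<^esub>) = 1) \<and>
       (\<forall>g\<in>carrier G. \<forall>h\<in>carrier G. \<forall>t\<in>carrier G.
          \<beta> (g, h) * \<beta> (g \<otimes>\<^bsub>G\<^esub> h, t) = \<beta> (h, t) * \<beta> (g, h \<otimes>\<^bsub>G\<^esub> t))},
     mult = (\<lambda>\<beta> \<gamma>. restrict (\<lambda>p. \<beta> p * \<gamma> p) (carrier G \<times> carrier G)),
     one = restrict (\<lambda>p. 1) (carrier G \<times> carrier G)\<rparr>"

definition B2 :: "('g, 'm) monoid_scheme \<Rightarrow> ('g \<times> 'g \<Rightarrow> 'k::field) set" where
  "B2 G = {restrict (\<lambda>(g, h). \<nu> g * \<nu> h / \<nu> (g \<otimes>\<^bsub>G\<^esub> h)) (carrier G \<times> carrier G) | \<nu>.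
     \<nu> \<in> carrier G \<rightarrow> UNIV - {0} \<and> \<nu> \<one>\<^bsub>G\<^esub> = 1}"

definition H2 :: "('g, 'm) monoid_scheme \<Rightarrow> ('g \<times> 'g \<Rightarrow> 'k::field) set monoid" where
  "H2 G = Z2 G Mod B2 G"

definition Z2inv :: "('g, 'm) monoid_scheme \<Rightarrow> ('g \<times> 'g \<Rightarrow> 'k::field) monoid" where
  "Z2inv G = (Z2 G)\<lparr>carrier := {\<beta> \<in> carrier (Z2 G).
     \<forall>g\<in>carrier G. \<forall>h\<in>carrier G. \<forall>t\<in>carrier G.
       \<beta> (inv\<^bsub>G\<^esub> t \<otimes>\<^bsub>G\<^esub> g \<otimes>\<^bsub>G\<^esub> t, inv\<^bsub>G\<^esub> t \<otimes>\<^bsub>G\<^esub> h \<otimes>\<^bsub>G\<^esub> t) = \<beta> (g, h)}\<rparr>"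

definition distinguished :: "('g, 'm) monoid_scheme \<Rightarrow> ('g \<times> 'g \<Rightarrow> 'k::field) \<Rightarrow> bool" where
  "distinguished G \<beta> \<longleftrightarrow> (\<forall>x\<in>carrier G. \<forall>g\<in>Cent G x. \<beta> (g, x) = \<beta> (x, g))"

definition H2distinv :: "('g, 'm) monoid_scheme \<Rightarrow> ('g \<times> 'g \<Rightarrow> 'k::field) set monoid" where
  "H2distinv G = (H2 G)\<lparr>carrier :=
     {B2 G #>\<^bsub>Z2 G\<^esub> \<beta> | \<beta>. \<beta> \<in> carrier (Z2inv G) \<and> distinguished G \<beta>}\<rparr>"


section \<open>The groups of the proposition\<close>

definition Hom_ab :: "('g, 'm) monoid_scheme \<Rightarrow> ('g set \<Rightarrow> 'g set \<Rightarrow> 'k::field) monoid" where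
  "Hom_ab G = hom_group (Gab G) (dual_group (Gab G))"

text \<open>\<open>b(g)(h)\<close> for group elements \<open>g\<close>, \<open>h\<close>.\<close>

definition ev :: "('g, 'm) monoid_scheme \<Rightarrow> ('g set \<Rightarrow> 'g set \<Rightarrow> 'k::field) \<Rightarrow> 'g \<Rightarrow> 'g \<Rightarrow> 'k" where
  "ev G b g h = b (derived G (carrier G) #>\<^bsub>G\<^esub> g) (derived G (carrier G) #>\<^bsub>G\<^esub> h)"

definition aut_of :: "('g, 'm) monoid_scheme \<Rightarrow> ('g set \<Rightarrow> 'g set \<Rightarrow> 'k::field) \<Rightarrow> ('g, 'k) dg_aut" where
  "aut_of G b = lin_ext (carrier G \<times> carrier G) (\<lambda>(g, h). scl (ev G b h g) (ket (g, h)))"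

definition form_of :: "('g, 'm) monoid_scheme \<Rightarrow> ('g \<times> 'g \<Rightarrow> 'k::field) \<Rightarrow> ('g, 'k) dg_form" where
  "form_of G \<beta> = (\<lambda>((g, x), (h, y)).
     if g \<in> carrier G \<and> h \<in> carrier G \<and> x \<in> carrier G \<and> y \<in> carrier G
     then \<beta> (g, h) * cou (kfun G) x * cou (kfun G) y else 0)"

definition Bsub :: "('g, 'm) monoid_scheme \<Rightarrow> ('g, 'k::field) dg_aut set" where
  "Bsub G = aut_of G ` carrier (Hom_ab G)"

definition Zhat :: "('g, 'm) monoid_scheme \<Rightarrow> ('g, 'k::field) dg_form set" where
  "Zhat G = form_of G ` carrier (Z2inv G)"

definition BL :: "('g, 'm) monoid_scheme \<Rightarrow> (('g, 'k::field) dg_aut \<times> ('g, 'k) dg_form) set" where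
  "BL G = {(aut_of G b, form_of G \<beta>) | b \<beta>.
     b \<in> carrier (Hom_ab G) \<and> \<beta> \<in> carrier (Z2inv G) \<and>
     (\<forall>g\<in>carrier G. \<forall>h\<in>carrier G. ev G b g h = \<beta> (h, g) / \<beta> (g, h))}"

definition Balt :: "('g, 'm) monoid_scheme \<Rightarrow> ('g, 'k::field) dg_aut set" where
  "Balt G = {aut_of G b | b. b \<in> carrier (Hom_ab G) \<and>
     (\<forall>g\<in>carrier G. \<forall>h\<in>carrier G. ev G b g h = inverse (ev G b h g) \<and> ev G b g g = 1)}"

definition BLtilde :: "('g, 'm) monoid_scheme \<Rightarrow>
    (('g, 'k::field) dg_aut set \<times> ('g, 'k) dg_form set) set" where
  "BLtilde G = to_OutH G ` BL G"

definition central_extension ::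
    "('a, 'm) monoid_scheme \<Rightarrow> ('b, 'n) monoid_scheme \<Rightarrow> ('c, 'l) monoid_scheme \<Rightarrow>
     ('a \<Rightarrow> 'b) \<Rightarrow> ('b \<Rightarrow> 'c) \<Rightarrow> bool" where
  "central_extension A E Q \<iota> \<pi> \<longleftrightarrow>
     group A \<and> group E \<and> group Q \<and>
     \<iota> \<in> hom A E \<and> inj_on \<iota> (carrier A) \<and>
     \<pi> \<in> hom E Q \<and> \<pi> ` carrier E = carrier Q \<and>
     \<iota> ` carrier A = kernel E Q \<pi> \<and>
     (\<forall>a\<in>carrier A. \<forall>x\<in>carrier E. \<iota> a \<otimes>\<^bsub>E\<^esub> x = x \<otimes>\<^bsub>E\<^esub> \<iota> a)"

end

theory Submission
  imports Defs "HOL-Algebra.Multiplicative_Group"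
begin

text \<open>
  A pair \<open>(b, \<beta>)\<close> acts through the \<open>G\<close>-grading of \<open>DG\<close>-modules: the functor multiplies the action of
  \<open>e_x \<times> y\<close> by \<open>b(x)(y)\<close>, and its tensor structure is multiplication by \<open>\<beta>(g, h)\<close> on vectors of
  degrees \<open>g\<close> and \<open>h\<close>.  Modules are spanned by homogeneous vectors, so all coherence conditions become
  identities between scalars.  The braiding condition reads \<open>b(h)(g) \<beta>(h, g) = \<beta>(g, h)\<close>: the form \<open>b\<close> is
  the antisymmetrisation of \<open>\<beta>\<close>.  Every alternating form on a finite abelian group is the
  antisymmetrisation of a bicharacter, by splitting off cyclic factors of maximal order; this gives
  surjectivity onto \<open>B_alt\<close>.

  Modulo inner automorphisms, which only conjugate by elements of \<open>G\<close>, the form \<open>b\<close> is still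
  determined, so the kernel of the projection to \<open>B_alt\<close> consists of the classes of symmetric \<open>\<beta>\<close>.
  A distinguished invariant cocycle becomes symmetric after twisting by \<open>d\<nu>\<close> for a suitable function \<open>\<nu>\<close>
  that scales by a character along each conjugacy class.  A symmetric coboundary \<open>d\<nu>\<close> has a class function \<open>\<nu>\<close>, hence
  comes from a central element of \<open>DG\<close>; and an invariant \<open>\<beta>\<close> that is a lazy coboundary is an ordinary
  coboundary.  So the kernel is \<open>H\<^sup>2_dist,inv\<close>.
\<close>

section \<open>Characters of finite abelian groups\<close>

text \<open>\<open>AutZ\<close> and \<open>OutH\<close> are used as bare monoid records, while
  \<open>subgroup\<close> refers to \<open>m_inv\<close>, a definite description over the whole
  carrier. Inverses must therefore be shown unique among all pairs, also those outside the subgroups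
  of interest; \<open>inv_AutZ\<close> and \<open>OutH_inverse_unique\<close> do this from the few
  products that are under control. These are tractable because convolution of forms on the dual of
  DG is multiplication in DG \<otimes> DG: lazy functionals become central elements, lazy
  coboundaries become (\<eta> \<otimes> \<eta>) \<Delta>(\<theta>) with \<theta> inverse to \<eta>,
  and the dagger of a bicharacter automorphism fixes the element of an invariant \<beta>, so that
  the semidirect product becomes direct on the pairs concerned.

  In general the quotient \<beta>(h, g) / \<beta>(g, h) is multiplicative only along centralisers.
  Conjugation invariance extends this to all of G and so produces a bicharacter. The dagger is a
  definite description as well, hence the components u, b, a, v of an automorphism have to be
  recovered from it before any dagger can be computed.\<close>

lemma kstar_simps [simp]:
  "carrier kstar = UNIV - {0}" "x \<otimes>\<^bsub>kstar\<^esub> y = x * y" "\<one>\<^bsub>kstar\<^esub> = 1"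
  by (auto simp: kstar_def)

lemma comm_group_kstar: "comm_group (kstar :: 'k::field monoid)"
proof (rule comm_groupI)
  show "\<exists>y\<in>carrier kstar. y \<otimes>\<^bsub>kstar\<^esub> x = \<one>\<^bsub>kstar\<^esub>" if "x \<in> carrier kstar" for x :: 'k
    using that by (intro bexI[of _ "inverse x"]) auto
qed auto

lemma kstar_pow [simp]: "x [^]\<^bsub>kstar\<^esub> (n::nat) = x ^ n"
  by (induction n) (auto simp: nat_pow_def kstar_def)

section \<open>Roots of unity in k and elements of maximal order\<close>

lemma card_roots_of_unity:
  assumes "n > 0"
  shows "card {x::'k::{alg_closed_field, field_char_0}. x ^ n = 1} = n"
proof -
  define p :: "'k poly" where "p = Polynomial.monom 1 n - 1"
  have cn: "Polynomial.coeff p n = 1" using assms by (simp add: p_def)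
  hence p0: "p \<noteq> 0" by auto
  have deg: "degree p = n"
    using assms degree_add_eq_left[of "- 1" "Polynomial.monom 1 n :: 'k poly"]
    by (simp add: p_def degree_monom_eq)
  have poly: "poly p x = x ^ n - 1" for x by (simp add: p_def poly_monom)
  have pd: "poly (pderiv p) x = of_nat n * x ^ (n - 1)" for x
    by (simp add: p_def pderiv_diff pderiv_monom poly_monom)
  obtain A where A: "size A = degree p" "p = Polynomial.smult (lead_coeff p) (\<Prod>x\<in>#A. [:-x, 1:])"
    using alg_closed_imp_factorization[OF p0] by auto
  have root: "x ^ n = 1 \<longleftrightarrow> x \<in># A" for x
  proof -
    have "poly p x = lead_coeff p * (\<Prod>y\<in>#A. x - y)"
      by (subst A(2)) (simp add: poly_prod_mset image_mset.compositionality o_def)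
    hence "poly p x = 0 \<longleftrightarrow> x \<in># A" using p0 by (auto simp: prod_mset_zero_iff)
    thus ?thesis by (simp add: poly)
  qed
  \<comment> \<open>A double root would also be a root of the derivative n X^(n-1); as n is nonzero
    in k this forces x^(n-1) = 0, against x^n = 1.\<close>
  have "count A x \<le> 1" for x
  proof (rule ccontr)
    assume "\<not> ?thesis"
    hence "count {#x, x#} y \<le> count A y" for y by (cases "y = x") auto
    hence "{#x, x#} \<subseteq># A" by (rule mset_subset_eqI)
    then obtain B where "A = {#x, x#} + B" by (rule mset_subset_eq_exists_conv[THEN iffD1, THEN exE])
    hence Ax: "A = add_mset x (add_mset x B)" by simp
    define q where "q = (\<Prod>x\<in>#B. [:-x, 1:])"
    have q: "p = Polynomial.smult (lead_coeff p) ([:-x, 1:] * ([:-x, 1:] * q))"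
      unfolding q_def by (subst A(2)) (simp only: Ax prod_mset.add_mset image_mset_add_mset)
    define r where "r = [:-x, 1:]"
    have r: "poly r x = 0" by (simp add: r_def)
    have "poly p x = 0" unfolding q[folded r_def, THEN arg_cong[of _ _ "\<lambda>p. poly p x"]] by (simp add: r)
    moreover have "poly (pderiv p) x = 0"
      unfolding q[folded r_def, THEN arg_cong[of _ _ "\<lambda>p. poly (pderiv p) x"]]
      by (simp only: pderiv_mult pderiv_smult poly_smult poly_add poly_mult r) simp
    ultimately
    have "x ^ (n - 1) = 0" and "x ^ n = 1" using pd[of x] poly[of x] assms by simp_all
    thus False by (metis power_eq_0_iff power_one_right zero_power zero_neq_one assms)
  qed
  hence "A = mset_set (set_mset A)"
    by (intro multiset_eqI) (auto simp: count_mset_set' le_antisym not_in_iff)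
  hence "card (set_mset A) = n" using A(1) deg by (metis size_mset_set)
  thus ?thesis using root by simp
qed

lemma (in comm_group) comm_group_subgroup:
  assumes "subgroup H G" shows "comm_group (G\<lparr>carrier := H\<rparr>)"
proof -
  interpret H: group "G\<lparr>carrier := H\<rparr>" using assms by (rule subgroup_imp_group)
  show ?thesis using subgroup.subset[OF assms]
    by (intro H.group_comm_groupI) (auto simp: m_comm subsetD)
qed

text \<open>Raising (x y)^ord(x y) = 1 to the power ord y removes y. Coprimality then gives that ord
  x divides ord(x y), and the roles of x and y can be exchanged.\<close>

lemma (in comm_group) ord_mult_coprime:
  assumes "x \<in> carrier G" "y \<in> carrier G" "coprime (ord x) (ord y)"
  shows "ord (x \<otimes> y) = ord x * ord y"
proof (rule dvd_antisym)
  show "ord (x \<otimes> y) dvd ord x * ord y" using assms by (simp add: abelian_ord_mul_divides)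
  have aux: "ord x dvd ord (x \<otimes> y)" if "x \<in> carrier G" "y \<in> carrier G" "coprime (ord x) (ord y)" for x y
  proof -
    have "\<one> = ((x \<otimes> y) [^] ord (x \<otimes> y)) [^] ord y" using that by simp
    also have "\<dots> = x [^] (ord (x \<otimes> y) * ord y) \<otimes> (y [^] ord y) [^] ord (x \<otimes> y)"
      using that by (simp add: nat_pow_pow nat_pow_distrib del: pow_ord_eq_1) (simp add: mult.commute)
    finally have "x [^] (ord (x \<otimes> y) * ord y) = \<one>" using that by simp
    hence "ord x dvd ord (x \<otimes> y) * ord y" using that pow_eq_id by blast
    thus ?thesis using that by (simp add: coprime_dvd_mult_left_iff)
  qed
  have "ord y dvd ord (x \<otimes> y)" using aux[of y x] assms by (simp add: m_comm coprime_commute)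
  thus "ord x * ord y dvd ord (x \<otimes> y)" using aux assms by (simp add: divides_mult)
qed

text \<open>An element x of maximal order works: if the p-part of ord y exceeded that of ord x, the
  prime-to-p part of x times the p-part of y would have an order larger than ord x.\<close>

lemma (in comm_group) exponent_attained:
  assumes "finite (carrier G)"
  obtains x where "x \<in> carrier G" "\<And>y. y \<in> carrier G \<Longrightarrow> ord y dvd ord x"
proof -
  have "Max (ord ` carrier G) \<in> ord ` carrier G" using assms one_closed by (intro Max_in) auto
  then obtain x where x: "x \<in> carrier G" "Max (ord ` carrier G) = ord x" by auto
  have mx: "ord y \<le> ord x" if "y \<in> carrier G" for y
    using x(2) assms that by (metis Max_ge finite_imageI imageI)
  note x = x(1)
  have pos: "ord y > 0" if "y \<in> carrier G" for y using ord_ge_1[OF assms that] by simp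
  have "ord y dvd ord x" if y: "y \<in> carrier G" for y
  proof (rule ccontr)
    assume "\<not> ord y dvd ord x"
    then obtain p where p: "prime p" "multiplicity p (ord y) > multiplicity p (ord x)"
      using multiplicity_le_imp_dvd[of "ord y" "ord x"] pos[OF y] by (metis not_less neq0_conv)
    define a b where "a = multiplicity p (ord x)" and "b = multiplicity p (ord y)"
    obtain n where n: "ord x = p ^ a * n" "\<not> p dvd n"
      using multiplicity_decompose'[of "ord x" p] pos[OF x] p(1) unfolding a_def
      by (metis not_prime_unit not_gr_zero)
    obtain m where m: "ord y = p ^ b * m" "\<not> p dvd m"
      using multiplicity_decompose'[of "ord y" p] pos[OF y] p(1) unfolding b_def
      by (metis not_prime_unit not_gr_zero)
    have p0: "p > 0" using p(1) by (simp add: prime_gt_0_nat)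
    have m0: "m > 0" "n > 0" using m n by (auto intro!: Nat.gr0I)
    have 1: "ord (x [^] (p ^ a)) = n" using ord_pow[of x "p ^ a"] x n p0 by simp
    have 2: "ord (y [^] m) = p ^ b" using ord_pow[of y m] y m m0 by simp
    have "coprime n (p ^ b)" using n(2) p(1) prime_imp_coprime[of p n] by (simp add: coprime_commute)
    hence "ord (x [^] (p ^ a) \<otimes> y [^] m) = n * p ^ b"
      using ord_mult_coprime x y 1 2 by simp
    hence "n * p ^ b \<le> p ^ a * n" using mx x y n by (metis m_closed nat_pow_closed)
    hence "p ^ b \<le> p ^ a" using m0 by simp
    hence "b \<le> a" using p(1) by (metis power_le_imp_le_exp prime_gt_1_nat)
    thus False using p(2) a_def b_def by simp
  qed
  thus ?thesis using that x by blast
qed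

text \<open>The n-th roots of unity form a finite group with an element z whose order is a multiple
  of all other orders. All n of them are then roots of X^(ord z) - 1, so ord z \<ge> n, and the
  powers of z exhaust the group.\<close>

lemma primitive_root_exists:
  assumes "n > 0"
  obtains z :: "'k::{alg_closed_field, field_char_0}" where "\<And>m. z ^ m = 1 \<longleftrightarrow> n dvd m"
    "\<And>x. x ^ n = 1 \<Longrightarrow> \<exists>i. x = z ^ i"
proof -
  interpret K: comm_group "kstar :: 'k monoid" by (rule comm_group_kstar)
  define U where "U = {x::'k. x ^ n = 1}"
  have sub: "subgroup U kstar"
  proof (rule K.subgroupI)
    have "1 \<in> U" by (simp add: U_def)
    thus "U \<noteq> {}" by blast
    show "U \<subseteq> carrier kstar" using assms by (auto simp: U_def power_0_left)
    show "inv\<^bsub>kstar\<^esub> a \<in> U" if "a \<in> U" for a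
    proof -
      have "a \<noteq> 0" using that assms by (auto simp: U_def power_0_left)
      hence "inv\<^bsub>kstar\<^esub> a = inverse a" by (intro K.inv_equality) auto
      thus ?thesis using that by (simp add: U_def power_inverse)
    qed
  qed (auto simp: U_def power_mult_distrib)
  interpret M: comm_group "kstar\<lparr>carrier := U\<rparr>"
    using K.comm_group_subgroup[OF sub] .
  have cU: "card U = n" unfolding U_def using card_roots_of_unity[OF assms] .
  hence fU: "finite U" using assms card_gt_0_iff by metis
  have pw: "x [^]\<^bsub>kstar\<lparr>carrier := U\<rparr>\<^esub> (m::nat) = x ^ m" for x :: 'k and m
    by (subst monoid.nat_pow_consistent[OF K.monoid_axioms, symmetric]) simp
  obtain z where z: "z \<in> U" "\<And>y. y \<in> U \<Longrightarrow> M.ord y dvd M.ord z"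
    using M.exponent_attained fU by auto
  have "y ^ M.ord z = 1" if "y \<in> U" for y
    using M.pow_eq_id[of y "M.ord z"] z(2)[OF that] that by (simp add: pw)
  hence "U \<subseteq> {x. x ^ M.ord z = 1}" by auto
  moreover have pos: "M.ord z > 0" using M.ord_ge_1 z fU by fastforce
  ultimately have le: "n \<le> M.ord z"
    using card_roots_of_unity[OF pos, where ?'k = 'k] card_mono[of "{x::'k. x ^ M.ord z = 1}" U] cU pos
      card.infinite[of "{x::'k. x ^ M.ord z = 1}"] by fastforce
  have iff: "z ^ m = 1 \<longleftrightarrow> M.ord z dvd m" for m using M.pow_eq_id[of z m] z(1) by (simp add: pw)
  have "M.ord z dvd n" using z(1) iff by (simp add: U_def)
  hence eq: "M.ord z = n" using le assms by (meson dvd_imp_le le_antisym)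
  have "inj_on (\<lambda>i. z ^ i) {..<n}"
  proof (rule linorder_inj_onI')
    fix i j assume "i \<in> {..<n}" "j \<in> {..<n}" "i < j"
    have "z \<noteq> 0" using sub z(1) subgroup.subset by fastforce
    moreover have "z ^ j = z ^ i * z ^ (j - i)" using \<open>i < j\<close> by (simp flip: power_add)
    ultimately have "z ^ i = z ^ j \<longleftrightarrow> z ^ (j - i) = 1" by simp
    moreover have "\<not> n dvd j - i" using \<open>i < j\<close> \<open>j \<in> _\<close> by (intro nat_dvd_not_less) auto
    ultimately show "z ^ i \<noteq> z ^ j" using iff eq by simp
  qed
  hence "card ((\<lambda>i. z ^ i) ` {..<n}) = n" by (simp add: card_image)
  moreover have "(z ^ i) ^ n = 1" for i
    using z(1) power_commutes by (simp add: U_def flip: power_mult) (simp add: power_mult mult.commute[of i n])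
  hence "(\<lambda>i. z ^ i) ` {..<n} \<subseteq> U" by (auto simp: U_def)
  ultimately have "(\<lambda>i. z ^ i) ` {..<n} = U" using card_subset_eq[OF fU] cU by simp
  hence "\<exists>i. x = z ^ i" if "x ^ n = 1" for x using that unfolding U_def by blast
  thus ?thesis using that[of z] iff eq by simp
qed

lemma (in group) hom_kstar:
  assumes "\<chi> \<in> hom G (kstar :: 'k::field monoid)"
  shows "\<And>x y. x \<in> carrier G \<Longrightarrow> y \<in> carrier G \<Longrightarrow> \<chi> (x \<otimes> y) = \<chi> x * \<chi> y"
    "\<And>x. x \<in> carrier G \<Longrightarrow> \<chi> x \<noteq> 0" "\<chi> \<one> = 1"
    "\<And>x. x \<in> carrier G \<Longrightarrow> \<chi> (inv x) = inverse (\<chi> x)"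
    "\<And>x m. x \<in> carrier G \<Longrightarrow> \<chi> (x [^] (m::nat)) = \<chi> x ^ m"
proof -
  show m: "\<chi> (x \<otimes> y) = \<chi> x * \<chi> y" if "x \<in> carrier G" "y \<in> carrier G" for x y
    using that assms by (auto simp: hom_def)
  show nz: "\<chi> x \<noteq> 0" if "x \<in> carrier G" for x using that assms by (auto simp: hom_def Pi_iff)
  have "\<chi> \<one> * \<chi> \<one> = \<chi> \<one>" using m[of \<one> \<one>] by simp
  thus o: "\<chi> \<one> = 1" using nz[of \<one>] by simp
  show "\<chi> (inv x) = inverse (\<chi> x)" if "x \<in> carrier G" for x
  proof (rule inverse_unique[symmetric])
    show "\<chi> x * \<chi> (inv x) = 1" using m[of x "inv x"] that by (simp add: o)
  qed
  show "\<chi> (x [^] (m::nat)) = \<chi> x ^ m" if "x \<in> carrier G" for x m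
    using that by (induction m) (auto simp: o m)
qed

lemma (in group) hom_kstarI:
  assumes "\<And>x y. x \<in> carrier G \<Longrightarrow> y \<in> carrier G \<Longrightarrow> \<chi> (x \<otimes> y) = \<chi> x * \<chi> y"
    "\<And>x. x \<in> carrier G \<Longrightarrow> \<chi> x \<noteq> 0"
  shows "\<chi> \<in> hom G (kstar :: 'k::field monoid)"
  using assms by (auto simp: hom_def)

section \<open>Extension of characters from subgroups\<close>

lemma (in group) finite_subgroupI:
  assumes "finite (carrier G)" "H \<subseteq> carrier G" "\<one> \<in> H"
    "\<And>x y. x \<in> H \<Longrightarrow> y \<in> H \<Longrightarrow> x \<otimes> y \<in> H"
  shows "subgroup H G"
proof (rule subgroupI)
  fix x assume x: "x \<in> H"
  have pw: "x [^] (m::nat) \<in> H" for m using x assms by (induction m) auto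
  have "order G > 0" using assms(1) order_gt_0_iff_finite by simp
  hence "x [^] (order G - 1) \<otimes> x = \<one>"
    using x assms(2) pow_order_eq_1[of x] by (metis Suc_diff_1 nat_pow_Suc subsetD)
  hence "inv x = x [^] (order G - 1)" using x assms(2) by (intro inv_equality) auto
  thus "inv x \<in> H" using pw by simp
qed (use assms in auto)

text \<open>One step of extending a character: adjoin \<open>a\<close> and prescribe its value, any \<open>n\<close>-th root of
  the value at \<open>a^n\<close>, where \<open>n\<close> is the order of \<open>a\<close> modulo \<open>H\<close>.\<close>

lemma (in comm_group) character_extend_step:
  fixes \<psi> :: "'a \<Rightarrow> 'k::field"
  assumes fin: "finite (carrier G)" and H: "subgroup H G"
    and \<psi>: "\<psi> \<in> hom (G\<lparr>carrier := H\<rparr>) kstar" and a: "a \<in> carrier G" and n: "n > 0"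
    and an: "\<And>m::nat. a [^] m \<in> H \<longleftrightarrow> n dvd m" and z: "z ^ n = \<psi> (a [^] n)"
  obtains H' \<chi> where "subgroup H' G" "H \<subseteq> H'" "a \<in> H'" "\<chi> \<in> hom (G\<lparr>carrier := H'\<rparr>) kstar"
    "\<And>h. h \<in> H \<Longrightarrow> \<chi> h = \<psi> h" "\<chi> a = z"
proof -
  interpret H: subgroup H G by (rule H)
  interpret HG: group "G\<lparr>carrier := H\<rparr>" by (rule subgroup_imp_group[OF H])
  have HC: "h \<in> carrier G" if "h \<in> H" for h using that by (rule H.mem_carrier)
  have \<psi>m: "\<psi> (g \<otimes> h) = \<psi> g * \<psi> h" "\<psi> g \<noteq> 0" if "g \<in> H" "h \<in> H" for g h
    using HG.hom_kstar(1,2)[OF \<psi>] that by auto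
  have \<psi>1: "\<psi> \<one> = 1" using HG.hom_kstar(3)[OF \<psi>] by simp
  have \<psi>p: "\<psi> (g [^] (m::nat)) = \<psi> g ^ m" if "g \<in> H" for g m
    using HG.hom_kstar(5)[OF \<psi>] that by (simp flip: nat_pow_consistent)
  have anH: "a [^] n \<in> H" using an by simp
  have z0: "z \<noteq> 0" using z n \<psi>m(2)[OF anH anH] by (auto simp: power_0_left)
  \<comment> \<open>The value assigned to h a^i must not depend on the factorisation. Two
    factorisations differ by a power of a lying in H, hence by a power of a^n, and z^n = \<psi>(a^n)
    makes both values agree.\<close>
  have wd: "\<psi> h * z ^ i = \<psi> h' * z ^ j" if "h \<in> H" "h' \<in> H" "h \<otimes> a [^] i = h' \<otimes> a [^] j" for h h' and i j :: nat
  proof -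
    have aux: "\<psi> h * z ^ i = \<psi> h' * z ^ j"
      if "h \<in> H" "h' \<in> H" "h \<otimes> a [^] i = h' \<otimes> a [^] j" "i \<le> j" for h h' and i j :: nat
    proof -
      have "h \<otimes> a [^] i = (h' \<otimes> a [^] (j - i)) \<otimes> a [^] i"
        using that a HC by (simp add: m_assoc nat_pow_mult)
      hence e: "h = h' \<otimes> a [^] (j - i)" using that a HC by (metis m_closed nat_pow_closed right_cancel)
      hence "a [^] (j - i) = inv h' \<otimes> h" using that a HC by (simp add: inv_solve_left)
      hence "a [^] (j - i) \<in> H" using that by simp
      then obtain q where q: "j - i = n * q" using an by (auto simp: dvd_def)
      have "\<psi> h = \<psi> h' * \<psi> (a [^] (j - i))" using e that \<open>a [^] (j - i) \<in> H\<close> by (simp add: \<psi>m)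
      also have "\<psi> (a [^] (j - i)) = z ^ (j - i)"
        unfolding q using a anH by (simp add: \<psi>p z power_mult flip: nat_pow_pow)
      finally show ?thesis using that(4) by (simp add: mult.assoc flip: power_add)
    qed
    show ?thesis
    proof (cases "i \<le> j")
      case False
      thus ?thesis using aux[of h' h j i] that by simp
    qed (use aux that in blast)
  qed
  define H' where "H' = {h \<otimes> a [^] (i::nat) | h i. h \<in> H}"
  define \<chi> where "\<chi> = (\<lambda>x. THE v. \<exists>h\<in>H. \<exists>i::nat. x = h \<otimes> a [^] i \<and> v = \<psi> h * z ^ i)"
  have \<chi>: "\<chi> (h \<otimes> a [^] i) = \<psi> h * z ^ i" if "h \<in> H" for h and i :: nat
    unfolding \<chi>_def
  proof (rule the_equality)
    show "\<exists>h'\<in>H. \<exists>j::nat. h \<otimes> a [^] i = h' \<otimes> a [^] j \<and> \<psi> h * z ^ i = \<psi> h' * z ^ j"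
      using that by (intro bexI[of _ h] exI[of _ i]) auto
    fix v assume "\<exists>h'\<in>H. \<exists>j::nat. h \<otimes> a [^] i = h' \<otimes> a [^] j \<and> v = \<psi> h' * z ^ j"
    thus "v = \<psi> h * z ^ i" using wd[OF that] by metis
  qed
  have HH': "h \<otimes> a [^] i \<in> H'" if "h \<in> H" for h and i :: nat using that by (auto simp: H'_def)
  have mult: "(h \<otimes> a [^] i) \<otimes> (h' \<otimes> a [^] j) = (h \<otimes> h') \<otimes> a [^] (i + j)" if "h \<in> H" "h' \<in> H" for h h' and i j :: nat
    using that a HC by (simp add: m_ac flip: nat_pow_mult)
  have "subgroup H' G"
  proof (rule finite_subgroupI[OF fin])
    show "\<one> \<in> H'" using HH'[of \<one> 0] by simp
    show "x \<otimes> y \<in> H'" if "x \<in> H'" "y \<in> H'" for x y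
    proof -
      obtain h i h' j where "x = h \<otimes> a [^] (i::nat)" "y = h' \<otimes> a [^] (j::nat)" "h \<in> H" "h' \<in> H"
        using \<open>x \<in> H'\<close> \<open>y \<in> H'\<close> by (auto simp: H'_def)
      thus ?thesis using HH'[of "h \<otimes> h'" "i + j"] by (simp add: mult)
    qed
  qed (auto simp: H'_def HC a)
  moreover have "H \<subseteq> H'"
  proof
    fix h assume "h \<in> H" thus "h \<in> H'" using HH'[of h 0] HC by simp
  qed
  moreover have "a \<in> H'" using HH'[of \<one> 1] a by simp
  moreover have "\<chi> \<in> hom (G\<lparr>carrier := H'\<rparr>) kstar"
    unfolding hom_def H'_def by (auto simp: \<chi> z0 \<psi>m mult power_add)
  moreover have "\<chi> h = \<psi> h" if "h \<in> H" for h using \<chi>[OF that, of 0] that HC by simp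
  moreover have "\<chi> a = z" using \<chi>[of \<one> 1] a by (simp add: \<psi>1)
  ultimately show ?thesis using that by blast
qed

text \<open>Exponents m with a^m in H are closed under division with remainder, so the least
  positive one divides them all.\<close>

lemma (in group) order_modulo_subgroup:
  assumes fin: "finite (carrier G)" and H: "subgroup H G" and a: "a \<in> carrier G"
  obtains n where "n > 0" "\<And>m::nat. a [^] m \<in> H \<longleftrightarrow> n dvd m"
proof -
  interpret H: subgroup H G by (rule H)
  define P where "P = (\<lambda>k::nat. k > 0 \<and> a [^] k \<in> H)"
  have "order G > 0" using fin order_gt_0_iff_finite by simp
  hence ex: "P (order G)" using a by (simp add: P_def pow_order_eq_1)
  define n where "n = (LEAST k. P k)"
  have n: "P n" "\<And>k. k < n \<Longrightarrow> \<not> P k" unfolding n_def using ex by (auto intro: LeastI dest: not_less_Least)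
  have hp: "h [^] (m::nat) \<in> H" if "h \<in> H" for h m using that by (induction m) auto
  have nq: "a [^] (n * q) \<in> H" for q
    using n(1) hp[of "a [^] n" q] a by (simp add: P_def nat_pow_pow)
  have "n dvd m" if "a [^] m \<in> H" for m
  proof -
    have "a [^] m = a [^] (n * (m div n)) \<otimes> a [^] (m mod n)" using a by (simp add: nat_pow_mult)
    hence "a [^] (m mod n) = inv (a [^] (n * (m div n))) \<otimes> a [^] m" using a by (simp add: inv_solve_left)
    hence "a [^] (m mod n) \<in> H" using nq that by simp
    hence "m mod n = 0" using n(2)[of "m mod n"] n(1) by (auto simp: P_def)
    thus ?thesis by auto
  qed
  moreover have "a [^] m \<in> H" if "n dvd m" for m using that nq by (auto elim!: dvdE)
  ultimately show ?thesis using that[of n] n(1) by (auto simp: P_def)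
qed

text \<open>Any element outside H can be adjoined, because the root needed for its value exists in
  an algebraically closed field. The complement of the domain shrinks until nothing is left.\<close>

lemma (in comm_group) character_extends:
  fixes \<psi> :: "'a \<Rightarrow> 'k::alg_closed_field"
  assumes fin: "finite (carrier G)" and "subgroup H G" "\<psi> \<in> hom (G\<lparr>carrier := H\<rparr>) kstar"
  obtains \<chi> where "\<chi> \<in> hom G kstar" "\<And>h. h \<in> H \<Longrightarrow> \<chi> h = \<psi> h"
  using assms(2,3)
proof (induction "card (carrier G) - card H" arbitrary: H \<psi> thesis rule: less_induct)
  case less
  have sub: "H \<subseteq> carrier G" using less.prems(2) by (rule subgroup.subset)
  show ?case
  proof (cases "H = carrier G")
    case True thus ?thesis using less.prems(1)[of \<psi>] less.prems(3) by simp
  next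
    case False
    then obtain a where a: "a \<in> carrier G" "a \<notin> H" using sub by blast
    obtain n where n: "n > 0" "\<And>m::nat. a [^] m \<in> H \<longleftrightarrow> n dvd m"
      using order_modulo_subgroup[OF fin less.prems(2) a(1)] by blast
    obtain z where z: "z ^ n = \<psi> (a [^] n)" using nth_root_exists[OF n(1)] by blast
    obtain H' \<chi>' where H': "subgroup H' G" "H \<subseteq> H'" "a \<in> H'" "\<chi>' \<in> hom (G\<lparr>carrier := H'\<rparr>) kstar"
      "\<And>h. h \<in> H \<Longrightarrow> \<chi>' h = \<psi> h"
      using character_extend_step[OF fin less.prems(2,3) a(1) n z] by metis
    have sub': "H' \<subseteq> carrier G" using H'(1) by (rule subgroup.subset)
    have "card H < card H'" using H' a sub' fin by (intro psubset_card_mono) (auto intro: finite_subset)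
    moreover have "card H' \<le> card (carrier G)" using sub' fin by (rule card_mono[rotated])
    ultimately have "card (carrier G) - card H' < card (carrier G) - card H" by simp
    from less.hyps[OF this _ H'(1,4)] obtain \<chi> where \<chi>: "\<chi> \<in> hom G kstar" "\<And>h. h \<in> H' \<Longrightarrow> \<chi> h = \<chi>' h"
      by blast
    show ?thesis by (rule less.prems(1)[OF \<chi>(1)]) (use \<chi>(2) H'(2,5) in auto)
  qed
qed

text \<open>A character that is faithful on an element \<open>c\<close> of maximal order \<open>n\<close> takes values in the \<open>n\<close>-th
  roots of unity only, so its kernel \<open>K\<close> is a complement of the subgroup generated by \<open>c\<close>; the projection
  to \<open>K\<close> is \<open>\<pi>\<close>.\<close>

locale cyclic_splitting = comm_group G for G (structure) +
  fixes c n K i \<pi> and \<zeta> :: "'k::field" and \<chi>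
  assumes split:
    "c \<in> carrier G" "\<chi> \<in> hom G kstar" "\<chi> c = \<zeta>" "c [^] (n::nat) = \<one>"
    "\<And>x. x ^ n = 1 \<Longrightarrow> \<exists>j. x = \<zeta> ^ j"
    "\<And>x. x \<in> carrier G \<Longrightarrow> \<chi> x = \<zeta> ^ i x"
    "\<And>a b::nat. \<zeta> ^ a = \<zeta> ^ b \<Longrightarrow> c [^] a = c [^] b"
    "subgroup K G" "K = {x \<in> carrier G. \<chi> x = 1}" "card K < card (carrier G)"
    "\<And>x. x \<in> carrier G \<Longrightarrow> \<pi> x \<in> K"
    "\<And>x. x \<in> carrier G \<Longrightarrow> c [^] i x \<otimes> \<pi> x = x"
    "\<And>x y. x \<in> carrier G \<Longrightarrow> y \<in> carrier G \<Longrightarrow> \<pi> (x \<otimes> y) = \<pi> x \<otimes> \<pi> y"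
    "\<And>x. x \<in> K \<Longrightarrow> \<pi> x = x"

text \<open>The character extends c \<mapsto> \<zeta>, where c has maximal order n and \<zeta> is a
  primitive n-th root of unity. Since n annihilates the group, all values are powers of \<zeta>, and
  \<open>i\<close> is a discrete logarithm of them.\<close>

lemma (in comm_group) cyclic_factor:
  assumes fin: "finite (carrier G)" and nontriv: "card (carrier G) > 1"
  obtains c n K i \<pi> and \<zeta> :: "'k::{alg_closed_field, field_char_0}" and \<chi> where
    "cyclic_splitting G c n K i \<pi> \<zeta> \<chi>"
proof -
  obtain c where c: "c \<in> carrier G" "\<And>y. y \<in> carrier G \<Longrightarrow> ord y dvd ord c"
    using exponent_attained[OF fin] by blast
  define n where "n = ord c"
  have n0: "n > 0" unfolding n_def using ord_ge_1[OF fin c(1)] by simp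
  have cm: "c [^] m = \<one> \<longleftrightarrow> n dvd m" for m :: nat unfolding n_def using c(1) by (rule pow_eq_id)
  have xn: "x [^] n = \<one>" if "x \<in> carrier G" for x
    using that c(2)[OF that] unfolding n_def by (simp add: pow_eq_id)
  obtain \<zeta> :: 'k where z: "\<And>m. \<zeta> ^ m = 1 \<longleftrightarrow> n dvd m" "\<And>x. x ^ n = 1 \<Longrightarrow> \<exists>i. x = \<zeta> ^ i"
    using primitive_root_exists[OF n0] by blast
  have z0: "\<zeta> \<noteq> 0" using z(1)[of n] n0 by (auto simp: power_0_left)
  have triv: "subgroup {\<one>} G" by (rule triv_subgroup)
  have "(\<lambda>_. 1 :: 'k) \<in> hom (G\<lparr>carrier := {\<one>}\<rparr>) kstar" by (auto simp: hom_def)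
  moreover have "c [^] m \<in> {\<one>} \<longleftrightarrow> n dvd m" for m :: nat using cm by simp
  moreover have "\<zeta> ^ n = 1" using z(1) by simp
  ultimately obtain H \<chi>0 where
    H: "subgroup H G" "c \<in> H" "\<chi>0 \<in> hom (G\<lparr>carrier := H\<rparr>) kstar" "\<chi>0 c = \<zeta>"
    using character_extend_step[OF fin triv _ c(1) n0] by metis
  obtain \<chi> where \<chi>: "\<chi> \<in> hom G kstar" "\<chi> c = \<zeta>"
    using character_extends[OF fin H(1,3)] H(2,4) by metis
  note \<chi>h = hom_kstar[OF \<chi>(1)]
  define i where "i = (\<lambda>x. SOME j. \<chi> x = \<zeta> ^ j)"
  have i: "\<chi> x = \<zeta> ^ i x" if "x \<in> carrier G" for x
  proof -
    have "\<chi> x ^ n = 1" using \<chi>h(5)[OF that, of n] xn[OF that] by (simp add: \<chi>h(3))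
    hence "\<exists>j. \<chi> x = \<zeta> ^ j" by (rule z(2))
    thus ?thesis unfolding i_def by (rule someI_ex)
  qed
  \<comment> \<open>The logarithm is chosen only up to multiples of n; powers of c do not see the
    difference.\<close>
  have eq: "c [^] a = c [^] b" if "\<zeta> ^ a = \<zeta> ^ b" for a b :: nat
  proof -
    have aux: "c [^] a = c [^] b" if "\<zeta> ^ a = \<zeta> ^ b" "a \<le> b" for a b :: nat
    proof -
      have "\<zeta> ^ b = \<zeta> ^ a * \<zeta> ^ (b - a)" using that(2) by (simp flip: power_add)
      hence "c [^] (b - a) = \<one>" using that(1) z0 cm z(1) by simp
      moreover have "c [^] b = c [^] a \<otimes> c [^] (b - a)" using that(2) c(1) by (simp add: nat_pow_mult)
      ultimately show ?thesis using c(1) by simp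
    qed
    show ?thesis
    proof (cases "a \<le> b")
      case True thus ?thesis using aux that by blast
    next
      case False thus ?thesis using aux[of b a] that by simp
    qed
  qed
  define K where "K = {x \<in> carrier G. \<chi> x = 1}"
  define \<pi> where "\<pi> = (\<lambda>x. x \<otimes> inv (c [^] i x))"
  have K: "subgroup K G"
    by (rule subgroupI) (auto simp: K_def \<chi>h intro: exI[of _ \<one>])
  \<comment> \<open>n = 1 would make the group trivial. That K is a proper subgroup is what later
    inductions on the group order rely on.\<close>
  have "n \<noteq> 1"
  proof
    assume "n = 1"
    hence "carrier G \<subseteq> {\<one>}" using xn by force
    thus False using nontriv card_mono[of "{\<one>}" "carrier G"] by simp
  qed
  hence "\<chi> c \<noteq> 1" using \<chi>(2) z(1)[of 1] by simp
  hence "K \<subset> carrier G" using c(1) by (auto simp: K_def)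
  hence cK: "card K < card (carrier G)" using fin psubset_card_mono by blast
  have \<pi>K: "\<pi> x \<in> K" if "x \<in> carrier G" for x
    using that c(1) i[OF that] z0 by (simp add: K_def \<pi>_def \<chi>h \<chi>(2))
  have rec: "c [^] i x \<otimes> \<pi> x = x" if "x \<in> carrier G" for x
    using that c(1) by (simp add: \<pi>_def m_lcomm)
  have \<pi>h: "\<pi> (x \<otimes> y) = \<pi> x \<otimes> \<pi> y" if xy: "x \<in> carrier G" "y \<in> carrier G" for x y
  proof -
    have "\<zeta> ^ i (x \<otimes> y) = \<zeta> ^ (i x + i y)"
      using i[of "x \<otimes> y"] i[of x] i[of y] xy by (simp add: \<chi>h power_add)
    hence "c [^] i (x \<otimes> y) = c [^] i x \<otimes> c [^] i y" using eq[of "i (x \<otimes> y)" "i x + i y"] c(1) by (simp add: nat_pow_mult)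
    moreover have "(x \<otimes> y) \<otimes> inv (p \<otimes> q) = (x \<otimes> inv p) \<otimes> (y \<otimes> inv q)"
      if "p \<in> carrier G" "q \<in> carrier G" for p q using that xy by (simp add: inv_mult m_ac)
    ultimately show ?thesis using c(1) by (simp add: \<pi>_def)
  qed
  have \<pi>k: "\<pi> x = x" if "x \<in> K" for x
  proof -
    have "\<zeta> ^ i x = \<zeta> ^ 0" using that i[of x] by (simp add: K_def)
    thus ?thesis using eq[of "i x" 0] that by (simp add: \<pi>_def K_def)
  qed
  show ?thesis
    by (rule that[of c n K i \<pi> \<zeta> \<chi>], intro cyclic_splitting.intro cyclic_splitting_axioms.intro comm_group_axioms)
      (fact c(1) \<chi> xn[OF c(1)] z(2) i eq K K_def cK \<pi>K rec \<pi>h \<pi>k)+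
qed

section \<open>Bicharacters on finite abelian groups\<close>

definition bichar :: "('a, 'm) monoid_scheme \<Rightarrow> ('a \<Rightarrow> 'a \<Rightarrow> 'k::field) \<Rightarrow> bool" where
  "bichar A f \<longleftrightarrow> (\<forall>x\<in>carrier A. \<forall>y\<in>carrier A. f x y \<noteq> 0 \<and>
     (\<forall>z\<in>carrier A. f (x \<otimes>\<^bsub>A\<^esub> y) z = f x z * f y z \<and> f z (x \<otimes>\<^bsub>A\<^esub> y) = f z x * f z y))"

lemma bichar_hom:
  assumes "bichar A f" "a \<in> carrier A"
  shows "f a \<in> hom A kstar" "(\<lambda>x. f x a) \<in> hom A kstar"
  using assms by (auto simp: bichar_def hom_def)

text \<open>Built from the pairing of c^i and c^j to \<zeta>^(i j) on the cyclic factor and,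
  inductively, a pairing on the complement K. The purpose is a (non-canonical) isomorphism with the
  dual group.\<close>

lemma perfect_pairing_exists:
  assumes "comm_group A" "finite (carrier A)"
  shows "\<exists>p :: 'a \<Rightarrow> 'a \<Rightarrow> 'k::{alg_closed_field, field_char_0}. bichar A p \<and>
     (\<forall>a\<in>carrier A. (\<forall>x\<in>carrier A. p a x = 1) \<longrightarrow> a = \<one>\<^bsub>A\<^esub>) \<and>
     (\<forall>\<psi>\<in>hom A kstar. \<exists>a\<in>carrier A. \<forall>x\<in>carrier A. \<psi> x = p a x)"
  using assms
proof (induction "card (carrier A)" arbitrary: A rule: less_induct)
  case (less A)
  interpret comm_group A by (rule less.prems(1))
  note fin = less.prems(2)
  show ?case
  proof (cases "card (carrier A) > 1")
    case False
    hence "carrier A = {\<one>\<^bsub>A\<^esub>}" using fin one_closed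
      by (metis card_le_Suc0_iff_eq One_nat_def not_less equals0D is_singletonI' is_singleton_def singletonD)
    thus ?thesis by (intro exI[of _ "\<lambda>_ _. 1"]) (auto simp: bichar_def dest: hom_kstar(3))
  next
    case True
    obtain c n K i \<pi> and \<zeta> :: 'k and \<chi> where "cyclic_splitting A c n K i \<pi> \<zeta> \<chi>"
      using cyclic_factor[OF fin True, where ?'k = 'k] by blast
    then interpret S: cyclic_splitting A c n K i \<pi> \<zeta> \<chi> .
    note f = S.split
    note \<chi>h = hom_kstar[OF f(2)]
    interpret K: comm_group "A\<lparr>carrier := K\<rparr>" using f(8) by (rule comm_group_subgroup)
    have KA: "x \<in> carrier A" if "x \<in> K" for x using that f(9) by simp
    hence fK: "finite K" using fin by (metis finite_subset subsetI)
    obtain p :: "'a \<Rightarrow> 'a \<Rightarrow> 'k" where p: "bichar (A\<lparr>carrier := K\<rparr>) p"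
      "\<And>a. a \<in> K \<Longrightarrow> (\<And>x. x \<in> K \<Longrightarrow> p a x = 1) \<Longrightarrow> a = \<one>\<^bsub>A\<^esub>"
      "\<And>\<psi>. \<psi> \<in> hom (A\<lparr>carrier := K\<rparr>) kstar \<Longrightarrow> \<exists>a\<in>K. \<forall>x\<in>K. \<psi> x = p a x"
      using less.hyps[of "A\<lparr>carrier := K\<rparr>"] f(10) K.comm_group_axioms fK by auto
    have p1: "p a \<one>\<^bsub>A\<^esub> = 1" if "a \<in> K" for a
      using K.hom_kstar(3)[OF bichar_hom(1)[OF p(1)]] that by simp
    define q where "q = (\<lambda>x y. \<chi> y ^ i x * p (\<pi> x) (\<pi> y))"
    \<comment> \<open>Both sides are \<zeta> to the power i x times i y. This transfers linearity
      from \<chi> to the argument that occurs through \<open>i\<close>, although \<open>i\<close>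
      itself need not be additive as a function to the naturals.\<close>
    have sym: "\<chi> y ^ i x = \<chi> x ^ i y" if "x \<in> carrier A" "y \<in> carrier A" for x y
      using that by (simp add: f(6) mult.commute flip: power_mult)
    have "bichar A q"
      unfolding bichar_def
    proof (intro ballI conjI)
      fix x y z assume xyz: "x \<in> carrier A" "y \<in> carrier A" "z \<in> carrier A"
      have pp: "p (a \<otimes>\<^bsub>A\<^esub> b) d = p a d * p b d" "p d (a \<otimes>\<^bsub>A\<^esub> b) = p d a * p d b" "p a b \<noteq> 0"
        if "a \<in> K" "b \<in> K" "d \<in> K" for a b d using p(1) that by (auto simp: bichar_def)
      show "q x y \<noteq> 0" using xyz by (simp add: q_def \<chi>h pp(3)[of _ _ "\<pi> x"] f(11))
      show "q z (x \<otimes>\<^bsub>A\<^esub> y) = q z x * q z y"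
        using xyz by (simp add: q_def \<chi>h f(11,13) pp power_mult_distrib)
      show "q (x \<otimes>\<^bsub>A\<^esub> y) z = q x z * q y z"
        using xyz by (simp add: q_def sym[of _ z] \<chi>h f(11,13) pp power_mult_distrib)
    qed
    moreover have "a = \<one>\<^bsub>A\<^esub>" if a: "a \<in> carrier A" "\<And>x. x \<in> carrier A \<Longrightarrow> q a x = 1" for a
    proof -
      \<comment> \<open>Pairing a with c itself tests the cyclic component: as \<pi> c is trivial,
        the value is \<chi> a, which puts a into K.\<close>
      have "c [^]\<^bsub>A\<^esub> i c = c" using f(7)[of "i c" 1] f(1,3) f(6)[of c] by simp
      hence "c \<otimes>\<^bsub>A\<^esub> \<pi> c = c" using f(12)[OF f(1)] by simp
      hence "\<pi> c = \<one>\<^bsub>A\<^esub>" using f(1) KA[OF f(11)[OF f(1)]] by simp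
      hence "\<chi> a = 1" using a(2)[OF f(1)] f(11)[OF a(1)] f(3) f(6)[OF a(1)] a(1) by (simp add: q_def p1)
      hence aK: "a \<in> K" using a(1) f(9) by simp
      have "p a x = 1" if "x \<in> K" for x using a(2)[of x] KA[OF that] that f(9) aK by (simp add: q_def f(14))
      thus ?thesis using p(2) aK by blast
    qed
    moreover have "\<exists>a\<in>carrier A. \<forall>x\<in>carrier A. \<psi> x = q a x" if \<psi>: "\<psi> \<in> hom A kstar" for \<psi>
    proof -
      note \<psi>h = hom_kstar[OF \<psi>]
      have "\<psi> \<in> hom (A\<lparr>carrier := K\<rparr>) kstar" using \<psi> KA by (auto simp: hom_def)
      then obtain k where k: "k \<in> K" "\<And>x. x \<in> K \<Longrightarrow> \<psi> x = p k x" using p(3) by blast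
      have "\<psi> c ^ n = 1" using \<psi>h(5)[OF f(1), of n] f(4) \<psi>h(3) by simp
      then obtain j where j: "\<psi> c = \<zeta> ^ j" using f(5) by blast
      \<comment> \<open>The factor c^j reproduces \<psi> on c and the factor k reproduces it on
        K.\<close>
      define a where "a = c [^]\<^bsub>A\<^esub> j \<otimes>\<^bsub>A\<^esub> k"
      have a: "a \<in> carrier A" using f(1) k KA by (simp add: a_def)
      have "\<chi> k = 1" using k(1) f(9) by simp
      hence \<chi>a: "\<chi> a = \<zeta> ^ j" using f(1,3) KA[OF k(1)] by (simp add: a_def \<chi>h)
      hence "c [^]\<^bsub>A\<^esub> i a = c [^]\<^bsub>A\<^esub> j" using f(6)[OF a] f(7)[of "i a" j] by simp
      hence "c [^]\<^bsub>A\<^esub> j \<otimes>\<^bsub>A\<^esub> \<pi> a = c [^]\<^bsub>A\<^esub> j \<otimes>\<^bsub>A\<^esub> k" using f(12)[OF a] a_def by simp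
      hence \<pi>a: "\<pi> a = k" using f(1) KA[OF k(1)] KA[OF f(11)[OF a]] by simp
      have "\<psi> x = q a x" if x: "x \<in> carrier A" for x
      proof -
        have "\<psi> x = \<psi> c ^ i x * \<psi> (\<pi> x)"
          using \<psi>h(1)[of "c [^]\<^bsub>A\<^esub> i x" "\<pi> x"] f(12)[OF x] f(1) KA[OF f(11)[OF x]] \<psi>h(5) by simp
        thus ?thesis using sym[OF a x] by (simp add: q_def \<pi>a \<chi>a j k(2) f(11) x)
      qed
      thus ?thesis using a by blast
    qed
    ultimately show ?thesis by blast
  qed
qed

text \<open>On \<open>\<langle>c\<rangle> \<times> K\<close> an alternating form is determined by its restriction to \<open>K \<times> K\<close> and its values
  \<open>b(c, k)\<close>, and the latter are skew-symmetrised from \<open>(g, h) \<mapsto> b(pr h, \<pi> g)\<close>, where \<open>pr\<close> is the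
  projection to \<open>\<langle>c\<rangle>\<close>.\<close>

lemma alternating_bichar_eq_quotient:
  fixes b :: "'a \<Rightarrow> 'a \<Rightarrow> 'k::{alg_closed_field, field_char_0}"
  assumes "comm_group A" "finite (carrier A)" "bichar A b"
    "\<And>x y. x \<in> carrier A \<Longrightarrow> y \<in> carrier A \<Longrightarrow> b x y = inverse (b y x)"
    "\<And>x. x \<in> carrier A \<Longrightarrow> b x x = 1"
  shows "\<exists>f. bichar A f \<and> (\<forall>x\<in>carrier A. \<forall>y\<in>carrier A. b x y = f y x / f x y)"
  using assms
proof (induction "card (carrier A)" arbitrary: A rule: less_induct)
  case (less A)
  interpret comm_group A by (rule less.prems(1))
  note fin = less.prems(2) and b = less.prems(3) and alt = less.prems(4,5)
  have bb: "b (x \<otimes>\<^bsub>A\<^esub> y) z = b x z * b y z" "b z (x \<otimes>\<^bsub>A\<^esub> y) = b z x * b z y" "b x y \<noteq> 0"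
    if "x \<in> carrier A" "y \<in> carrier A" "z \<in> carrier A" for x y z
    using b that by (auto simp: bichar_def)
  show ?case
  proof (cases "card (carrier A) > 1")
    case False
    hence "carrier A = {\<one>\<^bsub>A\<^esub>}" using fin one_closed
      by (metis card_le_Suc0_iff_eq One_nat_def not_less equals0D is_singletonI' is_singleton_def singletonD)
    thus ?thesis using alt by (intro exI[of _ "\<lambda>_ _. 1"]) (auto simp: bichar_def)
  next
    case True
    obtain c n K i \<pi> and \<zeta> :: 'k and \<chi> where "cyclic_splitting A c n K i \<pi> \<zeta> \<chi>"
      using cyclic_factor[OF fin True, where ?'k = 'k] by blast
    then interpret S: cyclic_splitting A c n K i \<pi> \<zeta> \<chi> .
    note f = S.split
    interpret K: comm_group "A\<lparr>carrier := K\<rparr>" using f(8) by (rule comm_group_subgroup)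
    have KA: "x \<in> carrier A" if "x \<in> K" for x using that f(9) by simp
    hence fK: "finite K" using fin by (metis finite_subset subsetI)
    have \<pi>A: "\<pi> x \<in> carrier A" if "x \<in> carrier A" for x using KA f(11) that by blast
    have bK: "bichar (A\<lparr>carrier := K\<rparr>) b" using b KA by (auto simp: bichar_def)
    have "\<exists>f. bichar (A\<lparr>carrier := K\<rparr>) f \<and>
       (\<forall>x\<in>carrier (A\<lparr>carrier := K\<rparr>). \<forall>y\<in>carrier (A\<lparr>carrier := K\<rparr>). b x y = f y x / f x y)"
      by (rule less.hyps[OF _ K.comm_group_axioms _ bK alt]) (use f(10) fK KA in auto)
    then obtain g where g: "bichar (A\<lparr>carrier := K\<rparr>) g" "\<And>x y. x \<in> K \<Longrightarrow> y \<in> K \<Longrightarrow> b x y = g y x / g x y"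
      by auto
    define q where "q = (\<lambda>x y. b (c [^]\<^bsub>A\<^esub> i y) (\<pi> x) * g (\<pi> x) (\<pi> y))"
    have cp: "c [^]\<^bsub>A\<^esub> m \<in> carrier A" for m :: nat using f(1) by simp
    have ci: "c [^]\<^bsub>A\<^esub> i (x \<otimes>\<^bsub>A\<^esub> y) = c [^]\<^bsub>A\<^esub> i x \<otimes>\<^bsub>A\<^esub> c [^]\<^bsub>A\<^esub> i y"
      if "x \<in> carrier A" "y \<in> carrier A" for x y
    proof -
      have "\<zeta> ^ i (x \<otimes>\<^bsub>A\<^esub> y) = \<zeta> ^ (i x + i y)"
        using f(6)[of "x \<otimes>\<^bsub>A\<^esub> y"] f(6)[of x] f(6)[of y] that hom_kstar(1)[OF f(2)] by (simp add: power_add)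
      thus ?thesis using f(7)[of "i (x \<otimes>\<^bsub>A\<^esub> y)" "i x + i y"] f(1) by (simp add: nat_pow_mult)
    qed
    have "bichar A q"
      unfolding bichar_def
    proof (intro ballI conjI)
      fix x y z assume xyz: "x \<in> carrier A" "y \<in> carrier A" "z \<in> carrier A"
      have gg: "g (a \<otimes>\<^bsub>A\<^esub> b) d = g a d * g b d" "g d (a \<otimes>\<^bsub>A\<^esub> b) = g d a * g d b" "g a b \<noteq> 0"
        if "a \<in> K" "b \<in> K" "d \<in> K" for a b d using g(1) that by (auto simp: bichar_def)
      show "q x y \<noteq> 0" using xyz by (simp add: q_def bb(3)[of _ _ x] gg(3)[of _ _ "\<pi> x"] f(11) cp \<pi>A)
      show "q z (x \<otimes>\<^bsub>A\<^esub> y) = q z x * q z y"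
        using xyz by (simp add: q_def ci f(11,13) gg bb cp \<pi>A)
      show "q (x \<otimes>\<^bsub>A\<^esub> y) z = q x z * q y z"
        using xyz by (simp add: q_def f(11,13) gg bb cp \<pi>A)
    qed
    moreover have "b x y = q y x / q x y" if xy: "x \<in> carrier A" "y \<in> carrier A" for x y
    proof -
      \<comment> \<open>On the cyclic factor the form is trivial because b(c, c) = 1; only the mixed
        terms and K contribute.\<close>
      have cc: "b (c [^]\<^bsub>A\<^esub> j) (c [^]\<^bsub>A\<^esub> m) = 1" for j m :: nat
        using hom_kstar(5)[OF bichar_hom(1)[OF b cp[of j]] f(1), of m]
          hom_kstar(5)[OF bichar_hom(2)[OF b f(1)] f(1), of j] alt(2)[OF f(1)] by simp
      have "b x y = b (c [^]\<^bsub>A\<^esub> i x \<otimes>\<^bsub>A\<^esub> \<pi> x) (c [^]\<^bsub>A\<^esub> i y \<otimes>\<^bsub>A\<^esub> \<pi> y)" using xy by (simp add: f(12))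
      also have "\<dots> = b (c [^]\<^bsub>A\<^esub> i x) (\<pi> y) * b (\<pi> x) (c [^]\<^bsub>A\<^esub> i y) * b (\<pi> x) (\<pi> y)"
        using xy by (simp add: bb cp \<pi>A cc)
      also have "b (\<pi> x) (c [^]\<^bsub>A\<^esub> i y) = inverse (b (c [^]\<^bsub>A\<^esub> i y) (\<pi> x))"
        by (rule alt(1)) (use xy cp \<pi>A in auto)
      also have "b (\<pi> x) (\<pi> y) = g (\<pi> y) (\<pi> x) / g (\<pi> x) (\<pi> y)" using xy g(2) f(11) by blast
      also have "b (c [^]\<^bsub>A\<^esub> i x) (\<pi> y) * inverse (b (c [^]\<^bsub>A\<^esub> i y) (\<pi> x)) * (g (\<pi> y) (\<pi> x) / g (\<pi> x) (\<pi> y)) = q y x / q x y"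
        by (simp add: q_def divide_inverse)
      finally show ?thesis .
    qed
    ultimately show ?thesis by blast
  qed
qed

section \<open>Dual groups and groups of alternating forms\<close>

lemma carrier_dual_group: "carrier (dual_group A :: ('a \<Rightarrow> 'k::field) monoid) = hom A kstar \<inter> extensional (carrier A)"
  by (simp add: dual_group_def hom_group_def)

lemma dual_group_mult: "x \<in> carrier A \<Longrightarrow> (\<chi> \<otimes>\<^bsub>dual_group A\<^esub> \<psi>) x = \<chi> x * (\<psi> x :: 'k::field)"
  by (simp add: dual_group_def hom_group_def)

lemma dual_group_one: "x \<in> carrier A \<Longrightarrow> \<one>\<^bsub>dual_group A\<^esub> x = (1 :: 'k::field)"
  by (simp add: dual_group_def hom_group_def)

lemma dual_group_ext: "\<chi> \<otimes>\<^bsub>dual_group A\<^esub> \<psi> \<in> extensional (carrier A)" "\<one>\<^bsub>dual_group A\<^esub> \<in> extensional (carrier A)"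
  by (simp_all add: dual_group_def hom_group_def)

lemma comm_group_hom_group:
  assumes "group A" "comm_group C" shows "comm_group (hom_group A C)"
proof -
  interpret A: group A by fact
  interpret C: comm_group C by fact
  have inH: "f x \<in> carrier C" if "f \<in> carrier (hom_group A C)" "x \<in> carrier A" for f x
    using that by (auto simp: hom_group_def hom_def)
  have inM: "f (x \<otimes>\<^bsub>A\<^esub> y) = f x \<otimes>\<^bsub>C\<^esub> f y"
    if "f \<in> carrier (hom_group A C)" "x \<in> carrier A" "y \<in> carrier A" for f x y
    using that by (auto simp: hom_group_def hom_def)
  have inI: "restrict f (carrier A) \<in> carrier (hom_group A C)"
    if "\<And>x. x \<in> carrier A \<Longrightarrow> f x \<in> carrier C"
      "\<And>x y. x \<in> carrier A \<Longrightarrow> y \<in> carrier A \<Longrightarrow> f (x \<otimes>\<^bsub>A\<^esub> y) = f x \<otimes>\<^bsub>C\<^esub> f y" for f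
    using that by (auto simp: hom_group_def hom_def)
  have mult: "f \<otimes>\<^bsub>hom_group A C\<^esub> g = restrict (\<lambda>x. f x \<otimes>\<^bsub>C\<^esub> g x) (carrier A)" for f g
    by (simp add: hom_group_def)
  have one: "\<one>\<^bsub>hom_group A C\<^esub> = restrict (\<lambda>x. \<one>\<^bsub>C\<^esub>) (carrier A)" by (simp add: hom_group_def)
  show ?thesis
  proof (rule comm_groupI)
    fix f g assume f: "f \<in> carrier (hom_group A C)" and g: "g \<in> carrier (hom_group A C)"
    note fg = inH[OF f] inM[OF f] inH[OF g] inM[OF g]
    show "f \<otimes>\<^bsub>hom_group A C\<^esub> g \<in> carrier (hom_group A C)"
      unfolding mult by (rule inI) (simp_all add: fg C.m_ac)
    show "f \<otimes>\<^bsub>hom_group A C\<^esub> g = g \<otimes>\<^bsub>hom_group A C\<^esub> f"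
      unfolding mult by (rule restrict_ext) (simp add: fg C.m_comm)
    show "\<exists>y\<in>carrier (hom_group A C). y \<otimes>\<^bsub>hom_group A C\<^esub> f = \<one>\<^bsub>hom_group A C\<^esub>"
    proof (rule bexI)
      show "restrict (\<lambda>x. inv\<^bsub>C\<^esub> f x) (carrier A) \<in> carrier (hom_group A C)"
        by (rule inI) (simp_all add: fg C.inv_mult)
      show "restrict (\<lambda>x. inv\<^bsub>C\<^esub> f x) (carrier A) \<otimes>\<^bsub>hom_group A C\<^esub> f = \<one>\<^bsub>hom_group A C\<^esub>"
        unfolding mult one by (rule restrict_ext) (simp add: fg)
    qed
    have "f \<in> extensional (carrier A)" using f by (simp add: hom_group_def)
    thus "\<one>\<^bsub>hom_group A C\<^esub> \<otimes>\<^bsub>hom_group A C\<^esub> f = f"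
      unfolding mult one by (intro extensionalityI[of _ "carrier A"]) (simp_all add: fg)
    fix h assume h: "h \<in> carrier (hom_group A C)"
    show "f \<otimes>\<^bsub>hom_group A C\<^esub> g \<otimes>\<^bsub>hom_group A C\<^esub> h = f \<otimes>\<^bsub>hom_group A C\<^esub> (g \<otimes>\<^bsub>hom_group A C\<^esub> h)"
      unfolding mult by (rule restrict_ext) (simp add: fg inH[OF h] C.m_assoc)
  qed (auto simp: one intro: inI)
qed

lemma comm_group_dual: "group A \<Longrightarrow> comm_group (dual_group A :: ('a \<Rightarrow> 'k::field) monoid)"
  unfolding dual_group_def by (intro comm_group_hom_group comm_group_kstar)

text \<open>Nondegeneracy of a perfect pairing p makes a \<mapsto> p(a, -) injective, its
  representing property makes it surjective.\<close>

lemma dual_group_iso: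
  assumes "comm_group A" "finite (carrier A)"
  obtains h where "h \<in> iso A (dual_group A :: ('a \<Rightarrow> 'k::{alg_closed_field, field_char_0}) monoid)"
proof -
  interpret comm_group A by fact
  obtain p :: "'a \<Rightarrow> 'a \<Rightarrow> 'k" where P: "bichar A p \<and>
     (\<forall>a\<in>carrier A. (\<forall>x\<in>carrier A. p a x = 1) \<longrightarrow> a = \<one>\<^bsub>A\<^esub>) \<and>
     (\<forall>\<psi>\<in>hom A kstar. \<exists>a\<in>carrier A. \<forall>x\<in>carrier A. \<psi> x = p a x)"
    using perfect_pairing_exists[OF assms, where ?'k = 'k] by (rule exE)
  hence p: "bichar A p"
    "\<And>a. a \<in> carrier A \<Longrightarrow> (\<And>x. x \<in> carrier A \<Longrightarrow> p a x = 1) \<Longrightarrow> a = \<one>\<^bsub>A\<^esub>"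
    "\<And>\<psi>. \<psi> \<in> hom A kstar \<Longrightarrow> \<exists>a\<in>carrier A. \<forall>x\<in>carrier A. \<psi> x = p a x"
    by simp_all
  define h where "h = (\<lambda>a. restrict (p a) (carrier A))"
  have h: "h \<in> hom A (dual_group A)"
  proof (rule homI)
    show "h x \<in> carrier (dual_group A)" if "x \<in> carrier A" for x
      using bichar_hom(1)[OF p(1) that] by (auto simp: carrier_dual_group h_def hom_def)
    show "h (x \<otimes>\<^bsub>A\<^esub> y) = h x \<otimes>\<^bsub>dual_group A\<^esub> h y" if "x \<in> carrier A" "y \<in> carrier A" for x y
      using p(1) that by (intro extensionalityI[of _ "carrier A"])
        (auto simp: h_def dual_group_mult dual_group_ext bichar_def)
  qed
  interpret D: comm_group "dual_group A :: ('a \<Rightarrow> 'k) monoid" by (intro comm_group_dual is_group)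
  interpret h: group_hom A "dual_group A :: ('a \<Rightarrow> 'k) monoid" h by unfold_locales (rule h)
  have "inj_on h (carrier A)"
    unfolding h.inj_iff_trivial_ker
  proof (intro equalityI subsetI)
    fix a assume "a \<in> kernel A (dual_group A :: ('a \<Rightarrow> 'k) monoid) h"
    hence a: "a \<in> carrier A" "h a = \<one>\<^bsub>dual_group A\<^esub>" by (auto simp: kernel_def)
    have "p a x = 1" if "x \<in> carrier A" for x
      using that arg_cong[OF a(2), of "\<lambda>f. f x"] by (simp add: h_def dual_group_one)
    thus "a \<in> {\<one>\<^bsub>A\<^esub>}" using p(2) a(1) by blast
  qed (auto simp: kernel_def)
  moreover have "h ` carrier A = carrier (dual_group A)"
  proof (intro equalityI subsetI)
    fix \<psi> assume \<psi>: "\<psi> \<in> carrier (dual_group A :: ('a \<Rightarrow> 'k) monoid)"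
    then obtain a where a: "a \<in> carrier A" "\<forall>x\<in>carrier A. \<psi> x = p a x"
      using p(3) by (auto simp: carrier_dual_group)
    hence "h a = \<psi>" using \<psi> by (intro extensionalityI[of _ "carrier A"]) (auto simp: h_def carrier_dual_group)
    thus "\<psi> \<in> h ` carrier A" using a by blast
  qed (use h.hom_closed in blast)
  ultimately show ?thesis using h by (intro that[of h]) (simp add: iso_def bij_betw_def)
qed

text \<open>Uncurrying. Elements of the iterated hom group carry a default value off the carrier in
  each of the two arguments; both levels of extensionality together make a bicharacter a unique
  element.\<close>

lemma hom_dual_iff:
  assumes "group A"
  shows "b \<in> carrier (hom_group A (dual_group A :: ('a \<Rightarrow> 'k::field) monoid)) \<longleftrightarrow>
    bichar A b \<and> b \<in> extensional (carrier A) \<and> (\<forall>x\<in>carrier A. b x \<in> extensional (carrier A))"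
    (is "?L \<longleftrightarrow> ?R")
proof
  interpret A: group A by fact
  assume b: ?L
  hence hb: "b \<in> hom A (dual_group A)" "b \<in> extensional (carrier A)" by (auto simp: hom_group_def)
  have bx: "b x \<in> hom A kstar \<inter> extensional (carrier A)" if "x \<in> carrier A" for x
    using hb(1) that by (auto simp: hom_def carrier_dual_group)
  have "b (x \<otimes>\<^bsub>A\<^esub> y) z = b x z * b y z" if "x \<in> carrier A" "y \<in> carrier A" "z \<in> carrier A" for x y z
    using hb(1) that by (simp add: hom_def dual_group_mult)
  moreover have "b z (x \<otimes>\<^bsub>A\<^esub> y) = b z x * b z y" "b x y \<noteq> 0" if "x \<in> carrier A" "y \<in> carrier A" "z \<in> carrier A" for x y z
    using A.hom_kstar(1,2) bx that by blast+
  ultimately have "bichar A b" unfolding bichar_def by simp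
  thus ?R using hb bx by blast
next
  assume R: ?R
  have "b \<in> hom A (dual_group A)"
  proof (rule homI)
    show "b x \<in> carrier (dual_group A)" if "x \<in> carrier A" for x
      using R that bichar_hom(1)[of A b x] by (auto simp: carrier_dual_group)
    show "b (x \<otimes>\<^bsub>A\<^esub> y) = b x \<otimes>\<^bsub>dual_group A\<^esub> b y" if "x \<in> carrier A" "y \<in> carrier A" for x y
      using R that assms by (intro extensionalityI[of _ "carrier A"])
        (auto simp: dual_group_mult dual_group_ext bichar_def group.is_monoid monoid.m_closed)
  qed
  thus ?L using R by (auto simp: hom_group_def)
qed

lemma hom_dual_mult:
  "x \<in> carrier A \<Longrightarrow> y \<in> carrier A \<Longrightarrow>
    (b \<otimes>\<^bsub>hom_group A (dual_group A)\<^esub> c) x y = b x y * (c x y :: 'k::field)"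
  by (simp add: hom_group_def dual_group_mult)

lemma hom_dual_eqI:
  assumes "b \<in> extensional (carrier A)" "c \<in> extensional (carrier A)"
    "\<And>x. x \<in> carrier A \<Longrightarrow> b x \<in> extensional (carrier A)" "\<And>x. x \<in> carrier A \<Longrightarrow> c x \<in> extensional (carrier A)"
    "\<And>x y. x \<in> carrier A \<Longrightarrow> y \<in> carrier A \<Longrightarrow> b x y = c x y"
  shows "b = c"
  by (rule extensionalityI[OF assms(1,2)], rule extensionalityI[OF assms(3,4)]) (use assms(5) in auto)

lemma hom_dual_mult_ext:
  "b \<otimes>\<^bsub>hom_group A (dual_group A)\<^esub> c \<in> extensional (carrier A)"
  "x \<in> carrier A \<Longrightarrow> (b \<otimes>\<^bsub>hom_group A (dual_group A)\<^esub> c) x \<in> extensional (carrier A)"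
  by (auto simp: hom_group_def dual_group_def)

definition alternating :: "('a, 'm) monoid_scheme \<Rightarrow> ('a \<Rightarrow> 'a \<Rightarrow> 'k::field) \<Rightarrow> bool" where
  "alternating A b \<longleftrightarrow> (\<forall>x\<in>carrier A. \<forall>y\<in>carrier A. b x y = inverse (b y x) \<and> b x x = 1)"

text \<open>Isomorphic to the character group of the exterior square of A; it mediates between
  \<open>Balt\<close> and the exterior square of the dual group.\<close>

definition alt_group :: "('a, 'm) monoid_scheme \<Rightarrow> ('a \<Rightarrow> 'a \<Rightarrow> 'k::field) monoid" where
  "alt_group A = (hom_group A (dual_group A))\<lparr>carrier :=
     {b \<in> carrier (hom_group A (dual_group A)). alternating A b}\<rparr>"

lemma alternatingD:
  assumes "alternating A b" "x \<in> carrier A"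
  shows "b x x = 1" "y \<in> carrier A \<Longrightarrow> b x y = inverse (b y x)"
  using assms unfolding alternating_def by blast+

lemma carrier_alt_group:
  assumes "group A"
  shows "b \<in> carrier (alt_group A :: ('a \<Rightarrow> 'a \<Rightarrow> 'k::field) monoid) \<longleftrightarrow>
    bichar A b \<and> alternating A b \<and> b \<in> extensional (carrier A) \<and> (\<forall>x\<in>carrier A. b x \<in> extensional (carrier A))"
  using hom_dual_iff[OF assms, of b] by (auto simp: alt_group_def)

definition pull :: "('a, 'm) monoid_scheme \<Rightarrow> ('a \<Rightarrow> 'b) \<Rightarrow> ('b \<Rightarrow> 'b \<Rightarrow> 'k::field) \<Rightarrow> 'a \<Rightarrow> 'a \<Rightarrow> 'k" where
  "pull A h b = restrict (\<lambda>x. restrict (\<lambda>y. b (h x) (h y)) (carrier A)) (carrier A)"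

lemma pull_alt_group:
  fixes A :: "('a, 'm) monoid_scheme" and D :: "('b, 'n) monoid_scheme" and b :: "'b \<Rightarrow> 'b \<Rightarrow> 'k::field"
  assumes A: "group A" and D: "group D" and b: "b \<in> carrier (alt_group D)"
    and hc: "\<And>x. x \<in> carrier A \<Longrightarrow> h x \<in> carrier D"
    and hm: "\<And>x y. x \<in> carrier A \<Longrightarrow> y \<in> carrier A \<Longrightarrow> h (x \<otimes>\<^bsub>A\<^esub> y) = h x \<otimes>\<^bsub>D\<^esub> h y"
  shows "pull A h b \<in> carrier (alt_group A)"
proof -
  interpret A: group A by fact
  have "bichar D b" and alt: "alternating D b" using b by (auto simp: carrier_alt_group[OF D])
  hence "bichar A (pull A h b)" by (auto simp: bichar_def pull_def hc hm)
  moreover have "alternating A (pull A h b)"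
    unfolding alternating_def
  proof (intro ballI conjI)
    fix x y assume xy: "x \<in> carrier A" "y \<in> carrier A"
    show "pull A h b x y = inverse (pull A h b y x)"
      using alternatingD(2)[OF alt hc[OF xy(1)] hc[OF xy(2)]] xy by (simp add: pull_def)
    show "pull A h b x x = 1" using alternatingD(1)[OF alt hc[OF xy(1)]] xy by (simp add: pull_def)
  qed
  ultimately show ?thesis by (auto simp: carrier_alt_group[OF A] pull_def)
qed

text \<open>Pulling back is contravariant: an isomorphism from A to its dual will carry forms on the
  dual to forms on A.\<close>

lemma alt_group_iso:
  fixes A :: "('a, 'm) monoid_scheme" and D :: "('b, 'n) monoid_scheme"
  assumes A: "group A" and D: "group D" and h: "h \<in> iso A D"
  shows "pull A h \<in> iso (alt_group D) (alt_group A :: ('a \<Rightarrow> 'a \<Rightarrow> 'k::field) monoid)"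
proof -
  interpret A: group A by fact
  interpret D: group D by fact
  have hh: "h \<in> hom A D" "bij_betw h (carrier A) (carrier D)" using h by (auto simp: iso_def)
  hence hc: "h x \<in> carrier D" if "x \<in> carrier A" for x using that by (auto simp: hom_def)
  have hm: "h (x \<otimes>\<^bsub>A\<^esub> y) = h x \<otimes>\<^bsub>D\<^esub> h y" if "x \<in> carrier A" "y \<in> carrier A" for x y
    using hh that by (auto simp: hom_def)
  define g where "g = inv_into (carrier A) h"
  have g: "g y \<in> carrier A" "h (g y) = y" if "y \<in> carrier D" for y
    using hh(2) that unfolding g_def bij_betw_def by (auto intro: inv_into_into f_inv_into_f)
  have gm: "g (x \<otimes>\<^bsub>D\<^esub> y) = g x \<otimes>\<^bsub>A\<^esub> g y" if "x \<in> carrier D" "y \<in> carrier D" for x y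
    using hh(2) g that by (intro inj_onD[of h "carrier A"]) (auto simp: hm bij_betw_def)
  have gh: "g (h x) = x" if "x \<in> carrier A" for x
    using hh(2) that by (simp add: g_def bij_betw_def)
  have alt: "pull A h b \<in> carrier (alt_group A)" if "b \<in> carrier (alt_group D :: ('b \<Rightarrow> 'b \<Rightarrow> 'k) monoid)" for b
    by (rule pull_alt_group[OF A D that hc hm])
  have "pull A h \<in> hom (alt_group D) (alt_group A :: ('a \<Rightarrow> 'a \<Rightarrow> 'k) monoid)"
  proof (rule homI[OF alt])
    fix b c :: "'b \<Rightarrow> 'b \<Rightarrow> 'k"
    show "pull A h (b \<otimes>\<^bsub>alt_group D\<^esub> c) = pull A h b \<otimes>\<^bsub>alt_group A\<^esub> pull A h c"
      by (rule hom_dual_eqI[of _ A])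
        (auto simp: alt_group_def pull_def hom_dual_mult hc hom_dual_mult_ext)
  qed
  moreover have "bij_betw (pull A h) (carrier (alt_group D)) (carrier (alt_group A :: ('a \<Rightarrow> 'a \<Rightarrow> 'k) monoid))"
  proof (rule bij_betw_byWitness[where f' = "pull D g"])
    show "\<forall>b\<in>carrier (alt_group D). pull D g (pull A h b) = (b :: 'b \<Rightarrow> 'b \<Rightarrow> 'k)"
      by (intro ballI hom_dual_eqI[of _ D]) (auto simp: carrier_alt_group[OF D] pull_def g)
    show "\<forall>b\<in>carrier (alt_group A). pull A h (pull D g b) = (b :: 'a \<Rightarrow> 'a \<Rightarrow> 'k)"
      by (intro ballI hom_dual_eqI[of _ A]) (auto simp: carrier_alt_group[OF A] pull_def gh hc)
    show "pull D g ` carrier (alt_group A) \<subseteq> carrier (alt_group D :: ('b \<Rightarrow> 'b \<Rightarrow> 'k) monoid)"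
      using pull_alt_group[OF D A _ g(1) gm] by blast
  qed (use alt in auto)
  ultimately show ?thesis by (auto simp: iso_def)
qed

section \<open>The exterior square\<close>

lemma ext_square_eq:
  "ext_square A = free_Abelian_group (carrier A \<times> carrier A) Mod
     generate (free_Abelian_group (carrier A \<times> carrier A)) (ext_square_rel A)"
  by (simp add: ext_square_def Let_def)

locale ext_sq = comm_group D for D (structure)
begin

abbreviation "F \<equiv> free_Abelian_group (carrier D \<times> carrier D)"
abbreviation "R \<equiv> generate F (ext_square_rel D)"
abbreviation "E \<equiv> ext_square D"

definition wedge where "wedge x y = R #>\<^bsub>F\<^esub> frag_of (x, y)"

sublocale F: comm_group F by (rule abelian_free_Abelian_group)

lemma rel_carrier: "ext_square_rel D \<subseteq> carrier F"
proof -
  have "frag_of p \<in> carrier F" if "p \<in> carrier D \<times> carrier D" for p using that by simp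
  hence "frag_of p - frag_of q - frag_of r \<in> carrier F"
    if "p \<in> carrier D \<times> carrier D" "q \<in> carrier D \<times> carrier D" "r \<in> carrier D \<times> carrier D" for p q r
    using that by (metis F.inv_closed F.m_closed carrier_free_Abelian_group_iff inv_free_Abelian_group
      mult_free_Abelian_group add_uminus_conv_diff)
  thus ?thesis unfolding ext_square_rel_def by auto
qed

lemma normal_R: "R \<lhd> F"
  using F.subgroup_imp_normal F.generate_is_subgroup rel_carrier by blast

sublocale R: normal R F by (rule normal_R)

lemma comm_group_E: "comm_group E"
  unfolding ext_square_eq using F.abelian_FactGroup normal_R normal_imp_subgroup by blast

sublocale E: comm_group E by (rule comm_group_E)

lemma coset_hom: "(\<lambda>x. R #>\<^bsub>F\<^esub> x) \<in> hom F E"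
  unfolding ext_square_eq by (rule R.r_coset_hom_Mod)

lemma rel_coset: "r \<in> ext_square_rel D \<Longrightarrow> R #>\<^bsub>F\<^esub> r = \<one>\<^bsub>E\<^esub>"
  unfolding ext_square_eq one_FactGroup
  by (rule F.coset_join2[OF _ F.generate_is_subgroup[OF rel_carrier] generate.incl])
    (use subsetD[OF rel_carrier] in blast)+

lemma coset_diff:
  assumes "x \<in> carrier F" "y \<in> carrier F"
  shows "R #>\<^bsub>F\<^esub> (x - y) = (R #>\<^bsub>F\<^esub> x) \<otimes>\<^bsub>E\<^esub> inv\<^bsub>E\<^esub> (R #>\<^bsub>F\<^esub> y)"
proof -
  interpret group_hom F E "\<lambda>x. R #>\<^bsub>F\<^esub> x" by unfold_locales (rule coset_hom)
  have "x - y = x \<otimes>\<^bsub>F\<^esub> inv\<^bsub>F\<^esub> y" using assms by simp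
  thus ?thesis using assms by (simp only: hom_mult hom_inv F.inv_closed)
qed

lemma wedge_closed [simp]: "x \<in> carrier D \<Longrightarrow> y \<in> carrier D \<Longrightarrow> wedge x y \<in> carrier E"
  unfolding wedge_def using coset_hom by (auto simp: hom_def Pi_iff)

text \<open>The free group is written additively and its quotient multiplicatively. The bilinearity
  relators all have the shape p - q - r, and they turn into p = q r.\<close>

lemma frag3:
  assumes "p \<in> carrier D \<times> carrier D" "q \<in> carrier D \<times> carrier D" "r \<in> carrier D \<times> carrier D"
    "frag_of p - frag_of q - frag_of r \<in> ext_square_rel D"
  shows "R #>\<^bsub>F\<^esub> frag_of p = (R #>\<^bsub>F\<^esub> frag_of q) \<otimes>\<^bsub>E\<^esub> (R #>\<^bsub>F\<^esub> frag_of r)"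
proof -
  let ?q = "\<lambda>x. R #>\<^bsub>F\<^esub> x"
  have c: "frag_of p \<in> carrier F" "frag_of q \<in> carrier F" "frag_of r \<in> carrier F" using assms by simp_all
  have d: "frag_of p - frag_of q \<in> carrier F"
    using F.m_closed[OF c(1) F.inv_closed[OF c(2)]] c by simp
  have qc: "?q x \<in> carrier E" if "x \<in> carrier F" for x using coset_hom that by (auto simp: hom_def)
  have "\<one>\<^bsub>E\<^esub> = ?q (frag_of p) \<otimes>\<^bsub>E\<^esub> inv\<^bsub>E\<^esub> ?q (frag_of q) \<otimes>\<^bsub>E\<^esub> inv\<^bsub>E\<^esub> ?q (frag_of r)"
    using rel_coset[OF assms(4)] coset_diff d c by metis
  moreover have "p = q \<otimes>\<^bsub>E\<^esub> r" if "\<one>\<^bsub>E\<^esub> = p \<otimes>\<^bsub>E\<^esub> inv\<^bsub>E\<^esub> q \<otimes>\<^bsub>E\<^esub> inv\<^bsub>E\<^esub> r"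
    "p \<in> carrier E" "q \<in> carrier E" "r \<in> carrier E" for p q r
  proof -
    have "r = p \<otimes>\<^bsub>E\<^esub> inv\<^bsub>E\<^esub> q" using that by (metis E.inv_closed E.inv_solve_right E.m_closed E.one_closed E.l_one)
    thus ?thesis using that by (simp add: E.m_assoc[symmetric] E.m_comm[of q p]) (simp add: E.m_assoc)
  qed
  ultimately show ?thesis using qc c by blast
qed

lemma wedge_bilinear:
  assumes "x \<in> carrier D" "y \<in> carrier D" "z \<in> carrier D"
  shows "wedge (x \<otimes> y) z = wedge x z \<otimes>\<^bsub>E\<^esub> wedge y z"
    "wedge z (x \<otimes> y) = wedge z x \<otimes>\<^bsub>E\<^esub> wedge z y"
proof -
  have "frag_of (x \<otimes> y, z) - frag_of (x, z) - frag_of (y, z) \<in> ext_square_rel D"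
    "frag_of (z, x \<otimes> y) - frag_of (z, x) - frag_of (z, y) \<in> ext_square_rel D"
    unfolding ext_square_rel_def using assms by blast+
  thus "wedge (x \<otimes> y) z = wedge x z \<otimes>\<^bsub>E\<^esub> wedge y z"
    "wedge z (x \<otimes> y) = wedge z x \<otimes>\<^bsub>E\<^esub> wedge z y"
    unfolding wedge_def using assms by (simp_all add: frag3)
qed

lemma wedge_self: "x \<in> carrier D \<Longrightarrow> wedge x x = \<one>\<^bsub>E\<^esub>"
  unfolding wedge_def by (rule rel_coset) (unfold ext_square_rel_def, blast)

text \<open>Wedges generate. Stating this for an arbitrary subgroup T covers both uses: T the range
  of a finite set of products, and T the locus where two characters agree.\<close>

lemma wedge_induct:
  assumes "e \<in> carrier E" and T: "subgroup T E"
    and "\<And>x y. x \<in> carrier D \<Longrightarrow> y \<in> carrier D \<Longrightarrow> wedge x y \<in> T"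
  shows "e \<in> T"
proof -
  obtain u where u: "u \<in> carrier F" "e = R #>\<^bsub>F\<^esub> u"
    using assms(1) by (auto simp: ext_square_eq carrier_FactGroup)
  have "Poly_Mapping.keys u \<subseteq> carrier D \<times> carrier D" using u by simp
  hence "R #>\<^bsub>F\<^esub> u \<in> T"
  proof (rule free_Abelian_group_induct)
    have "R #>\<^bsub>F\<^esub> \<one>\<^bsub>F\<^esub> = \<one>\<^bsub>E\<^esub>" by (rule hom_one[OF coset_hom F.is_group E.is_group])
    thus "R #>\<^bsub>F\<^esub> 0 \<in> T" using subgroup.one_closed[OF T] by simp
    show "R #>\<^bsub>F\<^esub> (x - y) \<in> T" if "Poly_Mapping.keys x \<subseteq> carrier D \<times> carrier D"
      "Poly_Mapping.keys y \<subseteq> carrier D \<times> carrier D" "R #>\<^bsub>F\<^esub> x \<in> T" "R #>\<^bsub>F\<^esub> y \<in> T" for x y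
      using that by (simp add: coset_diff subgroup.m_closed[OF T] subgroup.m_inv_closed[OF T])
    show "R #>\<^bsub>F\<^esub> frag_of a \<in> T" if "a \<in> carrier D \<times> carrier D" for a
      using assms(3) that by (auto simp: wedge_def)
  qed
  thus ?thesis using u by simp
qed

text \<open>Each wedge is annihilated by N = |D|, so every element is a product of wedge powers with
  exponents below N. Finiteness is the condition under which self-duality applies to the exterior
  square.\<close>

lemma finite_E:
  assumes fin: "finite (carrier D)" shows "finite (carrier E)"
proof -
  define N where "N = order D"
  have N0: "N > 0" using fin order_gt_0_iff_finite by (simp add: N_def)
  let ?S = "carrier D \<times> carrier D"
  let ?w = "\<lambda>p. wedge (fst p) (snd p)"
  define P where "P = (\<lambda>f :: _ \<Rightarrow> nat. finprod E (\<lambda>p. ?w p [^]\<^bsub>E\<^esub> f p) ?S)"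
  have wN: "wedge x y [^]\<^bsub>E\<^esub> N = \<one>\<^bsub>E\<^esub>" if "x \<in> carrier D" "y \<in> carrier D" for x y
  proof -
    have "(\<lambda>x. wedge x y) \<in> hom D E" using that wedge_bilinear by (auto simp: hom_def)
    then interpret w: group_hom D E "\<lambda>x. wedge x y" by unfold_locales
    show ?thesis using w.hom_nat_pow[OF that(1), of N] that(1) w.hom_one by (simp add: N_def pow_order_eq_1)
  qed
  have Pm: "P f \<otimes>\<^bsub>E\<^esub> P g = P (\<lambda>p. f p + g p)" for f g
  proof -
    have w: "(\<lambda>p. ?w p [^]\<^bsub>E\<^esub> h p) \<in> ?S \<rightarrow> carrier E" for h :: "_ \<Rightarrow> nat" by auto
    have "P f \<otimes>\<^bsub>E\<^esub> P g = finprod E (\<lambda>p. ?w p [^]\<^bsub>E\<^esub> f p \<otimes>\<^bsub>E\<^esub> ?w p [^]\<^bsub>E\<^esub> g p) ?S"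
      unfolding P_def by (rule E.finprod_multf[OF w w, symmetric])
    also have "\<dots> = P (\<lambda>p. f p + g p)"
      unfolding P_def by (intro E.finprod_cong' refl w) (auto simp: E.nat_pow_mult)
    finally show ?thesis .
  qed
  have Pc: "P f \<in> carrier E" for f unfolding P_def by (intro E.finprod_closed) auto
  have P1: "P f = \<one>\<^bsub>E\<^esub>" if dv: "\<And>p. N dvd f p" for f
    unfolding P_def
  proof (rule E.finprod_one_eqI)
    fix p assume p: "p \<in> ?S"
    obtain m where "f p = N * m" using dv[of p] by (auto simp: dvd_def)
    moreover have "?w p [^]\<^bsub>E\<^esub> (N * m) = (?w p [^]\<^bsub>E\<^esub> N) [^]\<^bsub>E\<^esub> m"
      using p by (intro E.nat_pow_pow[symmetric]) auto
    ultimately show "?w p [^]\<^bsub>E\<^esub> f p = \<one>\<^bsub>E\<^esub>" using p wN by (cases p) simp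
  qed
  have sub: "subgroup (range P) E"
  proof (rule E.subgroupI)
    fix a assume "a \<in> range P"
    then obtain f where f: "a = P f" by blast
    \<comment> \<open>The exponent N - 1 stands in for -1, since exponents divisible by N give the
      identity.\<close>
    have "P (\<lambda>p. (N - 1) * f p) \<otimes>\<^bsub>E\<^esub> P f = P (\<lambda>p. N * f p)"
      unfolding Pm using N0 by (intro arg_cong[where f = P]) (auto simp: fun_eq_iff diff_mult_distrib)
    hence "P (\<lambda>p. (N - 1) * f p) \<otimes>\<^bsub>E\<^esub> a = \<one>\<^bsub>E\<^esub>" by (simp add: P1 f)
    hence "inv\<^bsub>E\<^esub> a = P (\<lambda>p. (N - 1) * f p)" using Pc f by (intro E.inv_equality) auto
    thus "inv\<^bsub>E\<^esub> a \<in> range P" by simp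
  qed (use Pc Pm in auto)
  have red: "P f = P (\<lambda>p. f p mod N)" for f
  proof -
    have "P f = P (\<lambda>p. N * (f p div N)) \<otimes>\<^bsub>E\<^esub> P (\<lambda>p. f p mod N)" by (simp add: Pm)
    thus ?thesis using Pc by (simp add: P1)
  qed
  have res: "P f = P (restrict f ?S)" for f
    unfolding P_def by (intro E.finprod_cong' refl) auto
  have "range P \<subseteq> P ` (?S \<rightarrow>\<^sub>E {..<N})"
  proof
    fix a assume "a \<in> range P"
    then obtain f where "a = P f" by blast
    hence "a = P (restrict (\<lambda>p. f p mod N) ?S)" using red res by metis
    moreover have "restrict (\<lambda>p. f p mod N) ?S \<in> ?S \<rightarrow>\<^sub>E {..<N}" using N0 by auto
    ultimately show "a \<in> P ` (?S \<rightarrow>\<^sub>E {..<N})" by blast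
  qed
  moreover have "finite (?S \<rightarrow>\<^sub>E {..<N})" using fin by (intro finite_PiE) auto
  ultimately have "finite (range P)" by (metis finite_imageI finite_subset)
  moreover have "carrier E \<subseteq> range P"
  proof
    fix e assume e: "e \<in> carrier E"
    show "e \<in> range P"
    proof (rule wedge_induct[OF e sub])
      fix x y assume xy: "x \<in> carrier D" "y \<in> carrier D"
      have "P (\<lambda>p. if p = (x, y) then 1 else 0) = finprod E (\<lambda>p. if (x, y) = p then ?w p else \<one>\<^bsub>E\<^esub>) ?S"
        unfolding P_def using xy by (intro E.finprod_cong' refl) auto
      also have "\<dots> = wedge x y" using xy fin E.finprod_singleton[of "(x, y)" ?S ?w] by (simp add: Pi_iff)
      finally show "wedge x y \<in> range P" by (metis rangeI)
    qed
  qed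
  ultimately show ?thesis by (metis finite_subset)
qed

text \<open>The universal property: a character of the quotient is a character of the free group
  that kills the relators, and killing them means that its values on pairs form an alternating
  bicharacter.\<close>

lemma dual_ext_square_iso_alt:
  "(\<lambda>l. restrict (\<lambda>x. restrict (\<lambda>y. l (wedge x y)) (carrier D)) (carrier D)) \<in>
     iso (dual_group E) (alt_group D :: ('a \<Rightarrow> 'a \<Rightarrow> 'k::field) monoid)"
    (is "?T \<in> _")
proof -
  have alt: "?T l \<in> carrier (alt_group D)" if "l \<in> carrier (dual_group E)" for l :: "_ \<Rightarrow> 'k"
  proof -
    have l: "l \<in> hom E kstar" using that by (simp add: carrier_dual_group)
    note lh = E.hom_kstar[OF l]
    have bi: "bichar D (?T l)" unfolding bichar_def by (auto simp: wedge_bilinear lh)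
    have "?T l x y = inverse (?T l y x)" "?T l x x = 1" if "x \<in> carrier D" "y \<in> carrier D" for x y
    proof -
      \<comment> \<open>Expanding the wedge of x y with itself leaves only the two mixed wedges,
        whence skew-symmetry.\<close>
      have "1 = l (wedge (x \<otimes> y) (x \<otimes> y))" using that by (simp add: wedge_self lh)
      also have "\<dots> = l (wedge x y) * l (wedge y x)" using that by (simp add: wedge_bilinear lh) (simp add: wedge_self lh)
      finally have "l (wedge y x) * l (wedge x y) = 1" by (simp add: mult.commute)
      hence "inverse (l (wedge y x)) = l (wedge x y)" by (rule inverse_unique)
      thus "?T l x y = inverse (?T l y x)" using that by simp
      show "?T l x x = 1" using that by (simp add: wedge_self lh)
    qed
    hence "alternating D (?T l)" unfolding alternating_def by blast
    thus ?thesis using bi by (auto simp: carrier_alt_group[OF is_group])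
  qed
  have "?T \<in> hom (dual_group E) (alt_group D :: ('a \<Rightarrow> 'a \<Rightarrow> 'k) monoid)"
  proof (rule homI[OF alt])
    fix l m :: "_ \<Rightarrow> 'k"
    show "?T (l \<otimes>\<^bsub>dual_group E\<^esub> m) = ?T l \<otimes>\<^bsub>alt_group D\<^esub> ?T m"
      by (rule hom_dual_eqI[of _ D])
        (auto simp: alt_group_def hom_dual_mult hom_dual_mult_ext dual_group_mult)
  qed
  moreover have "inj_on ?T (carrier (dual_group E :: (_ \<Rightarrow> 'k) monoid))"
  proof (rule inj_onI)
    fix l m :: "_ \<Rightarrow> 'k" assume l: "l \<in> carrier (dual_group E)" and m: "m \<in> carrier (dual_group E)" and eq: "?T l = ?T m"
    have lm: "l \<in> hom E kstar" "m \<in> hom E kstar" using l m by (auto simp: carrier_dual_group)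
    note lh = E.hom_kstar[OF lm(1)] and mh = E.hom_kstar[OF lm(2)]
    have sub: "subgroup {e \<in> carrier E. l e = m e} E"
      by (rule E.subgroupI) (auto simp: lh mh intro: exI[of _ "\<one>\<^bsub>E\<^esub>"])
    have "l (wedge x y) = m (wedge x y)" if "x \<in> carrier D" "y \<in> carrier D" for x y
      using fun_cong[OF fun_cong[OF eq], of x y] that by simp
    hence "wedge x y \<in> {e \<in> carrier E. l e = m e}" if "x \<in> carrier D" "y \<in> carrier D" for x y
      using that by simp
    hence "e \<in> {e \<in> carrier E. l e = m e}" if "e \<in> carrier E" for e
      by (rule wedge_induct[OF that sub])
    thus "l = m" using l m by (intro extensionalityI[of _ "carrier E"]) (auto simp: carrier_dual_group)
  qed
  moreover have "?T ` carrier (dual_group E) = carrier (alt_group D :: ('a \<Rightarrow> 'a \<Rightarrow> 'k) monoid)"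
  proof (intro equalityI subsetI)
    fix b assume b: "b \<in> carrier (alt_group D :: ('a \<Rightarrow> 'a \<Rightarrow> 'k) monoid)"
    hence bi: "bichar D b" "alternating D b" and ext: "b \<in> extensional (carrier D)" "\<And>x. x \<in> carrier D \<Longrightarrow> b x \<in> extensional (carrier D)"
      by (auto simp: carrier_alt_group[OF is_group])
    interpret K: comm_group "kstar :: 'k monoid" by (rule comm_group_kstar)
    have "(\<lambda>(x, y). b x y) ` (carrier D \<times> carrier D) \<subseteq> carrier (kstar :: 'k monoid)"
      using bi(1) by (auto simp: bichar_def)
    then obtain h where h: "h \<in> hom F (kstar :: 'k monoid)"
      "\<And>p. p \<in> carrier D \<times> carrier D \<Longrightarrow> h (frag_of p) = (\<lambda>(x, y). b x y) p"
      using K.free_Abelian_group_universal by metis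
    interpret h: group_hom F "kstar :: 'k monoid" h by unfold_locales (rule h(1))
    have hd: "h (x - y) = h x / h y" if "x \<in> carrier F" "y \<in> carrier F" for x y
      using F.hom_kstar(1,4)[OF h(1)] that F.inv_closed[OF that(2)]
      by (metis add_uminus_conv_diff divide_inverse inv_free_Abelian_group carrier_free_Abelian_group_iff mult_free_Abelian_group)
    have h3: "h (frag_of p - frag_of q - frag_of r) = h (frag_of p) / h (frag_of q) / h (frag_of r)"
      if "p \<in> carrier D \<times> carrier D" "q \<in> carrier D \<times> carrier D" "r \<in> carrier D \<times> carrier D" for p q r
    proof -
      have c: "frag_of p \<in> carrier F" "frag_of q \<in> carrier F" "frag_of r \<in> carrier F" using that by simp_all
      have d: "frag_of p - frag_of q \<in> carrier F"
        using F.m_closed[OF c(1) F.inv_closed[OF c(2)]] c by simp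
      show ?thesis by (simp only: hd[OF d c(3)] hd[OF c(1,2)])
    qed
    have "h r = 1" if "r \<in> ext_square_rel D" for r
      using that bi(1) alternatingD(1)[OF bi(2)] unfolding ext_square_rel_def
      by (auto simp: h3 h(2) bichar_def)
    hence "ext_square_rel D \<subseteq> kernel F kstar h"
      using subsetD[OF rel_carrier] by (simp add: kernel_def subset_iff del: carrier_free_Abelian_group_iff)
    hence "R \<subseteq> kernel F kstar h" using F.generate_subgroup_incl h.subgroup_kernel by blast
    then obtain l where l: "l \<in> hom (F Mod R) (kstar :: 'k monoid)" "\<And>x. x \<in> carrier F \<Longrightarrow> l (R #>\<^bsub>F\<^esub> x) = h x"
      using h.FactGroup_universal_kernel[OF normal_R] by metis
    have rl: "restrict l (carrier E) \<in> carrier (dual_group E)"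
      using l(1) by (auto simp: carrier_dual_group hom_def ext_square_eq[symmetric])
    have "b = ?T (restrict l (carrier E))"
      by (rule hom_dual_eqI[of _ D]) (auto simp: ext wedge_def[symmetric] l(2)[of "frag_of (_, _)", folded wedge_def] h(2))
    thus "b \<in> ?T ` carrier (dual_group E)" using rl by (rule image_eqI)
  qed (use alt in auto)
  ultimately show ?thesis by (auto simp: iso_def bij_betw_def)
qed

end

text \<open>Self-duality is used twice, with D the dual of A: for the exterior square of D, to
  replace it by its characters, and for A, to move alternating forms from D back to A.\<close>

lemma alt_group_iso_ext_square:
  assumes "comm_group A" "finite (carrier A)"
  shows "ext_square (dual_group A :: ('a \<Rightarrow> 'k) monoid) \<cong> (alt_group A :: ('a \<Rightarrow> 'a \<Rightarrow> 'k::{alg_closed_field, field_char_0}) monoid)"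
proof -
  interpret A: comm_group A by fact
  interpret D: comm_group "dual_group A :: ('a \<Rightarrow> 'k) monoid" by (rule comm_group_dual) (rule A.is_group)
  interpret X: ext_sq "dual_group A :: ('a \<Rightarrow> 'k) monoid" by unfold_locales
  obtain h where h: "h \<in> iso A (dual_group A :: ('a \<Rightarrow> 'k) monoid)" using dual_group_iso[OF assms] by blast
  hence "finite (carrier (dual_group A :: ('a \<Rightarrow> 'k) monoid))"
    using assms(2) by (auto simp: iso_def dest: bij_betw_finite)
  then obtain e where "e \<in> iso X.E (dual_group X.E :: (_ \<Rightarrow> 'k) monoid)"
    using dual_group_iso[OF X.comm_group_E X.finite_E] by blast
  from iso_set_trans[OF iso_set_trans[OF this X.dual_ext_square_iso_alt] alt_group_iso[OF A.is_group D.is_group h]]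
  show ?thesis by (rule is_isoI)
qed

section \<open>Coordinate spaces and Hopf automorphisms\<close>

lemma ket_coords: "i \<in> I \<Longrightarrow> ket i \<in> coords I"
  by (auto simp: coords_def ket_def)

lemma coordsD: "v \<in> coords I \<Longrightarrow> i \<notin> I \<Longrightarrow> v i = 0"
  by (simp add: coords_def)

lemma sum_ket:
  assumes "finite I" "i \<in> I"
  shows "(\<Sum>x\<in>I. ket i x * f x) = (f i :: 'k::field)" "(\<Sum>x\<in>I. f x * ket i x) = f i"
    "(\<Sum>x\<in>I. f x * ket x i) = f i"
  using assms by (simp_all add: ket_def if_distrib if_distribR cong: if_cong)

lemma lin_ext_ket [simp]: "finite I \<Longrightarrow> i \<in> I \<Longrightarrow> lin_ext I f (ket i) = (f i :: 'j \<Rightarrow> 'k::field)"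
  by (simp add: lin_ext_def sum_ket fun_eq_iff)

lemma lin_ext_cong: "(\<And>i. i \<in> I \<Longrightarrow> f i = g i) \<Longrightarrow> lin_ext I f = lin_ext I g"
  by (simp add: lin_ext_def)

lemma lin_ext_lin:
  assumes "finite I" "\<And>i. i \<in> I \<Longrightarrow> f i \<in> coords J"
  shows "lin_ext I f \<in> lin I J"
  using assms by (auto simp: lin_def intro!: lin_ext_cong)

lemma linE: "f \<in> lin I J \<Longrightarrow> f v = (\<lambda>j. \<Sum>i\<in>I. v i * f (ket i) j)"
  by (simp add: lin_def) (metis lin_ext_def)

text \<open>A member of \<open>lin\<close> ignores coordinates off I, so agreement on basis vectors
  gives equality as functions everywhere, also outside \<open>coords I\<close>.\<close>

lemma lin_eqI:
  assumes "f \<in> lin I J" "g \<in> lin I J'" "\<And>i. i \<in> I \<Longrightarrow> f (ket i) = g (ket i)"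
  shows "f = g"
proof
  fix v show "f v = g v" using linE[OF assms(1), of v] linE[OF assms(2), of v] assms(3) by simp
qed

lemma lin_coords:
  assumes "f \<in> lin I J" shows "f v \<in> coords J"
proof -
  have "f (ket i) j = 0" if "i \<in> I" "j \<notin> J" for i j using assms that by (auto simp: lin_def coords_def)
  thus ?thesis by (simp add: linE[OF assms, of v] coords_def)
qed

lemma lin_sum:
  assumes "f \<in> lin I J"
  shows "f (\<lambda>i. \<Sum>a\<in>A. c a * v a i) = (\<lambda>j. \<Sum>a\<in>A. c a * f (v a) j)"
proof (rule ext)
  fix j
  have "f (\<lambda>i. \<Sum>a\<in>A. c a * v a i) j = (\<Sum>i\<in>I. \<Sum>a\<in>A. c a * (v a i * f (ket i) j))"
    by (subst linE[OF assms]) (simp add: sum_distrib_right mult.assoc)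
  also have "\<dots> = (\<Sum>a\<in>A. c a * (\<Sum>i\<in>I. v a i * f (ket i) j))"
    by (subst sum.swap) (simp add: sum_distrib_left)
  also have "\<dots> = (\<Sum>a\<in>A. c a * f (v a) j)" by (simp add: linE[OF assms, of "v _"])
  finally show "f (\<lambda>i. \<Sum>a\<in>A. c a * v a i) j = (\<Sum>a\<in>A. c a * f (v a) j)" .
qed

lemma lin_scl:
  assumes "f \<in> lin I J" shows "f (scl c v) = scl c (f v)"
  by (subst (1 2) linE[OF assms]) (simp add: scl_def sum_distrib_left mult.assoc)

lemma lin_zero:
  assumes "f \<in> lin I J" shows "f (\<lambda>_. 0) = (\<lambda>_. 0)"
  by (subst linE[OF assms]) simp

lemma coords_expand:
  fixes v :: "'i \<Rightarrow> 'k::field"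
  assumes "finite I" "v \<in> coords I"
  shows "v = (\<lambda>j. \<Sum>i\<in>I. v i * ket i j)"
proof
  fix j show "v j = (\<Sum>i\<in>I. v i * ket i j)"
  proof (cases "j \<in> I")
    case False
    hence "v i * ket i j = 0" if "i \<in> I" for i using that by (auto simp: ket_def)
    hence "(\<Sum>i\<in>I. v i * ket i j) = 0" by (rule sum.neutral[rule_format])
    thus ?thesis using coordsD[OF assms(2) False] by simp
  qed (use assms(1) in \<open>simp add: sum_ket\<close>)
qed

lemma lin_comp:
  assumes "f \<in> lin I J" "g \<in> lin J K"
  shows "g \<circ> f \<in> lin I K"
proof -
  have "(g \<circ> f) v = lin_ext I (\<lambda>i. (g \<circ> f) (ket i)) v" for v
    by (simp add: lin_ext_def linE[OF assms(1), of v] lin_sum[OF assms(2)])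
  hence "g \<circ> f = lin_ext I (\<lambda>i. (g \<circ> f) (ket i))" by (rule ext)
  moreover have "\<forall>i\<in>I. (g \<circ> f) (ket i) \<in> coords K" using lin_coords[OF assms(2)] by simp
  ultimately show ?thesis unfolding lin_def by (intro CollectI conjI)
qed

lemma id_map_lin: "finite I \<Longrightarrow> id_map I \<in> lin I I"
  unfolding id_map_def by (intro lin_ext_lin) (auto intro: ket_coords)

lemma id_map_eq: "finite I \<Longrightarrow> v \<in> coords I \<Longrightarrow> id_map I v = v"
  unfolding id_map_def lin_ext_def by (rule coords_expand[symmetric])

lemma id_map_comp: "finite J \<Longrightarrow> f \<in> lin I J \<Longrightarrow> id_map J \<circ> f = f"
  by (auto simp: fun_eq_iff id_map_eq lin_coords)

lemma comp_id_map: "finite I \<Longrightarrow> f \<in> lin I J \<Longrightarrow> f \<circ> id_map I = f"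
  by (rule lin_eqI[of _ I J _ J]) (auto intro: lin_comp id_map_lin simp: id_map_eq ket_coords)

section \<open>Tensor products of linear maps, and Hopf maps in coordinates\<close>

lemma tensor_map_apply:
  "tensor_map I f g t (z, w) = (\<Sum>(x, y)\<in>I \<times> I. t (x, y) * (f (ket x) z * g (ket y) w))"
  by (simp add: tensor_map_def lin_ext_def case_prod_unfold)

lemma tensor_map_comp:
  assumes "finite I" "f \<in> lin I J" "g \<in> lin J K" "finite J"
  shows "tensor_map J g g (tensor_map I f f t) = tensor_map I (g \<circ> f) (g \<circ> f) t"
proof (rule ext, unfold split_paired_all)
  fix z w
  have gf: "g (f (ket a)) z = (\<Sum>x\<in>J. f (ket a) x * g (ket x) z)" for a z by (simp add: linE[OF assms(3), of "f _"])
  have "tensor_map J g g (tensor_map I f f t) (z, w) =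
    (\<Sum>x\<in>J. \<Sum>y\<in>J. \<Sum>a\<in>I. \<Sum>b\<in>I. t (a, b) * (f (ket a) x * g (ket x) z) * (f (ket b) y * g (ket y) w))"
    by (simp add: tensor_map_apply sum.cartesian_product[symmetric] sum_distrib_right sum_distrib_left mult_ac)
  also have "\<dots> = (\<Sum>x\<in>J. \<Sum>a\<in>I. \<Sum>y\<in>J. \<Sum>b\<in>I. t (a, b) * (f (ket a) x * g (ket x) z) * (f (ket b) y * g (ket y) w))"
    by (intro sum.cong refl sum.swap)
  also have "\<dots> = (\<Sum>a\<in>I. \<Sum>x\<in>J. \<Sum>y\<in>J. \<Sum>b\<in>I. t (a, b) * (f (ket a) x * g (ket x) z) * (f (ket b) y * g (ket y) w))"
    by (rule sum.swap)
  also have "\<dots> = (\<Sum>a\<in>I. \<Sum>x\<in>J. \<Sum>b\<in>I. \<Sum>y\<in>J. t (a, b) * (f (ket a) x * g (ket x) z) * (f (ket b) y * g (ket y) w))"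
    by (intro sum.cong refl sum.swap)
  also have "\<dots> = (\<Sum>a\<in>I. \<Sum>b\<in>I. \<Sum>x\<in>J. \<Sum>y\<in>J. t (a, b) * (f (ket a) x * g (ket x) z) * (f (ket b) y * g (ket y) w))"
    by (intro sum.cong refl sum.swap)
  also have "\<dots> = (\<Sum>a\<in>I. \<Sum>b\<in>I. t (a, b) * (g (f (ket a)) z * g (f (ket b)) w))"
    unfolding gf unfolding sum_product by (simp only: sum_distrib_left mult.assoc)
  also have "\<dots> = tensor_map I (g \<circ> f) (g \<circ> f) t (z, w)"
    by (simp add: tensor_map_apply sum.cartesian_product[symmetric])
  finally show "tensor_map J g g (tensor_map I f f t) (z, w) = tensor_map I (g \<circ> f) (g \<circ> f) t (z, w)" .
qed

lemma tensor_map_id: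
  assumes "finite I" "t \<in> coords (I \<times> I)"
  shows "tensor_map I (id_map I) (id_map I) t = t"
proof (rule ext)
  fix p :: "'a \<times> 'a"
  obtain z w where p: "p = (z, w)" by (cases p)
  have "tensor_map I (id_map I) (id_map I) t p = (\<Sum>q\<in>I \<times> I. t q * ket q p)"
    using assms(1) unfolding p tensor_map_apply
    by (intro sum.cong refl) (auto simp: id_map_eq ket_coords, auto simp: ket_def split: if_splits)
  also have "\<dots> = t p" using coords_expand[OF _ assms(2)] assms(1) by (metis finite_SigmaI)
  finally show "tensor_map I (id_map I) (id_map I) t p = t p" .
qed

lemma tensor_map_pure:
  assumes "f \<in> lin I J"
  shows "tensor_map I f f (\<lambda>(x, y). u x * v y) = (\<lambda>(x, y). f u x * f v y)"
  by (intro ext)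
    (auto simp: tensor_map_apply linE[OF assms, of u] linE[OF assms, of v] sum_product
      sum.cartesian_product[symmetric] mult_ac intro!: sum.cong)

text \<open>Only supports are constrained; the algebra laws enter with \<open>based_alg\<close>. In
  this form the tensor square with its dummy coalgebra data is an instance as well.\<close>

locale based_bialg =
  fixes H :: "('i, 'k::field) bialg"
  assumes fin: "finite (basis H)" and unt_coords: "unt H \<in> coords (basis H)"
    and prd_coords: "\<And>x y. x \<in> basis H \<Longrightarrow> y \<in> basis H \<Longrightarrow> prd H x y \<in> coords (basis H)"
    and cop_coords: "\<And>x. x \<in> basis H \<Longrightarrow> cop H x \<in> coords (basis H \<times> basis H)"
begin

lemma bmult_coords: "bmult H u v \<in> coords (basis H)"
  using coordsD[OF prd_coords] by (auto simp: bmult_def coords_def)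

lemma bcomult_coords: "bcomult H u \<in> coords (basis H \<times> basis H)"
  using coordsD[OF cop_coords] by (auto simp: bcomult_def coords_def intro!: sum.neutral)

lemma bmult_alt: "bmult H u v = (\<lambda>z. \<Sum>x\<in>basis H. u x * (\<Sum>y\<in>basis H. v y * prd H x y z))"
  by (simp add: bmult_def sum_distrib_left mult.assoc)

lemma bmult_alt': "bmult H u v = (\<lambda>z. \<Sum>y\<in>basis H. v y * (\<Sum>x\<in>basis H. u x * prd H x y z))"
  unfolding bmult_def by (subst sum.swap) (simp add: sum_distrib_left mult_ac)

lemma bmult_ket: "x \<in> basis H \<Longrightarrow> y \<in> basis H \<Longrightarrow> bmult H (ket x) (ket y) = prd H x y"
  using fin by (simp add: bmult_alt sum_ket)

lemma bmult_scl: "bmult H (scl a u) (scl b v) = scl (a * b) (bmult H u v)"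
  by (simp add: bmult_def scl_def sum_distrib_left mult_ac)

lemma bcounit_ket: "x \<in> basis H \<Longrightarrow> bcounit H (ket x) = cou H x"
  using fin by (simp add: bcounit_def sum_ket)

lemma bcomult_ket: "x \<in> basis H \<Longrightarrow> bcomult H (ket x) = cop H x"
  using fin by (simp add: bcomult_def sum_ket fun_eq_iff)

lemma bmult_lin_left: "bmult H u v = (\<lambda>z. \<Sum>x\<in>basis H. u x * bmult H (ket x) v z)"
  using fin by (simp add: bmult_alt sum_ket)

lemma bmult_lin_right: "bmult H u v = (\<lambda>z. \<Sum>y\<in>basis H. v y * bmult H u (ket y) z)"
  using fin by (simp add: bmult_alt' sum_ket)

text \<open>\<open>Inn_Hopf\<close> fixes a conjugation by its values on basis vectors; bilinearity
  extends the formula to all vectors.\<close>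

lemma conj_lin:
  "lin_ext (basis H) (\<lambda>i. bmult H (bmult H t (ket i)) t') v = bmult H (bmult H t v) t'"
proof -
  have "bmult H (bmult H t v) t' = (\<lambda>z. \<Sum>x\<in>basis H. (\<Sum>i\<in>basis H. v i * bmult H t (ket i) x) * bmult H (ket x) t' z)"
    unfolding fun_cong[OF bmult_lin_right[of t v], symmetric] by (rule bmult_lin_left)
  also have "\<dots> = (\<lambda>z. \<Sum>i\<in>basis H. v i * (\<Sum>x\<in>basis H. bmult H t (ket i) x * bmult H (ket x) t' z))"
    by (rule ext, subst sum_distrib_left, subst sum_distrib_right, subst sum.swap) (simp add: mult.assoc)
  also have "\<dots> = (\<lambda>z. \<Sum>i\<in>basis H. v i * bmult H (bmult H t (ket i)) t' z)"
    unfolding fun_cong[OF bmult_lin_left[of "bmult H t (ket _)" t'], symmetric] by (rule refl)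
  finally show ?thesis by (simp add: lin_ext_def)
qed

end

text \<open>All conditions are linear in each argument, so they can be tested on basis vectors,
  where product and coproduct are structure constants.\<close>

lemma hopf_mapI:
  assumes "based_bialg H" "based_bialg K" "f \<in> lin (basis H) (basis K)" "f (unt H) = unt K"
    and m: "\<And>p q. p \<in> basis H \<Longrightarrow> q \<in> basis H \<Longrightarrow> f (prd H p q) = bmult K (f (ket p)) (f (ket q))"
    and c: "\<And>p. p \<in> basis H \<Longrightarrow> bcounit K (f (ket p)) = cou H p"
    and d: "\<And>p. p \<in> basis H \<Longrightarrow> bcomult K (f (ket p)) = tensor_map (basis H) f f (cop H p)"
  shows "hopf_map H K f"
proof -
  interpret H: based_bialg H by fact
  interpret K: based_bialg K by fact
  note f = assms(3)
  have "f (bmult H u v) = bmult K (f u) (f v)" for u v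
  proof -
    have "bmult H u v = (\<lambda>z. \<Sum>p\<in>basis H \<times> basis H. (u (fst p) * v (snd p)) * prd H (fst p) (snd p) z)"
      by (simp add: bmult_def sum.cartesian_product case_prod_unfold)
    hence "f (bmult H u v) = (\<lambda>z. \<Sum>p\<in>basis H \<times> basis H. (u (fst p) * v (snd p)) * f (prd H (fst p) (snd p)) z)"
      by (simp only: lin_sum[OF f])
    also have "\<dots> = (\<lambda>z. \<Sum>p\<in>basis H \<times> basis H. (u (fst p) * v (snd p)) * bmult K (f (ket (fst p))) (f (ket (snd p))) z)"
      by (intro ext sum.cong) (auto simp: m)
    also have "\<dots> = (\<lambda>z. \<Sum>x\<in>basis H. u x * (\<Sum>y\<in>basis H. v y * bmult K (f (ket x)) (f (ket y)) z))"
      by (simp add: sum.cartesian_product case_prod_unfold sum_distrib_left mult.assoc)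
    also have "\<dots> = bmult K (f u) (f v)"
    proof (rule ext)
      fix z
      let ?B = "basis K"
      have "(\<Sum>x\<in>basis H. u x * (\<Sum>y\<in>basis H. v y * bmult K (f (ket x)) (f (ket y)) z)) =
        (\<Sum>x\<in>basis H. \<Sum>y\<in>basis H. \<Sum>a\<in>?B. \<Sum>b\<in>?B. (u x * f (ket x) a) * (v y * f (ket y) b) * prd K a b z)"
        by (simp add: bmult_def sum_distrib_left mult_ac)
      also have "\<dots> = (\<Sum>x\<in>basis H. \<Sum>a\<in>?B. \<Sum>y\<in>basis H. \<Sum>b\<in>?B. (u x * f (ket x) a) * (v y * f (ket y) b) * prd K a b z)"
        by (intro sum.cong refl sum.swap)
      also have "\<dots> = (\<Sum>a\<in>?B. \<Sum>x\<in>basis H. \<Sum>y\<in>basis H. \<Sum>b\<in>?B. (u x * f (ket x) a) * (v y * f (ket y) b) * prd K a b z)"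
        by (rule sum.swap)
      also have "\<dots> = (\<Sum>a\<in>?B. \<Sum>x\<in>basis H. \<Sum>b\<in>?B. \<Sum>y\<in>basis H. (u x * f (ket x) a) * (v y * f (ket y) b) * prd K a b z)"
        by (intro sum.cong refl sum.swap)
      also have "\<dots> = (\<Sum>a\<in>?B. \<Sum>b\<in>?B. \<Sum>x\<in>basis H. \<Sum>y\<in>basis H. (u x * f (ket x) a) * (v y * f (ket y) b) * prd K a b z)"
        by (intro sum.cong refl sum.swap)
      also have "\<dots> = bmult K (f u) (f v) z"
        unfolding bmult_def linE[OF f, of u] linE[OF f, of v] sum_product by (simp only: sum_distrib_right)
      finally show "(\<Sum>x\<in>basis H. u x * (\<Sum>y\<in>basis H. v y * bmult K (f (ket x)) (f (ket y)) z)) = bmult K (f u) (f v) z" .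
    qed
    finally show ?thesis .
  qed
  moreover have "bcounit K (f u) = bcounit H u" for u
  proof -
    have "bcounit K (f u) = (\<Sum>x\<in>basis K. \<Sum>i\<in>basis H. u i * (f (ket i) x * cou K x))"
      by (simp add: bcounit_def linE[OF f, of u] sum_distrib_right mult.assoc)
    also have "\<dots> = (\<Sum>i\<in>basis H. u i * bcounit K (f (ket i)))"
      by (subst sum.swap) (simp add: bcounit_def sum_distrib_left)
    also have "\<dots> = bcounit H u" by (simp add: c) (simp add: bcounit_def)
    finally show ?thesis .
  qed
  moreover have "bcomult K (f u) = tensor_map (basis H) f f (bcomult H u)" for u
  proof (rule ext, unfold split_paired_all)
    fix z w
    have "bcomult K (f u) (z, w) = (\<Sum>x\<in>basis K. \<Sum>i\<in>basis H. u i * (f (ket i) x * cop K x (z, w)))"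
      by (simp add: bcomult_def linE[OF f, of u] sum_distrib_right mult.assoc)
    also have "\<dots> = (\<Sum>i\<in>basis H. u i * bcomult K (f (ket i)) (z, w))"
      by (subst sum.swap) (simp add: bcomult_def sum_distrib_left)
    also have "\<dots> = (\<Sum>i\<in>basis H. \<Sum>q\<in>basis H \<times> basis H. u i * (cop H i q * (f (ket (fst q)) z * f (ket (snd q)) w)))"
      by (simp add: d tensor_map_apply case_prod_unfold sum_distrib_left)
    also have "\<dots> = tensor_map (basis H) f f (bcomult H u) (z, w)"
      by (subst sum.swap) (simp add: tensor_map_apply case_prod_unfold bcomult_def sum_distrib_right mult.assoc)
    finally show "bcomult K (f u) (z, w) = tensor_map (basis H) f f (bcomult H u) (z, w)" .
  qed
  ultimately show ?thesis using assms by (simp add: hopf_map_def)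
qed

context based_bialg
begin

lemma Aut_Hopf_carrier: "f \<in> carrier (Aut_Hopf H) \<longleftrightarrow> hopf_map H H f \<and> bij_betw f (coords (basis H)) (coords (basis H))"
  by (simp add: Aut_Hopf_def)

lemma Aut_Hopf_simps [simp]: "f \<otimes>\<^bsub>Aut_Hopf H\<^esub> g = f \<circ> g" "\<one>\<^bsub>Aut_Hopf H\<^esub> = id_map (basis H)"
  by (simp_all add: Aut_Hopf_def)

lemma hopf_map_comp:
  assumes "hopf_map H H f" "hopf_map H H g" shows "hopf_map H H (g \<circ> f)"
proof -
  have l: "f \<in> lin (basis H) (basis H)" "g \<in> lin (basis H) (basis H)" using assms by (auto simp: hopf_map_def)
  have c: "f u \<in> coords (basis H)" for u by (rule lin_coords[OF l(1)])
  show ?thesis using assms lin_comp[OF l] tensor_map_comp[OF fin l fin] c by (simp add: hopf_map_def)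
qed

lemma hopf_map_id: "hopf_map H H (id_map (basis H))"
  using fin by (simp add: hopf_map_def id_map_lin id_map_eq unt_coords bmult_coords tensor_map_id bcomult_coords)

text \<open>The tensor square of g undoes the tensor square of f, which turns the coproduct
  condition for f into the one for g; the other conditions are transported through g f = 1 = f
  g.\<close>

lemma hopf_map_inverse:
  assumes f: "hopf_map H H f" and g: "g \<in> lin (basis H) (basis H)"
    and gf: "\<And>u. u \<in> coords (basis H) \<Longrightarrow> g (f u) = u" and fg: "\<And>u. u \<in> coords (basis H) \<Longrightarrow> f (g u) = u"
  shows "hopf_map H H g"
proof -
  have l: "f \<in> lin (basis H) (basis H)" using f by (simp add: hopf_map_def)
  note c = lin_coords[OF g]
  have "g \<circ> f = id_map (basis H)"
    by (rule lin_eqI[OF lin_comp[OF l g] id_map_lin[OF fin]]) (simp add: gf fin id_map_eq ket_coords)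
  hence t: "tensor_map (basis H) g g (tensor_map (basis H) f f (bcomult H u)) = bcomult H u" for u
    using tensor_map_comp[OF fin l g fin] tensor_map_id[OF fin bcomult_coords] by simp
  have "g (bmult H u v) = bmult H (g u) (g v)" if "u \<in> coords (basis H)" "v \<in> coords (basis H)" for u v
    using f c fg that gf[OF bmult_coords] unfolding hopf_map_def by metis
  moreover have "bcomult H (g u) = tensor_map (basis H) g g (bcomult H u)" if "u \<in> coords (basis H)" for u
    using f c fg that t unfolding hopf_map_def by metis
  ultimately show ?thesis using f g c fg gf unt_coords unfolding hopf_map_def by metis
qed

lemma group_Aut_Hopf: "group (Aut_Hopf H)"
proof (rule groupI)
  let ?B = "coords (basis H) :: ('i \<Rightarrow> 'k) set"
  fix f g assume f: "f \<in> carrier (Aut_Hopf H)" and g: "g \<in> carrier (Aut_Hopf H)"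
  show "f \<otimes>\<^bsub>Aut_Hopf H\<^esub> g \<in> carrier (Aut_Hopf H)"
    using f g by (auto simp: Aut_Hopf_carrier intro: hopf_map_comp bij_betw_trans)
next
  show "\<one>\<^bsub>Aut_Hopf H\<^esub> \<in> carrier (Aut_Hopf H)"
    using hopf_map_id fin by (auto simp: Aut_Hopf_carrier id_map_eq bij_betw_def inj_on_def image_iff)
next
  fix f assume f: "f \<in> carrier (Aut_Hopf H)"
  hence l: "f \<in> lin (basis H) (basis H)" and b: "bij_betw f (coords (basis H)) (coords (basis H))" and h: "hopf_map H H f"
    by (auto simp: Aut_Hopf_carrier hopf_map_def)
  show "\<one>\<^bsub>Aut_Hopf H\<^esub> \<otimes>\<^bsub>Aut_Hopf H\<^esub> f = f" using id_map_comp[OF fin l] by simp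
  define i where "i = inv_into (coords (basis H)) f"
  have ic: "i v \<in> coords (basis H)" "f (i v) = v" if "v \<in> coords (basis H)" for v
    using bij_betwE[OF bij_betw_inv_into[OF b]] bij_betw_inv_into_right[OF b] that by (auto simp: i_def)
  \<comment> \<open>\<open>inv_into\<close> is arbitrary outside \<open>coords\<close>. Keeping its
    values on basis vectors and extending linearly yields a legitimate representative of the
    inverse.\<close>
  define g where "g = lin_ext (basis H) (\<lambda>x. i (ket x))"
  have gl: "g \<in> lin (basis H) (basis H)" unfolding g_def by (rule lin_ext_lin[OF fin]) (auto intro: ic ket_coords)
  have "f \<circ> g = id_map (basis H)"
    by (rule lin_eqI[OF lin_comp[OF gl l] id_map_lin[OF fin]]) (simp add: g_def fin ic id_map_eq ket_coords)
  hence fg: "f (g u) = u" if "u \<in> coords (basis H)" for u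
    using that id_map_eq[OF fin that] by (metis comp_apply)
  have gf: "g (f u) = u" if "u \<in> coords (basis H)" for u
    using b fg[OF lin_coords[OF l, of u]] lin_coords[OF gl] that unfolding bij_betw_def by (meson inj_onD)
  have "bij_betw g (coords (basis H)) (coords (basis H))"
    by (rule bij_betw_byWitness[where f' = f]) (use fg gf lin_coords[OF gl] lin_coords[OF l] in auto)
  hence "g \<in> carrier (Aut_Hopf H)" using hopf_map_inverse[OF h gl gf fg] by (simp add: Aut_Hopf_carrier)
  moreover have "g \<circ> f = id_map (basis H)"
    by (rule lin_eqI[OF lin_comp[OF l gl] id_map_lin[OF fin]]) (simp add: gf fin id_map_eq ket_coords)
  ultimately show "\<exists>y\<in>carrier (Aut_Hopf H). y \<otimes>\<^bsub>Aut_Hopf H\<^esub> f = \<one>\<^bsub>Aut_Hopf H\<^esub>" by auto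
qed (auto simp: comp_assoc)

text \<open>Conjugation by t turns into conjugation by \<phi> t, and \<phi> preserves group-like
  elements and their inverses.\<close>

lemma Inn_Hopf_conj:
  assumes \<phi>: "\<phi> \<in> carrier (Aut_Hopf H)" and c: "c \<in> Inn_Hopf H"
  shows "\<phi> \<circ> c \<circ> inv\<^bsub>Aut_Hopf H\<^esub> \<phi> \<in> Inn_Hopf H"
proof -
  interpret A: group "Aut_Hopf H" by (rule group_Aut_Hopf)
  obtain t t' where t: "c = lin_ext (basis H) (\<lambda>i. bmult H (bmult H t (ket i)) t')" "group_like H t"
    "t' \<in> coords (basis H)" "bmult H t t' = unt H" "bmult H t' t = unt H"
    using c by (auto simp: Inn_Hopf_def)
  define \<psi> where "\<psi> = inv\<^bsub>Aut_Hopf H\<^esub> \<phi>"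
  have \<psi>: "\<psi> \<in> carrier (Aut_Hopf H)" using \<phi> by (simp add: \<psi>_def)
  have l: "\<phi> \<in> lin (basis H) (basis H)" "\<psi> \<in> lin (basis H) (basis H)" using \<phi> \<psi> by (auto simp: Aut_Hopf_carrier hopf_map_def)
  have "\<phi> \<circ> \<psi> = id_map (basis H)" using A.r_inv[OF \<phi>] by (simp add: \<psi>_def)
  hence \<phi>\<psi>: "\<phi> (\<psi> v) = v" if "v \<in> coords (basis H)" for v using id_map_eq[OF fin that] by (metis comp_apply)
  have tc: "t \<in> coords (basis H)" using t by (simp add: group_like_def)
  have h: "\<phi> (unt H) = unt H" "\<And>u v. u \<in> coords (basis H) \<Longrightarrow> v \<in> coords (basis H) \<Longrightarrow> \<phi> (bmult H u v) = bmult H (\<phi> u) (\<phi> v)"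
    "\<And>u. u \<in> coords (basis H) \<Longrightarrow> bcounit H (\<phi> u) = bcounit H u"
    "\<And>u. u \<in> coords (basis H) \<Longrightarrow> bcomult H (\<phi> u) = tensor_map (basis H) \<phi> \<phi> (bcomult H u)"
    using \<phi> by (auto simp: Aut_Hopf_carrier hopf_map_def)
  note lc = lin_coords[OF l(1)] lin_coords[OF l(2)]
  have cl: "lin_ext (basis H) (\<lambda>i. bmult H (bmult H u (ket i)) u') \<in> lin (basis H) (basis H)" for u u'
    by (rule lin_ext_lin[OF fin bmult_coords])
  have "\<phi> \<circ> c \<circ> \<psi> = lin_ext (basis H) (\<lambda>i. bmult H (bmult H (\<phi> t) (ket i)) (\<phi> t'))"
  proof (rule lin_eqI[OF lin_comp[OF l(2) lin_comp[OF _ l(1)]] cl])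
    show "c \<in> lin (basis H) (basis H)" unfolding t(1) by (rule cl)
    fix i assume "i \<in> basis H"
    hence "(\<phi> \<circ> c \<circ> \<psi>) (ket i) = bmult H (bmult H (\<phi> t) (ket i)) (\<phi> t')"
      unfolding t(1) comp_apply conj_lin
      by (simp add: h(2) bmult_coords lc tc t(3) \<phi>\<psi> ket_coords)
    thus "(\<phi> \<circ> c \<circ> \<psi>) (ket i) = lin_ext (basis H) (\<lambda>i. bmult H (bmult H (\<phi> t) (ket i)) (\<phi> t')) (ket i)"
      using \<open>i \<in> basis H\<close> fin by simp
  qed
  moreover have "group_like H (\<phi> t)"
    using t(2) h(3,4)[OF tc] lc tensor_map_pure[OF l(1), of t t] by (simp add: group_like_def)
  moreover have "bmult H (\<phi> t) (\<phi> t') = unt H" "bmult H (\<phi> t') (\<phi> t) = unt H"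
    using h(2)[OF tc t(3)] h(2)[OF t(3) tc] h(1) t(4,5) by simp_all
  ultimately show ?thesis unfolding \<psi>_def[symmetric] Inn_Hopf_def using lc by blast
qed

end

text \<open>The automorphisms of DG in question permute the basis up to scalars. For such maps each
  Hopf axiom becomes an identity between scalars.\<close>

definition mono_map :: "'i set \<Rightarrow> ('i \<Rightarrow> 'k) \<Rightarrow> ('i \<Rightarrow> 'i) \<Rightarrow> ('i \<Rightarrow> 'k::field) \<Rightarrow> 'i \<Rightarrow> 'k" where
  "mono_map I s \<pi> = lin_ext I (\<lambda>p. scl (s p) (ket (\<pi> p)))"

locale monomial =
  fixes I :: "'i set" and s :: "'i \<Rightarrow> 'k::field" and \<pi> :: "'i \<Rightarrow> 'i"
  assumes finI: "finite I" and bij: "bij_betw \<pi> I I" and nz: "\<And>p. p \<in> I \<Longrightarrow> s p \<noteq> 0"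
begin

lemma \<pi>_closed: "p \<in> I \<Longrightarrow> \<pi> p \<in> I" using bij by (auto simp: bij_betw_def)

lemma \<pi>_inj: "p \<in> I \<Longrightarrow> q \<in> I \<Longrightarrow> \<pi> p = \<pi> q \<longleftrightarrow> p = q" using bij by (auto simp: bij_betw_def inj_on_def)

lemma \<pi>_surj: assumes "q \<in> I" obtains p where "p \<in> I" "q = \<pi> p" using assms bij by (auto simp: bij_betw_def)

lemma mono_ket: "p \<in> I \<Longrightarrow> mono_map I s \<pi> (ket p) = scl (s p) (ket (\<pi> p))"
  using finI by (simp add: mono_map_def)

lemma mono_lin: "mono_map I s \<pi> \<in> lin I I"
  unfolding mono_map_def by (rule lin_ext_lin[OF finI]) (auto simp: coords_def scl_def ket_def \<pi>_closed)

lemma mono_apply: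
  assumes "p \<in> I" shows "mono_map I s \<pi> v (\<pi> p) = s p * v p"
proof -
  have "mono_map I s \<pi> v (\<pi> p) = (\<Sum>q\<in>I. (v q * s q) * ket p q)"
    unfolding mono_map_def lin_ext_def using assms \<pi>_inj
    by (intro sum.cong) (auto simp: scl_def ket_def)
  thus ?thesis using finI assms by (simp add: sum_ket)
qed

lemma tensor_mono:
  assumes "p \<in> I" "q \<in> I"
  shows "tensor_map I (mono_map I s \<pi>) (mono_map I s \<pi>) t (\<pi> p, \<pi> q) = s p * s q * t (p, q)"
proof -
  have "tensor_map I (mono_map I s \<pi>) (mono_map I s \<pi>) t (\<pi> p, \<pi> q) = (\<Sum>r\<in>I \<times> I. (t r * (s (fst r) * s (snd r))) * ket (p, q) r)"
    unfolding tensor_map_apply using assms \<pi>_inj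
    by (intro sum.cong refl) (auto simp: scl_def mono_ket, auto simp: ket_def split: if_splits)
  thus ?thesis using finI assms by (simp add: sum_ket)
qed

lemma tensor_mono_off:
  assumes "\<not> (p \<in> I \<and> q \<in> I)"
  shows "tensor_map I (mono_map I s \<pi>) (mono_map I s \<pi>) t (p, q) = 0"
proof -
  have "mono_map I s \<pi> v r = 0" if "r \<notin> I" for v r using coordsD[OF lin_coords[OF mono_lin] that] .
  thus ?thesis using assms by (auto simp: tensor_map_apply intro!: sum.neutral)
qed

lemma mono_bij: "bij_betw (mono_map I s \<pi>) (coords I) (coords I)"
proof (rule bij_betw_imageI)
  show "inj_on (mono_map I s \<pi>) (coords I)"
  proof (rule inj_onI)
    fix u v :: "'i \<Rightarrow> 'k" assume uv: "u \<in> coords I" "v \<in> coords I" "mono_map I s \<pi> u = mono_map I s \<pi> v"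
    show "u = v"
    proof
      fix p show "u p = v p"
        using fun_cong[OF uv(3), of "\<pi> p"] nz uv(1,2) by (cases "p \<in> I") (auto simp: mono_apply coordsD)
    qed
  qed
  show "mono_map I s \<pi> ` coords I = coords I"
  proof (intro equalityI subsetI)
    fix v :: "'i \<Rightarrow> 'k" assume v: "v \<in> coords I"
    define u where "u = (\<lambda>p. if p \<in> I then v (\<pi> p) / s p else 0)"
    have "mono_map I s \<pi> u = v"
    proof
      fix q show "mono_map I s \<pi> u q = v q"
      proof (cases "q \<in> I")
        case True
        then obtain p where "p \<in> I" "q = \<pi> p" by (rule \<pi>_surj)
        thus ?thesis using nz by (simp add: mono_apply u_def)
      next
        case False
        thus ?thesis using coordsD[OF v False] coordsD[OF lin_coords[OF mono_lin] False] by simp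
      qed
    qed
    moreover have "u \<in> coords I" by (simp add: u_def coords_def)
    ultimately show "v \<in> mono_map I s \<pi> ` coords I" by blast
  qed (use lin_coords[OF mono_lin] in blast)
qed

end

lemma (in based_bialg) bcounit_scl: "bcounit H (scl a u) = a * bcounit H u"
  by (simp add: bcounit_def scl_def sum_distrib_left mult.assoc)

lemma (in based_bialg) bcomult_scl: "bcomult H (scl a u) = scl a (bcomult H u)"
  by (simp add: bcomult_def scl_def sum_distrib_left mult.assoc)

text \<open>The coefficient of an image at \<pi> r comes from the single source label r, so
  \<open>C1\<close> to \<open>C4\<close> are the coefficientwise conditions for unit, product,
  counit and coproduct.\<close>

lemma mono_Aut:
  assumes "based_bialg H" "monomial (basis H) s \<pi>"
    and C1: "\<And>p. p \<in> basis H \<Longrightarrow> unt H (\<pi> p) = s p * unt H p"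
    and C2: "\<And>p q r. p \<in> basis H \<Longrightarrow> q \<in> basis H \<Longrightarrow> r \<in> basis H \<Longrightarrow>
      s p * s q * prd H (\<pi> p) (\<pi> q) (\<pi> r) = s r * prd H p q r"
    and C3: "\<And>p. p \<in> basis H \<Longrightarrow> s p * cou H (\<pi> p) = cou H p"
    and C4: "\<And>p q r. p \<in> basis H \<Longrightarrow> q \<in> basis H \<Longrightarrow> r \<in> basis H \<Longrightarrow>
      s p * cop H (\<pi> p) (\<pi> q, \<pi> r) = s q * s r * cop H p (q, r)"
  shows "mono_map (basis H) s \<pi> \<in> carrier (Aut_Hopf H)"
proof -
  interpret based_bialg H by fact
  interpret M: monomial "basis H" s \<pi> by fact
  let ?f = "mono_map (basis H) s \<pi>"
  have eqI: "u = v" if "u \<in> coords (basis H)" "v \<in> coords (basis H)"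
    "\<And>r. r \<in> basis H \<Longrightarrow> u (\<pi> r) = v (\<pi> r)" for u v :: "'a \<Rightarrow> 'b"
  proof
    fix z show "u z = v z" using that M.\<pi>_surj by (cases "z \<in> basis H") (metis, simp add: coordsD)
  qed
  note lc = lin_coords[OF M.mono_lin]
  have "hopf_map H H ?f"
  proof (rule hopf_mapI[OF assms(1,1) M.mono_lin])
    show "?f (unt H) = unt H"
      by (rule eqI[OF lc unt_coords]) (simp add: M.mono_apply C1)
    fix p assume p: "p \<in> basis H"
    have \<pi>p: "\<pi> p \<in> basis H" using p by (rule M.\<pi>_closed)
    show "?f (prd H p q) = bmult H (?f (ket p)) (?f (ket q))" if q: "q \<in> basis H" for q
      by (rule eqI[OF lc bmult_coords])
        (simp add: M.mono_apply M.mono_ket p q bmult_scl bmult_ket M.\<pi>_closed C2[symmetric], simp add: scl_def)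
    have "bcounit H (?f (ket p)) = s p * cou H (\<pi> p)"
      by (simp add: M.mono_ket p bcounit_scl bcounit_ket[OF \<pi>p])
    thus "bcounit H (?f (ket p)) = cou H p" by (simp add: C3 p)
    have d: "bcomult H (?f (ket p)) = scl (s p) (cop H (\<pi> p))"
      by (simp add: M.mono_ket p bcomult_scl bcomult_ket[OF \<pi>p])
    show "bcomult H (?f (ket p)) = tensor_map (basis H) ?f ?f (cop H p)"
    proof (rule ext, unfold split_paired_all)
      fix z w
      show "bcomult H (?f (ket p)) (z, w) = tensor_map (basis H) ?f ?f (cop H p) (z, w)"
      proof (cases "z \<in> basis H \<and> w \<in> basis H")
        case True
        then obtain q r where qr: "q \<in> basis H" "z = \<pi> q" "r \<in> basis H" "w = \<pi> r" using M.\<pi>_surj by metis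
        thus ?thesis using C4[OF p qr(1,3)] by (simp add: d M.tensor_mono scl_def)
      next
        case False
        thus ?thesis using coordsD[OF bcomult_coords, of "(z, w)"] M.tensor_mono_off by auto
      qed
    qed
  qed
  thus ?thesis using M.mono_bij by (simp add: Aut_Hopf_carrier)
qed

section \<open>Automorphisms of the Drinfeld double\<close>

type_synonym ('g, 'k) dg_pair = "('g, 'k) dg_aut \<times> ('g, 'k) dg_form"
type_synonym ('g, 'k) dg_class = "('g, 'k) dg_aut set \<times> ('g, 'k) dg_form set"

locale fin_group = group G for G (structure) +
  assumes fin: "finite (carrier G)"
begin

abbreviation U where "U \<equiv> carrier G"

abbreviation cj where "cj \<equiv> conj_by G"

lemma inv_cancel [simp]:
  "t \<in> U \<Longrightarrow> x \<in> U \<Longrightarrow> inv t \<otimes> (t \<otimes> x) = x"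
  "t \<in> U \<Longrightarrow> x \<in> U \<Longrightarrow> t \<otimes> (inv t \<otimes> x) = x"
  by (simp_all flip: m_assoc)

lemma cj_closed [simp]: "t \<in> U \<Longrightarrow> x \<in> U \<Longrightarrow> cj t x \<in> U"
  by (simp add: conj_by_def)

lemma cj_mult: "t \<in> U \<Longrightarrow> x \<in> U \<Longrightarrow> y \<in> U \<Longrightarrow> cj t (x \<otimes> y) = cj t x \<otimes> cj t y"
  by (simp add: conj_by_def m_assoc)

lemma cj_cj: "s \<in> U \<Longrightarrow> t \<in> U \<Longrightarrow> x \<in> U \<Longrightarrow> cj s (cj t x) = cj (s \<otimes> t) x"
  by (simp add: conj_by_def m_assoc inv_mult_group)

lemma cj_one [simp]: "x \<in> U \<Longrightarrow> cj \<one> x = x" "t \<in> U \<Longrightarrow> cj t \<one> = \<one>"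
  by (simp_all add: conj_by_def)

lemma cj_inv [simp]: "t \<in> U \<Longrightarrow> x \<in> U \<Longrightarrow> cj (inv t) (cj t x) = x"
  "t \<in> U \<Longrightarrow> x \<in> U \<Longrightarrow> cj t (cj (inv t) x) = x"
  by (simp_all add: cj_cj)

lemma cj_m_inv: "t \<in> U \<Longrightarrow> x \<in> U \<Longrightarrow> inv (cj t x) = cj t (inv x)"
  by (simp add: conj_by_def m_assoc inv_mult_group)

lemma cj_inj [simp]: "t \<in> U \<Longrightarrow> x \<in> U \<Longrightarrow> y \<in> U \<Longrightarrow> cj t x = cj t y \<longleftrightarrow> x = y"
  by (metis cj_inv(1))

lemma cj_inj_one [simp]: "t \<in> U \<Longrightarrow> x \<in> U \<Longrightarrow> cj t x = \<one> \<longleftrightarrow> x = \<one>"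
  using cj_inj[of t x \<one>] by simp

lemma cj_move: "t \<in> U \<Longrightarrow> x \<in> U \<Longrightarrow> y \<in> U \<Longrightarrow> cj t x = y \<longleftrightarrow> x = cj (inv t) y"
  by auto

lemma cj_eq': "t \<in> U \<Longrightarrow> inv t \<otimes> x \<otimes> t = cj (inv t) x" by (simp add: conj_by_def)

section \<open>The double in coordinates\<close>

abbreviation B where "B \<equiv> U \<times> U"

abbreviation DD :: "('a \<times> 'a, 'k::field) bialg" where "DD \<equiv> DG G"

abbreviation DDd :: "('a \<times> 'a, 'k::field) bialg" where "DDd \<equiv> DGd G"

abbreviation kf :: "('a, 'k::field) bialg" where "kf \<equiv> kfun G"

abbreviation kg :: "('a, 'k::field) bialg" where "kg \<equiv> kgrp G"

abbreviation AutD :: "('a, 'k::field) dg_aut monoid" where "AutD \<equiv> Aut_Hopf DD"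

abbreviation form :: "('a \<times> 'a \<Rightarrow> 'k::field) \<Rightarrow> ('a, 'k) dg_form" where "form \<equiv> form_of G"

lemma finB [simp]: "finite B" "finite U" using fin by simp_all

lemma basis_DG [simp]: "basis DD = B" by (simp add: DG_def)

lemma prd_DG: "prd DD (x, y) (x', y') = (if x = cj y x' then ket (x, y \<otimes> y') else (\<lambda>_. 0 :: 'k::field))"
  by (simp add: DG_def conj_by_def)

lemma unt_DG: "unt DD (x, y) = (if x \<in> U \<and> y = \<one> then 1 else (0 :: 'k::field))"
  by (simp add: DG_def)

lemma cop_DG: "cop DD (x, y) ((x1, y1), (x2, y2)) =
    (if x1 \<in> U \<and> x2 \<in> U \<and> x1 \<otimes> x2 = x \<and> y1 = y \<and> y2 = y then 1 else (0 :: 'k::field))"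
  by (simp add: DG_def)

lemma cou_DG: "cou DD (x, y) = (if x = \<one> then 1 else (0 :: 'k::field))"
  by (simp add: DG_def)

lemma based_DG: "based_bialg (DD :: ('a \<times> 'a, 'k::field) bialg)"
  by unfold_locales (auto simp: coords_def ket_def unt_DG prd_DG cop_DG split: if_splits)

sublocale DG: based_bialg "DG G :: ('a \<times> 'a, 'k::field) bialg" by (rule based_DG)

lemma based_kfun: "based_bialg (kfun G :: ('a, 'k::field) bialg)"
  by unfold_locales (auto simp: kfun_def coords_def ket_def split: if_splits)

lemma based_kgrp: "based_bialg (kgrp G :: ('a, 'k::field) bialg)"
  by unfold_locales (auto simp: kgrp_def coords_def ket_def split: if_splits)

lemma bichar_cj:
  assumes "bichar G c" "t \<in> U" "x \<in> U" "y \<in> U"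
  shows "c (cj t x) y = c x y" "c x (cj t y) = (c x y :: 'k::field)"
proof -
  note h = hom_kstar[OF bichar_hom(1)[OF assms(1)]] hom_kstar[OF bichar_hom(2)[OF assms(1)]]
  show "c (cj t x) y = c x y" "c x (cj t y) = c x y" using assms(2-4) by (simp_all add: conj_by_def h)
qed

lemma bichar_one:
  assumes "bichar G c" "x \<in> U" shows "c \<one> x = 1" "c x \<one> = (1 :: 'k::field)"
  using hom_kstar(3)[OF bichar_hom(1)[OF assms]] hom_kstar(3)[OF bichar_hom(2)[OF assms]] by simp_all

lemma bicharD:
  assumes "bichar G c" "x \<in> U" "y \<in> U"
  shows "c x y \<noteq> (0 :: 'k::field)"
    "z \<in> U \<Longrightarrow> c (x \<otimes> y) z = c x z * c y z"
    "z \<in> U \<Longrightarrow> c z (x \<otimes> y) = c z x * c z y"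
  using assms by (auto simp: bichar_def)

text \<open>With g = \<one> these are the elements of B, with trivial c the inner automorphisms. One
  family for both contains the cosets of the latter as well.\<close>

definition dg_aut :: "'a \<Rightarrow> ('a \<Rightarrow> 'a \<Rightarrow> 'k::field) \<Rightarrow> ('a \<times> 'a \<Rightarrow> 'k) \<Rightarrow> 'a \<times> 'a \<Rightarrow> 'k" where
  "dg_aut g c = mono_map B (\<lambda>(x, y). c y x) (\<lambda>(x, y). (cj g x, cj g y))"

abbreviation baut :: "('a \<Rightarrow> 'a \<Rightarrow> 'k::field) \<Rightarrow> ('a, 'k) dg_aut" where "baut \<equiv> dg_aut \<one>"

lemma monomial_dg:
  assumes "g \<in> U" "bichar G c"
  shows "monomial B (\<lambda>(x, y). c y x :: 'k::field) (\<lambda>(x, y). (cj g x, cj g y))"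
proof
  show "bij_betw (\<lambda>(x, y). (cj g x, cj g y)) B B"
    by (rule bij_betw_byWitness[where f' = "\<lambda>(x, y). (cj (inv g) x, cj (inv g) y)"]) (use assms in auto)
qed (use assms bicharD(1) in auto)

lemma dg_aut_ket:
  assumes "g \<in> U" "bichar G c" "x \<in> U" "y \<in> U"
  shows "dg_aut g c (ket (x, y)) = scl (c y x) (ket (cj g x, cj g y) :: _ \<Rightarrow> 'k::field)"
  using monomial.mono_ket[OF monomial_dg[OF assms(1,2)], of "(x, y)"] assms by (simp add: dg_aut_def)

lemma dg_aut_lin:
  assumes "g \<in> U" "bichar G c" shows "dg_aut g c \<in> lin B B"
  using monomial.mono_lin[OF monomial_dg[OF assms]] by (simp add: dg_aut_def)

text \<open>The product axiom uses multiplicativity of c in its first argument, the group label, and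
  the coproduct axiom uses the second. Conjugations drop out because c takes values in an abelian
  group.\<close>

lemma dg_aut_Aut:
  assumes g: "g \<in> U" and c: "bichar G (c :: 'a \<Rightarrow> 'a \<Rightarrow> 'k::field)"
  shows "dg_aut g c \<in> carrier AutD"
proof -
  have "mono_map B (\<lambda>(x, y). c y x) (\<lambda>(x, y). (cj g x, cj g y)) \<in> carrier AutD"
  proof (rule mono_Aut[OF based_DG, unfolded basis_DG], goal_cases)
    case 1 show ?case using monomial_dg[OF g c] by simp
  next
    case (2 p) thus ?case using g by (auto simp: unt_DG bichar_one[OF c])
  next
    case (3 p q r)
    obtain x y x' y' z w where pqr: "p = (x, y)" "q = (x', y')" "r = (z, w)" by (cases p, cases q, cases r)
    have m: "x \<in> U" "y \<in> U" "x' \<in> U" "y' \<in> U" "z \<in> U" "w \<in> U"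
      using 3 pqr by auto
    have "cj g x = cj (cj g y) (cj g x') \<longleftrightarrow> x = cj y x'"
    proof -
      have "cj (cj g y) (cj g x') = cj g (cj y x')"
        using m g by (simp add: cj_cj) (simp add: conj_by_def m_assoc)
      thus ?thesis using m g by simp
    qed
    thus ?case using m g
      by (auto simp: pqr prd_DG ket_def cj_mult[symmetric] bicharD[OF c] bichar_cj[OF c])
  next
    case (4 p) thus ?case using g by (auto simp: cou_DG bichar_one[OF c])
  next
    case (5 p q r)
    thus ?case using g by (auto simp: cop_DG bicharD[OF c] cj_mult[symmetric])
  qed
  thus ?thesis by (simp add: dg_aut_def)
qed

lemma bichar_mult: "bichar G c \<Longrightarrow> bichar G d \<Longrightarrow> bichar G (\<lambda>x y. c x y * (d x y :: 'k::field))"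
  by (auto simp: bichar_def)

lemma bichar_trivial: "bichar G (\<lambda>x y. 1 :: 'k::field)"
  by (auto simp: bichar_def)

lemma bichar_inverse: "bichar G c \<Longrightarrow> bichar G (\<lambda>x y. inverse (c x y :: 'k::field))"
  by (auto simp: bichar_def)

lemma bichar_flip: "bichar G c \<Longrightarrow> bichar G (\<lambda>x y. c y x :: 'k::field)"
  by (auto simp: bichar_def)

lemma dg_aut_comp:
  assumes "g \<in> U" "h \<in> U" "bichar G c" "bichar G d"
  shows "dg_aut g c \<circ> dg_aut h d = dg_aut (g \<otimes> h) (\<lambda>x y. c x y * (d x y :: 'k::field))"
proof (rule lin_eqI[OF lin_comp[OF dg_aut_lin dg_aut_lin] dg_aut_lin])
  fix p assume "p \<in> B"
  then obtain x y where p: "p = (x, y)" "x \<in> U" "y \<in> U" by auto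
  have "(dg_aut g c \<circ> dg_aut h d) (ket p) = scl (d y x) (scl (c (cj h y) (cj h x)) (ket (cj g (cj h x), cj g (cj h y))))"
    using assms p by (simp add: dg_aut_ket lin_scl[OF dg_aut_lin])
  also have "\<dots> = dg_aut (g \<otimes> h) (\<lambda>x y. c x y * d x y) (ket p)"
    using assms p by (simp add: dg_aut_ket bichar_mult cj_cj bichar_cj scl_def fun_eq_iff)
  finally show "(dg_aut g c \<circ> dg_aut h d) (ket p) = dg_aut (g \<otimes> h) (\<lambda>x y. c x y * d x y) (ket p)" .
qed (use assms in \<open>auto intro: bichar_mult\<close>)

lemma dg_aut_one: "baut (\<lambda>x y. 1) = (id_map B :: ('a \<times> 'a \<Rightarrow> 'k::field) \<Rightarrow> _)"
  by (rule lin_eqI[OF dg_aut_lin id_map_lin])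
    (auto simp: bichar_trivial dg_aut_ket id_map_eq ket_coords scl_def)

text \<open>The scalars of the map reveal c; its permutation of the basis reveals g only up to the
  centre.\<close>

lemma dg_aut_eq_iff:
  assumes "bichar G c" "bichar G d" "g \<in> U" "h \<in> U"
    and eq: "dg_aut g c = (dg_aut h d :: ('a \<times> 'a \<Rightarrow> 'k::field) \<Rightarrow> _)" "x \<in> U" "y \<in> U"
  shows "c x y = d x y" "cj g x = cj h x"
proof -
  have e: "scl (c x y) (ket (cj g y, cj g x)) = scl (d x y) (ket (cj h y, cj h x) :: _ \<Rightarrow> 'k)"
    using assms dg_aut_ket by metis
  have "scl (c x y) (ket (cj g y, cj g x)) (cj g y, cj g x) \<noteq> 0"
    using bicharD(1)[OF assms(1)] assms by (simp add: scl_def ket_def)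
  hence e2: "(cj g y, cj g x) = (cj h y, cj h x)" unfolding e by (auto simp: scl_def ket_def split: if_splits)
  show "cj g x = cj h x" using e2 by simp
  show "c x y = d x y" using fun_cong[OF e, of "(cj g y, cj g x)"] e2 by (simp add: scl_def ket_def)
qed

lemma dg_aut_cong:
  assumes "\<And>x y. x \<in> U \<Longrightarrow> y \<in> U \<Longrightarrow> c x y = (d x y :: 'k::field)"
    "\<And>x. x \<in> U \<Longrightarrow> cj g x = cj h x"
  shows "dg_aut g c = dg_aut h d"
  unfolding dg_aut_def mono_map_def by (rule lin_ext_cong) (use assms in auto)

text \<open>For a fixed left factor, at most one right factor contributes to the coefficient at (x,
  z).\<close>

lemma sum_prd_DG:
  assumes ay: "a \<in> U" "y \<in> U" and m: "x \<in> U" "z \<in> U"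
  shows "(\<Sum>q\<in>B. v q * prd DD (a, y) q (x, z)) =
    (if a = x then v (cj (inv y) x, inv y \<otimes> z) else (0 :: 'k::field))"
proof -
  have "v q * prd DD (a, y) q (x, z) =
      (if a = x then v q else 0) * ket (cj (inv y) x, inv y \<otimes> z) q" if "q \<in> B" for q
    using that ay m by (auto simp: prd_DG ket_def cj_move inv_solve_left split: if_splits)
  hence "(\<Sum>q\<in>B. v q * prd DD (a, y) q (x, z)) =
      (\<Sum>q\<in>B. (if a = x then v q else 0) * ket (cj (inv y) x, inv y \<otimes> z) q)" by (intro sum.cong) auto
  also have "\<dots> = (if a = x then v (cj (inv y) x, inv y \<otimes> z) else 0)"
    using ay m by (subst sum_ket(2)) auto
  finally show ?thesis .
qed

lemma bmult_DG:
  "bmult DD u v = (\<lambda>(x, z). if x \<in> U \<and> z \<in> U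
     then \<Sum>y\<in>U. u (x, y) * v (cj (inv y) x, inv y \<otimes> z) else (0 :: 'k::field))"
proof (rule ext, unfold split_paired_all)
  fix x z
  show "bmult DD u v (x, z) = (\<lambda>(x, z). if x \<in> U \<and> z \<in> U
     then \<Sum>y\<in>U. u (x, y) * v (cj (inv y) x, inv y \<otimes> z) else (0 :: 'k)) (x, z)"
  proof (cases "x \<in> U \<and> z \<in> U")
    case False
    thus ?thesis using coordsD[OF DG.bmult_coords, of "(x, z)" u v] by auto
  next
    case True
    hence m: "x \<in> U" "z \<in> U" by auto
    have "bmult DD u v (x, z) = (\<Sum>p\<in>B. u p * (\<Sum>q\<in>B. v q * prd DD p q (x, z)))"
      by (simp add: DG.bmult_alt)
    also have "\<dots> = (\<Sum>p\<in>B. u p * (if fst p = x then v (cj (inv (snd p)) x, inv (snd p) \<otimes> z) else 0))"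
      by (intro sum.cong refl) (use m in \<open>auto simp: sum_prd_DG\<close>)
    also have "\<dots> = (\<Sum>a\<in>U. \<Sum>y\<in>U. u (a, y) * (if a = x then v (cj (inv y) x, inv y \<otimes> z) else 0))"
      by (simp add: sum.cartesian_product case_prod_unfold)
    also have "\<dots> = (\<Sum>a\<in>U. if a = x then \<Sum>y\<in>U. u (a, y) * v (cj (inv y) x, inv y \<otimes> z) else 0)"
      by (intro sum.cong) auto
    finally show ?thesis using m by (simp add: fin)
  qed
qed

text \<open>The character part cancels against its inverse, since characters are constant on
  conjugacy classes; only the conjugation by g survives.\<close>

lemma dg_aut_inner:
  assumes g: "g \<in> U" and \<chi>: "\<chi> \<in> hom G (kstar :: 'k::field monoid)"
    and t: "\<And>x y. x \<in> U \<Longrightarrow> y \<in> U \<Longrightarrow> t (x, y) = (if y = g then \<chi> x else 0)"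
    and t': "\<And>x y. x \<in> U \<Longrightarrow> y \<in> U \<Longrightarrow> t' (x, y) = (if y = inv g then inverse (\<chi> x) else 0)"
  shows "lin_ext B (\<lambda>i. bmult DD (bmult DD t (ket i)) t') = dg_aut g (\<lambda>x y. 1)"
proof -
  note \<chi>h = hom_kstar[OF \<chi>]
  have \<chi>c: "\<chi> (cj s x) = \<chi> x" if "s \<in> U" "x \<in> U" for s x using that by (simp add: conj_by_def \<chi>h)
  have 1: "bmult DD t (ket (x, y)) (a, z) = (if a = cj g x \<and> z = g \<otimes> y then \<chi> x else 0)"
    if "x \<in> U" "y \<in> U" "a \<in> U" "z \<in> U" for x y a z
  proof -
    have "bmult DD t (ket (x, y)) (a, z) = (\<Sum>w\<in>U. ket g w * (\<chi> a * ket (x, y) (cj (inv w) a, inv w \<otimes> z)))"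
      using that by (simp add: bmult_DG) (rule sum.cong[OF refl], simp add: t ket_def[of g])
    also have "\<dots> = \<chi> a * ket (x, y) (cj (inv g) a, inv g \<otimes> z)" using g by (subst sum_ket(1)) auto
    also have "\<dots> = (if a = cj g x \<and> z = g \<otimes> y then \<chi> x else 0)"
      using that g by (auto simp: ket_def cj_move[symmetric] \<chi>c inv_solve_left)
    finally show ?thesis .
  qed
  have 2: "bmult DD (bmult DD t (ket (x, y))) t' = ket (cj g x, cj g y)"
    if xy: "x \<in> U" "y \<in> U" for x y
  proof (rule ext, unfold split_paired_all)
    fix a z
    show "bmult DD (bmult DD t (ket (x, y))) t' (a, z) = ket (cj g x, cj g y) (a, z)"
    proof (cases "a \<in> U \<and> z \<in> U")
      case False
      thus ?thesis using coordsD[OF DG.bmult_coords, of "(a, z)"] xy g by (auto simp: ket_def)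
    next
      case True
      hence az: "a \<in> U" "z \<in> U" by auto
      have "bmult DD (bmult DD t (ket (x, y))) t' (a, z) =
        (\<Sum>w\<in>U. bmult DD t (ket (x, y)) (a, w) * t' (cj (inv w) a, inv w \<otimes> z))"
        by (subst bmult_DG) (simp add: az)
      also have "\<dots> = (\<Sum>w\<in>U. ket (g \<otimes> y) w * ((if a = cj g x then \<chi> x else 0) * t' (cj (inv w) a, inv w \<otimes> z)))"
        by (intro sum.cong refl) (simp add: 1 az xy ket_def[of "g \<otimes> y"])
      also have "\<dots> = (if a = cj g x then \<chi> x * t' (cj (inv (g \<otimes> y)) a, inv (g \<otimes> y) \<otimes> z) else 0)"
        using g xy by (subst sum_ket(1)) auto
      also have "\<dots> = (if a = cj g x \<and> z = cj g y then 1 else 0)"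
      proof -
        have "inv (g \<otimes> y) \<otimes> z = inv g \<longleftrightarrow> z = cj g y"
          using az xy g by (metis conj_by_def inv_closed inv_solve_left m_assoc m_closed)
        thus ?thesis using az xy g by (auto simp: t' \<chi>c \<chi>h(2))
      qed
      finally show ?thesis by (auto simp: ket_def)
    qed
  qed
  show ?thesis
    unfolding dg_aut_def mono_map_def
    by (rule lin_ext_cong) (auto simp: 2 scl_def)
qed

text \<open>Group-like elements of DG have the form \<chi> \<times> g with a character \<chi>, and
  by \<open>dg_aut_inner\<close> the conjugation depends on g alone. To realise a given g the
  trivial character is enough.\<close>

lemma Inn_DG: "Inn_Hopf DD = {dg_aut g (\<lambda>x y. 1 :: 'k::field) | g. g \<in> U}"
proof (intro equalityI subsetI)
  fix c assume "c \<in> {dg_aut g (\<lambda>x y. 1 :: 'k) | g. g \<in> U}"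
  then obtain g where g: "g \<in> U" "c = dg_aut g (\<lambda>x y. 1)" by blast
  define t :: "'a \<times> 'a \<Rightarrow> 'k" where "t = (\<lambda>(x, y). if x \<in> U \<and> y = g then 1 else 0)"
  define t' :: "'a \<times> 'a \<Rightarrow> 'k" where "t' = (\<lambda>(x, y). if x \<in> U \<and> y = inv g then 1 else 0)"
  have "(\<lambda>_. 1 :: 'k) \<in> hom G kstar" by (auto simp: hom_def)
  hence "c = lin_ext B (\<lambda>i. bmult DD (bmult DD t (ket i)) t')"
    using dg_aut_inner[OF g(1), of "\<lambda>_. 1" t t'] g by (simp add: t_def t'_def)
  moreover have "t \<in> coords B" "t' \<in> coords B"
    using g by (auto simp: coords_def t_def t'_def)
  moreover have "bcounit DD t = 1"
  proof -
    have "bcounit DD t = (\<Sum>p\<in>B. ket (\<one>, g) p * 1)"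
      unfolding bcounit_def using g by (intro sum.cong) (auto simp: t_def cou_DG ket_def split: if_splits)
    thus ?thesis using g by (subst (asm) sum_ket(1)) auto
  qed
  moreover have "bcomult DD t = (\<lambda>(x, y). t x * t y)"
  proof (rule ext, unfold split_paired_all)
    fix x1 y1 x2 y2
    have "bcomult DD t ((x1, y1), (x2, y2)) =
      (\<Sum>p\<in>B. ket (x1 \<otimes> x2, g) p * (if x1 \<in> U \<and> x2 \<in> U \<and> y1 = g \<and> y2 = g then 1 else 0))"
      unfolding bcomult_def basis_DG
      by (intro sum.cong refl) (use g in \<open>auto simp: t_def cop_DG ket_def split: if_splits\<close>)
    also have "\<dots> = t (x1, y1) * t (x2, y2)"
      using g by (cases "x1 \<in> U \<and> x2 \<in> U") (subst sum_ket(1), auto simp: t_def)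
    finally show "bcomult DD t ((x1, y1), (x2, y2)) = (\<lambda>(x, y). t x * t y) ((x1, y1), (x2, y2))" by simp
  qed
  moreover have "bmult DD t t' = unt DD" "bmult DD t' t = unt DD"
  proof -
    have aux: "bmult DD (\<lambda>(x, y). if x \<in> U \<and> y = h then 1 else 0 :: 'k)
       (\<lambda>(x, y). if x \<in> U \<and> y = inv h then 1 else 0) = unt DD" if h: "h \<in> U" for h
    proof (rule ext, unfold split_paired_all)
      fix x z
      have "(\<Sum>y\<in>U. (if y = h then 1 else 0) * (if inv y \<otimes> z = inv h then 1 else 0 :: 'k)) =
          (\<Sum>y\<in>U. ket h y * (if inv y \<otimes> z = inv h then 1 else 0))" by (simp add: ket_def)
      also have "\<dots> = (if inv h \<otimes> z = inv h then 1 else 0)" using h by (simp add: sum_ket)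
      finally show "bmult DD (\<lambda>(x, y). if x \<in> U \<and> y = h then 1 else 0 :: 'k)
       (\<lambda>(x, y). if x \<in> U \<and> y = inv h then 1 else 0) (x, z) = unt DD (x, z)"
        using h by (auto simp: bmult_DG unt_DG)
    qed
    show "bmult DD t t' = unt DD" "bmult DD t' t = unt DD"
      using aux[of g] aux[of "inv g"] g by (simp_all add: t_def t'_def)
  qed
  ultimately show "c \<in> Inn_Hopf DD" unfolding Inn_Hopf_def group_like_def basis_DG by blast
next
  fix c :: "('a \<times> 'a \<Rightarrow> 'k) \<Rightarrow> 'a \<times> 'a \<Rightarrow> 'k" assume "c \<in> Inn_Hopf DD"
  then obtain t t' where t: "c = lin_ext B (\<lambda>i. bmult DD (bmult DD t (ket i)) t')" "group_like DD t"
    "t' \<in> coords B" "bmult DD t t' = unt DD"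
    unfolding Inn_Hopf_def basis_DG by blast
  \<comment> \<open>Coefficients of \<Delta> t = t \<otimes> t: entries with different group labels
    multiply to 0, those with equal labels are multiplicative in x.\<close>
  have m: "t (x1, y1) * t (x2, y2) = (if y1 = y2 then t (x1 \<otimes> x2, y1) else 0)"
    if "x1 \<in> U" "y1 \<in> U" "x2 \<in> U" "y2 \<in> U" for x1 x2 y1 y2
  proof -
    have "bcomult DD t ((x1, y1), (x2, y2)) = (\<Sum>p\<in>B. ket (x1 \<otimes> x2, y1) p * (if y1 = y2 then t p else 0))"
      unfolding bcomult_def basis_DG
      by (intro sum.cong refl) (use that in \<open>auto simp: cop_DG ket_def split: if_splits\<close>)
    also have "\<dots> = (if y1 = y2 then t (x1 \<otimes> x2, y1) else 0)" using that by (subst sum_ket(1)) auto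
    finally show ?thesis using t(2) by (simp add: group_like_def)
  qed
  have "(\<Sum>x\<in>U. \<Sum>y\<in>U. t (x, y) * (if x = \<one> then 1 else 0)) = 1"
  proof -
    have "(\<Sum>p\<in>B. t p * cou DD p) = 1" using t(2) by (simp add: group_like_def bcounit_def)
    moreover have "(\<Sum>p\<in>B. t p * cou DD p) = (\<Sum>(x, y)\<in>B. t (x, y) * (if x = \<one> then 1 else 0))"
      by (intro sum.cong) (auto simp: cou_DG)
    ultimately show ?thesis by (simp only: sum.cartesian_product)
  qed
  hence s1: "(\<Sum>y\<in>U. t (\<one>, y)) = 1"
    by (subst (asm) sum.swap) (simp add: if_distrib cong: if_cong)
  then obtain g where g: "g \<in> U" "t (\<one>, g) \<noteq> 0" by (metis sum.neutral zero_neq_one)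
  \<comment> \<open>The product with the nonzero entry at (\<one>, g) vanishes, so a single group
    label carries t.\<close>
  have off: "t (x, y) = 0" if "x \<in> U" "y \<in> U" "y \<noteq> g" for x y
    using m[of \<one> g x y] that g by auto
  have "(\<Sum>y\<in>U. t (\<one>, y)) = (\<Sum>y\<in>U. ket g y * t (\<one>, y))"
    using off by (intro sum.cong) (auto simp: ket_def)
  hence t1: "t (\<one>, g) = 1" using s1 g by (simp add: sum_ket)
  define \<chi> where "\<chi> = (\<lambda>x. t (x, g))"
  have \<chi>m: "\<chi> (x \<otimes> y) = \<chi> x * \<chi> y" if "x \<in> U" "y \<in> U" for x y
    using m[of x g y g] that g by (simp add: \<chi>_def)
  have \<chi>n: "\<chi> x \<noteq> 0" if "x \<in> U" for x
    using \<chi>m[of x "inv x"] that t1 by (auto simp: \<chi>_def)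
  have \<chi>: "\<chi> \<in> hom G kstar" by (rule hom_kstarI[OF \<chi>m \<chi>n])
  note \<chi>h = hom_kstar[OF \<chi>]
  have \<chi>c: "\<chi> (cj s x) = \<chi> x" if "s \<in> U" "x \<in> U" for s x using that by (simp add: conj_by_def \<chi>h)
  have tt: "t (x, y) = (if y = g then \<chi> x else 0)" if "x \<in> U" "y \<in> U" for x y
    using off that by (auto simp: \<chi>_def)
  have "t' (x, y) = (if y = inv g then inverse (\<chi> x) else 0)" if xy: "x \<in> U" "y \<in> U" for x y
  proof -
    have "unt DD (cj g x, g \<otimes> y) = bmult DD t t' (cj g x, g \<otimes> y)" using t(4) by simp
    also have "\<dots> = (\<Sum>w\<in>U. ket g w * (\<chi> (cj g x) * t' (cj (inv w) (cj g x), inv w \<otimes> (g \<otimes> y))))"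
      using xy g by (auto simp: bmult_DG tt ket_def intro!: sum.cong)
    also have "\<dots> = \<chi> x * t' (x, y)" using xy g by (subst sum_ket(1)) (auto simp: \<chi>c m_assoc[symmetric])
    finally have "unt DD (cj g x, g \<otimes> y) = \<chi> x * t' (x, y)" .
    have "\<chi> x * t' (x, y) = (if y = inv g then 1 else 0)"
    proof -
      have "g \<otimes> y = \<one> \<longleftrightarrow> y = inv g" using xy g(1) by (metis inv_comm inv_equality r_inv)
      thus ?thesis using xy g \<open>unt DD (cj g x, g \<otimes> y) = \<chi> x * t' (x, y)\<close> by (simp add: unt_DG)
    qed
    thus ?thesis using \<chi>n[OF xy(1)] by (auto simp: field_simps)
  qed
  hence "c = dg_aut g (\<lambda>x y. 1)" using dg_aut_inner[OF g(1) \<chi> tt] t(1) by simp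
  thus "c \<in> {dg_aut g (\<lambda>x y. 1) | g. g \<in> U}" using g by blast
qed

lemma Inn_normal: "Inn_Hopf DD \<lhd> (AutD :: (('a \<times> 'a \<Rightarrow> 'k::field) \<Rightarrow> _) monoid)"
proof -
  interpret A: group "AutD :: (('a \<times> 'a \<Rightarrow> 'k) \<Rightarrow> _) monoid" by (rule DG.group_Aut_Hopf)
  have c: "dg_aut g (\<lambda>x y. 1) \<circ> dg_aut h (\<lambda>x y. 1) = (dg_aut (g \<otimes> h) (\<lambda>x y. 1) :: ('a \<times> 'a \<Rightarrow> 'k) \<Rightarrow> _)"
    if "g \<in> U" "h \<in> U" for g h
    using dg_aut_comp[OF that bichar_trivial bichar_trivial] by simp
  have sub: "subgroup (Inn_Hopf DD) (AutD :: (('a \<times> 'a \<Rightarrow> 'k) \<Rightarrow> _) monoid)"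
  proof (rule A.subgroupI)
    show "Inn_Hopf DD \<subseteq> carrier (AutD :: (('a \<times> 'a \<Rightarrow> 'k) \<Rightarrow> _) monoid)"
      by (auto simp: Inn_DG intro!: dg_aut_Aut bichar_trivial)
    show "Inn_Hopf DD \<noteq> ({} :: (('a \<times> 'a \<Rightarrow> 'k) \<Rightarrow> _) set)" by (auto simp: Inn_DG)
    fix a :: "('a \<times> 'a \<Rightarrow> 'k) \<Rightarrow> _" assume "a \<in> Inn_Hopf DD"
    then obtain g where g: "g \<in> U" "a = dg_aut g (\<lambda>x y. 1)" by (auto simp: Inn_DG)
    have "dg_aut (inv g) (\<lambda>x y. 1) \<circ> a = \<one>\<^bsub>AutD\<^esub>" using c[of "inv g" g] g by (simp add: dg_aut_one)
    hence "inv\<^bsub>AutD\<^esub> a = dg_aut (inv g) (\<lambda>x y. 1)"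
      using g by (intro A.inv_equality) (auto intro!: dg_aut_Aut bichar_trivial)
    thus "inv\<^bsub>AutD\<^esub> a \<in> Inn_Hopf DD" using g by (auto simp: Inn_DG)
    fix b :: "('a \<times> 'a \<Rightarrow> 'k) \<Rightarrow> _" assume "b \<in> Inn_Hopf DD"
    then obtain h where "h \<in> U" "b = dg_aut h (\<lambda>x y. 1)" by (auto simp: Inn_DG)
    thus "a \<otimes>\<^bsub>AutD\<^esub> b \<in> Inn_Hopf DD" using g c by (auto simp: Inn_DG)
  qed
  have "x \<otimes>\<^bsub>AutD\<^esub> h \<otimes>\<^bsub>AutD\<^esub> inv\<^bsub>AutD\<^esub> x \<in> Inn_Hopf DD"
    if "x \<in> carrier AutD" "h \<in> Inn_Hopf DD" for x h :: "('a \<times> 'a \<Rightarrow> 'k) \<Rightarrow> _"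
    using DG.Inn_Hopf_conj[OF that] by simp
  thus ?thesis unfolding A.normal_inv_iff using sub by blast
qed

end

section \<open>The components of an automorphism and the dagger\<close>

lemma sum_ket_one: "finite I \<Longrightarrow> i \<in> I \<Longrightarrow> (\<Sum>x\<in>I. ket i x) = (1 :: 'k::field)"
  using sum_ket(1)[of I i "\<lambda>_. 1"] by simp

context fin_group
begin

lemma bmult_kfun: "y \<in> U \<Longrightarrow> bmult kf p q y = p y * (q y :: 'k::field)"
proof -
  assume y: "y \<in> U"
  have "bmult kf p q y = (\<Sum>x\<in>U. p x * (\<Sum>x'\<in>U. q x' * (if x = x' then ket x y else 0)))"
    by (simp add: based_bialg.bmult_alt[OF based_kfun]) (simp add: kfun_def if_distrib if_distribR cong: if_cong)
  also have "\<dots> = (\<Sum>x\<in>U. (p x * q x) * ket x y)"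
    by (intro sum.cong refl) (simp add: if_distrib cong: if_cong)
  also have "\<dots> = p y * q y" using y by (simp add: sum_ket)
  finally show ?thesis .
qed

lemma bmult_kgrp: "bmult kg p q h = (\<Sum>x\<in>U. \<Sum>y\<in>U. p x * q y * (ket (x \<otimes> y) h :: 'k::field))"
  by (simp add: bmult_def kgrp_def)

lemma sum_bmult_kgrp: "(\<Sum>h\<in>U. bmult kg p q h) = (\<Sum>x\<in>U. p x) * (\<Sum>y\<in>U. q y :: 'k::field)"
proof -
  have "(\<Sum>h\<in>U. bmult kg p q h) =
    (\<Sum>x\<in>U. \<Sum>y\<in>U. \<Sum>h\<in>U. p x * q y * ket (x \<otimes> y) h)"
    unfolding bmult_kgrp by (rule trans[OF sum.swap], rule sum.cong[OF refl], rule sum.swap)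
  also have "\<dots> = (\<Sum>x\<in>U. \<Sum>y\<in>U. p x * q y)"
    by (intro sum.cong refl) (simp add: sum_ket_one flip: sum_distrib_left)
  finally show ?thesis by (simp add: sum_product)
qed

lemma bmult_kgrp_one:
  assumes "h \<in> U"
  shows "bmult kg p (ket \<one>) h = (p h :: 'k::field)" "bmult kg (ket \<one>) p h = p h"
proof -
  have "bmult kg p (ket \<one>) h = (\<Sum>x\<in>U. \<Sum>y\<in>U. ket \<one> y * (p x * ket (x \<otimes> y) h))"
    unfolding bmult_kgrp by (simp add: mult_ac)
  also have "\<dots> = (\<Sum>x\<in>U. p x * ket x h)" by (intro sum.cong refl) (subst sum_ket(1), auto)
  finally show "bmult kg p (ket \<one>) h = p h" using assms by (simp add: sum_ket)
  have "bmult kg (ket \<one>) p h = (\<Sum>x\<in>U. ket \<one> x * (\<Sum>y\<in>U. p y * ket (x \<otimes> y) h))"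
    unfolding bmult_kgrp by (simp add: sum_distrib_left mult_ac)
  also have "\<dots> = (\<Sum>y\<in>U. p y * ket (\<one> \<otimes> y) h)" by (subst sum_ket(1)) auto
  also have "\<dots> = (\<Sum>y\<in>U. p y * ket y h)" by (intro sum.cong) auto
  finally show "bmult kg (ket \<one>) p h = p h" using assms by (simp add: sum_ket)
qed

lemma assemble_ket:
  assumes "x \<in> U" "g \<in> U"
  shows "assemble G u b a v (ket (x, g)) (y, h) = (\<Sum>x1\<in>U.
     bmult kf (u (ket x1)) (b (ket g)) y * bmult kg (a (ket (inv x1 \<otimes> x))) (v (ket g)) h :: 'k::field)"
proof -
  let ?F = "\<lambda>x1 x2. bmult kf (u (ket x1)) (b (ket g)) y * bmult kg (a (ket x2)) (v (ket g)) h"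
  have "assemble G u b a v (ket (x, g)) (y, h) = (\<Sum>(x1, x2)\<in>B. cop kf x (x1, x2) * ?F x1 x2)"
    using assms by (simp add: assemble_def mult.assoc)
  also have "\<dots> = (\<Sum>x1\<in>U. \<Sum>x2\<in>U. cop kf x (x1, x2) * ?F x1 x2)"
    by (simp add: sum.cartesian_product)
  also have "\<dots> = (\<Sum>x1\<in>U. \<Sum>x2\<in>U. ket (inv x1 \<otimes> x) x2 * ?F x1 x2)"
  proof (intro sum.cong refl)
    fix x1 x2 assume x12: "x1 \<in> U" "x2 \<in> U"
    hence "x1 \<otimes> x2 = x \<longleftrightarrow> x2 = inv x1 \<otimes> x" using assms by (metis inv_cancel inv_closed)
    thus "cop kf x (x1, x2) * ?F x1 x2 = ket (inv x1 \<otimes> x) x2 * ?F x1 x2"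
      using x12 by (simp add: kfun_def ket_def)
  qed
  also have "\<dots> = (\<Sum>x1\<in>U. ?F x1 (inv x1 \<otimes> x))"
    using assms by (intro sum.cong refl) (subst sum_ket(1), auto)
  finally show ?thesis .
qed

text \<open>Units and counits isolate the factors: summing over h is the counit of kG, evaluating at
  \<one> is the counit of k^G, and summing over z inserts the unit of k^G. The map thus determines
  its components, as the description in \<open>dagger\<close> requires.\<close>

lemma assemble_components:
  assumes u: "hopf_map kf kf u" and b: "hopf_map kg kf b"
    and a: "hopf_map kf kg a" and v0: "v0 \<in> hom G G"
    and v: "v = lin_ext U (\<lambda>g. ket (v0 g))"
    and x: "x \<in> U" and y: "y \<in> U"
  defines "\<phi> \<equiv> assemble G u b a v"
  shows "u (ket x) y = (\<Sum>h\<in>U. \<phi> (ket (x, \<one>)) (y, h) :: 'k::field)"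
    "b (ket x) y = (\<Sum>z\<in>U. \<Sum>h\<in>U. \<phi> (ket (z, x)) (y, h))"
    "a (ket x) y = \<phi> (ket (x, \<one>)) (\<one>, y)"
    "v (ket x) y = (\<Sum>z\<in>U. \<phi> (ket (z, x)) (\<one>, y))"
proof -
  have lins: "u \<in> lin U U" "b \<in> lin U U" "a \<in> lin U U"
    using u b a by (auto simp: hopf_map_def kfun_def kgrp_def)
  have v0c: "v0 g \<in> U" if "g \<in> U" for g using v0 that by (auto simp: hom_def)
  have vk: "v (ket g) = ket (v0 g)" if "g \<in> U" for g using that v by simp
  have cf: "bcounit kf w = w \<one>" for w :: "'a \<Rightarrow> 'k"
    by (simp add: bcounit_def kfun_def if_distrib cong: if_cong)
  have cg: "bcounit kg w = (\<Sum>z\<in>U. w z)" for w :: "'a \<Rightarrow> 'k"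
    by (simp add: bcounit_def kgrp_def)
  have kc: "ket z \<in> coords (basis (kfun G :: ('a, 'k) bialg))" "ket z \<in> coords (basis (kgrp G :: ('a, 'k) bialg))"
    if "z \<in> U" for z using that by (auto simp: kfun_def kgrp_def intro: ket_coords)
  have u1: "u (ket z) \<one> = ket z \<one>" if "z \<in> U" for z
    using u kc(1)[OF that] unfolding hopf_map_def by (metis cf)
  have b1: "b (ket g) \<one> = 1" if "g \<in> U" for g
  proof -
    have "b (ket g) \<one> = (\<Sum>z\<in>U. ket g z)"
      using b kc(2)[OF that] unfolding hopf_map_def by (metis cf cg)
    thus ?thesis using that by (simp add: ket_def)
  qed
  have as: "(\<Sum>h\<in>U. a (ket z) h) = ket z \<one>" if "z \<in> U" for z
    using a kc(1)[OF that] unfolding hopf_map_def by (metis cf cg)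
  have vs: "(\<Sum>h\<in>U. v (ket g) h) = 1" if "g \<in> U" for g
    using that v0c by (simp add: vk sum_ket_one)
  have bu: "b (ket \<one>) y = 1"
    using b y unfolding hopf_map_def by (auto simp: kfun_def kgrp_def)
  have un: "(\<Sum>z\<in>U. f (ket z) h) = f (unt kf) h" if "f \<in> lin U J" for f :: "('a \<Rightarrow> 'k) \<Rightarrow> 'a \<Rightarrow> 'k" and h J
    unfolding linE[OF that, of "unt kf"] by (simp add: kfun_def)
  have us: "(\<Sum>z\<in>U. u (ket z) y) = 1"
    using un[OF lins(1)] u y unfolding hopf_map_def by (simp add: kfun_def)
  \<comment> \<open>The counit of kG turns a into the counit of k^G and v into 1, which leaves the
    first tensor factor.\<close>
  have S: "(\<Sum>h\<in>U. \<phi> (ket (z, g)) (y, h)) = u (ket z) y * b (ket g) y"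
    if "z \<in> U" "g \<in> U" for z g
  proof -
    have "(\<Sum>h\<in>U. \<phi> (ket (z, g)) (y, h)) = (\<Sum>x1\<in>U. (u (ket x1) y * b (ket g) y) *
       (\<Sum>h\<in>U. bmult kg (a (ket (inv x1 \<otimes> z))) (v (ket g)) h))"
      unfolding \<phi>_def assemble_ket[OF that] by (subst sum.swap) (simp add: bmult_kfun y sum_distrib_left)
    also have "\<dots> = (\<Sum>x1\<in>U. (u (ket x1) y * b (ket g) y) * ket x1 z)"
    proof (intro sum.cong refl)
      fix x1 assume x1: "x1 \<in> U"
      have "inv x1 \<otimes> z = \<one> \<longleftrightarrow> z = x1" using x1 that by (metis inv_cancel(2) l_inv r_one)
      hence "ket (inv x1 \<otimes> z) \<one> = (ket x1 z :: 'k)" by (auto simp: ket_def)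
      thus "(u (ket x1) y * b (ket g) y) * (\<Sum>h\<in>U. bmult kg (a (ket (inv x1 \<otimes> z))) (v (ket g)) h) =
        (u (ket x1) y * b (ket g) y) * ket x1 z"
        using x1 that by (simp add: sum_bmult_kgrp as vs)
    qed
    also have "\<dots> = u (ket z) y * b (ket g) y" using that by (simp add: sum_ket)
    finally show ?thesis .
  qed
  show "u (ket x) y = (\<Sum>h\<in>U. \<phi> (ket (x, \<one>)) (y, h))" using S[OF x one_closed] bu by simp
  show "b (ket x) y = (\<Sum>z\<in>U. \<Sum>h\<in>U. \<phi> (ket (z, x)) (y, h))"
    using us x by (simp add: S flip: sum_distrib_right)
  \<comment> \<open>Evaluation at \<one> turns u into the counit and b into 1, which leaves the
    second tensor factor.\<close>
  have T: "\<phi> (ket (z, g)) (\<one>, y) = bmult kg (a (ket z)) (ket (v0 g)) y"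
    if "z \<in> U" "g \<in> U" for z g
  proof -
    have "\<phi> (ket (z, g)) (\<one>, y) = (\<Sum>x1\<in>U. ket \<one> x1 * bmult kg (a (ket (inv x1 \<otimes> z))) (ket (v0 g)) y)"
      unfolding \<phi>_def assemble_ket[OF that]
      by (intro sum.cong refl) (simp add: bmult_kfun u1 b1 that vk, simp add: ket_def)
    also have "\<dots> = bmult kg (a (ket (inv \<one> \<otimes> z))) (ket (v0 g)) y" by (subst sum_ket(1)) auto
    finally show ?thesis using that by simp
  qed
  have v1: "v0 \<one> = \<one>" using v0 by (rule hom_one) unfold_locales
  show "a (ket x) y = \<phi> (ket (x, \<one>)) (\<one>, y)"
    using x y by (simp add: T v1 bmult_kgrp_one)
  have "(\<Sum>z\<in>U. \<phi> (ket (z, x)) (\<one>, y)) = (\<Sum>z\<in>U. \<Sum>w\<in>U. a (ket z) w * bmult kg (ket w) (ket (v0 x)) y)"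
    using x by (simp add: T based_bialg.bmult_lin_left[OF based_kgrp, of "a (ket _)"]) (simp add: kgrp_def)
  also have "\<dots> = (\<Sum>w\<in>U. a (unt kf) w * bmult kg (ket w) (ket (v0 x)) y)"
    by (subst sum.swap) (simp add: un[OF lins(3)] flip: sum_distrib_right)
  also have "a (unt kf) = ket \<one>" using a unfolding hopf_map_def by (simp add: kgrp_def)
  also have "(\<Sum>w\<in>U. ket \<one> w * bmult kg (ket w) (ket (v0 x)) y) = ket (v0 x) y"
    using y by (subst sum_ket(1)) (auto simp: bmult_kgrp_one)
  finally show "v (ket x) y = (\<Sum>z\<in>U. \<phi> (ket (z, x)) (\<one>, y))" using x by (simp add: vk)
qed

lemma lin_eq_onI:
  assumes "f \<in> lin I J" "f' \<in> lin I J" "\<And>x y. x \<in> I \<Longrightarrow> y \<in> J \<Longrightarrow> f (ket x) y = f' (ket x) y"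
  shows "f = f'"
proof (rule lin_eqI[OF assms(1,2)], rule ext)
  fix x y assume "x \<in> I"
  thus "f (ket x) y = f' (ket x) y"
    using assms(3) coordsD[OF lin_coords[OF assms(1)]] coordsD[OF lin_coords[OF assms(2)]]
    by (cases "y \<in> J") auto
qed

text \<open>By uniqueness of the components all admissible decompositions give the same transposed
  map, so the description denotes it.\<close>

lemma dagger_assemble:
  assumes u: "hopf_map kf kf u" and b: "hopf_map kg kf b"
    and a: "hopf_map kf kg a" and v0: "v0 \<in> hom G G"
    and v: "v = lin_ext U (\<lambda>g. ket (v0 g) :: _ \<Rightarrow> 'k::field)"
  shows "dagger G (assemble G u b a v) =
    assemble G (dual_map U v) (dual_map U b) (dual_map U a) (dual_map U u)"
  unfolding dagger_def
proof (rule the_equality)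
  fix \<psi> assume "\<exists>u' b' a' v0' v'. hopf_map kf kf u' \<and> hopf_map kg kf b' \<and>
     hopf_map kf kg a' \<and> v0' \<in> hom G G \<and> v' = lin_ext U (\<lambda>g. ket (v0' g)) \<and>
     assemble G u b a v = assemble G u' b' a' v' \<and>
     \<psi> = assemble G (dual_map U v') (dual_map U b') (dual_map U a') (dual_map U u')"
  then obtain u' b' a' v0' v' where h: "hopf_map kf kf u'" "hopf_map kg kf b'"
     "hopf_map kf kg a'" "v0' \<in> hom G G" "v' = lin_ext U (\<lambda>g. ket (v0' g))"
     and eq: "assemble G u b a v = assemble G u' b' a' v'"
     and \<psi>: "\<psi> = assemble G (dual_map U v') (dual_map U b') (dual_map U a') (dual_map U u')"
    by blast
  have lins: "u \<in> lin U U" "b \<in> lin U U" "a \<in> lin U U"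
    "u' \<in> lin U U" "b' \<in> lin U U" "a' \<in> lin U U"
    using u b a h by (auto simp: hopf_map_def kfun_def kgrp_def)
  have "v0 g \<in> U" "v0' g \<in> U" if "g \<in> U" for g using v0 h(4) that by (auto simp: hom_def)
  hence vl: "v \<in> lin U U" "v' \<in> lin U U"
    unfolding v h(5) by (auto intro!: lin_ext_lin ket_coords)
  note c = assemble_components[OF u b a v0 v] assemble_components[OF h(1-5)]
  have "u = u'" by (rule lin_eq_onI[OF lins(1,4)]) (simp only: c(1) c(5) eq)
  moreover have "b = b'" by (rule lin_eq_onI[OF lins(2,5)]) (simp only: c(2) c(6) eq)
  moreover have "a = a'" by (rule lin_eq_onI[OF lins(3,6)]) (simp only: c(3) c(7) eq)
  moreover have "v = v'" by (rule lin_eq_onI[OF vl]) (simp only: c(4) c(8) eq)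
  ultimately show "\<psi> = assemble G (dual_map U v) (dual_map U b) (dual_map U a) (dual_map U u)"
    using \<psi> by simp
qed (use assms in blast)

text \<open>The hypotheses concern basis vectors only; thus the lemma also evaluates the assembly of
  the transposed components that forms the dagger.\<close>

lemma assemble_dg_aut:
  assumes g: "g \<in> U" and c: "bichar G (c :: 'a \<Rightarrow> 'a \<Rightarrow> 'k::field)"
    and u: "\<And>x. x \<in> U \<Longrightarrow> u (ket x) = ket (cj g x)"
    and b: "\<And>y z. y \<in> U \<Longrightarrow> z \<in> U \<Longrightarrow> b (ket y) z = c y z"
    and a: "\<And>x. x \<in> U \<Longrightarrow> a (ket x) = scl (if x = \<one> then 1 else 0) (ket \<one>)"
    and v: "\<And>y. y \<in> U \<Longrightarrow> v (ket y) = ket (cj g y)"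
  shows "assemble G u b a v = dg_aut g c"
proof -
  have k: "assemble G u b a v (ket (x, y)) (z, h) = scl (c y x) (ket (cj g x, cj g y)) (z, h)"
    if xy: "x \<in> U" "y \<in> U" and zh: "z \<in> U" "h \<in> U" for x y z h
  proof -
    have "assemble G u b a v (ket (x, y)) (z, h) = (\<Sum>x1\<in>U.
       bmult kf (u (ket x1)) (b (ket y)) z * bmult kg (a (ket (inv x1 \<otimes> x))) (v (ket y)) h)"
      by (rule assemble_ket[OF xy])
    also have "\<dots> = (\<Sum>x1\<in>U. ket x x1 * (ket (cj g x1) z * c y z * ket (cj g y) h))"
    proof (intro sum.cong refl)
      fix x1 assume x1: "x1 \<in> U"
      have e: "inv x1 \<otimes> x = \<one> \<longleftrightarrow> x1 = x" using x1 xy by (metis inv_cancel(2) l_inv r_one)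
      have s: "bmult kg (scl k (ket \<one>)) w h = k * w h" for k :: 'k and w
      proof -
        have "bmult kg (scl k (ket \<one>)) (scl 1 w) h = k * bmult kg (ket \<one>) w h"
          unfolding based_bialg.bmult_scl[OF based_kgrp] by (simp add: scl_def)
        thus ?thesis using zh by (simp add: bmult_kgrp_one scl_def)
      qed
      show "bmult kf (u (ket x1)) (b (ket y)) z * bmult kg (a (ket (inv x1 \<otimes> x))) (v (ket y)) h =
        ket x x1 * (ket (cj g x1) z * c y z * ket (cj g y) h)"
        using x1 xy zh by (simp add: bmult_kfun u b a v s e) (simp add: ket_def)
    qed
    also have "\<dots> = ket (cj g x) z * c y z * ket (cj g y) h" using xy by (subst sum_ket(1)) auto
    also have "\<dots> = scl (c y x) (ket (cj g x, cj g y)) (z, h)"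
      using xy g by (auto simp: scl_def ket_def bichar_cj[OF c])
    finally show ?thesis .
  qed
  have "assemble G u b a v (ket (x, y)) (z, h) = 0"
    if xy: "x \<in> U" "y \<in> U" and zh: "\<not> (z \<in> U \<and> h \<in> U)" for x y z h
  proof -
    have "bmult kf p q z = 0 \<or> bmult kg p' q' h = 0" for p q p' q' :: "'a \<Rightarrow> 'k"
      using zh coordsD[OF based_bialg.bmult_coords[OF based_kfun], of z p q]
        coordsD[OF based_bialg.bmult_coords[OF based_kgrp], of h p' q'] by (auto simp: kfun_def kgrp_def)
    thus ?thesis unfolding assemble_ket[OF xy] by (intro sum.neutral) auto
  qed
  hence "assemble G u b a v (ket p) = scl (c (snd p) (fst p)) (ket (cj g (fst p), cj g (snd p)))" if "p \<in> B" for p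
  proof (intro ext, unfold split_paired_all)
    fix z h show "assemble G u b a v (ket p) (z, h) = scl (c (snd p) (fst p)) (ket (cj g (fst p), cj g (snd p))) (z, h)"
      using k[of "fst p" "snd p" z h] that g
        \<open>\<And>x y z h. x \<in> U \<Longrightarrow> y \<in> U \<Longrightarrow> \<not> (z \<in> U \<and> h \<in> U) \<Longrightarrow> assemble G u b a v (ket (x, y)) (z, h) = 0\<close>[of "fst p" "snd p" z h]
      by (cases "z \<in> U \<and> h \<in> U") (auto simp: scl_def, auto simp: ket_def split: if_splits)
  qed
  moreover have "assemble G u b a v = lin_ext B (\<lambda>p. assemble G u b a v (ket p))"
    unfolding assemble_def by (intro lin_ext_cong) simp
  ultimately have "assemble G u b a v = lin_ext B (\<lambda>p. scl (c (snd p) (fst p)) (ket (cj g (fst p), cj g (snd p))))"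
    by (simp cong: lin_ext_cong)
  thus ?thesis by (simp add: dg_aut_def mono_map_def case_prod_unfold)
qed

text \<open>Here u and v are conjugation by g, b is c, and a sends e_x to 1 if x = \<one> and to 0
  otherwise. Transposition inverts a permutation, exchanges the arguments of c and fixes a; as u =
  v, their exchange in the dagger has no further effect.\<close>

lemma dagger_dg_aut:
  assumes g: "g \<in> U" and c: "bichar G (c :: 'a \<Rightarrow> 'a \<Rightarrow> 'k::field)"
  shows "dagger G (dg_aut g c) = dg_aut (inv g) (\<lambda>x y. c y x)"
proof -
  define u :: "('a \<Rightarrow> 'k) \<Rightarrow> 'a \<Rightarrow> 'k" where "u = lin_ext U (\<lambda>x. ket (cj g x))"
  define b :: "('a \<Rightarrow> 'k) \<Rightarrow> 'a \<Rightarrow> 'k" where "b = lin_ext U (\<lambda>y z. if z \<in> U then c y z else 0)"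
  define a :: "('a \<Rightarrow> 'k) \<Rightarrow> 'a \<Rightarrow> 'k" where "a = lin_ext U (\<lambda>x. scl (if x = \<one> then 1 else 0) (ket \<one>))"
  have ul: "u \<in> lin U U" unfolding u_def using g by (intro lin_ext_lin ket_coords) auto
  have bl: "b \<in> lin U U" unfolding b_def by (intro lin_ext_lin) (auto simp: coords_def)
  have al: "a \<in> lin U U" unfolding a_def by (intro lin_ext_lin) (auto simp: coords_def scl_def ket_def)
  have uk: "u (ket x) = ket (cj g x)" if "x \<in> U" for x using that by (simp add: u_def)
  have bk: "b (ket y) = (\<lambda>z. if z \<in> U then c y z else 0)" if "y \<in> U" for y using that by (simp add: b_def)
  have ak: "a (ket x) = scl (if x = \<one> then 1 else 0) (ket \<one>)" if "x \<in> U" for x using that by (simp add: a_def)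
  have bas: "basis (kfun G :: ('a, 'k) bialg) = U" "basis (kgrp G :: ('a, 'k) bialg) = U"
    by (simp_all add: kfun_def kgrp_def)
  \<comment> \<open>Once x1 is fixed, the second factor is forced to be its complement to x; the
    coproduct of k^G becomes a single sum.\<close>
  have tm: "tensor_map U f f (cop kf x) (z, w) = (\<Sum>x1\<in>U. f (ket x1) z * f (ket (inv x1 \<otimes> x)) w)"
    if x: "x \<in> U" for f :: "('a \<Rightarrow> 'k) \<Rightarrow> 'a \<Rightarrow> 'k" and x z w
  proof -
    have "tensor_map U f f (cop kf x) (z, w) =
      (\<Sum>x1\<in>U. \<Sum>x2\<in>U. ket (inv x1 \<otimes> x) x2 * (f (ket x1) z * f (ket x2) w))"
      unfolding tensor_map_apply sum.cartesian_product[symmetric]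
    proof (intro sum.cong refl)
      fix x1 x2 assume x12: "x1 \<in> U" "x2 \<in> U"
      hence "x1 \<otimes> x2 = x \<longleftrightarrow> x2 = inv x1 \<otimes> x" using x by (metis inv_cancel inv_closed)
      thus "cop kf x (x1, x2) * (f (ket x1) z * f (ket x2) w) = ket (inv x1 \<otimes> x) x2 * (f (ket x1) z * f (ket x2) w)"
        using x12 by (simp add: kfun_def ket_def)
    qed
    also have "\<dots> = (\<Sum>x1\<in>U. f (ket x1) z * f (ket (inv x1 \<otimes> x)) w)"
      using x by (intro sum.cong refl) (subst sum_ket(1), auto)
    finally show ?thesis .
  qed
  interpret KF: based_bialg "kfun G :: ('a, 'k) bialg" by (rule based_kfun)
  interpret KG: based_bialg "kgrp G :: ('a, 'k) bialg" by (rule based_kgrp)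
  have kf: "bmult kf (ket x) (ket y) = (prd kf x y :: 'a \<Rightarrow> 'k)"
    "bcounit kf (ket x) = (cou kf x :: 'k)" "bcomult kf (ket x) = (cop kf x :: _ \<Rightarrow> 'k)"
    if "x \<in> U" "y \<in> U" for x y
    using that KF.bmult_ket KF.bcounit_ket KF.bcomult_ket by (simp_all add: bas)
  have hu: "hopf_map kf kf u"
  proof (rule hopf_mapI[OF based_kfun based_kfun], unfold bas)
    show "u (unt kf) = unt kf"
    proof
      fix z
      have "u (unt kf) z = (\<Sum>x\<in>U. ket (cj g x) z)"
        by (simp add: linE[OF ul, of "unt kf"] uk) (simp add: kfun_def)
      also have "\<dots> = (\<Sum>x\<in>U. if z \<in> U then ket (cj (inv g) z) x else 0)"
        using g by (intro sum.cong refl) (auto simp: ket_def)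
      also have "\<dots> = unt kf z" using g by (auto simp: ket_def kfun_def)
      finally show "u (unt kf) z = unt kf z" .
    qed
    fix p assume p: "p \<in> U"
    show "u (prd kf p q) = bmult kf (u (ket p)) (u (ket q))" if q: "q \<in> U" for q
      using g p q by (simp add: uk kf) (auto simp: kfun_def uk lin_zero[OF ul])
    show "bcounit kf (u (ket p)) = cou kf p"
      using g p by (simp add: uk kf) (simp add: kfun_def)
    show "bcomult kf (u (ket p)) = tensor_map U u u (cop kf p)"
    proof (rule ext, unfold split_paired_all)
      fix z w
      have "tensor_map U u u (cop kf p) (z, w) =
          (\<Sum>x1\<in>U. ket (cj g x1) z * ket (cj g (inv x1 \<otimes> p)) w)"
        unfolding tm[OF p] using p by (intro sum.cong refl) (simp add: uk)
      also have "\<dots> = (\<Sum>x1\<in>U. if z \<in> U then ket (cj (inv g) z) x1 * ket (inv z \<otimes> cj g p) w else 0)"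
        using g p by (intro sum.cong refl) (auto simp: ket_def cj_mult cj_m_inv)
      also have "\<dots> = cop kf (cj g p) (z, w)"
      proof -
        have "w = inv z \<otimes> cj g p \<longleftrightarrow> w \<in> U \<and> z \<otimes> w = cj g p" if "z \<in> U"
          using that g p inv_cancel cj_closed m_closed inv_closed by metis
        thus ?thesis using g
          by (cases "z \<in> U")
            (auto simp: kfun_def ket_def[of "inv z \<otimes> cj g p"] sum_ket_one simp flip: sum_distrib_right)
      qed
      finally show "bcomult kf (u (ket p)) (z, w) = tensor_map U u u (cop kf p) (z, w)"
        using g p by (simp add: uk kf)
    qed
  qed (rule ul)
  have hb: "hopf_map kg kf b"
  proof (rule hopf_mapI[OF based_kgrp based_kfun], unfold bas)
    show "b (unt kg) = unt kf"
      using bichar_one(1)[OF c] by (auto simp: kgrp_def bk) (auto simp: kfun_def)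
    fix p assume p: "p \<in> U"
    show "b (prd kg p q) = bmult kf (b (ket p)) (b (ket q))" if q: "q \<in> U" for q
    proof
      fix z show "b (prd kg p q) z = bmult kf (b (ket p)) (b (ket q)) z"
        using p q coordsD[OF KF.bmult_coords[unfolded bas], of z "b (ket p)" "b (ket q)"]
        by (cases "z \<in> U") (auto simp: bmult_kfun kgrp_def bk bicharD[OF c])
    qed
    show "bcounit kf (b (ket p)) = cou kg p"
      using p bichar_one(2)[OF c p] by (simp add: bcounit_def bk kfun_def kgrp_def if_distrib cong: if_cong)
    show "bcomult kf (b (ket p)) = tensor_map U b b (cop kg p)"
    proof (rule ext, unfold split_paired_all)
      fix z w
      have "tensor_map U b b (cop kg p) (z, w) = (\<Sum>q\<in>B. ket (p, p) q * (b (ket (fst q)) z * b (ket (snd q)) w))"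
        by (simp add: tensor_map_apply kgrp_def case_prod_unfold)
      also have "\<dots> = b (ket p) z * b (ket p) w" using p by (subst sum_ket(1)) auto
      also have "\<dots> = (if z \<in> U \<and> w \<in> U then c p (z \<otimes> w) else 0)" using p by (auto simp: bk bicharD[OF c])
      also have "\<dots> = (\<Sum>x\<in>U. ket (z \<otimes> w) x * (if z \<in> U \<and> w \<in> U then b (ket p) x else 0))"
      proof (cases "z \<in> U \<and> w \<in> U")
        case True thus ?thesis using p by (subst sum_ket(1)) (auto simp: bk)
      qed auto
      also have "\<dots> = bcomult kf (b (ket p)) (z, w)"
        unfolding bcomult_def bas by (intro sum.cong refl) (auto simp: kfun_def ket_def)
      finally show "bcomult kf (b (ket p)) (z, w) = tensor_map U b b (cop kg p) (z, w)" by simp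
    qed
  qed (rule bl)
  have ha: "hopf_map kf kg a"
  proof (rule hopf_mapI[OF based_kfun based_kgrp], unfold bas)
    show "a (unt kf) = unt kg"
    proof
      fix z
      have "a (unt kf) z = (\<Sum>x\<in>U. ket \<one> x * ket \<one> z)"
        unfolding linE[OF al, of "unt kf"]
        by (intro sum.cong refl) (simp add: ak, simp add: kfun_def scl_def ket_def)
      thus "a (unt kf) z = unt kg z" by (subst (asm) sum_ket(1)) (auto simp: kgrp_def)
    qed
    fix p assume p: "p \<in> U"
    have k1: "bmult kg (ket \<one>) (ket \<one>) = (ket \<one> :: 'a \<Rightarrow> 'k)"
      using KG.bmult_ket[of \<one> \<one>] by (simp add: kgrp_def)
    show "a (prd kf p q) = bmult kg (a (ket p)) (a (ket q))" if q: "q \<in> U" for q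
      using p q by (auto simp: ak KG.bmult_scl k1 kfun_def lin_zero[OF al]) (auto simp: scl_def)
    show "bcounit kg (a (ket p)) = cou kf p"
      using p by (simp add: ak KG.bcounit_scl KG.bcounit_ket bas)
        (simp add: kgrp_def kfun_def)
    show "bcomult kg (a (ket p)) = tensor_map U a a (cop kf p)"
    proof (rule ext, unfold split_paired_all)
      fix z w
      have "tensor_map U a a (cop kf p) (z, w) = (\<Sum>x1\<in>U. ket \<one> x1 * (ket \<one> z * a (ket (inv x1 \<otimes> p)) w))"
        unfolding tm[OF p] by (intro sum.cong refl) (simp add: ak, simp add: scl_def ket_def)
      also have "\<dots> = ket \<one> z * a (ket p) w" using p by (subst sum_ket(1)) auto
      also have "\<dots> = bcomult kg (a (ket p)) (z, w)"
        using p by (simp add: ak KG.bcomult_scl KG.bcomult_ket bas)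
          (auto simp: kgrp_def scl_def ket_def)
      finally show "bcomult kg (a (ket p)) (z, w) = tensor_map U a a (cop kf p) (z, w)" by simp
    qed
  qed (rule al)
  have v0: "cj g \<in> hom G G" using g by (auto simp: hom_def cj_mult)
  have e: "dg_aut g c = assemble G u b a u"
    by (rule assemble_dg_aut[OF g c, symmetric]) (auto simp: uk bk ak)
  have dual: "dual_map U f (ket x) i = f (ket i) x" if "x \<in> U" for f :: "('a \<Rightarrow> 'k) \<Rightarrow> 'a \<Rightarrow> 'k" and x i
    using that by (simp add: dual_map_def)
  \<comment> \<open>The transpose is also evaluated at labels outside the group, where linear
    representatives vanish.\<close>
  have off: "f (ket i) = (\<lambda>_. 0)" if "f \<in> lin U U" "i \<notin> U" for f :: "('a \<Rightarrow> 'k) \<Rightarrow> 'a \<Rightarrow> 'k" and i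
  proof
    fix j
    have "ket i l = (0 :: 'k)" if "l \<in> U" for l using that \<open>i \<notin> U\<close> by (auto simp: ket_def)
    thus "f (ket i) j = 0" by (subst linE[OF that(1)]) simp
  qed
  have du: "dual_map U u (ket x) = ket (cj (inv g) x)" if "x \<in> U" for x
  proof
    fix i show "dual_map U u (ket x) i = ket (cj (inv g) x) i"
      using that g by (cases "i \<in> U") (auto simp: dual uk off[OF ul], auto simp: ket_def)
  qed
  have da: "dual_map U a (ket x) = scl (if x = \<one> then 1 else 0) (ket \<one>)" if "x \<in> U" for x
  proof
    fix i show "dual_map U a (ket x) i = scl (if x = \<one> then 1 else 0) (ket \<one>) i"
      using that by (cases "i \<in> U") (auto simp: dual ak off[OF al], auto simp: scl_def ket_def)
  qed
  have "dagger G (dg_aut g c) =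
    assemble G (dual_map U u) (dual_map U b) (dual_map U a) (dual_map U u)"
    unfolding e by (rule dagger_assemble[OF hu hb ha v0 u_def])
  also have "\<dots> = dg_aut (inv g) (\<lambda>x y. c y x)"
    by (rule assemble_dg_aut) (use g c in \<open>auto simp: bichar_flip du da dual bk\<close>)
  finally show ?thesis .
qed

end

section \<open>Tensor squares\<close>

text \<open>The coalgebra fields are dummies.\<close>

definition tens_alg :: "('i, 'k::field) bialg \<Rightarrow> ('i \<times> 'i, 'k) bialg" where
  "tens_alg H = \<lparr>basis = basis H \<times> basis H,
     prd = (\<lambda>(x, y) (x', y') (z, w). prd H x x' z * prd H y y' w),
     unt = (\<lambda>(x, y). unt H x * unt H y),
     cop = (\<lambda>_ _. 0), cou = (\<lambda>_. 0)\<rparr>"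

lemma bmult_tens_alg: "bmult (tens_alg H) s t = tensor_mult H s t"
  by (rule ext, unfold split_paired_all)
    (simp add: bmult_def tensor_mult_def tens_alg_def case_prod_unfold mult_ac)

locale based_alg = based_bialg H for H :: "('i, 'k::field) bialg" +
  assumes assoc_ket: "\<And>a b c. a \<in> basis H \<Longrightarrow> b \<in> basis H \<Longrightarrow> c \<in> basis H \<Longrightarrow>
      bmult H (prd H a b) (ket c) = bmult H (ket a) (prd H b c)"
    and unit_ket: "\<And>a. a \<in> basis H \<Longrightarrow> bmult H (unt H) (ket a) = ket a"
      "\<And>a. a \<in> basis H \<Longrightarrow> bmult H (ket a) (unt H) = ket a"

lemma (in based_bialg) bmult_lin:
  "(\<lambda>u. bmult H u w) \<in> lin (basis H) (basis H)" "(\<lambda>w. bmult H u w) \<in> lin (basis H) (basis H)"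
proof -
  have 1: "(\<lambda>u. bmult H u w) = lin_ext (basis H) (\<lambda>i. bmult H (ket i) w)"
    unfolding lin_ext_def by (intro ext) (subst bmult_lin_left, rule refl)
  have 2: "(\<lambda>w. bmult H u w) = lin_ext (basis H) (\<lambda>i. bmult H u (ket i))"
    unfolding lin_ext_def by (intro ext) (subst bmult_lin_right, rule refl)
  show "(\<lambda>u. bmult H u w) \<in> lin (basis H) (basis H)" "(\<lambda>w. bmult H u w) \<in> lin (basis H) (basis H)"
    by (subst 1, rule lin_ext_lin[OF fin bmult_coords]) (subst 2, rule lin_ext_lin[OF fin bmult_coords])
qed

context based_alg
begin

text \<open>Three passes extend associativity from basis vectors to arbitrary vectors, one argument
  at a time, beginning with the rightmost.\<close>

lemma bmult_assoc: "bmult H (bmult H u v) w = bmult H u (bmult H v w)"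
proof -
  note L = bmult_lin(1) and R = bmult_lin(2)
  have 1: "bmult H (bmult H (ket a) (ket b)) w = bmult H (ket a) (bmult H (ket b) w)"
    if ab: "a \<in> basis H" "b \<in> basis H" for a b w
  proof -
    have "(\<lambda>w. bmult H (bmult H (ket a) (ket b)) w) = (\<lambda>w. bmult H (ket a) w) \<circ> (\<lambda>w. bmult H (ket b) w)"
      by (rule lin_eqI[OF R lin_comp[OF R R]]) (simp add: bmult_ket ab assoc_ket)
    from fun_cong[OF this, of w] show ?thesis by simp
  qed
  have 2: "bmult H (bmult H (ket a) v) w = bmult H (ket a) (bmult H v w)"
    if a: "a \<in> basis H" for a v w
  proof -
    have "(\<lambda>v. bmult H v w) \<circ> (\<lambda>v. bmult H (ket a) v) = (\<lambda>v. bmult H (ket a) v) \<circ> (\<lambda>v. bmult H v w)"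
      by (rule lin_eqI[OF lin_comp[OF R L] lin_comp[OF L R]]) (simp add: 1 a)
    from fun_cong[OF this, of v] show ?thesis by simp
  qed
  have "(\<lambda>u. bmult H u w) \<circ> (\<lambda>u. bmult H u v) = (\<lambda>u. bmult H u (bmult H v w))"
    by (rule lin_eqI[OF lin_comp[OF L L] L]) (simp add: 2)
  from fun_cong[OF this, of u] show ?thesis by simp
qed

lemma bmult_unt:
  assumes "u \<in> coords (basis H)"
  shows "bmult H (unt H) u = u" "bmult H u (unt H) = u"
proof -
  have 1: "(\<lambda>u. bmult H (unt H) u) = id_map (basis H)"
    by (rule lin_eqI[OF bmult_lin(2) id_map_lin[OF fin]]) (simp add: unit_ket id_map_eq ket_coords fin)
  have 2: "(\<lambda>u. bmult H u (unt H)) = id_map (basis H)"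
    by (rule lin_eqI[OF bmult_lin(1) id_map_lin[OF fin]]) (simp add: unit_ket id_map_eq ket_coords fin)
  show "bmult H (unt H) u = u" "bmult H u (unt H) = u"
    using fun_cong[OF 1, of u] fun_cong[OF 2, of u] assms fin by (simp_all add: id_map_eq)
qed

lemma tensor_mult_pure:
  "tensor_mult H (\<lambda>(x, y). u x * u' y) (\<lambda>(x, y). v x * v' y) = (\<lambda>(x, y). bmult H u v x * bmult H u' v' y)"
proof (rule ext, unfold split_paired_all)
  fix z w
  have "tensor_mult H (\<lambda>(x, y). u x * u' y) (\<lambda>(x, y). v x * v' y) (z, w) =
    (\<Sum>x\<in>basis H. \<Sum>y\<in>basis H. \<Sum>x'\<in>basis H. \<Sum>y'\<in>basis H.
      (u x * v x' * prd H x x' z) * (u' y * v' y' * prd H y y' w))"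
    by (simp add: tensor_mult_def sum.cartesian_product[symmetric] mult_ac)
  also have "\<dots> = (\<Sum>x\<in>basis H. \<Sum>x'\<in>basis H. \<Sum>y\<in>basis H. \<Sum>y'\<in>basis H.
      (u x * v x' * prd H x x' z) * (u' y * v' y' * prd H y y' w))"
    by (rule sum.cong[OF refl], rule sum.swap)
  also have "\<dots> = bmult H u v z * bmult H u' v' w"
    by (simp add: bmult_def sum_distrib_right) (simp add: sum_distrib_left)
  finally show "tensor_mult H (\<lambda>(x, y). u x * u' y) (\<lambda>(x, y). v x * v' y) (z, w) =
    (\<lambda>(x, y). bmult H u v x * bmult H u' v' y) (z, w)" by simp
qed

lemma ket_pair: "ket (x, y) = (\<lambda>(a, b). ket x a * (ket y b :: 'k))"
  by (auto simp: ket_def fun_eq_iff)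

lemma basis_tens_alg: "basis (tens_alg H) = basis H \<times> basis H" by (simp add: tens_alg_def)

lemma prd_tens_alg: "prd (tens_alg H) (x, y) (x', y') = (\<lambda>(z, w). prd H x x' z * prd H y y' w)"
  by (simp add: tens_alg_def)

text \<open>Associativity and units of H \<otimes> H come from those of H. For H = DG they are the
  laws of convolution for forms on the dual.\<close>

lemma based_alg_tens_alg: "based_alg (tens_alg H)"
proof
  show "finite (basis (tens_alg H))" using fin by (simp add: tens_alg_def)
  show "unt (tens_alg H) \<in> coords (basis (tens_alg H))"
    using unt_coords by (auto simp: tens_alg_def coords_def)
  show "prd (tens_alg H) x y \<in> coords (basis (tens_alg H))" if "x \<in> basis (tens_alg H)" "y \<in> basis (tens_alg H)" for x y
    using that prd_coords by (auto simp: tens_alg_def coords_def)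
  show "cop (tens_alg H) x \<in> coords (basis (tens_alg H) \<times> basis (tens_alg H))" for x
    by (auto simp: tens_alg_def coords_def)
  fix a b c assume "a \<in> basis (tens_alg H)" "b \<in> basis (tens_alg H)" "c \<in> basis (tens_alg H)"
  thus "bmult (tens_alg H) (prd (tens_alg H) a b) (ket c) = bmult (tens_alg H) (ket a) (prd (tens_alg H) b c)"
    by (cases a, cases b, cases c)
      (simp add: basis_tens_alg bmult_tens_alg prd_tens_alg ket_pair tensor_mult_pure assoc_ket)
next
  fix a assume "a \<in> basis (tens_alg H)"
  then obtain x y where a: "a = (x, y)" "x \<in> basis H" "y \<in> basis H" by (auto simp: tens_alg_def)
  have u: "unt (tens_alg H) = (\<lambda>(x, y). unt H x * unt H y)" by (simp add: tens_alg_def)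
  show "bmult (tens_alg H) (unt (tens_alg H)) (ket a) = ket a" "bmult (tens_alg H) (ket a) (unt (tens_alg H)) = ket a"
    using a by (simp_all add: bmult_tens_alg u ket_pair tensor_mult_pure unit_ket)
qed

lemma tensor_mult_lin:
  "(\<lambda>s. tensor_mult H s t) \<in> lin (basis H \<times> basis H) (basis H \<times> basis H)"
  "(\<lambda>t. tensor_mult H s t) \<in> lin (basis H \<times> basis H) (basis H \<times> basis H)"
proof -
  interpret T: based_alg "tens_alg H" by (rule based_alg_tens_alg)
  show "(\<lambda>s. tensor_mult H s t) \<in> lin (basis H \<times> basis H) (basis H \<times> basis H)"
    "(\<lambda>t. tensor_mult H s t) \<in> lin (basis H \<times> basis H) (basis H \<times> basis H)"
    using T.bmult_lin by (simp_all only: basis_tens_alg bmult_tens_alg)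
qed

lemma tensor_mult_coords: "tensor_mult H s t \<in> coords (basis H \<times> basis H)"
  using lin_coords[OF tensor_mult_lin(1)] .

lemma tensor_mult_assoc: "tensor_mult H (tensor_mult H r s) t = tensor_mult H r (tensor_mult H s t)"
proof -
  interpret T: based_alg "tens_alg H" by (rule based_alg_tens_alg)
  show ?thesis using T.bmult_assoc by (simp only: bmult_tens_alg)
qed

lemma tensor_mult_unt:
  assumes "s \<in> coords (basis H \<times> basis H)"
  shows "tensor_mult H (\<lambda>(x, y). unt H x * unt H y) s = s" "tensor_mult H s (\<lambda>(x, y). unt H x * unt H y) = s"
proof -
  interpret T: based_alg "tens_alg H" by (rule based_alg_tens_alg)
  have u: "unt (tens_alg H) = (\<lambda>(x, y). unt H x * unt H y)" by (simp add: tens_alg_def)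
  show "tensor_mult H (\<lambda>(x, y). unt H x * unt H y) s = s" "tensor_mult H s (\<lambda>(x, y). unt H x * unt H y) = s"
    using T.bmult_unt[of s] assms by (simp_all only: basis_tens_alg bmult_tens_alg u)
qed

lemma tensor_map_mult:
  assumes f: "f \<in> lin (basis H) (basis H)"
    and m: "\<And>u v. u \<in> coords (basis H) \<Longrightarrow> v \<in> coords (basis H) \<Longrightarrow> f (bmult H u v) = bmult H (f u) (f v)"
  shows "tensor_map (basis H) f f (tensor_mult H s t) =
    tensor_mult H (tensor_map (basis H) f f s) (tensor_map (basis H) f f t)"
proof -
  let ?B = "basis H \<times> basis H" and ?f = "tensor_map (basis H) f f"
  have fl: "?f \<in> lin ?B ?B"
    unfolding tensor_map_def using lin_coords[OF f] fin
    by (intro lin_ext_lin) (auto simp: coords_def)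
  have fk: "?f (ket p) = (\<lambda>(x, y). f (ket (fst p)) x * f (ket (snd p)) y)" for p
    by (cases p) (simp add: ket_pair tensor_map_pure[OF f])
  note kc = ket_coords[of _ "basis H"]
  have 1: "?f (tensor_mult H (ket p) t) = tensor_mult H (?f (ket p)) (?f t)" if p: "p \<in> ?B" for p t
  proof -
    have "?f \<circ> (\<lambda>t. tensor_mult H (ket p) t) = (\<lambda>t. tensor_mult H (?f (ket p)) t) \<circ> ?f"
    proof (rule lin_eqI[OF lin_comp[OF tensor_mult_lin(2) fl] lin_comp[OF fl tensor_mult_lin(2)]])
      fix q assume "q \<in> ?B"
      thus "(?f \<circ> tensor_mult H (ket p)) (ket q) = (tensor_mult H (?f (ket p)) \<circ> ?f) (ket q)"
        using p by (cases p, cases q) (simp add: fk, simp add: ket_pair tensor_mult_pure tensor_map_pure[OF f] m kc)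
    qed
    from fun_cong[OF this, of t] show ?thesis by simp
  qed
  have "?f \<circ> (\<lambda>s. tensor_mult H s t) = (\<lambda>s. tensor_mult H s (?f t)) \<circ> ?f"
    by (rule lin_eqI[OF lin_comp[OF tensor_mult_lin(1) fl] lin_comp[OF fl tensor_mult_lin(1)]]) (simp add: 1)
  from fun_cong[OF this, of s] show ?thesis by simp
qed

text \<open>For H = DG this is laziness of a functional on the dual; see
  \<open>Reg1L_iff\<close>.\<close>

definition central :: "('i \<Rightarrow> 'k) \<Rightarrow> bool" where
  "central \<eta> \<longleftrightarrow> \<eta> \<in> coords (basis H) \<and> (\<forall>v. bmult H \<eta> v = bmult H v \<eta>)"

lemma centralI:
  assumes "\<eta> \<in> coords (basis H)" "\<And>i. i \<in> basis H \<Longrightarrow> bmult H \<eta> (ket i) = bmult H (ket i) \<eta>"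
  shows "central \<eta>"
proof -
  have "(\<lambda>v. bmult H \<eta> v) = (\<lambda>v. bmult H v \<eta>)"
    by (rule lin_eqI[OF bmult_lin(2,1)]) (rule assms(2))
  thus ?thesis using assms(1) by (simp add: central_def fun_eq_iff)
qed

lemma central_square:
  assumes "central \<eta>"
  shows "tensor_mult H (\<lambda>(x, y). \<eta> x * \<eta> y) s = tensor_mult H s (\<lambda>(x, y). \<eta> x * \<eta> y)"
proof -
  have "(\<lambda>s. tensor_mult H (\<lambda>(x, y). \<eta> x * \<eta> y) s) = (\<lambda>s. tensor_mult H s (\<lambda>(x, y). \<eta> x * \<eta> y))"
  proof (rule lin_eqI[OF tensor_mult_lin(2,1)])
    fix p assume "p \<in> basis H \<times> basis H"
    show "tensor_mult H (\<lambda>(x, y). \<eta> x * \<eta> y) (ket p) = tensor_mult H (ket p) (\<lambda>(x, y). \<eta> x * \<eta> y)"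
      using assms by (cases p) (simp add: ket_pair tensor_mult_pure central_def)
  qed
  from fun_cong[OF this, of s] show ?thesis .
qed

lemma central_mult: "central \<eta> \<Longrightarrow> central \<theta> \<Longrightarrow> central (bmult H \<eta> \<theta>)"
  unfolding central_def using bmult_coords bmult_assoc by metis

lemma central_inverse:
  assumes "central \<eta>" "\<theta> \<in> coords (basis H)" "bmult H \<eta> \<theta> = unt H" "bmult H \<theta> \<eta> = unt H"
  shows "central \<theta>"
proof (rule centralI[OF assms(2)])
  fix i assume i: "i \<in> basis H"
  have "bmult H \<theta> (ket i) = bmult H \<theta> (bmult H (ket i) (bmult H \<eta> \<theta>))"
    using i by (simp add: assms(3) bmult_unt ket_coords)
  also have "\<dots> = bmult H \<theta> (bmult H (bmult H \<eta> (ket i)) \<theta>)"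
    using assms(1) by (simp add: bmult_assoc central_def)
  also have "\<dots> = bmult H (ket i) \<theta>"
    using assms(4) by (simp add: bmult_assoc[symmetric] bmult_unt bmult_coords ket_coords i)
  finally show "bmult H \<theta> (ket i) = bmult H (ket i) \<theta>" .
qed

end

section \<open>Lazy cocycles on the dual of the double\<close>

context fin_group
begin

lemma based_alg_DG: "based_alg (DD :: ('a \<times> 'a, 'k::field) bialg)"
proof
  fix a b c :: "'a \<times> 'a"
  assume "a \<in> basis (DD :: ('a \<times> 'a, 'k) bialg)" "b \<in> basis (DD :: ('a \<times> 'a, 'k) bialg)" "c \<in> basis (DD :: ('a \<times> 'a, 'k) bialg)"
  moreover obtain a1 a2 b1 b2 c1 c2 where "a = (a1, a2)" "b = (b1, b2)" "c = (c1, c2)" by (cases a, cases b, cases c)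
  ultimately have abc: "a = (a1, a2)" "b = (b1, b2)" "c = (c1, c2)"
    "a1 \<in> U" "a2 \<in> U" "b1 \<in> U" "b2 \<in> U" "c1 \<in> U" "c2 \<in> U" by auto
  have z: "bmult DD (\<lambda>_. 0) v = (\<lambda>_. 0 :: 'k)" "bmult DD v (\<lambda>_. 0) = (\<lambda>_. 0 :: 'k)" for v
    by (simp_all add: bmult_def)
  have k: "bmult DD (ket (x, y)) (ket (z, w)) = (prd DD (x, y) (z, w) :: _ \<Rightarrow> 'k)"
    if "x \<in> U" "y \<in> U" "z \<in> U" "w \<in> U" for x y z w
    using that by (intro DG.bmult_ket) auto
  show "bmult DD (prd DD a b) (ket c) = (bmult DD (ket a) (prd DD b c) :: _ \<Rightarrow> 'k)"
    using abc by (auto simp: prd_DG z k m_assoc cj_cj[symmetric])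
next
  fix a :: "'a \<times> 'a"
  assume "a \<in> basis (DD :: ('a \<times> 'a, 'k) bialg)"
  then obtain x y where a: "a = (x, y)" "x \<in> U" "y \<in> U" by auto
  show "bmult DD (unt DD) (ket a) = (ket a :: _ \<Rightarrow> 'k)"
  proof (rule ext, unfold split_paired_all)
    fix u z
    have "(\<Sum>w\<in>U. unt DD (u, w) * ket a (cj (inv w) u, inv w \<otimes> z)) =
      (\<Sum>w\<in>U. ket \<one> w * ket a (cj (inv w) u, inv w \<otimes> z) :: 'k)" if "u \<in> U"
      using that by (intro sum.cong) (auto simp: unt_DG ket_def)
    thus "bmult DD (unt DD) (ket a) (u, z) = (ket a (u, z) :: 'k)"
      using a by (auto simp: bmult_DG sum_ket, auto simp: ket_def)
  qed
  show "bmult DD (ket a) (unt DD) = (ket a :: _ \<Rightarrow> 'k)"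
  proof (rule ext, unfold split_paired_all)
    fix u z
    have "(\<Sum>w\<in>U. ket a (u, w) * unt DD (cj (inv w) u, inv w \<otimes> z)) =
      (\<Sum>w\<in>U. ket z w * ket a (u, w) :: 'k)" if uz: "u \<in> U" "z \<in> U"
    proof (intro sum.cong refl)
      fix w assume w: "w \<in> U"
      have "inv w \<otimes> z = \<one> \<longleftrightarrow> w = z" using w uz by (metis inv_cancel(2) l_inv r_one)
      thus "ket a (u, w) * unt DD (cj (inv w) u, inv w \<otimes> z) = (ket z w * ket a (u, w) :: 'k)"
        using w uz by (simp add: unt_DG ket_def)
    qed
    thus "bmult DD (ket a) (unt DD) (u, z) = (ket a (u, z) :: 'k)"
      using a by (auto simp: bmult_DG sum_ket, auto simp: ket_def)
  qed
qed

sublocale DG: based_alg "DG G :: ('a \<times> 'a, 'k::field) bialg" by (rule based_alg_DG)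

section \<open>Convolution on the dual as multiplication in the double\<close>

lemma basis_DGd [simp]: "basis DDd = B" by (simp add: DGd_def)

text \<open>The coproduct of x \<times> e_z has one term for each factorisation of z, and a
  factorisation is determined by its first factor y.\<close>

lemma sum_cop_DGd:
  assumes x: "x \<in> U" and z: "z \<in> U"
  shows "(\<Sum>(a, b)\<in>B \<times> B. cop DDd (x, z) (a, b) * f a b) =
    (\<Sum>y\<in>U. f (x, y) (cj (inv y) x, inv y \<otimes> z) :: 'k::field)"
proof -
  let ?h = "\<lambda>y. ((x, y), (cj (inv y) x, inv y \<otimes> z))"
  have "(\<Sum>(a, b)\<in>B \<times> B. cop DDd (x, z) (a, b) * f a b) =
    (\<Sum>(a, b)\<in>?h ` U. cop DDd (x, z) (a, b) * f a b)"
  proof (rule sum.mono_neutral_right)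
    show "\<forall>i\<in>B \<times> B - ?h ` U. (case i of (a, b) \<Rightarrow> cop DDd (x, z) (a, b) * f a b) = 0"
    proof
      fix i assume i: "i \<in> B \<times> B - ?h ` U"
      obtain x1 y1 x2 y2 where e: "i = ((x1, y1), (x2, y2))" by (cases i) auto
      have "\<not> (y1 \<otimes> y2 = z \<and> x1 = x \<and> x2 = cj (inv y1) x)"
      proof
        assume "y1 \<otimes> y2 = z \<and> x1 = x \<and> x2 = cj (inv y1) x"
        hence "i = ?h y1" using i e by auto
        thus False using i e by auto
      qed
      thus "(case i of (a, b) \<Rightarrow> cop DDd (x, z) (a, b) * f a b) = 0"
        using i e by (auto simp: DGd_def cj_eq')
    qed
  qed (use x z in auto)
  also have "\<dots> = (\<Sum>y\<in>U. f (x, y) (cj (inv y) x, inv y \<otimes> z))"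
    by (subst sum.reindex) (use x z in \<open>auto simp: inj_on_def DGd_def cj_eq' intro!: sum.cong\<close>)
  finally show ?thesis .
qed

text \<open>The common value of convolution of forms on the dual and of multiplication in DG
  \<otimes> DG; see \<open>conv2_DGd\<close> and \<open>tensor_mult_DG\<close>.\<close>

definition star :: "(('a \<times> 'a) \<times> ('a \<times> 'a) \<Rightarrow> 'k::field) \<Rightarrow> (('a \<times> 'a) \<times> ('a \<times> 'a) \<Rightarrow> 'k) \<Rightarrow> ('a \<times> 'a) \<times> ('a \<times> 'a) \<Rightarrow> 'k" where
  "star \<sigma> \<tau> = (\<lambda>((x, z), (x', z')). if x \<in> U \<and> z \<in> U \<and> x' \<in> U \<and> z' \<in> U
     then \<Sum>y\<in>U. \<Sum>y'\<in>U. \<sigma> ((x, y), (x', y')) * \<tau> ((cj (inv y) x, inv y \<otimes> z), (cj (inv y') x', inv y' \<otimes> z'))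
     else 0)"

lemma conv2_DGd: "conv2 DDd \<sigma> \<tau> = (star \<sigma> \<tau> :: _ \<Rightarrow> 'k::field)"
proof (rule ext, unfold split_paired_all)
  fix x z x' z'
  have "(\<Sum>(a1, a2)\<in>B \<times> B. \<Sum>(b1, b2)\<in>B \<times> B.
      cop DDd (x, z) (a1, a2) * cop DDd (x', z') (b1, b2) * \<sigma> (a1, b1) * \<tau> (a2, b2)) =
    (\<Sum>y\<in>U. \<Sum>y'\<in>U. \<sigma> ((x, y), (x', y')) * \<tau> ((cj (inv y) x, inv y \<otimes> z), (cj (inv y') x', inv y' \<otimes> z')))"
    if m: "x \<in> U" "z \<in> U" "x' \<in> U" "z' \<in> U"
  proof -
    have "(\<Sum>(a1, a2)\<in>B \<times> B. \<Sum>(b1, b2)\<in>B \<times> B.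
        cop DDd (x, z) (a1, a2) * cop DDd (x', z') (b1, b2) * \<sigma> (a1, b1) * \<tau> (a2, b2)) =
      (\<Sum>(a1, a2)\<in>B \<times> B. cop DDd (x, z) (a1, a2) * (\<Sum>(b1, b2)\<in>B \<times> B.
        cop DDd (x', z') (b1, b2) * (\<sigma> (a1, b1) * \<tau> (a2, b2))))"
      by (simp add: case_prod_unfold sum_distrib_left mult.assoc)
    thus ?thesis by (simp only: sum_cop_DGd m)
  qed
  thus "conv2 DDd \<sigma> \<tau> ((x, z), (x', z')) = star \<sigma> \<tau> ((x, z), (x', z'))"
    by (simp add: conv2_def star_def)
qed

lemma sum_B: "(\<Sum>p\<in>B. f p) = (\<Sum>a\<in>U. \<Sum>y\<in>U. f (a, y))"
  by (simp add: sum.cartesian_product)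

text \<open>Together with \<open>conv2_DGd\<close> this lends the associativity and the unit of DG
  \<otimes> DG to the convolution of forms.\<close>

lemma tensor_mult_DG: "tensor_mult DD \<sigma> \<tau> = (star \<sigma> \<tau> :: _ \<Rightarrow> 'k::field)"
proof (rule ext, unfold split_paired_all)
  fix x z x' z'
  show "tensor_mult DD \<sigma> \<tau> ((x, z), (x', z')) = star \<sigma> \<tau> ((x, z), (x', z'))"
  proof (cases "x \<in> U \<and> z \<in> U \<and> x' \<in> U \<and> z' \<in> U")
    case False
    thus ?thesis using coordsD[OF DG.tensor_mult_coords[of \<sigma> \<tau>], of "((x, z), (x', z'))"]
      by (auto simp: star_def)
  next
    case True
    hence m: "x \<in> U" "z \<in> U" "x' \<in> U" "z' \<in> U" by auto
    let ?t = "\<lambda>y y'. \<tau> ((cj (inv y) x, inv y \<otimes> z), (cj (inv y') x', inv y' \<otimes> z'))"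
    have in1: "(\<Sum>q\<in>B. (\<Sum>q'\<in>B. \<tau> (q, q') * prd DD (a', y') q' (x', z')) * prd DD (a, y) q (x, z)) =
        ket x a * (ket x' a' * ?t y y')"
      if "a \<in> U" "y \<in> U" "a' \<in> U" "y' \<in> U" for a y a' y'
      using that m by (simp add: sum_prd_DG) (simp add: ket_def)
    have "tensor_mult DD \<sigma> \<tau> ((x, z), (x', z')) =
      (\<Sum>p\<in>B. \<Sum>p'\<in>B. \<sigma> (p, p') * (\<Sum>q\<in>B. (\<Sum>q'\<in>B. \<tau> (q, q') * prd DD p' q' (x', z')) * prd DD p q (x, z)))"
      unfolding tensor_mult_def basis_DG
      by (simp add: sum.cartesian_product[symmetric, where A = B and B = B] sum_distrib_left sum_distrib_right mult_ac del: sum.cartesian_product)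
    also have "\<dots> = (\<Sum>p\<in>B. \<Sum>p'\<in>B. \<sigma> (p, p') * (ket x (fst p) * (ket x' (fst p') * ?t (snd p) (snd p'))))"
      by (intro sum.cong refl) (auto simp: in1)
    also have "\<dots> = (\<Sum>a\<in>U. \<Sum>y\<in>U. \<Sum>a'\<in>U. \<Sum>y'\<in>U.
        \<sigma> ((a, y), (a', y')) * (ket x a * (ket x' a' * ?t y y')))"
      by (simp add: sum_B)
    also have "\<dots> = (\<Sum>a\<in>U. ket x a * (\<Sum>y\<in>U. \<Sum>a'\<in>U. ket x' a' * (\<Sum>y'\<in>U.
        \<sigma> ((a, y), (a', y')) * ?t y y')))"
      by (simp add: sum_distrib_left mult_ac)
    also have "\<dots> = star \<sigma> \<tau> ((x, z), (x', z'))"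
      using m by (simp add: sum_ket star_def)
    finally show ?thesis .
  qed
qed

lemma conv1_DGd: "conv1 DDd \<eta> \<theta> = (bmult DD \<eta> \<theta> :: _ \<Rightarrow> 'k::field)"
proof (rule ext, unfold split_paired_all)
  fix x z
  have "(\<Sum>(a1, a2)\<in>B \<times> B. cop DDd (x, z) (a1, a2) * \<eta> a1 * \<theta> a2) =
     (\<Sum>y\<in>U. \<eta> (x, y) * \<theta> (cj (inv y) x, inv y \<otimes> z))" if "x \<in> U" "z \<in> U"
    using sum_cop_DGd[OF that, of "\<lambda>a b. \<eta> a * \<theta> b"] by (simp add: mult.assoc)
  thus "conv1 DDd \<eta> \<theta> (x, z) = bmult DD \<eta> \<theta> (x, z)" by (simp add: conv1_def bmult_DG)
qed

lemma eps1_DGd: "eps1 DDd = (unt DD :: _ \<Rightarrow> 'k::field)"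
  by (rule ext, unfold split_paired_all) (auto simp: eps1_def unt_DG, auto simp: DGd_def)

lemma eps2_DGd: "eps2 DDd = (\<lambda>(x, y). unt DD x * (unt DD y :: 'k::field))"
  by (simp add: eps2_def eps1_DGd)

lemma bcomult_DG: "bcomult DD \<theta> = (\<lambda>((x, z), (x', z')).
    if x \<in> U \<and> z \<in> U \<and> x' \<in> U \<and> z' = z then \<theta> (x \<otimes> x', z) else (0 :: 'k::field))"
proof (rule ext, unfold split_paired_all)
  fix x z x' z'
  have "bcomult DD \<theta> ((x, z), (x', z')) = (\<Sum>p\<in>B. ket (x \<otimes> x', z) p *
      (if x \<in> U \<and> z \<in> U \<and> x' \<in> U \<and> z' = z then \<theta> (x \<otimes> x', z) else 0))"
    unfolding bcomult_def basis_DG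
    by (intro sum.cong refl) (auto simp: cop_DG ket_def split: if_splits)
  also have "\<dots> = (if x \<in> U \<and> z \<in> U \<and> x' \<in> U \<and> z' = z then \<theta> (x \<otimes> x', z) else 0)"
    by (cases "x \<in> U \<and> z \<in> U \<and> x' \<in> U \<and> z' = z") (subst sum_ket(1), auto)
  finally show "bcomult DD \<theta> ((x, z), (x', z')) = (\<lambda>((x, z), (x', z')).
    if x \<in> U \<and> z \<in> U \<and> x' \<in> U \<and> z' = z then \<theta> (x \<otimes> x', z) else 0) ((x, z), (x', z'))" by simp
qed

text \<open>A coproduct has equal group labels in both factors, so the double sum reduces to a
  product at x x'. The identity lets \<Delta>(\<eta>) cancel \<Delta>(\<theta>) when \<theta>
  inverts \<eta>.\<close>

lemma bcomult_mult: "bcomult DD (bmult DD \<eta> \<theta>) = (star (bcomult DD \<eta>) (bcomult DD \<theta>) :: _ \<Rightarrow> 'k::field)"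
proof (rule ext, unfold split_paired_all)
  fix x z x' z'
  show "bcomult DD (bmult DD \<eta> \<theta>) ((x, z), (x', z')) = star (bcomult DD \<eta>) (bcomult DD \<theta>) ((x, z), (x', z'))"
  proof (cases "x \<in> U \<and> z \<in> U \<and> x' \<in> U \<and> z' \<in> U")
    case False
    thus ?thesis by (auto simp: bcomult_DG star_def)
  next
    case True
    hence m: "x \<in> U" "z \<in> U" "x' \<in> U" "z' \<in> U" by auto
    have "star (bcomult DD \<eta>) (bcomult DD \<theta>) ((x, z), (x', z')) =
      (\<Sum>y\<in>U. \<Sum>y'\<in>U. ket y y' *
        (if z' = z then \<eta> (x \<otimes> x', y) * \<theta> (cj (inv y) (x \<otimes> x'), inv y \<otimes> z) else 0))"
      using m unfolding star_def
      by (simp, intro sum.cong refl) (auto simp: bcomult_DG ket_def cj_mult)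
    also have "\<dots> = (\<Sum>y\<in>U. if z' = z then \<eta> (x \<otimes> x', y) * \<theta> (cj (inv y) (x \<otimes> x'), inv y \<otimes> z) else 0)"
      by (intro sum.cong refl) (simp add: sum_ket)
    also have "\<dots> = bcomult DD (bmult DD \<eta> \<theta>) ((x, z), (x', z'))"
      using m by (simp add: bcomult_DG bmult_DG)
    finally show ?thesis by simp
  qed
qed

lemma bcomult_unt: "bcomult DD (unt DD) = (\<lambda>(x, y). unt DD x * (unt DD y :: 'k::field))"
  by (rule ext, unfold split_paired_all) (auto simp: bcomult_DG unt_DG)

lemma conv_inverse_iff: "conv_inverse DDd \<eta> \<theta> \<longleftrightarrow>
    \<theta> \<in> coords B \<and> bmult DD \<eta> \<theta> = unt DD \<and> bmult DD \<theta> \<eta> = (unt DD :: _ \<Rightarrow> 'k::field)"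
  by (simp add: conv_inverse_def conv1_DGd eps1_DGd)

text \<open>Associativity makes a two-sided inverse unique, which resolves the description inside
  \<open>lazy_coboundary\<close>.\<close>

lemma the_conv_inverse:
  assumes "conv_inverse DDd \<eta> (\<theta> :: _ \<Rightarrow> 'k::field)" "\<eta> \<in> coords B"
  shows "(THE \<theta>. conv_inverse DDd \<eta> \<theta>) = \<theta>"
proof (rule the_equality)
  show "conv_inverse DDd \<eta> \<theta>" by (rule assms(1))
  fix \<theta>' :: "_ \<Rightarrow> 'k" assume "conv_inverse DDd \<eta> \<theta>'"
  thus "\<theta>' = \<theta>" using assms unfolding conv_inverse_iff
    by (metis DG.bmult_assoc DG.bmult_unt basis_DG)
qed

text \<open>The two sides of the laziness equation are coefficients of the products of \<eta> with a
  basis vector, from the left and from the right.\<close>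

lemma Reg1L_iff:
  "\<eta> \<in> Reg1L DDd \<longleftrightarrow> DG.central \<eta> \<and> (\<exists>\<theta>. conv_inverse DDd \<eta> \<theta>) \<and> bcounit DD \<eta> = (1 :: 'k::field)"
proof -
  have u: "(\<Sum>x\<in>B. unt DDd x * \<eta> x) = bcounit DD \<eta>"
    by (auto simp: bcounit_def DGd_def cou_DG intro!: sum.cong)
  have l: "(\<Sum>a1\<in>B. cop DDd a (a1, z) * \<eta> a1) = bmult DD \<eta> (ket z) a"
    "(\<Sum>a2\<in>B. cop DDd a (z, a2) * \<eta> a2) = bmult DD (ket z) \<eta> a" if az: "a \<in> B" "z \<in> B" for a z
  proof -
    have "bmult DD \<eta> (ket z) a = (\<Sum>a1\<in>B. \<Sum>a2\<in>B. ket z a2 * (cop DDd a (a1, a2) * \<eta> a1))"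
      unfolding conv1_DGd[symmetric] conv1_def using az by (simp add: sum.cartesian_product mult_ac)
    also have "\<dots> = (\<Sum>a1\<in>B. cop DDd a (a1, z) * \<eta> a1)"
      using az by (intro sum.cong refl, subst sum_ket(1)) auto
    finally show "(\<Sum>a1\<in>B. cop DDd a (a1, z) * \<eta> a1) = bmult DD \<eta> (ket z) a" ..
    have "bmult DD (ket z) \<eta> a = (\<Sum>a1\<in>B. ket z a1 * (\<Sum>a2\<in>B. cop DDd a (a1, a2) * \<eta> a2))"
      unfolding conv1_DGd[symmetric] conv1_def using az by (simp add: sum.cartesian_product[symmetric] sum_distrib_left mult_ac)
    also have "\<dots> = (\<Sum>a2\<in>B. cop DDd a (z, a2) * \<eta> a2)"
      using az by (subst sum_ket(1)) auto
    finally show "(\<Sum>a2\<in>B. cop DDd a (z, a2) * \<eta> a2) = bmult DD (ket z) \<eta> a" ..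
  qed
  have c: "DG.central \<eta> \<longleftrightarrow> \<eta> \<in> coords B \<and> (\<forall>a\<in>B. \<forall>z\<in>B. bmult DD \<eta> (ket z) a = bmult DD (ket z) \<eta> a)"
  proof
    assume R: "\<eta> \<in> coords B \<and> (\<forall>a\<in>B. \<forall>z\<in>B. bmult DD \<eta> (ket z) a = bmult DD (ket z) \<eta> a)"
    show "DG.central \<eta>"
    proof (rule DG.centralI)
      fix i :: "'a \<times> 'a" assume "i \<in> basis (DD :: ('a \<times> 'a, 'k) bialg)"
      hence i: "i \<in> B" by simp
      show "bmult DD \<eta> (ket i) = bmult DD (ket i) \<eta>"
      proof
        fix a show "bmult DD \<eta> (ket i) a = bmult DD (ket i) \<eta> a"
        proof (cases "a \<in> B")
          case False
          thus ?thesis using coordsD[OF DG.bmult_coords, unfolded basis_DG, OF False] by metis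
        qed (use R i in blast)
      qed
    qed (use R in simp)
  qed (simp add: DG.central_def)
  show ?thesis unfolding Reg1L_def basis_DGd c by (auto simp: l u)
qed

text \<open>Evaluating \<theta> on a product in the dual is the coproduct of \<theta> in DG; the
  coboundary is therefore (\<eta> \<otimes> \<eta>) \<Delta>(\<theta>).\<close>

lemma lazy_coboundary_eq:
  assumes "conv_inverse DDd \<eta> (\<theta> :: _ \<Rightarrow> 'k::field)" "\<eta> \<in> coords B"
  shows "lazy_coboundary DDd \<eta> = star (\<lambda>(x, y). \<eta> x * \<eta> y) (bcomult DD \<theta>)"
proof (rule ext, unfold split_paired_all)
  fix x z x' z'
  have p: "(\<Sum>q\<in>B. prd DDd (a, b) (a', b') q * \<theta> q) = bcomult DD \<theta> ((a, b), (a', b'))"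
    if "a \<in> U" "b \<in> U" "a' \<in> U" "b' \<in> U" for a b a' b'
  proof (cases "b = b'")
    case True
    hence "(\<Sum>q\<in>B. prd DDd (a, b) (a', b') q * \<theta> q) = (\<Sum>q\<in>B. ket (a \<otimes> a', b) q * \<theta> q)" by (simp add: DGd_def)
    also have "\<dots> = \<theta> (a \<otimes> a', b)" using that by (subst sum_ket(1)) auto
    finally show ?thesis using that True by (simp add: bcomult_DG)
  qed (auto simp: DGd_def bcomult_DG)
  have "(\<Sum>(a1, a2)\<in>B \<times> B. \<Sum>(b1, b2)\<in>B \<times> B.
      cop DDd (x, z) (a1, a2) * cop DDd (x', z') (b1, b2) * \<eta> a1 * \<eta> b1 * (\<Sum>q\<in>B. prd DDd a2 b2 q * \<theta> q)) =
    star (\<lambda>(x, y). \<eta> x * \<eta> y) (bcomult DD \<theta>) ((x, z), (x', z'))"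
    if m: "x \<in> U" "z \<in> U" "x' \<in> U" "z' \<in> U"
  proof -
    have "(\<Sum>(a1, a2)\<in>B \<times> B. \<Sum>(b1, b2)\<in>B \<times> B.
      cop DDd (x, z) (a1, a2) * cop DDd (x', z') (b1, b2) * \<eta> a1 * \<eta> b1 * (\<Sum>q\<in>B. prd DDd a2 b2 q * \<theta> q)) =
      (\<Sum>(a1, a2)\<in>B \<times> B. cop DDd (x, z) (a1, a2) * (\<Sum>(b1, b2)\<in>B \<times> B.
        cop DDd (x', z') (b1, b2) * (\<eta> a1 * \<eta> b1 * (\<Sum>q\<in>B. prd DDd a2 b2 q * \<theta> q))))"
      by (simp add: case_prod_unfold sum_distrib_left mult.assoc)
    also have "\<dots> = (\<Sum>y\<in>U. \<Sum>y'\<in>U. \<eta> (x, y) * \<eta> (x', y') *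
       (\<Sum>q\<in>B. prd DDd (cj (inv y) x, inv y \<otimes> z) (cj (inv y') x', inv y' \<otimes> z') q * \<theta> q))"
      by (simp only: sum_cop_DGd m)
    also have "\<dots> = star (\<lambda>(x, y). \<eta> x * \<eta> y) (bcomult DD \<theta>) ((x, z), (x', z'))"
      using m by (simp add: star_def p)
    finally show ?thesis .
  qed
  thus "lazy_coboundary DDd \<eta> ((x, z), (x', z')) = star (\<lambda>(x, y). \<eta> x * \<eta> y) (bcomult DD \<theta>) ((x, z), (x', z'))"
    unfolding lazy_coboundary_def the_conv_inverse[OF assms] by (simp add: star_def)
qed

end

section \<open>Invariant cocycles as lazy cocycles\<close>

lemma carrier_Z2: "\<beta> \<in> carrier (Z2 G) \<longleftrightarrow> \<beta> \<in> carrier G \<times> carrier G \<rightarrow>\<^sub>E UNIV - {0 :: 'k::field} \<and>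
    (\<forall>g\<in>carrier G. \<beta> (\<one>\<^bsub>G\<^esub>, g) = 1 \<and> \<beta> (g, \<one>\<^bsub>G\<^esub>) = 1) \<and>
    (\<forall>g\<in>carrier G. \<forall>h\<in>carrier G. \<forall>t\<in>carrier G.
       \<beta> (g, h) * \<beta> (g \<otimes>\<^bsub>G\<^esub> h, t) = \<beta> (h, t) * \<beta> (g, h \<otimes>\<^bsub>G\<^esub> t))"
  by (simp add: Z2_def)

context fin_group
begin

abbreviation Zi :: "('a \<times> 'a \<Rightarrow> 'k::field) set" where "Zi \<equiv> carrier (Z2inv G)"

lemma Z2invD:
  assumes "\<beta> \<in> Zi"
  shows "\<beta> \<in> extensional B"
    "\<And>g h. g \<in> U \<Longrightarrow> h \<in> U \<Longrightarrow> \<beta> (g, h) \<noteq> (0 :: 'k::field)"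
    "\<And>g. g \<in> U \<Longrightarrow> \<beta> (\<one>, g) = 1" "\<And>g. g \<in> U \<Longrightarrow> \<beta> (g, \<one>) = 1"
    "\<And>g h t. g \<in> U \<Longrightarrow> h \<in> U \<Longrightarrow> t \<in> U \<Longrightarrow>
      \<beta> (g, h) * \<beta> (g \<otimes> h, t) = \<beta> (h, t) * \<beta> (g, h \<otimes> t)"
    "\<And>g h t. g \<in> U \<Longrightarrow> h \<in> U \<Longrightarrow> t \<in> U \<Longrightarrow> \<beta> (cj t g, cj t h) = \<beta> (g, h)"
proof -
  have b: "\<beta> \<in> carrier (Z2 G)" and i: "\<And>g h t. g \<in> U \<Longrightarrow> h \<in> U \<Longrightarrow> t \<in> U \<Longrightarrow>
      \<beta> (inv t \<otimes> g \<otimes> t, inv t \<otimes> h \<otimes> t) = \<beta> (g, h)"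
    using assms by (auto simp: Z2inv_def)
  show "\<beta> \<in> extensional B" using b by (auto simp: carrier_Z2 PiE_def)
  show "\<beta> (g, h) \<noteq> 0" if "g \<in> U" "h \<in> U" for g h
    using b that unfolding carrier_Z2 by blast
  show "\<beta> (\<one>, g) = 1" "\<beta> (g, \<one>) = 1" if "g \<in> U" for g using b that by (auto simp: carrier_Z2)
  show "\<beta> (g, h) * \<beta> (g \<otimes> h, t) = \<beta> (h, t) * \<beta> (g, h \<otimes> t)"
    if "g \<in> U" "h \<in> U" "t \<in> U" for g h t using b that by (simp add: carrier_Z2)
  show "\<beta> (cj t g, cj t h) = \<beta> (g, h)" if "g \<in> U" "h \<in> U" "t \<in> U" for g h t
    using i[of g h "inv t"] that by (simp add: conj_by_def)
qed

lemma Z2invI: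
  assumes "\<beta> \<in> extensional B"
    "\<And>g h. g \<in> U \<Longrightarrow> h \<in> U \<Longrightarrow> \<beta> (g, h) \<noteq> (0 :: 'k::field)"
    "\<And>g. g \<in> U \<Longrightarrow> \<beta> (\<one>, g) = 1" "\<And>g. g \<in> U \<Longrightarrow> \<beta> (g, \<one>) = 1"
    "\<And>g h t. g \<in> U \<Longrightarrow> h \<in> U \<Longrightarrow> t \<in> U \<Longrightarrow>
      \<beta> (g, h) * \<beta> (g \<otimes> h, t) = \<beta> (h, t) * \<beta> (g, h \<otimes> t)"
    "\<And>g h t. g \<in> U \<Longrightarrow> h \<in> U \<Longrightarrow> t \<in> U \<Longrightarrow> \<beta> (cj t g, cj t h) = \<beta> (g, h)"
  shows "\<beta> \<in> Zi"
proof -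
  have "\<beta> \<in> carrier (Z2 G)" unfolding carrier_Z2 using assms by (auto simp: PiE_def)
  moreover have "\<beta> (inv t \<otimes> g \<otimes> t, inv t \<otimes> h \<otimes> t) = \<beta> (g, h)"
    if "g \<in> U" "h \<in> U" "t \<in> U" for g h t
    using that assms(6)[of g h "inv t"] by (simp add: cj_eq')
  ultimately show ?thesis by (simp add: Z2inv_def)
qed

lemma Z2inv_simps [simp]:
  "\<beta> \<otimes>\<^bsub>Z2inv G\<^esub> \<gamma> = restrict (\<lambda>p. \<beta> p * (\<gamma> p :: 'k::field)) B" "\<one>\<^bsub>Z2inv G\<^esub> = restrict (\<lambda>p. 1 :: 'k) B"
  by (simp_all add: Z2inv_def Z2_def)

lemma Z2inv_mult:
  assumes "\<beta> \<in> Zi" "\<gamma> \<in> Zi"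
  shows "restrict (\<lambda>p. \<beta> p * (\<gamma> p :: 'k::field)) B \<in> Zi"
proof -
  note b = Z2invD[OF assms(1)] and c = Z2invD[OF assms(2)]
  show ?thesis
  proof (rule Z2invI)
    fix g h t assume m: "g \<in> U" "h \<in> U" "t \<in> U"
    have "(\<beta> (g, h) * \<beta> (g \<otimes> h, t)) * (\<gamma> (g, h) * \<gamma> (g \<otimes> h, t)) = (\<beta> (h, t) * \<beta> (g, h \<otimes> t)) * (\<gamma> (h, t) * \<gamma> (g, h \<otimes> t))"
      using b(5)[OF m] c(5)[OF m] by simp
    thus "restrict (\<lambda>p. \<beta> p * \<gamma> p) B (g, h) * restrict (\<lambda>p. \<beta> p * \<gamma> p) B (g \<otimes> h, t) =
      restrict (\<lambda>p. \<beta> p * \<gamma> p) B (h, t) * restrict (\<lambda>p. \<beta> p * \<gamma> p) B (g, h \<otimes> t)"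
      using m by (simp add: mult_ac)
  qed (use b c in auto)
qed

lemma Z2inv_inverse:
  assumes "\<beta> \<in> Zi"
  shows "restrict (\<lambda>p. inverse (\<beta> p :: 'k::field)) B \<in> Zi"
proof -
  note b = Z2invD[OF assms]
  show ?thesis
  proof (rule Z2invI)
    fix g h t assume m: "g \<in> U" "h \<in> U" "t \<in> U"
    have "inverse (\<beta> (g, h) * \<beta> (g \<otimes> h, t)) = inverse (\<beta> (h, t) * \<beta> (g, h \<otimes> t))"
      using b(5)[OF m] by simp
    thus "restrict (\<lambda>p. inverse (\<beta> p)) B (g, h) * restrict (\<lambda>p. inverse (\<beta> p)) B (g \<otimes> h, t) =
      restrict (\<lambda>p. inverse (\<beta> p)) B (h, t) * restrict (\<lambda>p. inverse (\<beta> p)) B (g, h \<otimes> t)"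
      using m by simp
  qed (use b in auto)
qed

lemma Z2inv_one: "restrict (\<lambda>p. 1 :: 'k::field) B \<in> Zi"
  by (rule Z2invI) auto

lemma form_apply:
  assumes "g \<in> U" "x \<in> U" "h \<in> U" "y \<in> U"
  shows "form \<beta> ((g, x), (h, y)) = (ket \<one> x * ket \<one> y * \<beta> (g, h) :: 'k::field)"
  using assms by (simp add: form_of_def kfun_def ket_def)

lemma form_coords: "form \<beta> \<in> coords (B \<times> B)"
  by (auto simp: form_of_def coords_def)

lemma form_eqI:
  assumes "\<sigma> \<in> coords (B \<times> B)" "\<And>x z x' z'. x \<in> U \<Longrightarrow> z \<in> U \<Longrightarrow> x' \<in> U \<Longrightarrow> z' \<in> U \<Longrightarrow>
     \<sigma> ((x, z), (x', z')) = (\<tau> ((x, z), (x', z')) :: 'k::field)" "\<tau> \<in> coords (B \<times> B)"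
  shows "\<sigma> = \<tau>"
proof (rule ext, unfold split_paired_all)
  fix x z x' z' show "\<sigma> ((x, z), (x', z')) = \<tau> ((x, z), (x', z'))"
    using assms(2) coordsD[OF assms(1), of "((x, z), (x', z'))"] coordsD[OF assms(3), of "((x, z), (x', z'))"]
    by (cases "x \<in> U \<and> z \<in> U \<and> x' \<in> U \<and> z' \<in> U") auto
qed

lemma form_inj:
  assumes "form \<beta> = (form \<gamma> :: _ \<Rightarrow> 'k::field)" "g \<in> U" "h \<in> U"
  shows "\<beta> (g, h) = \<gamma> (g, h)"
  using fun_cong[OF assms(1), of "((g, \<one>), (h, \<one>))"] assms(2,3) by (simp add: form_apply ket_def)

lemma form_cong:
  assumes "\<And>g h. g \<in> U \<Longrightarrow> h \<in> U \<Longrightarrow> \<beta> (g, h) = (\<gamma> (g, h) :: 'k::field)"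
  shows "form \<beta> = form \<gamma>"
  by (rule form_eqI[OF form_coords _ form_coords]) (simp add: form_apply assms)

lemma star_coords: "star \<sigma> \<tau> \<in> coords (B \<times> B)"
  by (auto simp: star_def coords_def)

lemma star_form_left:
  assumes m: "x \<in> U" "z \<in> U" "x' \<in> U" "z' \<in> U"
  shows "star (form \<beta>) \<tau> ((x, z), (x', z')) = \<beta> (x, x') * (\<tau> ((x, z), (x', z')) :: 'k::field)"
proof -
  have "star (form \<beta>) \<tau> ((x, z), (x', z')) = (\<Sum>y\<in>U. ket \<one> y * (\<Sum>y'\<in>U. ket \<one> y' *
     (\<beta> (x, x') * \<tau> ((cj (inv y) x, inv y \<otimes> z), (cj (inv y') x', inv y' \<otimes> z')))))"
    using m by (simp add: star_def form_apply sum_distrib_left mult_ac)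
  thus ?thesis using m by (simp add: sum_ket)
qed

text \<open>On the right of \<sigma> the arguments of \<beta> are conjugated by the two group labels
  of \<sigma>; on the left, in \<open>star_form_left\<close>, they are not. The difference measures
  the failure to commute.\<close>

lemma star_form_right:
  assumes m: "x \<in> U" "z \<in> U" "x' \<in> U" "z' \<in> U"
  shows "star \<sigma> (form \<beta>) ((x, z), (x', z')) = \<sigma> ((x, z), (x', z')) * (\<beta> (cj (inv z) x, cj (inv z') x') :: 'k::field)"
proof -
  have k: "ket \<one> (inv y \<otimes> z) = (ket z y :: 'k)" if "y \<in> U" "z \<in> U" for y z
  proof -
    have "inv y \<otimes> z = \<one> \<longleftrightarrow> y = z" using that by (metis inv_cancel(2) l_inv r_one)
    thus ?thesis by (simp add: ket_def)
  qed
  have "star \<sigma> (form \<beta>) ((x, z), (x', z')) = (\<Sum>y\<in>U. ket z y * (\<Sum>y'\<in>U. ket z' y' *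
     (\<sigma> ((x, y), (x', y')) * \<beta> (cj (inv y) x, cj (inv y') x'))))"
    using m by (simp add: star_def form_apply k sum_distrib_left mult_ac)
  thus ?thesis using m by (simp add: sum_ket)
qed

lemma star_form: "star (form \<beta>) (form \<gamma>) = form (\<lambda>p. \<beta> p * (\<gamma> p :: 'k::field))"
  by (rule form_eqI[OF star_coords _ form_coords]) (simp add: star_form_left form_apply mult_ac)

lemma eps2_form: "eps2 DDd = form (\<lambda>p. 1 :: 'k::field)"
  by (rule form_eqI[OF _ _ form_coords]) (auto simp: eps2_DGd form_apply unt_DG ket_def coords_def)

lemma star_eps2:
  assumes "\<sigma> \<in> coords (B \<times> B)"
  shows "star (eps2 DDd) \<sigma> = \<sigma>" "star \<sigma> (eps2 DDd) = (\<sigma> :: _ \<Rightarrow> 'k::field)"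
  using DG.tensor_mult_unt[of \<sigma>] assms by (simp_all add: eps2_DGd tensor_mult_DG)

lemma star_assoc: "star (star \<rho> \<sigma>) \<tau> = star \<rho> (star \<sigma> (\<tau> :: _ \<Rightarrow> 'k::field))"
  using DG.tensor_mult_assoc by (simp add: tensor_mult_DG)

text \<open>The two group labels of a coproduct agree, so the arguments of \<beta> are conjugated
  simultaneously, and invariance applies.\<close>

lemma form_lazy:
  assumes "\<beta> \<in> Zi"
  shows "star (form \<beta>) (bcomult DD \<theta>) = (star (bcomult DD \<theta>) (form \<beta>) :: _ \<Rightarrow> 'k::field)"
  by (rule form_eqI[OF star_coords _ star_coords])
    (auto simp: star_form_left star_form_right bcomult_DG Z2invD(6)[OF assms])

lemma form_at_ket:
  assumes "p \<in> B" "q \<in> B" shows "form_at DDd \<sigma> (ket p) (ket q) = (\<sigma> (p, q) :: 'k::field)"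
proof -
  have "form_at DDd \<sigma> (ket p) (ket q) = (\<Sum>x\<in>B. ket p x * (\<Sum>y\<in>B. ket q y * \<sigma> (x, y)))"
    unfolding form_at_def by (simp add: sum.cartesian_product[symmetric, where A = B and B = B] sum_distrib_left mult.assoc del: sum.cartesian_product)
  thus ?thesis using assms by (simp add: sum_ket)
qed

text \<open>Convolution with \<beta> multiplies by scalars, so the cocycle condition reduces to that
  of \<beta> and laziness to its invariance.\<close>

lemma form_Z2L:
  assumes \<beta>: "\<beta> \<in> Zi"
  shows "form \<beta> \<in> carrier (Z2L DDd :: (_ \<Rightarrow> 'k::field) monoid)"
proof -
  note b = Z2invD[OF \<beta>]
  let ?f = "form \<beta> :: _ \<Rightarrow> 'k"
  let ?g = "form (\<lambda>p. inverse (\<beta> p)) :: _ \<Rightarrow> 'k"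
  have inv: "conv2 DDd ?f ?g = eps2 DDd" "conv2 DDd ?g ?f = eps2 DDd"
    unfolding conv2_DGd star_form eps2_form using b(2) by (auto intro!: form_cong)
  have prd: "prd DDd (x, y) (x', y') = (if y = y' then ket (x \<otimes> x', y) else (\<lambda>_. 0 :: 'k))" for x y x' y'
    by (simp add: DGd_def)
  have fa0: "form_at DDd \<sigma> (\<lambda>_. 0) v = 0" "form_at DDd \<sigma> v (\<lambda>_. 0) = 0" for \<sigma> :: "_ \<Rightarrow> 'k" and v
    by (simp_all add: form_at_def)
  have unit: "form_at DDd ?f (unt DDd) (ket p) = cou DDd p \<and> form_at DDd ?f (ket p) (unt DDd) = cou DDd p"
    if "p \<in> B" for p
  proof -
    obtain x y where p: "p = (x, y)" "x \<in> U" "y \<in> U" using \<open>p \<in> B\<close> by auto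
    have u: "unt DDd (a, w) = (if w \<in> U then ket \<one> a else (0 :: 'k))" for a w by (auto simp: DGd_def ket_def)
    have "form_at DDd ?f (unt DDd) (ket p) = (\<Sum>q\<in>B. unt DDd q * (\<Sum>r\<in>B. ket p r * ?f (q, r)))"
      unfolding form_at_def by (simp add: sum.cartesian_product[symmetric, where A = B and B = B] sum_distrib_left mult.assoc del: sum.cartesian_product)
    also have "\<dots> = (\<Sum>q\<in>B. unt DDd q * ?f (q, p))" using \<open>p \<in> B\<close> by (simp add: sum_ket)
    also have "\<dots> = (\<Sum>a\<in>U. ket \<one> a * (\<Sum>w\<in>U. ket \<one> w * (ket \<one> y * \<beta> (a, x))))"
      using p by (simp add: sum_B u form_apply sum_distrib_left mult_ac)
    also have "\<dots> = cou DDd p" using p b by (simp add: sum_ket, simp add: ket_def DGd_def)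
    finally have 1: "form_at DDd ?f (unt DDd) (ket p) = cou DDd p" .
    have "form_at DDd ?f (ket p) (unt DDd) = (\<Sum>r\<in>B. ket p r * (\<Sum>q\<in>B. unt DDd q * ?f (r, q)))"
      unfolding form_at_def by (simp add: sum.cartesian_product[symmetric, where A = B and B = B] sum_distrib_left mult.assoc del: sum.cartesian_product)
    also have "\<dots> = (\<Sum>q\<in>B. unt DDd q * ?f (p, q))" using \<open>p \<in> B\<close> by (simp add: sum_ket)
    also have "\<dots> = (\<Sum>a\<in>U. ket \<one> a * (\<Sum>w\<in>U. ket \<one> w * (ket \<one> y * \<beta> (x, a))))"
      using p by (simp add: sum_B u form_apply sum_distrib_left mult_ac)
    also have "\<dots> = cou DDd p" using p b by (simp add: sum_ket, simp add: ket_def DGd_def)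
    finally show ?thesis using 1 by simp
  qed
  \<comment> \<open>The nested coproduct sums in the cocycle and laziness conditions are
    convolutions of F with H, also where one of the two is a coefficient of a product.\<close>
  have nest: "(\<Sum>(a1, a2)\<in>B \<times> B. \<Sum>(b1, b2)\<in>B \<times> B. cop DDd (x, z) (a1, a2) * cop DDd (x', z') (b1, b2) * F a1 b1 * H a2 b2) =
      star (\<lambda>(a, b). F a b) (\<lambda>(a, b). H a b) ((x, z), (x', z'))"
    if m: "x \<in> U" "z \<in> U" "x' \<in> U" "z' \<in> U" for F H :: "_ \<Rightarrow> _ \<Rightarrow> 'k" and x z x' z'
    using fun_cong[OF conv2_DGd[of "\<lambda>(a, b). F a b" "\<lambda>(a, b). H a b"], of "((x, z), (x', z'))"] m by (simp add: conv2_def)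
  have co: "(\<Sum>(a1, a2)\<in>B \<times> B. \<Sum>(b1, b2)\<in>B \<times> B.
           cop DDd a (a1, a2) * cop DDd b (b1, b2) * ?f (a1, b1) * form_at DDd ?f (prd DDd a2 b2) (ket c))
      = (\<Sum>(b1, b2)\<in>B \<times> B. \<Sum>(c1, c2)\<in>B \<times> B.
           cop DDd b (b1, b2) * cop DDd c (c1, c2) * ?f (b1, c1) * form_at DDd ?f (ket a) (prd DDd b2 c2))"
    if "a \<in> B" "b \<in> B" "c \<in> B" for a b c
  proof -
    obtain x y x' y' u w where abc: "a = (x, y)" "b = (x', y')" "c = (u, w)" by (cases a, cases b, cases c)
    have m: "x \<in> U" "y \<in> U" "x' \<in> U" "y' \<in> U" "u \<in> U" "w \<in> U"
      using that abc by auto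
    have 1: "form_at DDd ?f (prd DDd a b) (ket c) = ket y y' * (ket \<one> y * ket \<one> w * \<beta> (x \<otimes> x', u))"
      using m by (simp add: abc prd fa0 form_at_ket form_apply) (simp add: ket_def)
    have 2: "form_at DDd ?f (ket a) (prd DDd b c) = ket y' w * (ket \<one> y * ket \<one> y' * \<beta> (x, x' \<otimes> u))"
      using m by (simp add: abc prd fa0 form_at_ket form_apply) (simp add: ket_def)
    \<comment> \<open>The Kronecker factors force all three function labels to be \<one>, leaving
      the group cocycle identity.\<close>
    have "\<beta> (x, x') * (ket y y' * (ket \<one> y * ket \<one> w * \<beta> (x \<otimes> x', u))) =
      \<beta> (x', u) * (ket y' w * (ket \<one> y * ket \<one> y' * \<beta> (x, x' \<otimes> u)))"
      using b(5)[of x x' u] m by (simp add: ket_def)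
    thus ?thesis using m unfolding abc
      by (simp only: nest nest[of x' y' u w] case_prod_eta star_form_left case_prod_conv 1[unfolded abc] 2[unfolded abc])
  qed
  have lz: "(\<Sum>(a1, a2)\<in>B \<times> B. \<Sum>(b1, b2)\<in>B \<times> B.
        cop DDd a (a1, a2) * cop DDd b (b1, b2) * ?f (a1, b1) * prd DDd a2 b2 c)
   = (\<Sum>(a1, a2)\<in>B \<times> B. \<Sum>(b1, b2)\<in>B \<times> B.
        cop DDd a (a1, a2) * cop DDd b (b1, b2) * prd DDd a1 b1 c * ?f (a2, b2))"
    if "a \<in> B" "b \<in> B" for a b c
  proof -
    obtain x y x' y' where ab: "a = (x, y)" "b = (x', y')" by (cases a, cases b)
    have m: "x \<in> U" "y \<in> U" "x' \<in> U" "y' \<in> U"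
      using that ab by auto
    have "\<beta> (x, x') * prd DDd (x, y) (x', y') c = prd DDd (x, y) (x', y') c * \<beta> (cj (inv y) x, cj (inv y') x')"
      using b(6) m by (simp add: prd)
    thus ?thesis using m unfolding ab
      by (simp only: nest case_prod_eta star_form_left star_form_right case_prod_conv)
  qed
  have "cocycle2 DDd ?f"
    unfolding cocycle2_def basis_DGd using form_coords[of \<beta>] form_coords[of "\<lambda>p. inverse (\<beta> p)"] inv unit co by blast
  moreover have "lazy2 DDd ?f" unfolding lazy2_def basis_DGd using lz by blast
  ultimately show ?thesis by (simp add: Z2L_def)
qed

text \<open>The form is supported on function label \<one> of the dual basis, where c is 1, and the
  conjugation is absorbed by invariance. Consequently these automorphisms act trivially on invariant
  cocycles.\<close>

lemma tensor_map_form: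
  assumes "g \<in> U" "bichar G c" "\<beta> \<in> Zi"
  shows "tensor_map B (dg_aut g c) (dg_aut g c) (form \<beta>) = (form \<beta> :: _ \<Rightarrow> 'k::field)"
proof -
  interpret M: monomial B "\<lambda>(x, y). c y x :: 'k" "\<lambda>(x, y). (cj g x, cj g y)" by (rule monomial_dg[OF assms(1,2)])
  show ?thesis
  proof (rule form_eqI[OF _ _ form_coords])
    show "tensor_map B (dg_aut g c) (dg_aut g c) (form \<beta>) \<in> coords (B \<times> B)"
      unfolding dg_aut_def coords_def using M.tensor_mono_off by auto
    fix x z x' z' assume m: "x \<in> U" "z \<in> U" "x' \<in> U" "z' \<in> U"
    define a y a' y' where d: "a = cj (inv g) x" "y = cj (inv g) z" "a' = cj (inv g) x'" "y' = cj (inv g) z'"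
    have e: "x = cj g a" "z = cj g y" "x' = cj g a'" "z' = cj g y'" and dm: "a \<in> U" "y \<in> U" "a' \<in> U" "y' \<in> U"
      using m assms(1) by (simp_all add: d)
    have "tensor_map B (dg_aut g c) (dg_aut g c) (form \<beta>) ((cj g a, cj g y), (cj g a', cj g y')) =
      c y a * c y' a' * form \<beta> ((a, y), (a', y'))"
      using M.tensor_mono[of "(a, y)" "(a', y')" "form \<beta>"] dm by (simp add: dg_aut_def)
    also have "\<dots> = form \<beta> ((cj g a, cj g y), (cj g a', cj g y'))"
      using dm assms(1) by (simp add: form_apply Z2invD(6)[OF assms(3)]) (auto simp: ket_def bichar_one[OF assms(2)])
    finally show "tensor_map B (dg_aut g c) (dg_aut g c) (form \<beta>) ((x, z), (x', z')) = form \<beta> ((x, z), (x', z'))"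
      by (simp only: e)
  qed
qed

section \<open>Lazy coboundaries\<close>

lemma B2L_iff:
  "\<tau> \<in> B2L DDd \<longleftrightarrow> (\<exists>\<eta> \<theta>. DG.central \<eta> \<and> bcounit DD \<eta> = 1 \<and> conv_inverse DDd \<eta> \<theta> \<and>
     \<tau> = star (\<lambda>(x, y). \<eta> x * \<eta> y) (bcomult DD \<theta> :: _ \<Rightarrow> 'k::field))"
proof -
  have c: "\<eta> \<in> coords B" if "DG.central \<eta>" for \<eta> :: "_ \<Rightarrow> 'k" using that by (simp add: DG.central_def)
  show ?thesis unfolding B2L_def image_iff Bex_def Reg1L_iff
    using lazy_coboundary_eq c by metis
qed

lemma star_pure: "star (\<lambda>(x, y). u x * u' y) (\<lambda>(x, y). v x * v' y) =
    (\<lambda>(x, y). bmult DD u v x * (bmult DD u' v' y :: 'k::field))"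
  using DG.tensor_mult_pure by (simp add: tensor_mult_DG)

lemma central_star: "DG.central \<eta> \<Longrightarrow> star (\<lambda>(x, y). \<eta> x * \<eta> y) \<sigma> = star \<sigma> (\<lambda>(x, y). \<eta> x * (\<eta> y :: 'k::field))"
  using DG.central_square by (simp add: tensor_mult_DG)

lemma bcounit_DG: "bcounit DD \<eta> = (\<Sum>w\<in>U. \<eta> (\<one>, w) :: 'k::field)"
proof -
  have "bcounit DD \<eta> = (\<Sum>a\<in>U. ket \<one> a * (\<Sum>w\<in>U. \<eta> (a, w)))"
    by (simp add: bcounit_def sum_B sum_distrib_left cou_DG) (simp add: ket_def mult.commute)
  thus ?thesis by (simp add: sum_ket)
qed

lemma bcounit_mult: "DG.central \<eta> \<Longrightarrow> bcounit DD (bmult DD \<eta> \<theta>) = bcounit DD \<eta> * (bcounit DD \<theta> :: 'k::field)"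
proof -
  have "bcounit DD (bmult DD \<eta> \<theta>) = (\<Sum>w\<in>U. \<Sum>y\<in>U. \<eta> (\<one>, y) * \<theta> (\<one>, inv y \<otimes> w))"
    by (simp add: bcounit_DG bmult_DG)
  also have "\<dots> = (\<Sum>y\<in>U. \<Sum>w\<in>U. \<eta> (\<one>, y) * \<theta> (\<one>, inv y \<otimes> w))" by (rule sum.swap)
  also have "\<dots> = (\<Sum>y\<in>U. \<eta> (\<one>, y) * (\<Sum>w\<in>U. \<theta> (\<one>, w)))"
  proof (intro sum.cong refl)
    fix y assume y: "y \<in> U"
    have "(\<Sum>w\<in>U. \<theta> (\<one>, inv y \<otimes> w)) = (\<Sum>w\<in>U. \<theta> (\<one>, w))"
      by (rule sum.reindex_bij_witness[where i = "\<lambda>w. y \<otimes> w" and j = "\<lambda>w. inv y \<otimes> w"]) (use y in auto)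
    thus "(\<Sum>w\<in>U. \<eta> (\<one>, y) * \<theta> (\<one>, inv y \<otimes> w)) = \<eta> (\<one>, y) * (\<Sum>w\<in>U. \<theta> (\<one>, w))"
      by (simp flip: sum_distrib_left)
  qed
  also have "\<dots> = bcounit DD \<eta> * bcounit DD \<theta>" by (simp add: bcounit_DG sum_distrib_right)
  finally show ?thesis .
qed

lemma bcounit_unt: "bcounit DD (unt DD) = (1 :: 'k::field)"
  by (simp add: bcounit_DG unt_DG)

lemma central_unt: "DG.central (unt DD :: _ \<Rightarrow> 'k::field)"
  by (rule DG.centralI[OF DG.unt_coords]) (simp add: DG.unit_ket)

text \<open>The inverse is (\<theta> \<otimes> \<theta>) \<Delta>(\<eta>): the central squares can
  be moved next to each other, after which squares and coproducts cancel separately.\<close>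

lemma B2L_inverse:
  assumes "\<tau> \<in> B2L DDd"
  obtains \<tau>' where "\<tau>' \<in> B2L DDd" "star \<tau> \<tau>' = eps2 DDd" "star \<tau>' \<tau> = (eps2 DDd :: _ \<Rightarrow> 'k::field)"
proof -
  obtain \<eta> \<theta> where e: "DG.central \<eta>" "bcounit DD \<eta> = 1" "conv_inverse DDd \<eta> \<theta>"
    "\<tau> = star (\<lambda>(x, y). \<eta> x * \<eta> y) (bcomult DD \<theta>)" using assms unfolding B2L_iff by blast
  have t: "\<theta> \<in> coords B" "bmult DD \<eta> \<theta> = unt DD" "bmult DD \<theta> \<eta> = unt DD"
    using e(3) by (auto simp: conv_inverse_iff)
  have ct: "DG.central \<theta>" using DG.central_inverse[OF e(1) _ t(2,3)] t(1) by simp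
  have "bcounit DD \<theta> = 1" using bcounit_mult[OF e(1), of \<theta>] by (simp add: e(2) t(2) bcounit_unt)
  moreover have "conv_inverse DDd \<theta> \<eta>" using e(1) t by (auto simp: conv_inverse_iff DG.central_def)
  ultimately have 1: "star (\<lambda>(x, y). \<theta> x * \<theta> y) (bcomult DD \<eta>) \<in> B2L DDd"
    unfolding B2L_iff using ct by blast
  have aux: "star (star (\<lambda>(x, y). a x * a y) (bcomult DD b)) (star (\<lambda>(x, y). b x * b y) (bcomult DD a)) = eps2 DDd"
    if "DG.central b" "bmult DD a b = unt DD" "bmult DD b a = unt DD" for a b :: "_ \<Rightarrow> 'k"
  proof -
    have "star (star (\<lambda>(x, y). a x * a y) (bcomult DD b)) (star (\<lambda>(x, y). b x * b y) (bcomult DD a)) =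
      star (\<lambda>(x, y). a x * a y) (star (star (bcomult DD b) (\<lambda>(x, y). b x * b y)) (bcomult DD a))"
      by (simp add: star_assoc)
    also have "star (bcomult DD b) (\<lambda>(x, y). b x * b y) = star (\<lambda>(x, y). b x * b y) (bcomult DD b)"
      by (rule central_star[OF that(1), symmetric])
    also have "star (\<lambda>(x, y). a x * a y) (star (star (\<lambda>(x, y). b x * b y) (bcomult DD b)) (bcomult DD a)) =
      star (star (\<lambda>(x, y). a x * a y) (\<lambda>(x, y). b x * b y)) (star (bcomult DD b) (bcomult DD a))"
      by (simp add: star_assoc)
    also have "\<dots> = eps2 DDd"
      using star_eps2(1)[of "eps2 DDd"] form_coords[of "\<lambda>p. 1 :: 'k"]
      by (simp add: star_pure bcomult_mult[symmetric] that bcomult_unt eps2_DGd[symmetric] eps2_form)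
    finally show ?thesis .
  qed
  show ?thesis using that[OF 1] aux[OF ct t(2,3)] aux[OF e(1) t(3,2)] e(4) by simp
qed

lemma B2L_eps2: "eps2 DDd \<in> (B2L DDd :: (_ \<Rightarrow> 'k::field) set)"
proof -
  have "conv_inverse DDd (unt DD) (unt DD :: _ \<Rightarrow> 'k)"
    using DG.unt_coords DG.bmult_unt[OF DG.unt_coords] by (simp add: conv_inverse_iff)
  moreover have "eps2 DDd = star (\<lambda>(x, y). unt DD x * unt DD y) (bcomult DD (unt DD) :: _ \<Rightarrow> 'k)"
    using star_eps2(1)[of "eps2 DDd :: _ \<Rightarrow> 'k"] form_coords[of "\<lambda>p. 1 :: 'k"]
    by (simp add: bcomult_unt eps2_DGd[symmetric] eps2_form)
  ultimately show ?thesis unfolding B2L_iff using central_unt bcounit_unt by blast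
qed

text \<open>Centrality collects both squares on the left and both coproducts on the right, giving
  the coboundary of \<eta> \<eta>'.\<close>

lemma B2L_mult:
  assumes "\<tau> \<in> B2L DDd" "\<tau>' \<in> B2L DDd"
  shows "star \<tau> \<tau>' \<in> (B2L DDd :: (_ \<Rightarrow> 'k::field) set)"
proof -
  obtain \<eta> \<theta> where e: "DG.central \<eta>" "bcounit DD \<eta> = 1" "conv_inverse DDd \<eta> \<theta>"
    "\<tau> = star (\<lambda>(x, y). \<eta> x * \<eta> y) (bcomult DD \<theta>)" using assms unfolding B2L_iff by blast
  obtain \<eta>' \<theta>' where e': "DG.central \<eta>'" "bcounit DD \<eta>' = 1" "conv_inverse DDd \<eta>' \<theta>'"
    "\<tau>' = star (\<lambda>(x, y). \<eta>' x * \<eta>' y) (bcomult DD \<theta>')" using assms unfolding B2L_iff by blast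
  have t: "\<theta> \<in> coords B" "bmult DD \<eta> \<theta> = unt DD" "bmult DD \<theta> \<eta> = unt DD"
    and t': "\<theta>' \<in> coords B" "bmult DD \<eta>' \<theta>' = unt DD" "bmult DD \<theta>' \<eta>' = unt DD"
    using e(3) e'(3) by (auto simp: conv_inverse_iff)
  have "star \<tau> \<tau>' = star (\<lambda>(x, y). \<eta> x * \<eta> y) (star (star (bcomult DD \<theta>) (\<lambda>(x, y). \<eta>' x * \<eta>' y)) (bcomult DD \<theta>'))"
    by (simp add: e(4) e'(4) star_assoc)
  also have "star (bcomult DD \<theta>) (\<lambda>(x, y). \<eta>' x * \<eta>' y) = star (\<lambda>(x, y). \<eta>' x * \<eta>' y) (bcomult DD \<theta>)"
    by (rule central_star[OF e'(1), symmetric])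
  also have "star (\<lambda>(x, y). \<eta> x * \<eta> y) (star (star (\<lambda>(x, y). \<eta>' x * \<eta>' y) (bcomult DD \<theta>)) (bcomult DD \<theta>')) =
    star (star (\<lambda>(x, y). \<eta> x * \<eta> y) (\<lambda>(x, y). \<eta>' x * \<eta>' y)) (star (bcomult DD \<theta>) (bcomult DD \<theta>'))"
    by (simp add: star_assoc)
  also have "\<dots> = star (\<lambda>(x, y). bmult DD \<eta> \<eta>' x * bmult DD \<eta> \<eta>' y) (bcomult DD (bmult DD \<theta> \<theta>'))"
    by (simp add: star_pure bcomult_mult)
  finally have eq: "star \<tau> \<tau>' = star (\<lambda>(x, y). bmult DD \<eta> \<eta>' x * bmult DD \<eta> \<eta>' y) (bcomult DD (bmult DD \<theta> \<theta>'))" .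
  have c: "bmult DD \<eta> v = bmult DD v \<eta>" "bmult DD \<eta>' v = bmult DD v \<eta>'" for v
    using e(1) e'(1) by (auto simp: DG.central_def)
  have ec: "\<eta> \<in> coords B" "\<eta>' \<in> coords B" using e(1) e'(1) by (auto simp: DG.central_def)
  have "bmult DD (bmult DD \<eta> \<eta>') (bmult DD \<theta> \<theta>') = bmult DD \<eta> (bmult DD (bmult DD \<eta>' \<theta>) \<theta>')"
    by (simp add: DG.bmult_assoc)
  also have "\<dots> = bmult DD (bmult DD \<eta> \<theta>) (bmult DD \<eta>' \<theta>')"
    unfolding c(2)[of \<theta>] by (simp add: DG.bmult_assoc)
  also have "\<dots> = unt DD" using DG.bmult_unt[OF DG.unt_coords] by (simp add: t t')
  finally have i1: "bmult DD (bmult DD \<eta> \<eta>') (bmult DD \<theta> \<theta>') = unt DD" .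
  have "bmult DD (bmult DD \<theta> \<theta>') (bmult DD \<eta> \<eta>') = unt DD"
    using DG.central_mult[OF e(1) e'(1)] i1 by (simp add: DG.central_def)
  hence "conv_inverse DDd (bmult DD \<eta> \<eta>') (bmult DD \<theta> \<theta>')"
    using i1 DG.bmult_coords by (simp add: conv_inverse_iff)
  moreover have "bcounit DD (bmult DD \<eta> \<eta>') = 1" using bcounit_mult[OF e(1)] e(2) e'(2) by simp
  ultimately show ?thesis unfolding B2L_iff using DG.central_mult[OF e(1) e'(1)] eq by blast
qed

text \<open>In a coboundary, \<eta> \<otimes> \<eta> is central, and \<Delta>(\<theta>) commutes
  with \<beta> by laziness.\<close>

lemma B2L_form_comm:
  assumes "\<tau> \<in> B2L DDd" "\<beta> \<in> Zi"
  shows "star \<tau> (form \<beta>) = star (form \<beta>) (\<tau> :: _ \<Rightarrow> 'k::field)"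
proof -
  obtain \<eta> \<theta> where e: "DG.central \<eta>" "\<tau> = star (\<lambda>(x, y). \<eta> x * \<eta> y) (bcomult DD \<theta>)"
    using assms unfolding B2L_iff by blast
  have "star \<tau> (form \<beta>) = star (\<lambda>(x, y). \<eta> x * \<eta> y) (star (form \<beta>) (bcomult DD \<theta>))"
    unfolding e(2) star_assoc form_lazy[OF assms(2)] ..
  also have "\<dots> = star (star (\<lambda>(x, y). \<eta> x * \<eta> y) (form \<beta>)) (bcomult DD \<theta>)"
    by (simp add: star_assoc)
  also have "\<dots> = star (form \<beta>) \<tau>" by (subst central_star[OF e(1)]) (simp add: e(2) star_assoc)
  finally show ?thesis .
qed

text \<open>A Hopf automorphism carries (\<eta> \<otimes> \<eta>) \<Delta>(\<theta>) to the same
  expression in \<psi> \<eta> and \<psi> \<theta>; surjectivity of \<psi> keeps the image of \<eta>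
  central.\<close>

lemma B2L_Aut:
  assumes "\<tau> \<in> B2L DDd" "\<psi> \<in> carrier AutD"
  shows "tensor_map B \<psi> \<psi> \<tau> \<in> (B2L DDd :: (_ \<Rightarrow> 'k::field) set)"
proof -
  obtain \<eta> \<theta> where e: "DG.central \<eta>" "bcounit DD \<eta> = 1" "conv_inverse DDd \<eta> \<theta>"
    "\<tau> = star (\<lambda>(x, y). \<eta> x * \<eta> y) (bcomult DD \<theta>)" using assms unfolding B2L_iff by blast
  have t: "\<theta> \<in> coords B" "bmult DD \<eta> \<theta> = unt DD" "bmult DD \<theta> \<eta> = unt DD"
    using e(3) by (auto simp: conv_inverse_iff)
  have ec: "\<eta> \<in> coords B" using e(1) by (simp add: DG.central_def)
  have p: "\<psi> \<in> lin B B" "\<psi> (unt DD) = unt DD"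
    "\<And>u v. u \<in> coords B \<Longrightarrow> v \<in> coords B \<Longrightarrow> \<psi> (bmult DD u v) = bmult DD (\<psi> u) (\<psi> v)"
    "\<And>u. u \<in> coords B \<Longrightarrow> bcounit DD (\<psi> u) = bcounit DD u"
    "\<And>u. u \<in> coords B \<Longrightarrow> bcomult DD (\<psi> u) = tensor_map B \<psi> \<psi> (bcomult DD u)"
    and bij: "bij_betw \<psi> (coords B) (coords B)"
    using assms(2) by (auto simp: DG.Aut_Hopf_carrier hopf_map_def)
  have pc: "\<psi> u \<in> coords B" for u using lin_coords[OF p(1)] .
  have "tensor_map B \<psi> \<psi> \<tau> = star (tensor_map B \<psi> \<psi> (\<lambda>(x, y). \<eta> x * \<eta> y)) (tensor_map B \<psi> \<psi> (bcomult DD \<theta>))"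
    using DG.tensor_map_mult[of \<psi>] p(1,3) by (simp add: e(4) tensor_mult_DG)
  hence eq: "tensor_map B \<psi> \<psi> \<tau> = star (\<lambda>(x, y). \<psi> \<eta> x * \<psi> \<eta> y) (bcomult DD (\<psi> \<theta>))"
    by (simp add: tensor_map_pure[OF p(1)] p(5) t(1))
  have "DG.central (\<psi> \<eta>)"
  proof (rule DG.centralI)
    fix i :: "'a \<times> 'a" assume "i \<in> basis (DD :: ('a \<times> 'a, 'k) bialg)"
    hence "ket i \<in> coords B" by (auto intro: ket_coords)
    then obtain u where u: "u \<in> coords B" "ket i = \<psi> u" using bij by (auto simp: bij_betw_def)
    show "bmult DD (\<psi> \<eta>) (ket i) = bmult DD (ket i) (\<psi> \<eta>)"
      using e(1) by (simp add: u p(3)[symmetric] ec DG.central_def)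
  qed (simp add: pc)
  moreover have "conv_inverse DDd (\<psi> \<eta>) (\<psi> \<theta>)"
    using p(3)[OF ec t(1), symmetric] p(3)[OF t(1) ec, symmetric] by (simp add: conv_inverse_iff pc t p(2))
  ultimately show ?thesis unfolding B2L_iff using eq e(2) p(4)[OF ec] by metis
qed

text \<open>Multiplication by \<Delta>(\<eta>) gives \<beta> \<Delta>(\<eta>) = \<eta> \<otimes>
  \<eta>. At a fixed group label y this reads \<nu>(x) \<nu>(x') = \<beta>(x, x') \<nu>(x x') with
  \<nu>(x) = \<eta>(x, y), a trivialisation of \<beta>.\<close>

lemma form_B2L_imp_B2:
  assumes \<beta>: "\<beta> \<in> Zi" and "form \<beta> \<in> (B2L DDd :: (_ \<Rightarrow> 'k::field) set)"
  shows "\<beta> \<in> B2 G"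
proof -
  note b = Z2invD[OF \<beta>]
  obtain \<eta> \<theta> where e: "DG.central \<eta>" "bcounit DD \<eta> = 1" "conv_inverse DDd \<eta> \<theta>"
    "form \<beta> = star (\<lambda>(x, y). \<eta> x * \<eta> y) (bcomult DD \<theta>)" using assms(2) unfolding B2L_iff by blast
  have t: "bmult DD \<theta> \<eta> = unt DD" using e(3) by (auto simp: conv_inverse_iff)
  have ec: "\<eta> \<in> coords B" using e(1) by (simp add: DG.central_def)
  have "star (form \<beta>) (bcomult DD \<eta>) = star (\<lambda>(x, y). \<eta> x * \<eta> y) (eps2 DDd)"
    by (simp add: e(4) star_assoc bcomult_mult[symmetric] t bcomult_unt eps2_DGd)
  also have "\<dots> = (\<lambda>(x, y). \<eta> x * \<eta> y)"
    using ec by (intro star_eps2) (auto simp: coords_def)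
  finally have E: "star (form \<beta>) (bcomult DD \<eta>) = (\<lambda>(x, y). \<eta> x * \<eta> y)" .
  have m: "\<eta> (x, z) * \<eta> (x', z') = (if z' = z then \<beta> (x, x') * \<eta> (x \<otimes> x', z) else 0)"
    if "x \<in> U" "z \<in> U" "x' \<in> U" "z' \<in> U" for x z x' z'
    using fun_cong[OF E, of "((x, z), (x', z'))"] that
    by (cases "z' = z") (simp_all add: star_form_left bcomult_DG)
  have s1: "(\<Sum>w\<in>U. \<eta> (\<one>, w)) = 1" using e(2) by (simp add: bcounit_DG)
  then obtain y where y: "y \<in> U" "\<eta> (\<one>, y) \<noteq> 0" by (metis sum.neutral zero_neq_one)
  \<comment> \<open>The coefficient at \<one> is nonzero and idempotent, hence 1; this normalises
    \<nu> and makes it nowhere zero.\<close>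
  have y1: "\<eta> (\<one>, y) = 1" using m[of \<one> y \<one> y] y b(3)[of \<one>] by simp
  define \<nu> where "\<nu> = (\<lambda>x. \<eta> (x, y))"
  have nm: "\<nu> x * \<nu> x' = \<beta> (x, x') * \<nu> (x \<otimes> x')" if "x \<in> U" "x' \<in> U" for x x'
    using m[of x y x' y] that y by (simp add: \<nu>_def)
  have nz: "\<nu> x \<noteq> 0" if "x \<in> U" for x
    using nm[of x "inv x"] that b(2)[of x "inv x"] y1 by (auto simp: \<nu>_def)
  have "\<beta> = restrict (\<lambda>(g, h). \<nu> g * \<nu> h / \<nu> (g \<otimes> h)) B"
    using b(1) nm nz by (intro extensionalityI[of _ B]) (auto simp: field_simps)
  moreover have "\<nu> \<one> = 1" by (simp add: \<nu>_def y1)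
  ultimately show ?thesis unfolding B2_def using nz by blast
qed

text \<open>The witness \<eta> is the sum of all \<nu>(x) e_x \<times> 1, central because \<nu> is
  constant on conjugacy classes, with inverse built from 1/\<nu>.\<close>

lemma form_coboundary:
  assumes nz: "\<And>x. x \<in> U \<Longrightarrow> \<nu> x \<noteq> (0 :: 'k::field)" and n1: "\<nu> \<one> = 1"
    and cl: "\<And>x t. x \<in> U \<Longrightarrow> t \<in> U \<Longrightarrow> \<nu> (cj t x) = \<nu> x"
    and \<beta>: "\<And>g h. g \<in> U \<Longrightarrow> h \<in> U \<Longrightarrow> \<beta> (g, h) = \<nu> g * \<nu> h / \<nu> (g \<otimes> h)"
  shows "form \<beta> \<in> B2L DDd"
proof -
  define E where "E = (\<lambda>f :: 'a \<Rightarrow> 'k. \<lambda>(x, y). if x \<in> U \<and> y = \<one> then f x else 0)"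
  have Ek: "E f (x, y) = ket \<one> y * f x" if "x \<in> U" for f x y using that by (simp add: E_def ket_def)
  have Ec: "E f \<in> coords B" for f by (auto simp: E_def coords_def)
  have left: "bmult DD (E f) v (x, z) = f x * v (x, z)" if "x \<in> U" "z \<in> U" for f v x z
  proof -
    have "bmult DD (E f) v (x, z) = (\<Sum>y\<in>U. ket \<one> y * (f x * v (cj (inv y) x, inv y \<otimes> z)))"
      using that by (simp add: bmult_DG Ek mult.assoc)
    thus ?thesis using that by (simp add: sum_ket)
  qed
  have right: "bmult DD v (E f) (x, z) = v (x, z) * f (cj (inv z) x)" if "x \<in> U" "z \<in> U" for f v x z
  proof -
    have k: "ket \<one> (inv y \<otimes> z) = (ket z y :: 'k)" if "y \<in> U" for y
    proof -
      have "inv y \<otimes> z = \<one> \<longleftrightarrow> y = z" using that \<open>z \<in> U\<close> by (metis inv_cancel(2) l_inv r_one)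
      thus ?thesis by (simp add: ket_def)
    qed
    have "bmult DD v (E f) (x, z) = (\<Sum>y\<in>U. ket z y * (v (x, y) * f (cj (inv y) x)))"
      using that by (simp add: bmult_DG Ek k mult_ac)
    thus ?thesis using that by (simp add: sum_ket)
  qed
  have eqI: "u = v" if "u \<in> coords B" "v \<in> coords B" "\<And>x z. x \<in> U \<Longrightarrow> z \<in> U \<Longrightarrow> u (x, z) = v (x, z)" for u v :: "_ \<Rightarrow> 'k"
  proof (rule ext, unfold split_paired_all)
    fix x z show "u (x, z) = v (x, z)"
      using that coordsD[OF that(1), of "(x, z)"] coordsD[OF that(2), of "(x, z)"] by (cases "(x, z) \<in> B") auto
  qed
  note bc = DG.bmult_coords[unfolded basis_DG]
  have "DG.central (E \<nu>)"
    using Ec by (intro DG.centralI, simp, intro eqI bc) (simp add: left right cl mult.commute)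
  moreover have "bcounit DD (E \<nu>) = 1" using n1 by (simp add: bcounit_DG Ek sum_ket_one)
  moreover have "conv_inverse DDd (E \<nu>) (E (\<lambda>x. inverse (\<nu> x)))"
    unfolding conv_inverse_iff
    by (intro conjI Ec eqI bc DG.unt_coords[unfolded basis_DG]) (auto simp: left Ek unt_DG nz, auto simp: ket_def nz)
  moreover have "form \<beta> = star (\<lambda>(x, y). E \<nu> x * E \<nu> y) (bcomult DD (E (\<lambda>x. inverse (\<nu> x))))"
  proof -
    have eq: "(\<lambda>(x, y). E \<nu> x * E \<nu> y) = form (\<lambda>(x, y). \<nu> x * \<nu> y)"
      using Ec[of \<nu>] by (intro form_eqI[OF _ _ form_coords]) (auto simp: form_apply Ek coords_def)
    show ?thesis unfolding eq
      by (intro form_eqI[OF form_coords _ star_coords],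
          auto simp: star_form_left bcomult_DG form_apply Ek \<beta> divide_inverse,
          auto simp: ket_def split: if_splits)
  qed
  ultimately show ?thesis unfolding B2L_iff by blast
qed

end

section \<open>Bicharacters and the abelianisation\<close>

context fin_group
begin

abbreviation "N \<equiv> derived G U"

sublocale N: normal N G by (rule derived_self_is_normal)

lemma comm_group_Gab: "comm_group (Gab G)"
  unfolding Gab_def by (rule derived_quot_is_comm_group)

sublocale Gab: comm_group "Gab G" by (rule comm_group_Gab)

lemma carrier_Gab: "carrier (Gab G) = (\<lambda>g. N #> g) ` U"
  by (simp add: Gab_def carrier_FactGroup)

lemma Gab_mult: "g \<in> U \<Longrightarrow> h \<in> U \<Longrightarrow> (N #> g) \<otimes>\<^bsub>Gab G\<^esub> (N #> h) = N #> (g \<otimes> h)"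
  by (simp add: Gab_def N.rcos_sum)

lemma coset_Gab [simp]: "g \<in> U \<Longrightarrow> N #> g \<in> carrier (Gab G)"
  by (simp add: carrier_Gab)

lemma finite_Gab: "finite (carrier (Gab G))"
  by (simp add: carrier_Gab)

text \<open>The target is abelian, so all commutators lie in the kernel.\<close>

lemma hom_kstar_derived:
  assumes "\<chi> \<in> hom G (kstar :: 'k::field monoid)" "g \<in> U" "h \<in> U" "N #> g = N #> h"
  shows "\<chi> g = \<chi> h"
proof -
  interpret K: comm_group "kstar :: 'k monoid" by (rule comm_group_kstar)
  interpret X: group_hom G "kstar :: 'k monoid" \<chi> by unfold_locales (rule assms(1))
  note \<chi>h = hom_kstar[OF assms(1)]
  have "derived_set G U \<subseteq> kernel G kstar \<chi>"
  proof -
    have "inv\<^bsub>kstar\<^esub> x = inverse x" if "x \<noteq> 0" for x :: 'k using that by (intro K.inv_equality) auto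
    moreover have "a * b * inverse a * inverse b = 1" if "a \<noteq> 0" "b \<noteq> 0" for a b :: 'k using that by (simp add: field_simps)
    ultimately show ?thesis by (auto simp: kernel_def \<chi>h)
  qed
  hence ker: "N \<subseteq> kernel G kstar \<chi>"
    unfolding derived_def using generate_subgroup_incl X.subgroup_kernel by blast
  have "g \<in> N #> h" using assms(2,4) rcos_self[OF assms(2) derived_is_subgroup[OF subset_refl]] by simp
  then obtain n where "n \<in> N" "g = n \<otimes> h" by (auto simp: r_coset_def)
  thus ?thesis using ker assms(3) \<chi>h by (auto simp: kernel_def)
qed

lemma Hom_ab_iff: "b \<in> carrier (Hom_ab G) \<longleftrightarrow> bichar (Gab G) b \<and> b \<in> extensional (carrier (Gab G)) \<and>
    (\<forall>x\<in>carrier (Gab G). b x \<in> extensional (carrier (Gab G)))"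
  unfolding Hom_ab_def by (rule hom_dual_iff[OF Gab.is_group])

lemma bichar_ev: "b \<in> carrier (Hom_ab G) \<Longrightarrow> bichar G (ev G b)"
  by (auto simp: Hom_ab_iff bichar_def ev_def Gab_mult[symmetric])

lemma ev_mult: "g \<in> U \<Longrightarrow> h \<in> U \<Longrightarrow> ev G (b \<otimes>\<^bsub>Hom_ab G\<^esub> c) g h = ev G b g h * ev G c g h"
  by (simp add: ev_def Hom_ab_def hom_dual_mult)

lemma ev_inj:
  assumes "b \<in> carrier (Hom_ab G)" "c \<in> carrier (Hom_ab G)"
    "\<And>g h. g \<in> U \<Longrightarrow> h \<in> U \<Longrightarrow> ev G b g h = ev G c g h"
  shows "b = c"
  by (rule hom_dual_eqI[of _ "Gab G"]) (use assms in \<open>auto simp: Hom_ab_iff carrier_Gab ev_def\<close>)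

text \<open>A bicharacter is constant on cosets of the derived subgroup in each argument, so it can
  be evaluated on arbitrary coset representatives.\<close>

lemma ev_surj:
  assumes "bichar G c"
  obtains b where "b \<in> carrier (Hom_ab G)" "\<And>g h. g \<in> U \<Longrightarrow> h \<in> U \<Longrightarrow> ev G b g h = c g h"
proof -
  define r where "r = (\<lambda>X. SOME g. g \<in> U \<and> N #> g = X)"
  have r: "r (N #> g) \<in> U" "N #> r (N #> g) = N #> g" if "g \<in> U" for g
    using someI[of "\<lambda>h. h \<in> U \<and> N #> h = N #> g" g] that by (auto simp: r_def)
  define b where "b = restrict (\<lambda>X. restrict (\<lambda>Y. c (r X) (r Y)) (carrier (Gab G))) (carrier (Gab G))"
  have b: "b (N #> g) (N #> h) = c g h" if "g \<in> U" "h \<in> U" for g h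
  proof -
    have "c (r (N #> g)) (r (N #> h)) = c g (r (N #> h))"
      by (rule hom_kstar_derived[OF bichar_hom(2)[OF assms]]) (use that r in auto)
    also have "\<dots> = c g h" by (rule hom_kstar_derived[OF bichar_hom(1)[OF assms]]) (use that r in auto)
    finally show ?thesis using that by (simp add: b_def)
  qed
  have "bichar (Gab G) b"
    using assms unfolding bichar_def carrier_Gab by (auto simp: Gab_mult b)
  hence "b \<in> carrier (Hom_ab G)" by (auto simp: Hom_ab_iff b_def)
  thus ?thesis using that b by (simp add: ev_def)
qed

lemma comm_group_Hom_ab: "comm_group (Hom_ab G :: (_ \<Rightarrow> _ \<Rightarrow> 'k::field) monoid)"
  unfolding Hom_ab_def by (intro comm_group_hom_group comm_group_dual Gab.is_group)

lemma aut_of_eq: "aut_of G b = baut (ev G b)"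
  unfolding aut_of_def dg_aut_def mono_map_def by (rule lin_ext_cong) auto

text \<open>From here on elements of B are given by bicharacters on G itself, and the abelianisation
  is needed only where finite abelian groups are.\<close>

lemma Bsub_eq: "Bsub G = {baut c | c :: 'a \<Rightarrow> 'a \<Rightarrow> 'k::field. bichar G c}"
proof (intro equalityI subsetI)
  fix \<phi> assume "\<phi> \<in> {baut c | c :: 'a \<Rightarrow> 'a \<Rightarrow> 'k. bichar G c}"
  then obtain c :: "'a \<Rightarrow> 'a \<Rightarrow> 'k" where c: "bichar G c" "\<phi> = baut c" by blast
  obtain b where b: "b \<in> carrier (Hom_ab G)" "\<And>g h. g \<in> U \<Longrightarrow> h \<in> U \<Longrightarrow> ev G b g h = c g h"
    using ev_surj[OF c(1)] by blast
  have "\<phi> = aut_of G b" unfolding aut_of_eq c(2) by (rule dg_aut_cong) (simp_all add: b)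
  thus "\<phi> \<in> Bsub G" using b(1) by (auto simp: Bsub_def)
qed (auto simp: Bsub_def aut_of_eq bichar_ev)

lemma dg_aut_mult_one: "bichar G c \<Longrightarrow> bichar G d \<Longrightarrow> baut c \<circ> baut d = baut (\<lambda>x y. c x y * (d x y :: 'k::field))"
  using dg_aut_comp[of \<one> \<one> c d] by simp

lemma dg_aut_inverse_one:
  assumes "bichar G c" shows "baut c \<circ> baut (\<lambda>x y. inverse (c x y)) = (id_map B :: ('a \<times> 'a \<Rightarrow> 'k::field) \<Rightarrow> _)"
    "baut (\<lambda>x y. inverse (c x y)) \<circ> baut c = (id_map B :: ('a \<times> 'a \<Rightarrow> 'k::field) \<Rightarrow> _)"
  unfolding dg_aut_mult_one[OF assms bichar_inverse[OF assms]] dg_aut_mult_one[OF bichar_inverse[OF assms] assms] dg_aut_one[symmetric]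
  by (rule dg_aut_cong; use bicharD(1)[OF assms] in simp)+

lemma group_Aut: "group (AutD :: (('a \<times> 'a \<Rightarrow> 'k::field) \<Rightarrow> _) monoid)"
  by (rule DG.group_Aut_Hopf)

lemma inv_dg_aut:
  assumes "bichar G c"
  shows "inv\<^bsub>AutD\<^esub> (baut c) = baut (\<lambda>x y. inverse (c x y :: 'k::field))"
proof -
  interpret A: group "AutD :: (('a \<times> 'a \<Rightarrow> 'k) \<Rightarrow> _) monoid" by (rule group_Aut)
  show ?thesis
    by (rule A.inv_equality) (simp_all add: dg_aut_inverse_one[OF assms] dg_aut_Aut assms bichar_inverse[OF assms])
qed

lemma subgroup_Bsub: "subgroup (Bsub G) (AutD :: (('a \<times> 'a \<Rightarrow> 'k::field) \<Rightarrow> _) monoid)"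
proof -
  interpret A: group "AutD :: (('a \<times> 'a \<Rightarrow> 'k) \<Rightarrow> _) monoid" by (rule group_Aut)
  show ?thesis
  proof (rule A.subgroupI)
    show "Bsub G \<subseteq> carrier (AutD :: (('a \<times> 'a \<Rightarrow> 'k) \<Rightarrow> _) monoid)"
      unfolding Bsub_eq using dg_aut_Aut by blast
    show "Bsub G \<noteq> ({} :: (('a \<times> 'a \<Rightarrow> 'k) \<Rightarrow> _) set)" unfolding Bsub_eq using bichar_trivial by blast
    fix \<phi> :: "('a \<times> 'a \<Rightarrow> 'k) \<Rightarrow> _" assume "\<phi> \<in> Bsub G"
    then obtain c where c: "bichar G c" "\<phi> = baut c" unfolding Bsub_eq by blast
    show "inv\<^bsub>AutD\<^esub> \<phi> \<in> Bsub G" unfolding c(2) inv_dg_aut[OF c(1)] Bsub_eq using bichar_inverse[OF c(1)] by blast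
    fix \<psi> :: "('a \<times> 'a \<Rightarrow> 'k) \<Rightarrow> _" assume "\<psi> \<in> Bsub G"
    then obtain d where d: "bichar G d" "\<psi> = baut d" unfolding Bsub_eq by blast
    show "\<phi> \<otimes>\<^bsub>AutD\<^esub> \<psi> \<in> Bsub G"
      unfolding Bsub_eq using bichar_mult[OF c(1) d(1)] dg_aut_mult_one[OF c(1) d(1)] c d by auto
  qed
qed

lemma aut_of_mult:
  assumes "b \<in> carrier (Hom_ab G)" "c \<in> carrier (Hom_ab G)"
  shows "aut_of G (b \<otimes>\<^bsub>Hom_ab G\<^esub> c) = (aut_of G b \<circ> aut_of G c :: ('a \<times> 'a \<Rightarrow> 'k::field) \<Rightarrow> _)"
  unfolding aut_of_eq dg_aut_mult_one[OF assms[THEN bichar_ev]] by (rule dg_aut_cong) (simp_all add: ev_mult)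

lemma aut_of_inj: "inj_on (aut_of G) (carrier (Hom_ab G :: (_ \<Rightarrow> _ \<Rightarrow> 'k::field) monoid))"
proof (rule inj_onI)
  fix b c :: "'a set \<Rightarrow> 'a set \<Rightarrow> 'k"
  assume b: "b \<in> carrier (Hom_ab G)" and c: "c \<in> carrier (Hom_ab G)" and eq: "aut_of G b = aut_of G c"
  show "b = c"
    by (rule ev_inj[OF b c]) (use dg_aut_eq_iff(1)[OF bichar_ev[OF b] bichar_ev[OF c] one_closed one_closed] eq in \<open>simp add: aut_of_eq\<close>)
qed

lemma aut_of_iso:
  "aut_of G \<in> iso (Hom_ab G) ((AutD :: (('a \<times> 'a \<Rightarrow> 'k::field) \<Rightarrow> _) monoid)\<lparr>carrier := Bsub G\<rparr>)"
  using aut_of_inj by (auto simp: iso_def hom_def bij_betw_def Bsub_def aut_of_mult)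

section \<open>Invariant cocycles and their antisymmetrisation\<close>

lemma comm_group_Z2: "comm_group (Z2 G :: ('a \<times> 'a \<Rightarrow> 'k::field) monoid)"
proof -
  have m: "\<beta> \<otimes>\<^bsub>Z2 G\<^esub> \<gamma> = restrict (\<lambda>p. \<beta> p * (\<gamma> p :: 'k)) B" for \<beta> \<gamma> by (simp add: Z2_def)
  have o: "\<one>\<^bsub>Z2 G\<^esub> = restrict (\<lambda>p. 1 :: 'k) B" by (simp add: Z2_def)
  show ?thesis
  proof (rule comm_groupI)
    fix \<beta> \<gamma> :: "'a \<times> 'a \<Rightarrow> 'k" assume b: "\<beta> \<in> carrier (Z2 G)" and c: "\<gamma> \<in> carrier (Z2 G)"
    have "\<beta> (g, h) * \<beta> (g \<otimes> h, t) * (\<gamma> (g, h) * \<gamma> (g \<otimes> h, t)) = \<beta> (h, t) * \<beta> (g, h \<otimes> t) * (\<gamma> (h, t) * \<gamma> (g, h \<otimes> t))"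
      if "g \<in> U" "h \<in> U" "t \<in> U" for g h t
      using b c that by (simp add: carrier_Z2)
    thus "\<beta> \<otimes>\<^bsub>Z2 G\<^esub> \<gamma> \<in> carrier (Z2 G)"
      using b c unfolding m carrier_Z2 by (auto simp: mult_ac)
    show "\<beta> \<otimes>\<^bsub>Z2 G\<^esub> \<gamma> = \<gamma> \<otimes>\<^bsub>Z2 G\<^esub> \<beta>" unfolding m by (simp add: mult.commute)
    show "\<exists>\<delta>\<in>carrier (Z2 G). \<delta> \<otimes>\<^bsub>Z2 G\<^esub> \<beta> = \<one>\<^bsub>Z2 G\<^esub>"
    proof (rule bexI)
      have nz: "\<beta> (g, h) \<noteq> 0" if "g \<in> U" "h \<in> U" for g h using b that by (auto simp: carrier_Z2)
      show "restrict (\<lambda>p. inverse (\<beta> p)) B \<otimes>\<^bsub>Z2 G\<^esub> \<beta> = \<one>\<^bsub>Z2 G\<^esub>"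
        unfolding m o using nz by (intro restrict_ext) auto
      have "inverse (\<beta> (g, h)) * inverse (\<beta> (g \<otimes> h, t)) = inverse (\<beta> (h, t)) * inverse (\<beta> (g, h \<otimes> t))"
        if "g \<in> U" "h \<in> U" "t \<in> U" for g h t
        using b that by (simp add: carrier_Z2 flip: inverse_mult_distrib)
      thus "restrict (\<lambda>p. inverse (\<beta> p)) B \<in> carrier (Z2 G)"
        using b nz unfolding carrier_Z2 by auto
    qed
    show "\<one>\<^bsub>Z2 G\<^esub> \<otimes>\<^bsub>Z2 G\<^esub> \<beta> = \<beta>"
      unfolding m o using b by (intro extensionalityI[of _ B]) (auto simp: carrier_Z2 PiE_def)
    show "\<beta> \<otimes>\<^bsub>Z2 G\<^esub> \<gamma> \<otimes>\<^bsub>Z2 G\<^esub> \<delta> = \<beta> \<otimes>\<^bsub>Z2 G\<^esub> (\<gamma> \<otimes>\<^bsub>Z2 G\<^esub> \<delta>)" for \<delta> :: "'a \<times> 'a \<Rightarrow> 'k"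
      unfolding m by (intro restrict_ext) (simp add: mult.assoc)
  qed (auto simp: o carrier_Z2)
qed

lemma inv_Z2:
  assumes "\<beta> \<in> Zi"
  shows "inv\<^bsub>Z2 G\<^esub> \<beta> = restrict (\<lambda>p. inverse (\<beta> p :: 'k::field)) B"
proof -
  interpret Z: comm_group "Z2 G :: ('a \<times> 'a \<Rightarrow> 'k) monoid" by (rule comm_group_Z2)
  show ?thesis
  proof (rule Z.inv_equality)
    show "restrict (\<lambda>p. inverse (\<beta> p)) B \<otimes>\<^bsub>Z2 G\<^esub> \<beta> = \<one>\<^bsub>Z2 G\<^esub>"
      using Z2invD(2)[OF assms] by (simp add: Z2_def) (intro restrict_ext, auto)
  qed (use assms Z2inv_inverse[OF assms] in \<open>auto simp: Z2inv_def\<close>)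
qed

lemma subgroup_Z2inv: "subgroup (Zi) (Z2 G :: ('a \<times> 'a \<Rightarrow> 'k::field) monoid)"
proof -
  interpret Z: comm_group "Z2 G :: ('a \<times> 'a \<Rightarrow> 'k) monoid" by (rule comm_group_Z2)
  show ?thesis
  proof (rule Z.subgroupI)
    show "Zi \<subseteq> carrier (Z2 G :: ('a \<times> 'a \<Rightarrow> 'k) monoid)" by (auto simp: Z2inv_def)
    show "Zi \<noteq> ({} :: ('a \<times> 'a \<Rightarrow> 'k) set)" using Z2inv_one by blast
    show "inv\<^bsub>Z2 G\<^esub> \<beta> \<in> Zi" if "\<beta> \<in> Zi" for \<beta> :: "'a \<times> 'a \<Rightarrow> 'k"
      using inv_Z2[OF that] Z2inv_inverse[OF that] by simp
    show "\<beta> \<otimes>\<^bsub>Z2 G\<^esub> \<gamma> \<in> Zi" if "\<beta> \<in> Zi" "\<gamma> \<in> Zi" for \<beta> \<gamma> :: "'a \<times> 'a \<Rightarrow> 'k"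
      using Z2inv_mult[OF that] by (simp add: Z2_def)
  qed
qed

lemma comm_group_Z2inv: "comm_group (Z2inv G :: ('a \<times> 'a \<Rightarrow> 'k::field) monoid)"
proof -
  interpret Z: comm_group "Z2 G :: ('a \<times> 'a \<Rightarrow> 'k) monoid" by (rule comm_group_Z2)
  have "(Z2inv G :: ('a \<times> 'a \<Rightarrow> 'k) monoid) = (Z2 G)\<lparr>carrier := Zi\<rparr>" by (simp add: Z2inv_def)
  thus ?thesis using Z.comm_group_subgroup[OF subgroup_Z2inv] by simp
qed

section \<open>Antisymmetrisation of an invariant cocycle\<close>

definition asym :: "('a \<times> 'a \<Rightarrow> 'k::field) \<Rightarrow> 'a \<Rightarrow> 'a \<Rightarrow> 'k" where
  "asym \<beta> g h = \<beta> (h, g) / \<beta> (g, h)"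

text \<open>Three instances of the cocycle identity combine once a conjugate of h' can be replaced
  by h'. This is where invariance enters and where g and h need not commute.\<close>

lemma asym_mult_right:
  assumes \<beta>: "\<beta> \<in> Zi" and m: "g \<in> U" "h \<in> U" "h' \<in> U"
  shows "asym \<beta> g (h \<otimes> h') = asym \<beta> g h * (asym \<beta> g h' :: 'k::field)"
proof -
  note b = Z2invD[OF \<beta>]
  \<comment> \<open>Chosen so that g k = h' g. Invariance under conjugation by g turns \<beta>(g, k)
    into \<beta>(g, h') and \<beta>(h g, k) into \<beta>(g h, h').\<close>
  define k where "k = cj (inv g) h'"
  have k: "k \<in> U" "cj g k = h'" "g \<otimes> k = h' \<otimes> g" "h' \<in> U"
    using m by (simp_all add: k_def, simp add: conj_by_def m_assoc)
  have gg: "cj g g = g" "cj g (h \<otimes> g) = g \<otimes> h" using m by (simp_all add: conj_by_def m_assoc)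
  have 1: "\<beta> (g, h) * \<beta> (g \<otimes> h, h') = \<beta> (h, h') * \<beta> (g, h \<otimes> h')" by (rule b(5)) (use m in auto)
  have 2: "\<beta> (h, h') * \<beta> (h \<otimes> h', g) = \<beta> (h', g) * \<beta> (h, h' \<otimes> g)" by (rule b(5)) (use m in auto)
  have 3: "\<beta> (h, g) * \<beta> (h \<otimes> g, k) = \<beta> (g, k) * \<beta> (h, g \<otimes> k)" by (rule b(5)) (use m k in auto)
  have 4: "\<beta> (g, k) = \<beta> (g, h')" using b(6)[of g k g] m k gg by simp
  have 5: "\<beta> (h \<otimes> g, k) = \<beta> (g \<otimes> h, h')" using b(6)[of "h \<otimes> g" k g] m k gg by simp
  have nz: "\<beta> (x, y) \<noteq> 0" if "x \<in> U" "y \<in> U" for x y using b(2) that by blast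
  have e3: "\<beta> (h, g) * \<beta> (g \<otimes> h, h') = \<beta> (g, h') * \<beta> (h, h' \<otimes> g)" using 3 by (simp add: 4 5 k(3))
  have "(\<beta> (h, h') * \<beta> (h \<otimes> h', g)) * (\<beta> (g, h) * \<beta> (g \<otimes> h, h')) * \<beta> (g, h') =
    (\<beta> (h', g) * \<beta> (h, h' \<otimes> g)) * (\<beta> (h, h') * \<beta> (g, h \<otimes> h')) * \<beta> (g, h')" by (simp only: 1 2)
  also have "\<dots> = \<beta> (h', g) * (\<beta> (g, h') * \<beta> (h, h' \<otimes> g)) * (\<beta> (h, h') * \<beta> (g, h \<otimes> h'))" by (simp only: mult_ac)
  also have "\<dots> = \<beta> (h', g) * (\<beta> (h, g) * \<beta> (g \<otimes> h, h')) * (\<beta> (h, h') * \<beta> (g, h \<otimes> h'))" by (simp only: e3)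
  finally have "(\<beta> (h, h') * \<beta> (g \<otimes> h, h')) * (\<beta> (h \<otimes> h', g) * (\<beta> (g, h) * \<beta> (g, h'))) =
    (\<beta> (h, h') * \<beta> (g \<otimes> h, h')) * (\<beta> (h, g) * \<beta> (h', g) * \<beta> (g, h \<otimes> h'))" by (simp only: mult_ac)
  moreover have "\<beta> (h, h') * \<beta> (g \<otimes> h, h') \<noteq> 0" using nz m by simp
  ultimately have "\<beta> (h \<otimes> h', g) * (\<beta> (g, h) * \<beta> (g, h')) = \<beta> (h, g) * \<beta> (h', g) * \<beta> (g, h \<otimes> h')"
    using mult_left_cancel by blast
  thus ?thesis using nz m by (simp add: asym_def frac_eq_eq)
qed

lemma asym_swap: "asym \<beta> g h = inverse (asym \<beta> h g)"
  by (simp add: asym_def)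

lemma bichar_asym:
  assumes \<beta>: "\<beta> \<in> Zi"
  shows "bichar G (asym \<beta> :: 'a \<Rightarrow> 'a \<Rightarrow> 'k::field)"
proof -
  note b = Z2invD[OF \<beta>]
  have "asym \<beta> (x \<otimes> y) z = asym \<beta> x z * asym \<beta> y z"
    if "x \<in> U" "y \<in> U" "z \<in> U" for x y z
    using asym_mult_right[OF \<beta> that(3,1,2)] asym_swap[of \<beta> "x \<otimes> y" z] asym_swap[of \<beta> x z] asym_swap[of \<beta> y z] by simp
  thus ?thesis using asym_mult_right[OF \<beta>] b(2) by (auto simp: bichar_def) (auto simp: asym_def)
qed

lemma alternating_asym:
  assumes "\<beta> \<in> Zi"
  shows "alternating G (asym \<beta> :: 'a \<Rightarrow> 'a \<Rightarrow> 'k::field)"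
  unfolding alternating_def using asym_swap Z2invD(2)[OF assms] by (auto simp: asym_def)

text \<open>As b is determined by \<beta>, the set is an image of the abelian group of invariant
  cocycles. The subgroup, homomorphism and centrality statements use this parametrisation.\<close>

lemma BL_eq: "BL G = {(baut (asym \<beta>), form \<beta>) | \<beta> :: 'a \<times> 'a \<Rightarrow> 'k::field. \<beta> \<in> Zi}"
proof (intro equalityI subsetI)
  fix x :: "(('a \<times> 'a \<Rightarrow> 'k) \<Rightarrow> 'a \<times> 'a \<Rightarrow> 'k) \<times> (('a \<times> 'a) \<times> ('a \<times> 'a) \<Rightarrow> 'k)"
  assume "x \<in> BL G"
  then obtain b and \<beta> :: "'a \<times> 'a \<Rightarrow> 'k" where x: "x = (aut_of G b, form \<beta>)" "b \<in> carrier (Hom_ab G)" "\<beta> \<in> Zi"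
    "\<And>g h. g \<in> U \<Longrightarrow> h \<in> U \<Longrightarrow> ev G b g h = \<beta> (h, g) / \<beta> (g, h)" unfolding BL_def by blast
  have "aut_of G b = baut (asym \<beta>)" unfolding aut_of_eq by (rule dg_aut_cong) (simp_all add: x asym_def)
  thus "x \<in> {(baut (asym \<beta>), form \<beta>) | \<beta>. \<beta> \<in> Zi}" using x by blast
next
  fix x :: "(('a \<times> 'a \<Rightarrow> 'k) \<Rightarrow> 'a \<times> 'a \<Rightarrow> 'k) \<times> (('a \<times> 'a) \<times> ('a \<times> 'a) \<Rightarrow> 'k)"
  assume "x \<in> {(baut (asym \<beta>), form \<beta>) | \<beta>. \<beta> \<in> Zi}"
  then obtain \<beta> :: "'a \<times> 'a \<Rightarrow> 'k" where x: "x = (baut (asym \<beta>), form \<beta>)" "\<beta> \<in> Zi" by blast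
  obtain b where b: "b \<in> carrier (Hom_ab G)" "\<And>g h. g \<in> U \<Longrightarrow> h \<in> U \<Longrightarrow> ev G b g h = asym \<beta> g h"
    using ev_surj[OF bichar_asym[OF x(2)]] by blast
  have "aut_of G b = baut (asym \<beta>)" unfolding aut_of_eq by (rule dg_aut_cong) (simp_all add: b)
  thus "x \<in> BL G" unfolding BL_def
    by (intro CollectI exI[of _ b] exI[of _ \<beta>]) (use x b in \<open>simp add: asym_def\<close>)
qed

lemma Balt_eq: "Balt G = {baut c | c :: 'a \<Rightarrow> 'a \<Rightarrow> 'k::field. bichar G c \<and> alternating G c}"
proof (intro equalityI subsetI)
  fix x :: "('a \<times> 'a \<Rightarrow> 'k) \<Rightarrow> 'a \<times> 'a \<Rightarrow> 'k" assume "x \<in> Balt G"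
  then obtain b where b: "x = aut_of G b" "b \<in> carrier (Hom_ab G)"
    "\<forall>g\<in>U. \<forall>h\<in>U. ev G b g h = inverse (ev G b h g) \<and> ev G b g g = 1" unfolding Balt_def by blast
  show "x \<in> {baut c | c :: 'a \<Rightarrow> 'a \<Rightarrow> 'k. bichar G c \<and> alternating G c}"
    unfolding b(1) aut_of_eq alternating_def using b(3) bichar_ev[OF b(2)] by blast
next
  fix x assume "x \<in> {baut c | c :: 'a \<Rightarrow> 'a \<Rightarrow> 'k. bichar G c \<and> alternating G c}"
  then obtain c :: "'a \<Rightarrow> 'a \<Rightarrow> 'k" where c: "bichar G c" "alternating G c" "x = baut c" by blast
  obtain b where b: "b \<in> carrier (Hom_ab G)" "\<And>g h. g \<in> U \<Longrightarrow> h \<in> U \<Longrightarrow> ev G b g h = c g h"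
    using ev_surj[OF c(1)] by blast
  have "x = aut_of G b" unfolding c(3) aut_of_eq by (rule dg_aut_cong) (simp_all add: b)
  moreover have "ev G b g h = inverse (ev G b h g) \<and> ev G b g g = 1" if "g \<in> U" "h \<in> U" for g h
    using alternatingD(1)[OF c(2) that(1)] alternatingD(2)[OF c(2) that] that by (simp add: b)
  ultimately show "x \<in> Balt G" unfolding Balt_def using b(1) by blast
qed

section \<open>Braided pairs of automorphisms and cocycles\<close>

lemma AutZ_simps [simp]:
  "(\<phi>, \<sigma>) \<otimes>\<^bsub>AutZ G\<^esub> (\<phi>', \<sigma>') = (\<phi> \<circ> \<phi>', star \<sigma>' (tensor_map B (dagger G \<phi>') (dagger G \<phi>') (\<sigma> :: _ \<Rightarrow> 'k::field)))"
  "\<one>\<^bsub>AutZ G\<^esub> = (id_map B, eps2 DDd :: _ \<Rightarrow> 'k::field)"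
  by (simp_all add: AutZ_def tensor_mult_DG Z2L_def Aut_Hopf_def)

lemma AutZ_carrier: "carrier (AutZ G) = carrier AutD \<times> carrier (Z2L DDd)"
  by (simp add: AutZ_def)

text \<open>The dagger of the second factor fixes the form of \<beta>, which untwists the product.
  Keeping \<sigma>' arbitrary allows inverses to be compared among all pairs of
  \<open>AutZ\<close>.\<close>

lemma AutZ_mult:
  assumes "bichar G d" "\<beta> \<in> Zi"
  shows "(\<phi>, form \<beta>) \<otimes>\<^bsub>AutZ G\<^esub> (baut d, \<sigma>') = (\<phi> \<circ> baut d, star \<sigma>' (form \<beta> :: _ \<Rightarrow> 'k::field))"
  using tensor_map_form[OF one_closed bichar_flip[OF assms(1)] assms(2)] by (simp add: dagger_dg_aut assms(1))

lemma AutZ_mult_forms: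
  assumes "bichar G c" "bichar G d" "\<beta> \<in> Zi" "\<gamma> \<in> Zi"
  shows "(baut c, form \<beta>) \<otimes>\<^bsub>AutZ G\<^esub> (baut d, form \<gamma>) =
    (baut (\<lambda>x y. c x y * d x y), form (\<lambda>p. \<beta> p * (\<gamma> p :: 'k::field)))"
  unfolding AutZ_mult[OF assms(2,3)] star_form dg_aut_mult_one[OF assms(1,2)] by (simp add: mult.commute)

lemma form_restrict: "form (restrict \<beta> B) = form \<beta>"
  by (rule form_cong) simp

lemma form_inverse:
  assumes "\<beta> \<in> Zi"
  shows "star (form \<beta>) (form (\<lambda>p. inverse (\<beta> p))) = (eps2 DDd :: _ \<Rightarrow> 'k::field)"
    "star (form (\<lambda>p. inverse (\<beta> p))) (form \<beta>) = (eps2 DDd :: _ \<Rightarrow> 'k::field)"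
  unfolding star_form eps2_form using Z2invD(2)[OF assms] by (auto intro!: form_cong)

lemma Zhat_mem: "\<sigma> \<in> Zhat G \<longleftrightarrow> (\<exists>\<beta>\<in>Zi. \<sigma> = (form \<beta> :: _ \<Rightarrow> 'k::field))"
  by (auto simp: Zhat_def)

text \<open>A competing inverse (\<phi>, \<sigma>) is an arbitrary pair. Its first component is
  determined in the group of automorphisms; after that \<sigma> is found by cancelling
  \<beta>.\<close>

lemma inv_AutZ:
  assumes c: "bichar G c" and \<beta>: "\<beta> \<in> Zi"
  shows "inv\<^bsub>AutZ G\<^esub> (baut c, form \<beta>) =
    (baut (\<lambda>x y. inverse (c x y)), form (\<lambda>p. inverse (\<beta> p :: 'k::field)))"
  unfolding m_inv_def
proof (rule the_equality)
  let ?x = "(baut c, form \<beta>)"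
  let ?y = "(baut (\<lambda>x y. inverse (c x y)), form (\<lambda>p. inverse (\<beta> p)))"
  let ?\<gamma> = "restrict (\<lambda>p. inverse (\<beta> p)) B"
  have \<gamma>: "?\<gamma> \<in> Zi" by (rule Z2inv_inverse[OF \<beta>])
  have y: "?y = (baut (\<lambda>x y. inverse (c x y)), form ?\<gamma>)" by (simp add: form_restrict)
  note ci = bichar_inverse[OF c]
  have "?y \<in> carrier (AutZ G)" unfolding y AutZ_carrier using dg_aut_Aut[OF one_closed ci] form_Z2L[OF \<gamma>] by simp
  moreover have "?x \<otimes>\<^bsub>AutZ G\<^esub> ?y = \<one>\<^bsub>AutZ G\<^esub>" unfolding AutZ_mult[OF ci \<beta>] by (simp add: dg_aut_inverse_one[OF c] form_inverse[OF \<beta>])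
  moreover have "?y \<otimes>\<^bsub>AutZ G\<^esub> ?x = \<one>\<^bsub>AutZ G\<^esub>" unfolding y AutZ_mult[OF c \<gamma>]
    by (simp add: dg_aut_inverse_one[OF c] form_inverse[OF \<beta>] form_restrict)
  ultimately show "?y \<in> carrier (AutZ G) \<and> ?x \<otimes>\<^bsub>AutZ G\<^esub> ?y = \<one>\<^bsub>AutZ G\<^esub> \<and> ?y \<otimes>\<^bsub>AutZ G\<^esub> ?x = \<one>\<^bsub>AutZ G\<^esub>" by blast
  fix z assume z: "z \<in> carrier (AutZ G) \<and> ?x \<otimes>\<^bsub>AutZ G\<^esub> z = \<one>\<^bsub>AutZ G\<^esub> \<and> z \<otimes>\<^bsub>AutZ G\<^esub> ?x = \<one>\<^bsub>AutZ G\<^esub>"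
  obtain \<phi> \<sigma> where zz: "z = (\<phi>, \<sigma>)" by (cases z)
  interpret A: group "AutD :: (('a \<times> 'a \<Rightarrow> 'k) \<Rightarrow> _) monoid" by (rule group_Aut)
  have \<phi>: "\<phi> \<in> carrier AutD" and \<sigma>: "\<sigma> \<in> coords (B \<times> B)"
    using z zz by (auto simp: AutZ_carrier Z2L_def cocycle2_def)
  have p1: "baut c \<circ> \<phi> = id_map B" using z zz by simp
  hence "\<phi> \<otimes>\<^bsub>AutD\<^esub> baut c = \<one>\<^bsub>AutD\<^esub>"
    using A.inv_comm[of "baut c" \<phi>] \<phi> dg_aut_Aut[OF one_closed c] by simp
  hence p: "\<phi> = baut (\<lambda>x y. inverse (c x y))"
    using A.inv_equality[of \<phi> "baut c"] \<phi> dg_aut_Aut[OF one_closed c] inv_dg_aut[OF c] by simp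
  have "?x \<otimes>\<^bsub>AutZ G\<^esub> (baut (\<lambda>x y. inverse (c x y)), \<sigma>) = \<one>\<^bsub>AutZ G\<^esub>" using z unfolding zz p by blast
  hence s1: "star \<sigma> (form \<beta>) = eps2 DDd" unfolding AutZ_mult[OF ci \<beta>] by simp
  have "\<sigma> = star \<sigma> (eps2 DDd)" using star_eps2(2)[OF \<sigma>] by simp
  also have "\<dots> = star (star \<sigma> (form \<beta>)) (form (\<lambda>p. inverse (\<beta> p)))"
    by (simp add: form_inverse[OF \<beta>, symmetric] star_assoc)
  also have "\<dots> = form (\<lambda>p. inverse (\<beta> p))" unfolding s1 by (rule star_eps2(1)[OF form_coords])
  finally show "z = ?y" using zz p by simp
qed

lemma subgroup_BZ: "subgroup (Bsub G \<times> Zhat G) (AutZ G :: ('a, 'k::field) dg_pair monoid)"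
proof
  show "Bsub G \<times> Zhat G \<subseteq> carrier (AutZ G :: ('a, 'k) dg_pair monoid)"
    by (auto simp: AutZ_carrier Bsub_eq Zhat_mem dg_aut_Aut form_Z2L)
  show "\<one>\<^bsub>AutZ G\<^esub> \<in> (Bsub G \<times> Zhat G :: ('a, 'k) dg_pair set)"
    using Z2inv_one bichar_trivial by (auto simp: Bsub_eq Zhat_mem dg_aut_one[symmetric] eps2_form form_restrict intro!: bexI[OF _ Z2inv_one])
  fix x y :: "('a, 'k) dg_pair" assume "x \<in> Bsub G \<times> Zhat G"
  then obtain c \<beta> where x: "bichar G c" "\<beta> \<in> Zi" "x = (baut c, form \<beta>)"
    by (auto simp: Bsub_eq Zhat_mem)
  have "form (\<lambda>p. inverse (\<beta> p)) \<in> Zhat G"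
    unfolding Zhat_mem by (rule bexI[OF _ Z2inv_inverse[OF x(2)]]) (simp add: form_restrict)
  thus "inv\<^bsub>AutZ G\<^esub> x \<in> Bsub G \<times> Zhat G"
    unfolding x(3) inv_AutZ[OF x(1,2)] Bsub_eq using bichar_inverse[OF x(1)] by auto
  assume "y \<in> Bsub G \<times> Zhat G"
  then obtain d \<gamma> where y: "bichar G d" "\<gamma> \<in> Zi" "y = (baut d, form \<gamma>)"
    by (auto simp: Bsub_eq Zhat_mem)
  have "form (\<lambda>p. \<beta> p * \<gamma> p) \<in> Zhat G"
    unfolding Zhat_mem by (rule bexI[OF _ Z2inv_mult[OF x(2) y(2)]]) (simp add: form_restrict)
  thus "x \<otimes>\<^bsub>AutZ G\<^esub> y \<in> Bsub G \<times> Zhat G"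
    unfolding x(3) y(3) AutZ_mult_forms[OF x(1) y(1) x(2) y(2)] Bsub_eq using bichar_mult[OF x(1) y(1)] by auto
qed

lemma BZ_iso: "(\<lambda>(b, \<beta>). (aut_of G b, form \<beta>)) \<in>
    iso (Hom_ab G \<times>\<times> Z2inv G) ((AutZ G :: ('a, 'k::field) dg_pair monoid)\<lparr>carrier := Bsub G \<times> Zhat G\<rparr>)"
proof -
  have h: "(\<lambda>(b, \<beta>). (aut_of G b, form \<beta>)) \<in>
    hom (Hom_ab G \<times>\<times> Z2inv G) ((AutZ G :: ('a, 'k) dg_pair monoid)\<lparr>carrier := Bsub G \<times> Zhat G\<rparr>)"
  proof (rule homI)
    fix x y :: "('a set \<Rightarrow> 'a set \<Rightarrow> 'k) \<times> ('a \<times> 'a \<Rightarrow> 'k)" assume "x \<in> carrier (Hom_ab G \<times>\<times> Z2inv G)"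
    then obtain b \<beta> where x: "b \<in> carrier (Hom_ab G)" "\<beta> \<in> Zi" "x = (b, \<beta>)" by (auto simp: DirProd_def)
    thus "(case x of (b, \<beta>) \<Rightarrow> (aut_of G b, form \<beta>)) \<in> carrier ((AutZ G :: ('a, 'k) dg_pair monoid)\<lparr>carrier := Bsub G \<times> Zhat G\<rparr>)"
      by (auto simp: Bsub_def Zhat_def)
    assume "y \<in> carrier (Hom_ab G \<times>\<times> Z2inv G)"
    then obtain c \<gamma> where y: "c \<in> carrier (Hom_ab G)" "\<gamma> \<in> Zi" "y = (c, \<gamma>)" by (auto simp: DirProd_def)
    have "form (restrict (\<lambda>p. \<beta> p * \<gamma> p) B) = form (\<lambda>p. \<beta> p * \<gamma> p)" by (rule form_restrict)
    moreover have "(aut_of G b, form \<beta>) \<otimes>\<^bsub>AutZ G\<^esub> (aut_of G c, form \<gamma>) =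
      (aut_of G b \<circ> aut_of G c, form (\<lambda>p. \<beta> p * \<gamma> p))"
      unfolding aut_of_eq AutZ_mult_forms[OF x(1)[THEN bichar_ev] y(1)[THEN bichar_ev] x(2) y(2)]
        dg_aut_mult_one[OF x(1)[THEN bichar_ev] y(1)[THEN bichar_ev]] ..
    ultimately show "(case x \<otimes>\<^bsub>Hom_ab G \<times>\<times> Z2inv G\<^esub> y of (b, \<beta>) \<Rightarrow> (aut_of G b, form \<beta>)) =
      (case x of (b, \<beta>) \<Rightarrow> (aut_of G b, form \<beta>)) \<otimes>\<^bsub>(AutZ G :: ('a, 'k) dg_pair monoid)\<lparr>carrier := Bsub G \<times> Zhat G\<rparr>\<^esub>
      (case y of (b, \<beta>) \<Rightarrow> (aut_of G b, form \<beta>))"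
      unfolding x(3) y(3) by (simp add: aut_of_mult[OF x(1) y(1)] del: AutZ_simps)
  qed
  have f: "\<beta> = \<gamma>" if "\<beta> \<in> Zi" "\<gamma> \<in> Zi" "form \<beta> = form \<gamma>" for \<beta> \<gamma> :: "_ \<Rightarrow> 'k"
    using Z2invD(1)[OF that(1)] Z2invD(1)[OF that(2)] form_inj[OF that(3)]
    by (intro extensionalityI[of _ B]) auto
  have "inj_on (\<lambda>(b, \<beta>). (aut_of G b, form \<beta>)) (carrier (Hom_ab G \<times>\<times> Z2inv G :: (('a set \<Rightarrow> 'a set \<Rightarrow> 'k) \<times> ('a \<times> 'a \<Rightarrow> 'k)) monoid))"
  proof (rule inj_onI)
    fix x y :: "('a set \<Rightarrow> 'a set \<Rightarrow> 'k) \<times> ('a \<times> 'a \<Rightarrow> 'k)"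
    assume xy: "x \<in> carrier (Hom_ab G \<times>\<times> Z2inv G)" "y \<in> carrier (Hom_ab G \<times>\<times> Z2inv G)"
      and eq: "(case x of (b, \<beta>) \<Rightarrow> (aut_of G b, form \<beta>)) = (case y of (b, \<beta>) \<Rightarrow> (aut_of G b, form \<beta>))"
    have "fst x = fst y" using xy eq inj_onD[OF aut_of_inj, of "fst x" "fst y"] by (auto simp: DirProd_def)
    moreover have "snd x = snd y" using xy eq f[of "snd x" "snd y"] by (auto simp: DirProd_def)
    ultimately show "x = y" by (rule prod_eqI)
  qed
  moreover have "(\<lambda>(b, \<beta>). (aut_of G b, form \<beta>)) ` carrier (Hom_ab G \<times>\<times> Z2inv G) = (Bsub G \<times> Zhat G :: ('a, 'k) dg_pair set)"
    by (auto simp: DirProd_def Bsub_def Zhat_def image_iff)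
  ultimately show ?thesis using h by (simp add: iso_def bij_betw_def)
qed

lemma BZ_cases:
  assumes "x \<in> (Bsub G \<times> Zhat G :: ('a, 'k::field) dg_pair set)"
  obtains c \<beta> where "bichar G c" "\<beta> \<in> Zi" "x = (baut c, form \<beta>)"
  using assms by (auto simp: Bsub_eq Zhat_mem)

lemma AutZ_mult_forms':
  assumes "bichar G c" "bichar G d" "\<beta> \<in> Zi" "\<gamma> \<in> Zi"
  shows "(baut c, form \<beta>) \<otimes>\<^bsub>AutZ G\<^esub> (baut d, form \<gamma>) =
    (baut (\<lambda>x y. c x y * d x y), form (restrict (\<lambda>p. \<beta> p * (\<gamma> p :: 'k::field)) B))"
  using AutZ_mult_forms[OF assms] by (simp only: form_restrict)

lemma AutZ_one: "\<one>\<^bsub>AutZ G\<^esub> = (baut (\<lambda>x y. 1), form (restrict (\<lambda>p. 1 :: 'k::field) B))"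
  by (simp add: dg_aut_one eps2_form form_restrict)

text \<open>The group laws are transported along \<open>BZ_iso\<close> from the direct product of
  two abelian groups.\<close>

lemma group_BZ: "group ((AutZ G :: ('a, 'k::field) dg_pair monoid)\<lparr>carrier := Bsub G \<times> Zhat G\<rparr>)"
proof -
  interpret H: comm_group "Hom_ab G :: (_ \<Rightarrow> _ \<Rightarrow> 'k) monoid" by (rule comm_group_Hom_ab)
  interpret Z: comm_group "Z2inv G :: ('a \<times> 'a \<Rightarrow> 'k) monoid" by (rule comm_group_Z2inv)
  interpret P: group "(Hom_ab G :: (_ \<Rightarrow> _ \<Rightarrow> 'k) monoid) \<times>\<times> (Z2inv G :: ('a \<times> 'a \<Rightarrow> 'k) monoid)" by (rule DirProd_group[OF H.is_group Z.is_group])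
  have "aut_of G \<one>\<^bsub>Hom_ab G\<^esub> = (baut (\<lambda>x y. 1) :: ('a, 'k) dg_aut)"
    unfolding aut_of_eq by (rule dg_aut_cong) (simp_all add: ev_def Hom_ab_def hom_group_def dual_group_def)
  thus ?thesis using P.iso_imp_img_group[OF BZ_iso] by (simp add: AutZ_one[symmetric] del: AutZ_simps)
qed

lemma BL_subset: "BL G \<subseteq> (Bsub G \<times> Zhat G :: ('a, 'k::field) dg_pair set)"
  unfolding BL_eq using bichar_asym by (auto simp: Bsub_eq Zhat_mem)

lemma BL_mult:
  assumes "\<beta> \<in> Zi" "\<gamma> \<in> Zi"
  shows "(baut (asym \<beta>), form \<beta>) \<otimes>\<^bsub>AutZ G\<^esub> (baut (asym \<gamma>), form \<gamma>) =
    (let \<delta> = restrict (\<lambda>p. \<beta> p * (\<gamma> p :: 'k::field)) B in (baut (asym \<delta>), form \<delta>))"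
  unfolding AutZ_mult_forms'[OF bichar_asym[OF assms(1)] bichar_asym[OF assms(2)] assms] Let_def
  by (auto simp: asym_def intro!: dg_aut_cong)

text \<open>Sending \<beta> to the pair of its antisymmetrisation and its form is a homomorphism, so
  the image is a subgroup.\<close>

lemma subgroup_BL:
  "subgroup (BL G) ((AutZ G :: ('a, 'k::field) dg_pair monoid)\<lparr>carrier := Bsub G \<times> Zhat G\<rparr>)"
proof -
  let ?M = "(AutZ G :: ('a, 'k) dg_pair monoid)\<lparr>carrier := Bsub G \<times> Zhat G\<rparr>"
  let ?h = "\<lambda>\<beta>. (baut (asym \<beta>), form \<beta>) :: ('a, 'k) dg_pair"
  interpret M: group ?M by (rule group_BZ)
  interpret Z: comm_group "Z2inv G :: ('a \<times> 'a \<Rightarrow> 'k) monoid" by (rule comm_group_Z2inv)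
  have img: "BL G = ?h ` Zi" unfolding BL_eq by blast
  have "?h \<in> hom (Z2inv G) ?M"
  proof (rule homI)
    show "?h \<beta> \<in> carrier ?M" if "\<beta> \<in> Zi" for \<beta> using that BL_subset img by auto
    show "?h (\<beta> \<otimes>\<^bsub>Z2inv G\<^esub> \<gamma>) = ?h \<beta> \<otimes>\<^bsub>?M\<^esub> ?h \<gamma>" if "\<beta> \<in> Zi" "\<gamma> \<in> Zi" for \<beta> \<gamma>
      using BL_mult[OF that] by (simp add: Let_def del: AutZ_simps)
  qed
  then interpret h: group_hom "Z2inv G" ?M ?h by unfold_locales
  show ?thesis using h.img_is_subgroup by (simp add: img)
qed

lemma subgroup_Balt:
  "subgroup (Balt G) ((AutD :: ('a, 'k::field) dg_aut monoid)\<lparr>carrier := Bsub G\<rparr>)"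
proof -
  let ?M = "(AutD :: ('a, 'k) dg_aut monoid)\<lparr>carrier := Bsub G\<rparr>"
  interpret A: group "AutD :: ('a, 'k) dg_aut monoid" by (rule group_Aut)
  interpret M: group ?M by (rule A.subgroup_imp_group[OF subgroup_Bsub])
  have sub: "Balt G \<subseteq> (Bsub G :: ('a, 'k) dg_aut set)" unfolding Balt_eq Bsub_eq by blast
  show ?thesis
  proof (rule M.subgroupI)
    show "Balt G \<subseteq> carrier ?M" using sub by simp
    have "alternating G (\<lambda>x y. 1 :: 'k)" by (auto simp: alternating_def)
    thus "Balt G \<noteq> ({} :: ('a, 'k) dg_aut set)" unfolding Balt_eq using bichar_trivial by blast
    fix x :: "('a, 'k) dg_aut" assume xB: "x \<in> Balt G"
    then obtain c where x: "bichar G c" "alternating G c" "x = baut c" unfolding Balt_eq by blast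
    have "alternating G (\<lambda>x y. inverse (c x y))"
      unfolding alternating_def
    proof (intro ballI conjI)
      fix g h assume gh: "g \<in> U" "h \<in> U"
      show "inverse (c g h) = inverse (inverse (c h g))" using alternatingD(2)[OF x(2) gh] by simp
      show "inverse (c g g) = 1" using alternatingD(1)[OF x(2) gh(1)] by simp
    qed
    moreover have "inv\<^bsub>?M\<^esub> x = baut (\<lambda>x y. inverse (c x y))"
      using A.m_inv_consistent[OF subgroup_Bsub, of x] inv_dg_aut[OF x(1)] xB sub x(3) by auto
    ultimately show "inv\<^bsub>?M\<^esub> x \<in> Balt G" unfolding Balt_eq using bichar_inverse[OF x(1)] by auto
    fix y :: "('a, 'k) dg_aut" assume "y \<in> Balt G"
    then obtain d where y: "bichar G d" "alternating G d" "y = baut d" unfolding Balt_eq by blast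
    have "alternating G (\<lambda>x y. c x y * d x y)"
      unfolding alternating_def
    proof (intro ballI conjI)
      fix g h assume gh: "g \<in> U" "h \<in> U"
      show "c g h * d g h = inverse (c h g * d h g)" using alternatingD(2)[OF x(2) gh] alternatingD(2)[OF y(2) gh] by simp
      show "c g g * d g g = 1" using alternatingD(1)[OF x(2) gh(1)] alternatingD(1)[OF y(2) gh(1)] by simp
    qed
    thus "x \<otimes>\<^bsub>?M\<^esub> y \<in> Balt G"
      unfolding Balt_eq using bichar_mult[OF x(1) y(1)] dg_aut_mult_one[OF x(1) y(1)] x(3) y(3) by auto
  qed
qed

lemma fst_BL_hom:
  "fst \<in> hom ((AutZ G :: ('a, 'k::field) dg_pair monoid)\<lparr>carrier := BL G\<rparr>)
     (AutD\<lparr>carrier := Balt G\<rparr>)"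
proof (rule homI)
  fix x y :: "('a, 'k) dg_pair"
  assume "x \<in> carrier ((AutZ G)\<lparr>carrier := BL G\<rparr>)"
  then obtain \<beta> where x: "\<beta> \<in> Zi" "x = (baut (asym \<beta>), form \<beta>)" unfolding BL_eq by auto
  show "fst x \<in> carrier (AutD\<lparr>carrier := Balt G\<rparr>)"
    unfolding Balt_eq x(2) using bichar_asym[OF x(1)] alternating_asym[OF x(1)] by auto
  show "fst (x \<otimes>\<^bsub>(AutZ G)\<lparr>carrier := BL G\<rparr>\<^esub> y) = fst x \<otimes>\<^bsub>AutD\<lparr>carrier := Balt G\<rparr>\<^esub> fst y"
    by (cases x; cases y) simp
qed

lemma Gab_alternating:
  assumes "b \<in> carrier (Hom_ab G)" "alternating G (ev G b)"
  shows "alternating (Gab G) (b :: _ \<Rightarrow> _ \<Rightarrow> 'k::field)"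
  unfolding alternating_def carrier_Gab
proof (intro ballI, elim imageE, simp only:)
  fix x y assume xy: "x \<in> U" "y \<in> U"
  show "b (N #> x) (N #> y) = inverse (b (N #> y) (N #> x)) \<and> b (N #> x) (N #> x) = 1"
    using alternatingD(2)[OF assms(2) xy] alternatingD(1)[OF assms(2) xy(1)] by (simp add: ev_def)
qed

text \<open>An alternating form descends to the abelianisation, where
  \<open>alternating_bichar_eq_quotient\<close> supplies a bicharacter f. Inflated to G, f is a
  2-cocycle because it is bimultiplicative, and invariant because conjugation is trivial modulo
  commutators.\<close>

lemma fst_BL_surj:
  "fst ` BL G = (Balt G :: ('a, 'k::{alg_closed_field, field_char_0}) dg_aut set)"
proof (intro equalityI subsetI)
  fix x :: "('a, 'k) dg_aut" assume "x \<in> fst ` BL G"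
  thus "x \<in> Balt G" unfolding BL_eq Balt_eq using bichar_asym alternating_asym by fastforce
next
  fix x :: "('a, 'k) dg_aut" assume "x \<in> Balt G"
  then obtain c where c: "bichar G c" "alternating G c" "x = baut c" unfolding Balt_eq by blast
  obtain b where b: "b \<in> carrier (Hom_ab G)" "\<And>g h. g \<in> U \<Longrightarrow> h \<in> U \<Longrightarrow> ev G b g h = c g h"
    using ev_surj[OF c(1)] by blast
  have "alternating G (ev G b)"
    unfolding alternating_def
  proof (intro ballI conjI)
    fix g h assume gh: "g \<in> U" "h \<in> U"
    show "ev G b g h = inverse (ev G b h g)" using alternatingD(2)[OF c(2) gh] gh by (simp add: b)
    show "ev G b g g = 1" using alternatingD(1)[OF c(2) gh(1)] gh by (simp add: b)
  qed
  hence alt: "alternating (Gab G) b" by (rule Gab_alternating[OF b(1)])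
  have "\<exists>f. bichar (Gab G) f \<and> (\<forall>x\<in>carrier (Gab G). \<forall>y\<in>carrier (Gab G). b x y = f y x / f x y)"
    by (rule alternating_bichar_eq_quotient[OF comm_group_Gab finite_Gab _ alternatingD(2)[OF alt] alternatingD(1)[OF alt]])
      (use b(1) in \<open>auto simp: Hom_ab_iff\<close>)
  then obtain f where f: "bichar (Gab G) f"
    "\<And>x y. x \<in> carrier (Gab G) \<Longrightarrow> y \<in> carrier (Gab G) \<Longrightarrow> b x y = f y x / f x y" by blast
  define e where "e = (\<lambda>g h. f (N #> g) (N #> h))"
  have e: "bichar G e" using f(1) by (auto simp: bichar_def e_def Gab_mult[symmetric])
  define \<beta> where "\<beta> = restrict (\<lambda>(g, h). e g h) B"
  have \<beta>: "\<beta> \<in> Zi"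
    by (rule Z2invI) (auto simp: \<beta>_def bicharD[OF e] bichar_one[OF e] bichar_cj[OF e])
  have "x = baut (asym \<beta>)"
    unfolding c(3)
  proof (rule dg_aut_cong)
    fix g h assume gh: "g \<in> U" "h \<in> U"
    have "c g h = b (N #> g) (N #> h)" using b(2)[OF gh] by (simp add: ev_def)
    thus "c g h = asym \<beta> g h" using gh f(2)[of "N #> g" "N #> h"] by (simp add: asym_def \<beta>_def e_def)
  qed simp
  thus "x \<in> fst ` BL G" unfolding BL_eq using \<beta> by force
qed

text \<open>The isomorphism depends on the chosen self-dualities of finite abelian groups behind
  \<open>alt_group_iso_ext_square\<close>.\<close>

lemma Balt_iso_ext_square:
  "(AutD :: ('a, 'k::{alg_closed_field, field_char_0}) dg_aut monoid)\<lparr>carrier := Balt G\<rparr> \<cong>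
     ext_square (dual_group (Gab G) :: ('a set \<Rightarrow> 'k) monoid)"
proof -
  let ?D = "dual_group (Gab G) :: ('a set \<Rightarrow> 'k) monoid"
  let ?A = "(AutD :: ('a, 'k) dg_aut monoid)\<lparr>carrier := Balt G\<rparr>"
  interpret D: comm_group ?D by (rule comm_group_dual[OF Gab.is_group])
  interpret X: ext_sq ?D by unfold_locales
  have ac: "carrier (alt_group (Gab G) :: ('a set \<Rightarrow> 'a set \<Rightarrow> 'k) monoid) = {b \<in> carrier (Hom_ab G). alternating (Gab G) b}"
    by (simp add: alt_group_def Hom_ab_def)
  have am: "b \<otimes>\<^bsub>alt_group (Gab G)\<^esub> c = b \<otimes>\<^bsub>Hom_ab G\<^esub> c" for b c :: "'a set \<Rightarrow> 'a set \<Rightarrow> 'k"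
    by (simp add: alt_group_def Hom_ab_def)
  have alt_iff: "alternating (Gab G) b \<longleftrightarrow> (\<forall>g\<in>U. \<forall>h\<in>U. ev G b g h = inverse (ev G b h g) \<and> ev G b g g = 1)"
    for b :: "'a set \<Rightarrow> 'a set \<Rightarrow> 'k"
    by (simp only: alternating_def carrier_Gab ball_simps ev_def)
  have "aut_of G \<in> iso (alt_group (Gab G)) ?A"
  proof -
    have "aut_of G \<in> hom (alt_group (Gab G)) ?A"
    proof (rule homI)
      fix b c :: "'a set \<Rightarrow> 'a set \<Rightarrow> 'k" assume b: "b \<in> carrier (alt_group (Gab G))"
      show "aut_of G b \<in> carrier ?A" using b unfolding ac alt_iff Balt_def by auto
      assume c: "c \<in> carrier (alt_group (Gab G))"
      show "aut_of G (b \<otimes>\<^bsub>alt_group (Gab G)\<^esub> c) = aut_of G b \<otimes>\<^bsub>?A\<^esub> aut_of G c"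
        unfolding am using b c ac aut_of_mult[of b c] by simp
    qed
    moreover have "inj_on (aut_of G) (carrier (alt_group (Gab G) :: ('a set \<Rightarrow> 'a set \<Rightarrow> 'k) monoid))"
      using aut_of_inj unfolding ac by (rule inj_on_subset) blast
    moreover have "aut_of G ` carrier (alt_group (Gab G)) = carrier ?A"
      unfolding ac alt_iff by (auto simp: Balt_def)
    ultimately show ?thesis by (simp add: iso_def bij_betw_def)
  qed
  moreover obtain h where "h \<in> iso (ext_square ?D) (alt_group (Gab G) :: ('a set \<Rightarrow> 'a set \<Rightarrow> 'k) monoid)"
    using alt_group_iso_ext_square[OF comm_group_Gab finite_Gab, where ?'k = 'k] by (auto simp: is_iso_def)
  ultimately have "aut_of G \<circ> h \<in> iso (ext_square ?D) ?A" using iso_set_trans by blast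
  thus ?thesis using X.E.iso_sym is_isoI by blast
qed

section \<open>The central extension\<close>

lemma B2L_coset_iff:
  "\<sigma>' \<in> B2L DDd #>\<^bsub>Z2L DDd\<^esub> \<sigma> \<longleftrightarrow> (\<exists>\<tau>\<in>B2L DDd. \<sigma>' = (star \<tau> \<sigma> :: _ \<Rightarrow> 'k::field))"
  by (auto simp: r_coset_def Z2L_def conv2_DGd)

lemma B2L_coset_self:
  assumes "\<sigma> \<in> coords (B \<times> B)"
  shows "(\<sigma> :: _ \<Rightarrow> 'k::field) \<in> B2L DDd #>\<^bsub>Z2L DDd\<^esub> \<sigma>"
  unfolding B2L_coset_iff using B2L_eps2 star_eps2(1)[OF assms] by force

text \<open>Cosets are compared through inverses within \<open>B2L\<close>, in place of a group
  structure on all lazy cocycles.\<close>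

lemma B2L_coset_absorb:
  assumes \<tau>: "\<tau> \<in> B2L DDd" and \<sigma>: "(\<sigma> :: _ \<Rightarrow> 'k::field) \<in> coords (B \<times> B)"
  shows "B2L DDd #>\<^bsub>Z2L DDd\<^esub> (star \<tau> \<sigma>) = B2L DDd #>\<^bsub>Z2L DDd\<^esub> \<sigma>"
proof (intro equalityI subsetI)
  fix \<rho> assume "\<rho> \<in> B2L DDd #>\<^bsub>Z2L DDd\<^esub> (star \<tau> \<sigma>)"
  thus "\<rho> \<in> B2L DDd #>\<^bsub>Z2L DDd\<^esub> \<sigma>"
    using B2L_mult[OF _ \<tau>] by (auto simp: B2L_coset_iff star_assoc[symmetric])
next
  fix \<rho> assume "\<rho> \<in> B2L DDd #>\<^bsub>Z2L DDd\<^esub> \<sigma>"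
  then obtain \<tau>' where t: "\<tau>' \<in> B2L DDd" "\<rho> = star \<tau>' \<sigma>" unfolding B2L_coset_iff by blast
  obtain \<tau>i where i: "\<tau>i \<in> B2L DDd" "star \<tau>i \<tau> = (eps2 DDd :: _ \<Rightarrow> 'k)" using B2L_inverse[OF \<tau>] by metis
  have "star (star \<tau>' \<tau>i) (star \<tau> \<sigma>) = star \<tau>' (star (star \<tau>i \<tau>) \<sigma>)" by (simp only: star_assoc)
  also have "\<dots> = \<rho>" unfolding i(2) star_eps2(1)[OF \<sigma>] t(2) by (rule refl)
  finally have "\<rho> = star (star \<tau>' \<tau>i) (star \<tau> \<sigma>)" by (rule sym)
  thus "\<rho> \<in> B2L DDd #>\<^bsub>Z2L DDd\<^esub> (star \<tau> \<sigma>)"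
    unfolding B2L_coset_iff using B2L_mult[OF t(1) i(1)] by blast
qed

text \<open>Composing with an inner automorphism alters g and leaves the scalars d alone.\<close>

lemma Inn_coset:
  assumes "bichar G d"
  shows "Inn_Hopf DD #>\<^bsub>AutD\<^esub> (baut d) = {dg_aut g d | g. g \<in> U} \<and>
    {dg_aut g d | g. g \<in> U} \<subseteq> (carrier AutD :: ('a, 'k::field) dg_aut set)"
proof -
  have "dg_aut g (\<lambda>x y. 1) \<circ> baut d = dg_aut g d" if "g \<in> U" for g
    using dg_aut_comp[OF that one_closed bichar_trivial assms] that by simp
  thus ?thesis using dg_aut_Aut[OF _ assms] by (force simp: r_coset_def Inn_DG)
qed

text \<open>The product in \<open>OutH\<close> ranges over all representatives. The dagger of each
  of them fixes \<beta> and sends coboundaries to coboundaries, and coboundaries commute with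
  \<gamma>, so all products lie in one coset.\<close>

lemma to_OutH_mult:
  assumes c: "bichar G c" and d: "bichar G d" and \<beta>: "\<beta> \<in> Zi" and \<gamma>: "\<gamma> \<in> Zi"
  shows "to_OutH G (baut c, form \<beta>) \<otimes>\<^bsub>OutH G\<^esub> to_OutH G (baut d, form \<gamma>) =
    to_OutH G (baut (\<lambda>x y. c x y * d x y), form (restrict (\<lambda>p. \<beta> p * (\<gamma> p :: 'k::field)) B))"
proof -
  interpret I: normal "Inn_Hopf DD" "AutD :: ('a, 'k) dg_aut monoid" by (rule Inn_normal)
  let ?Z = "Z2L DDd :: ('a, 'k) dg_form monoid" and ?L = "B2L DDd :: ('a, 'k) dg_form set"
  let ?T = "\<lambda>\<phi>. tensor_map B (dagger G \<phi>) (dagger G \<phi>) :: ('a, 'k) dg_form \<Rightarrow> _"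
  have bg: "star (form \<gamma>) (form \<beta>) = form (restrict (\<lambda>p. \<beta> p * \<gamma> p) B)"
    unfolding star_form form_restrict by (rule form_cong) simp
  have "{star \<sigma>' (?T \<phi>' \<sigma>) | \<phi>' \<sigma> \<sigma>'. \<phi>' \<in> Inn_Hopf DD #>\<^bsub>AutD\<^esub> baut d \<and>
      \<sigma> \<in> ?L #>\<^bsub>?Z\<^esub> form \<beta> \<and> \<sigma>' \<in> ?L #>\<^bsub>?Z\<^esub> form \<gamma>} = ?L #>\<^bsub>?Z\<^esub> (form (restrict (\<lambda>p. \<beta> p * \<gamma> p) B))"
    (is "?A = ?C")
  proof (intro equalityI subsetI)
    fix \<rho> assume "\<rho> \<in> ?A"
    then obtain g \<tau> \<tau>' where g: "g \<in> U" and t: "\<tau> \<in> ?L" "\<tau>' \<in> ?L"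
      and \<rho>: "\<rho> = star (star \<tau>' (form \<gamma>)) (?T (dg_aut g d) (star \<tau> (form \<beta>)))"
      unfolding Inn_coset[OF d, THEN conjunct1] B2L_coset_iff by blast
    define \<psi> where "\<psi> = (dg_aut (inv g) (\<lambda>x y. d y x) :: ('a, 'k) dg_aut)"
    have \<psi>: "\<psi> \<in> carrier AutD" unfolding \<psi>_def by (rule dg_aut_Aut[OF _ bichar_flip[OF d]]) (use g in simp)
    have h: "\<psi> \<in> lin B B" "\<And>u v. u \<in> coords B \<Longrightarrow> v \<in> coords B \<Longrightarrow> \<psi> (bmult DD u v) = bmult DD (\<psi> u) (\<psi> v)"
      using \<psi> unfolding DG.Aut_Hopf_carrier hopf_map_def by simp_all
    have "?T (dg_aut g d) (star \<tau> (form \<beta>)) = star (tensor_map B \<psi> \<psi> \<tau>) (tensor_map B \<psi> \<psi> (form \<beta>))"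
      using DG.tensor_map_mult[of \<psi> \<tau> "form \<beta>"] h by (simp add: dagger_dg_aut[OF g d] \<psi>_def[symmetric] tensor_mult_DG)
    also have "tensor_map B \<psi> \<psi> (form \<beta>) = form \<beta>"
      unfolding \<psi>_def by (rule tensor_map_form[OF _ bichar_flip[OF d] \<beta>]) (use g in simp)
    finally have "\<rho> = star \<tau>' (star (star (form \<gamma>) (tensor_map B \<psi> \<psi> \<tau>)) (form \<beta>))"
      unfolding \<rho> by (simp only: star_assoc)
    \<comment> \<open>The transported coboundary passes \<gamma> and joins \<tau>' on the
      left.\<close>
    also have "\<dots> = star (star \<tau>' (tensor_map B \<psi> \<psi> \<tau>)) (star (form \<gamma>) (form \<beta>))"
      unfolding B2L_form_comm[OF B2L_Aut[OF t(1) \<psi>] \<gamma>, symmetric] by (simp only: star_assoc)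
    finally show "\<rho> \<in> ?C"
      unfolding bg B2L_coset_iff using B2L_mult[OF t(2) B2L_Aut[OF t(1) \<psi>]] by blast
  next
    fix \<rho> assume "\<rho> \<in> ?C"
    then obtain \<tau> where t: "\<tau> \<in> ?L" "\<rho> = star \<tau> (star (form \<gamma>) (form \<beta>))"
      unfolding bg B2L_coset_iff by blast
    \<comment> \<open>For the reverse inclusion the representative with g = \<one> and unmodified
      \<beta> is enough; the coboundary is put on the side of \<gamma>.\<close>
    have "?T (baut d) (form \<beta>) = form \<beta>"
      unfolding dagger_dg_aut[OF one_closed d] by (rule tensor_map_form[OF _ bichar_flip[OF d] \<beta>]) simp
    hence "\<rho> = star (star \<tau> (form \<gamma>)) (?T (baut d) (form \<beta>))"
      unfolding t(2) by (simp only: star_assoc)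
    moreover have "star \<tau> (form \<gamma>) \<in> ?L #>\<^bsub>?Z\<^esub> form \<gamma>" unfolding B2L_coset_iff using t(1) by blast
    moreover have "baut d \<in> Inn_Hopf DD #>\<^bsub>AutD\<^esub> baut d"
      unfolding Inn_coset[OF d, THEN conjunct1] by blast
    ultimately show "\<rho> \<in> ?A" using B2L_coset_self[OF form_coords[of \<beta>]] by blast
  qed
  moreover have "(Inn_Hopf DD #>\<^bsub>AutD\<^esub> baut c) <#>\<^bsub>AutD\<^esub> (Inn_Hopf DD #>\<^bsub>AutD\<^esub> baut d) =
      Inn_Hopf DD #>\<^bsub>AutD\<^esub> (baut (\<lambda>x y. c x y * d x y) :: ('a, 'k) dg_aut)"
    using I.rcos_sum[OF dg_aut_Aut[OF one_closed c] dg_aut_Aut[OF one_closed d]] by (simp add: dg_aut_mult_one[OF c d])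
  ultimately show ?thesis by (simp add: OutH_def to_OutH_def Out_Hopf_def tensor_mult_DG)
qed

lemma OutH_one: "\<one>\<^bsub>OutH G\<^esub> = to_OutH G (baut (\<lambda>x y. 1), form (restrict (\<lambda>p. 1 :: 'k::field) B))"
proof -
  interpret I: normal "Inn_Hopf DD" "AutD :: ('a, 'k) dg_aut monoid" by (rule Inn_normal)
  have "Inn_Hopf DD #>\<^bsub>AutD\<^esub> id_map B = (Inn_Hopf DD :: ('a, 'k) dg_aut set)"
    using I.coset_mult_one[OF I.subset] by simp
  moreover have "B2L DDd #>\<^bsub>Z2L DDd\<^esub> eps2 DDd = (B2L DDd :: ('a, 'k) dg_form set)"
  proof -
    have "star \<tau> (eps2 DDd) = \<tau>" if "\<tau> \<in> B2L DDd" for \<tau> :: "('a, 'k) dg_form"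
      using that star_coords by (intro star_eps2(2)) (auto simp: B2L_iff)
    thus ?thesis by (auto simp: set_eq_iff B2L_coset_iff)
  qed
  ultimately show ?thesis
    by (simp add: OutH_def to_OutH_def Out_Hopf_def H2L_def dg_aut_one form_restrict eps2_form)
qed

lemma to_OutH_closed:
  assumes "bichar G c" "\<beta> \<in> Zi"
  shows "to_OutH G (baut c, form \<beta>) \<in> carrier (OutH G :: ('a, 'k::field) dg_class monoid)"
  using dg_aut_Aut[OF one_closed assms(1)] form_Z2L[OF assms(2)]
  by (auto simp: to_OutH_def OutH_def Out_Hopf_def H2L_def carrier_FactGroup)

text \<open>The analogue of \<open>inv_AutZ\<close> in the quotient. The first component follows by
  cancellation in Out; for the second, the product of one pair of representatives is already a
  coboundary, and this fixes the coset of \<sigma>.\<close>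

lemma OutH_inverse_unique:
  assumes c: "bichar G c" and \<beta>: "\<beta> \<in> Zi"
    and Y: "Y \<in> carrier (OutH G :: ('a, 'k::field) dg_class monoid)"
    and eq: "to_OutH G (baut c, form \<beta>) \<otimes>\<^bsub>OutH G\<^esub> Y = \<one>\<^bsub>OutH G\<^esub>"
  shows "Y = to_OutH G (baut (\<lambda>x y. inverse (c x y)), form (restrict (\<lambda>p. inverse (\<beta> p)) B))"
proof -
  interpret I: normal "Inn_Hopf DD" "AutD :: ('a, 'k) dg_aut monoid" by (rule Inn_normal)
  interpret Q: group "AutD Mod Inn_Hopf DD :: ('a, 'k) dg_aut set monoid" by (rule I.factorgroup_is_group)
  let ?Z = "Z2L DDd :: ('a, 'k) dg_form monoid" and ?L = "B2L DDd :: ('a, 'k) dg_form set"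
  let ?I = "\<lambda>\<phi>. Inn_Hopf DD #>\<^bsub>AutD\<^esub> \<phi> :: ('a, 'k) dg_aut set"
  define ci where "ci = (\<lambda>x y. inverse (c x y))"
  have ci: "bichar G ci" unfolding ci_def by (rule bichar_inverse[OF c])
  obtain \<Phi> \<sigma> where Y': "Y = (\<Phi>, ?L #>\<^bsub>?Z\<^esub> \<sigma>)" "\<Phi> \<in> carrier (AutD Mod Inn_Hopf DD)" "\<sigma> \<in> carrier ?Z"
    using Y by (auto simp: OutH_def Out_Hopf_def H2L_def carrier_FactGroup)
  have \<sigma>: "\<sigma> \<in> coords (B \<times> B)" using Y'(3) by (simp add: Z2L_def cocycle2_def)
  have e1: "?I (baut c) <#>\<^bsub>AutD\<^esub> \<Phi> = Inn_Hopf DD"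
    using eq unfolding Y'(1) by (simp add: OutH_def to_OutH_def Out_Hopf_def)
  have "?I (baut c) <#>\<^bsub>AutD\<^esub> ?I (baut ci) = ?I (id_map B)"
    using I.rcos_sum[OF dg_aut_Aut[OF one_closed c] dg_aut_Aut[OF one_closed ci]] dg_aut_inverse_one(1)[OF c]
    by (simp add: ci_def)
  also have "\<dots> = Inn_Hopf DD" using I.coset_mult_one[OF I.subset] by simp
  finally have e2: "?I (baut c) <#>\<^bsub>AutD\<^esub> ?I (baut ci) = Inn_Hopf DD" .
  have cl: "?I (baut d) \<in> carrier (AutD Mod Inn_Hopf DD)" if "bichar G d" for d :: "'a \<Rightarrow> 'a \<Rightarrow> 'k"
    using dg_aut_Aut[OF one_closed that] by (auto simp: carrier_FactGroup)
  have \<Phi>: "\<Phi> = ?I (baut ci)"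
    using Q.Units_l_cancel[of "?I (baut c)" \<Phi> "?I (baut ci)"] cl[OF c] Y'(2) cl[OF ci] e1 e2 by (simp add: Q.Units_eq)
  let ?T = "tensor_map B (dagger G (baut ci)) (dagger G (baut ci)) :: ('a, 'k) dg_form \<Rightarrow> _"
  have "{star \<sigma>' (tensor_map B (dagger G \<phi>') (dagger G \<phi>') \<rho>) | \<phi>' \<rho> \<sigma>'. \<phi>' \<in> \<Phi> \<and>
      \<rho> \<in> ?L #>\<^bsub>?Z\<^esub> form \<beta> \<and> \<sigma>' \<in> ?L #>\<^bsub>?Z\<^esub> \<sigma>} = ?L"
    using eq unfolding Y'(1) by (simp add: OutH_def to_OutH_def H2L_def tensor_mult_DG)
  moreover have "baut ci \<in> \<Phi>" unfolding \<Phi> using Inn_coset[OF ci] by blast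
  ultimately have L: "star \<sigma> (?T (form \<beta>)) \<in> ?L"
    using B2L_coset_self[OF \<sigma>] B2L_coset_self[OF form_coords[of \<beta>]] by blast
  have T: "?T (form \<beta>) = form \<beta>"
    unfolding dagger_dg_aut[OF one_closed ci] by (rule tensor_map_form[OF _ bichar_flip[OF ci] \<beta>]) simp
  let ?i = "form (\<lambda>p. inverse (\<beta> p))"
  have "\<sigma> = star (star \<sigma> (form \<beta>)) ?i"
    unfolding star_assoc form_inverse(1)[OF \<beta>] star_eps2(2)[OF \<sigma>] ..
  hence "?L #>\<^bsub>?Z\<^esub> \<sigma> = ?L #>\<^bsub>?Z\<^esub> (star (star \<sigma> (form \<beta>)) ?i)" by simp
  also have "\<dots> = ?L #>\<^bsub>?Z\<^esub> ?i" by (rule B2L_coset_absorb[OF L[unfolded T] form_coords])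
  finally show ?thesis unfolding Y'(1) \<Phi> by (simp add: to_OutH_def ci_def form_restrict)
qed

text \<open>Every member of the first coset has the scalars c and every member of the second the
  scalars d, so equal cosets have equal scalars.\<close>

lemma to_OutH_fst:
  assumes c: "bichar G c" and d: "bichar G d"
    and eq: "to_OutH G (baut c, \<sigma>) = to_OutH G (baut d, \<sigma>')"
  shows "baut c = (baut d :: ('a, 'k::field) dg_aut)"
proof -
  have "{dg_aut g c | g. g \<in> U} = ({dg_aut g d | g. g \<in> U} :: ('a, 'k) dg_aut set)"
    using eq Inn_coset[OF c] Inn_coset[OF d] by (simp add: to_OutH_def)
  then obtain g where g: "g \<in> U" "baut c = dg_aut g d" using one_closed by blast
  show ?thesis by (rule dg_aut_cong) (use dg_aut_eq_iff(1)[OF c d one_closed g] in auto)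
qed

text \<open>Multiplicative from the invariant cocycles onto \<open>BLtilde\<close>; commutativity of
  its source is what makes the extension central.\<close>

definition cls :: "('a \<times> 'a \<Rightarrow> 'k::field) \<Rightarrow> ('a, 'k) dg_class" where
  "cls \<beta> = to_OutH G (baut (asym \<beta>), form \<beta>)"

lemma BLtilde_eq: "BLtilde G = cls ` (Zi :: ('a \<times> 'a \<Rightarrow> 'k::field) set)"
  by (auto simp: BLtilde_def BL_eq cls_def)

lemma cls_mult:
  assumes "\<beta> \<in> Zi" "\<gamma> \<in> Zi"
  shows "cls \<beta> \<otimes>\<^bsub>OutH G\<^esub> cls \<gamma> = cls (\<beta> \<otimes>\<^bsub>Z2inv G\<^esub> (\<gamma> :: 'a \<times> 'a \<Rightarrow> 'k::field))"
proof -
  have "baut (\<lambda>x y. asym \<beta> x y * asym \<gamma> x y) = baut (asym (restrict (\<lambda>p. \<beta> p * \<gamma> p) B))"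
    by (rule dg_aut_cong) (simp_all add: asym_def)
  thus ?thesis
    unfolding cls_def using to_OutH_mult[OF bichar_asym[OF assms(1)] bichar_asym[OF assms(2)] assms] by simp
qed

lemma cls_one: "cls \<one>\<^bsub>Z2inv G\<^esub> = (\<one>\<^bsub>OutH G\<^esub> :: ('a, 'k::field) dg_class)"
proof -
  have "baut (asym (restrict (\<lambda>p. 1) B)) = (baut (\<lambda>x y. 1) :: ('a, 'k) dg_aut)"
    by (rule dg_aut_cong) (simp_all add: asym_def)
  thus ?thesis by (simp add: cls_def OutH_one)
qed

lemma subgroup_BLtilde:
  "subgroup (BLtilde G) (OutH G :: ('a, 'k::field) dg_class monoid)"
proof
  interpret Z: comm_group "Z2inv G :: ('a \<times> 'a \<Rightarrow> 'k) monoid" by (rule comm_group_Z2inv)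
  have cl: "cls \<beta> \<in> carrier (OutH G)" if "\<beta> \<in> Zi" for \<beta> :: "'a \<times> 'a \<Rightarrow> 'k"
    unfolding cls_def by (rule to_OutH_closed[OF bichar_asym[OF that] that])
  show "BLtilde G \<subseteq> carrier (OutH G :: ('a, 'k) dg_class monoid)"
    unfolding BLtilde_eq using cl by blast
  fix X :: "('a, 'k) dg_class" assume "X \<in> BLtilde G"
  then obtain \<beta> where \<beta>: "\<beta> \<in> Zi" "X = cls \<beta>" unfolding BLtilde_eq by blast
  { fix Y :: "('a, 'k) dg_class" assume "Y \<in> BLtilde G"
    then obtain \<gamma> where \<gamma>: "\<gamma> \<in> Zi" "Y = cls \<gamma>" unfolding BLtilde_eq by blast
    show "X \<otimes>\<^bsub>OutH G\<^esub> Y \<in> BLtilde G"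
      unfolding \<beta>(2) \<gamma>(2) cls_mult[OF \<beta>(1) \<gamma>(1)] BLtilde_eq using Z.m_closed[OF \<beta>(1) \<gamma>(1)] by (rule imageI) }
  let ?j = "inv\<^bsub>Z2inv G\<^esub> \<beta>"
  note j = Z.inv_closed[OF \<beta>(1)]
  have "inv\<^bsub>OutH G\<^esub> X = cls ?j"
    unfolding m_inv_def[of "OutH G" X]
  proof (rule the_equality)
    show P: "cls ?j \<in> carrier (OutH G) \<and> X \<otimes>\<^bsub>OutH G\<^esub> cls ?j = \<one>\<^bsub>OutH G\<^esub> \<and> cls ?j \<otimes>\<^bsub>OutH G\<^esub> X = \<one>\<^bsub>OutH G\<^esub>"
      using cl[OF j] cls_mult[OF \<beta>(1) j] cls_mult[OF j \<beta>(1)]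
      by (simp add: \<beta>(2) Z.r_inv[OF \<beta>(1)] Z.l_inv[OF \<beta>(1)] cls_one del: Z2inv_simps)
    fix Y assume "Y \<in> carrier (OutH G) \<and> X \<otimes>\<^bsub>OutH G\<^esub> Y = \<one>\<^bsub>OutH G\<^esub> \<and> Y \<otimes>\<^bsub>OutH G\<^esub> X = \<one>\<^bsub>OutH G\<^esub>"
    with P show "Y = cls ?j"
      unfolding \<beta>(2) cls_def[of \<beta>] using OutH_inverse_unique[OF bichar_asym[OF \<beta>(1)] \<beta>(1)] by metis
  qed
  thus "inv\<^bsub>OutH G\<^esub> X \<in> BLtilde G" unfolding BLtilde_eq using j by simp
next
  interpret Z: comm_group "Z2inv G :: ('a \<times> 'a \<Rightarrow> 'k) monoid" by (rule comm_group_Z2inv)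
  show "\<one>\<^bsub>OutH G\<^esub> \<in> (BLtilde G :: ('a, 'k) dg_class set)"
    unfolding BLtilde_eq cls_one[symmetric] using Z.one_closed by (rule imageI)
qed

lemma group_BLtilde:
  "group ((OutH G :: ('a, 'k::field) dg_class monoid)\<lparr>carrier := BLtilde G\<rparr>)"
proof -
  interpret Z: comm_group "Z2inv G :: ('a \<times> 'a \<Rightarrow> 'k) monoid" by (rule comm_group_Z2inv)
  have "cls \<in> hom (Z2inv G) ((OutH G :: ('a, 'k) dg_class monoid)\<lparr>carrier := BLtilde G\<rparr>)"
    by (rule homI) (simp_all add: BLtilde_eq cls_mult del: Z2inv_simps)
  from Z.hom_imp_img_group[OF this] show ?thesis
    by (simp add: BLtilde_eq[symmetric] cls_one del: Z2inv_simps)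
qed

section \<open>Ordinary cohomology classes and symmetric cocycles\<close>

lemma Z2_simps [simp]:
  "\<beta> \<otimes>\<^bsub>Z2 G\<^esub> \<gamma> = restrict (\<lambda>p. \<beta> p * (\<gamma> p :: 'k::field)) B" "\<one>\<^bsub>Z2 G\<^esub> = restrict (\<lambda>p. 1 :: 'k) B"
  by (simp_all add: Z2_def)

lemma Z2inv_Z2: "\<beta> \<in> Zi \<Longrightarrow> \<beta> \<in> carrier (Z2 G)"
  by (simp add: Z2inv_def)

definition cobd :: "('a \<Rightarrow> 'k::field) \<Rightarrow> 'a \<times> 'a \<Rightarrow> 'k" where
  "cobd \<nu> = restrict (\<lambda>(g, h). \<nu> g * \<nu> h / \<nu> (g \<otimes> h)) B"

lemma B2_iff: "\<beta> \<in> B2 G \<longleftrightarrow> (\<exists>\<nu>. (\<forall>x\<in>U. \<nu> x \<noteq> (0 :: 'k::field)) \<and> \<nu> \<one> = 1 \<and> \<beta> = cobd \<nu>)"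
  by (auto simp: B2_def cobd_def Pi_iff)

lemma cobd_Z2:
  assumes nz: "\<And>x. x \<in> U \<Longrightarrow> \<nu> x \<noteq> (0 :: 'k::field)" and n1: "\<nu> \<one> = 1"
  shows "cobd \<nu> \<in> carrier (Z2 G)"
proof -
  have "cobd \<nu> (g, h) * cobd \<nu> (g \<otimes> h, t) = cobd \<nu> (h, t) * cobd \<nu> (g, h \<otimes> t)"
    if m: "g \<in> U" "h \<in> U" "t \<in> U" for g h t
    using nz[OF m(1)] nz[OF m(2)] nz[OF m(3)] nz[of "g \<otimes> h"] nz[of "h \<otimes> t"] nz[of "g \<otimes> (h \<otimes> t)"] m
    by (simp add: cobd_def m_assoc)
  thus ?thesis unfolding carrier_Z2 using nz by (auto simp: cobd_def n1)
qed

lemma subgroup_B2: "subgroup (B2 G) (Z2 G :: ('a \<times> 'a \<Rightarrow> 'k::field) monoid)"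
proof -
  interpret Z: comm_group "Z2 G :: ('a \<times> 'a \<Rightarrow> 'k) monoid" by (rule comm_group_Z2)
  show ?thesis
  proof (rule Z.subgroupI)
    show "B2 G \<subseteq> (carrier (Z2 G) :: ('a \<times> 'a \<Rightarrow> 'k) set)" by (auto simp: B2_iff intro!: cobd_Z2)
    show "B2 G \<noteq> ({} :: ('a \<times> 'a \<Rightarrow> 'k) set)" using B2_iff[of "cobd (\<lambda>_. 1) :: _ \<Rightarrow> 'k"] by (force intro: exI[of _ "\<lambda>_. 1"])
    fix \<beta> :: "'a \<times> 'a \<Rightarrow> 'k" assume "\<beta> \<in> B2 G"
    then obtain \<nu> where n: "\<And>x. x \<in> U \<Longrightarrow> \<nu> x \<noteq> 0" "\<nu> \<one> = 1" "\<beta> = cobd \<nu>" unfolding B2_iff by blast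
    have "cobd (\<lambda>x. inverse (\<nu> x)) \<otimes>\<^bsub>Z2 G\<^esub> \<beta> = \<one>\<^bsub>Z2 G\<^esub>"
      unfolding n(3) Z2_simps by (intro restrict_ext) (auto simp: cobd_def n(1) field_simps)
    hence "inv\<^bsub>Z2 G\<^esub> \<beta> = cobd (\<lambda>x. inverse (\<nu> x))"
      by (rule Z.inv_equality) (use n cobd_Z2[of "\<lambda>x. inverse (\<nu> x)"] cobd_Z2[of \<nu>] in auto)
    thus "inv\<^bsub>Z2 G\<^esub> \<beta> \<in> B2 G" unfolding B2_iff using n by (intro exI[of _ "\<lambda>x. inverse (\<nu> x)"]) auto
    fix \<gamma> :: "'a \<times> 'a \<Rightarrow> 'k" assume "\<gamma> \<in> B2 G"
    then obtain \<mu> where m: "\<And>x. x \<in> U \<Longrightarrow> \<mu> x \<noteq> 0" "\<mu> \<one> = 1" "\<gamma> = cobd \<mu>" unfolding B2_iff by blast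
    have "\<beta> \<otimes>\<^bsub>Z2 G\<^esub> \<gamma> = cobd (\<lambda>x. \<nu> x * \<mu> x)"
      unfolding n(3) m(3) Z2_simps cobd_def by (intro restrict_ext) auto
    thus "\<beta> \<otimes>\<^bsub>Z2 G\<^esub> \<gamma> \<in> B2 G" unfolding B2_iff using n m by (intro exI[of _ "\<lambda>x. \<nu> x * \<mu> x"]) auto
  qed
qed

lemma normal_B2: "B2 G \<lhd> (Z2 G :: ('a \<times> 'a \<Rightarrow> 'k::field) monoid)"
  by (rule comm_group.subgroup_imp_normal[OF comm_group_Z2 subgroup_B2])

definition coh :: "('a \<times> 'a \<Rightarrow> 'k::field) \<Rightarrow> ('a \<times> 'a \<Rightarrow> 'k) set" where
  "coh \<beta> = B2 G #>\<^bsub>Z2 G\<^esub> \<beta>"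

lemma coh_eq_iff:
  assumes "\<beta> \<in> Zi" "\<gamma> \<in> Zi"
  shows "coh \<beta> = coh \<gamma> \<longleftrightarrow> restrict (\<lambda>p. \<beta> p * inverse (\<gamma> p :: 'k::field)) B \<in> B2 G"
proof -
  interpret Z: comm_group "Z2 G :: ('a \<times> 'a \<Rightarrow> 'k) monoid" by (rule comm_group_Z2)
  interpret N: normal "B2 G" "Z2 G :: ('a \<times> 'a \<Rightarrow> 'k) monoid" by (rule normal_B2)
  note b = Z2inv_Z2[OF assms(1)] and c = Z2inv_Z2[OF assms(2)]
  have i: "restrict (\<lambda>p. \<beta> p * inverse (\<gamma> p)) B = \<beta> \<otimes>\<^bsub>Z2 G\<^esub> inv\<^bsub>Z2 G\<^esub> \<gamma>"
    unfolding Z2_simps inv_Z2[OF assms(2)] by (intro restrict_ext) simp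
  show ?thesis
  proof
    assume "coh \<beta> = coh \<gamma>"
    hence "\<beta> \<in> B2 G #>\<^bsub>Z2 G\<^esub> \<gamma>" using Z.rcos_self[OF b subgroup_B2] by (simp add: coh_def)
    then obtain \<delta> where "\<delta> \<in> B2 G" "\<beta> = \<delta> \<otimes>\<^bsub>Z2 G\<^esub> \<gamma>" unfolding r_coset_def by blast
    thus "restrict (\<lambda>p. \<beta> p * inverse (\<gamma> p)) B \<in> B2 G"
      unfolding i using Z.inv_solve_right'[OF _ b c] N.subset by (metis subset_iff)
  next
    assume r: "restrict (\<lambda>p. \<beta> p * inverse (\<gamma> p)) B \<in> B2 G"
    have "\<beta> = (\<beta> \<otimes>\<^bsub>Z2 G\<^esub> inv\<^bsub>Z2 G\<^esub> \<gamma>) \<otimes>\<^bsub>Z2 G\<^esub> \<gamma>"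
      using b c by (simp add: Z.m_assoc del: Z2_simps)
    hence "\<beta> \<in> B2 G #>\<^bsub>Z2 G\<^esub> \<gamma>" using r unfolding i r_coset_def by blast
    from Z.repr_independence[OF this c subgroup_B2] show "coh \<beta> = coh \<gamma>" by (simp add: coh_def)
  qed
qed

lemma form_coset_eq_iff:
  assumes \<beta>: "\<beta> \<in> Zi" and \<gamma>: "\<gamma> \<in> Zi"
  shows "B2L DDd #>\<^bsub>Z2L DDd\<^esub> form \<beta> = B2L DDd #>\<^bsub>Z2L DDd\<^esub> form \<gamma> \<longleftrightarrow>
    form (\<lambda>p. \<beta> p * inverse (\<gamma> p)) \<in> (B2L DDd :: (_ \<Rightarrow> 'k::field) set)"
    (is "?l = ?r \<longleftrightarrow> ?m \<in> ?L")
proof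
  assume "?l = ?r"
  hence "form \<beta> \<in> ?r" using B2L_coset_self[OF form_coords] by blast
  then obtain \<tau> where t: "\<tau> \<in> ?L" "form \<beta> = star \<tau> (form \<gamma>)" unfolding B2L_coset_iff by blast
  have "\<tau> \<in> coords (B \<times> B)" using t(1) star_coords by (auto simp: B2L_iff)
  hence "\<tau> = star (form \<beta>) (form (\<lambda>p. inverse (\<gamma> p)))"
    unfolding t(2) star_assoc form_inverse(1)[OF \<gamma>] by (simp add: star_eps2(2))
  thus "?m \<in> ?L" using t(1) by (simp add: star_form)
next
  assume m: "?m \<in> ?L"
  have "star ?m (form \<gamma>) = form \<beta>"
    unfolding star_form by (rule form_cong) (simp add: Z2invD(2)[OF \<gamma>])
  thus "?l = ?r" using B2L_coset_absorb[OF m form_coords[of \<gamma>]] by simp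
qed

text \<open>Among invariant cocycles these are the ones with trivial b, that is, the kernel of the
  map to B_alt before passing to classes; see \<open>asym_one_iff\<close>.\<close>

definition symm :: "('a \<times> 'a \<Rightarrow> 'k::field) \<Rightarrow> bool" where
  "symm \<beta> \<longleftrightarrow> (\<forall>g\<in>U. \<forall>h\<in>U. \<beta> (g, h) = \<beta> (h, g))"

lemma asym_one_iff:
  assumes "\<beta> \<in> Zi"
  shows "baut (asym \<beta>) = (id_map B :: ('a, 'k::field) dg_aut) \<longleftrightarrow> symm \<beta>"
proof
  assume "baut (asym \<beta>) = (id_map B :: ('a, 'k) dg_aut)"
  hence e: "baut (asym \<beta>) = (baut (\<lambda>x y. 1) :: ('a, 'k) dg_aut)" by (simp add: dg_aut_one)
  show "symm \<beta>" unfolding symm_def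
  proof (intro ballI)
    fix g h assume gh: "g \<in> U" "h \<in> U"
    have "asym \<beta> h g = 1" by (rule dg_aut_eq_iff(1)[OF bichar_asym[OF assms] bichar_trivial _ _ e gh(2,1)]) simp_all
    thus "\<beta> (g, h) = \<beta> (h, g)" using Z2invD(2)[OF assms gh(2,1)] by (simp add: asym_def)
  qed
next
  assume s: "symm \<beta>"
  have "baut (asym \<beta>) = (baut (\<lambda>x y. 1) :: ('a, 'k) dg_aut)"
  proof (rule dg_aut_cong)
    fix x y assume m: "x \<in> U" "y \<in> U"
    have "\<beta> (y, x) = \<beta> (x, y)" using s m by (simp add: symm_def)
    thus "asym \<beta> x y = 1" using Z2invD(2)[OF assms m] by (simp add: asym_def)
  qed simp
  thus "baut (asym \<beta>) = (id_map B :: ('a, 'k) dg_aut)" by (simp add: dg_aut_one)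
qed

lemma cls_symm:
  assumes "\<beta> \<in> Zi" "symm (\<beta> :: 'a \<times> 'a \<Rightarrow> 'k::field)"
  shows "cls \<beta> = to_OutH G (id_map B, form \<beta>)"
  using assms(2) by (simp add: cls_def asym_one_iff[OF assms(1), symmetric])

lemma symm_BL:
  "(id_map B, form \<beta>) \<in> BL G \<Longrightarrow> \<beta> \<in> Zi \<Longrightarrow> symm (\<beta> :: 'a \<times> 'a \<Rightarrow> 'k::field)"
proof -
  assume "(id_map B, form \<beta>) \<in> BL G" and \<beta>: "\<beta> \<in> Zi"
  then obtain \<gamma> where \<gamma>: "\<gamma> \<in> Zi" "id_map B = baut (asym \<gamma>)" "form \<beta> = form \<gamma>"
    unfolding BL_eq by blast
  have "symm \<gamma>" using asym_one_iff[OF \<gamma>(1)] \<gamma>(2) by simp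
  thus "symm \<beta>" using form_inj[OF \<gamma>(3)] by (auto simp: symm_def)
qed

text \<open>Symmetry of \<open>\<beta> / \<gamma> = d\<nu>\<close> means \<open>\<nu>(g h) = \<nu>(h g)\<close>, so \<open>\<nu>\<close> is a class function and
  gives a central element of \<open>DG\<close>.\<close>

lemma cls_eq_iff:
  assumes \<beta>: "\<beta> \<in> Zi" "symm \<beta>" and \<gamma>: "\<gamma> \<in> Zi" "symm (\<gamma> :: 'a \<times> 'a \<Rightarrow> 'k::field)"
  shows "cls \<beta> = cls \<gamma> \<longleftrightarrow> coh \<beta> = coh \<gamma>"
proof -
  define \<delta> where "\<delta> = restrict (\<lambda>p. \<beta> p * inverse (\<gamma> p)) B"
  have \<delta>: "\<delta> \<in> Zi"
    using Z2inv_mult[OF \<beta>(1) Z2inv_inverse[OF \<gamma>(1)]] by (simp add: \<delta>_def restrict_def if_distrib cong: if_cong)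
  have "cls \<beta> = cls \<gamma> \<longleftrightarrow> form (\<lambda>p. \<beta> p * inverse (\<gamma> p)) \<in> B2L DDd"
    unfolding cls_symm[OF \<beta>] cls_symm[OF \<gamma>] form_coset_eq_iff[OF \<beta>(1) \<gamma>(1), symmetric] by (simp add: to_OutH_def)
  also have "\<dots> \<longleftrightarrow> form \<delta> \<in> B2L DDd" by (simp add: \<delta>_def form_restrict)
  also have "\<dots> \<longleftrightarrow> \<delta> \<in> B2 G"
  proof
    assume "\<delta> \<in> B2 G"
    then obtain \<nu> where n: "\<And>x. x \<in> U \<Longrightarrow> \<nu> x \<noteq> 0" "\<nu> \<one> = 1" "\<delta> = cobd \<nu>" unfolding B2_iff by blast
    have c: "\<nu> (g \<otimes> h) = \<nu> (h \<otimes> g)" if m: "g \<in> U" "h \<in> U" for g h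
    proof -
      have "\<delta> (g, h) = \<delta> (h, g)" using \<beta>(2) \<gamma>(2) m by (simp add: \<delta>_def symm_def)
      thus ?thesis using n(1)[OF m(1)] n(1)[OF m(2)] n(1)[of "g \<otimes> h"] n(1)[of "h \<otimes> g"] m
        by (simp add: n(3) cobd_def field_simps)
    qed
    show "form \<delta> \<in> B2L DDd"
    proof (rule form_coboundary[of \<nu>])
      fix x t assume m: "x \<in> U" "t \<in> U"
      \<comment> \<open>The conjugate t x t^{-1} and x itself are the products of t and x t^{-1} in
        the two orders.\<close>
      show "\<nu> (cj t x) = \<nu> x" using c[of t "x \<otimes> inv t"] m by (simp add: conj_by_def m_assoc)
    qed (use n in \<open>auto simp: cobd_def\<close>)
  qed (rule form_B2L_imp_B2[OF \<delta>])
  finally show ?thesis unfolding coh_eq_iff[OF \<beta>(1) \<gamma>(1)] \<delta>_def .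
qed

text \<open>With x = t r t^{-1} for a fixed representative r of the class, put \<nu>(x) = c(r, t).
  Two choices of t differ by an element of the centraliser of r, on which c(r, -) is 1 by
  hypothesis.\<close>

lemma class_function_twist:
  fixes c :: "'a \<Rightarrow> 'a \<Rightarrow> 'k::field"
  assumes c: "bichar G c" and triv: "\<And>x t. x \<in> U \<Longrightarrow> t \<in> Cent G x \<Longrightarrow> c x t = 1"
  obtains \<nu> where "\<And>x. x \<in> U \<Longrightarrow> \<nu> x \<noteq> 0" "\<nu> \<one> = 1"
    "\<And>s x. s \<in> U \<Longrightarrow> x \<in> U \<Longrightarrow> \<nu> (cj s x) = c x s * \<nu> x"
proof -
  define K where "K = (\<lambda>x. {cj s x | s. s \<in> U})"
  \<comment> \<open>The choice is made from the set K x, so conjugate elements receive the same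
    representative.\<close>
  define r where "r = (\<lambda>x. SOME y. y \<in> K x)"
  define t where "t = (\<lambda>x. SOME s. s \<in> U \<and> x = cj s (r x))"
  have K_cj: "K (cj s x) = K x" if m: "s \<in> U" "x \<in> U" for s x
  proof (intro equalityI subsetI)
    fix y assume "y \<in> K x"
    then obtain u where u: "u \<in> U" "y = cj u x" by (auto simp: K_def)
    hence "y = cj (u \<otimes> inv s) (cj s x)" using m by (simp add: cj_cj m_assoc)
    thus "y \<in> K (cj s x)" unfolding K_def using u(1) m(1) by blast
  qed (use m in \<open>auto simp: K_def cj_cj\<close>)
  have rK: "r x \<in> K x" if "x \<in> U" for x
    unfolding r_def by (rule someI[of _ "cj \<one> x"]) (auto simp: K_def)
  have rc: "r x \<in> U" if "x \<in> U" for x using rK[OF that] that by (auto simp: K_def)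
  have t: "t x \<in> U \<and> x = cj (t x) (r x)" if x: "x \<in> U" for x
  proof -
    obtain s where s: "s \<in> U" "r x = cj s x" using rK[OF x] by (auto simp: K_def)
    show ?thesis unfolding t_def by (rule someI[of _ "inv s"]) (use s x in simp)
  qed
  define \<nu> where "\<nu> = (\<lambda>x. c (r x) (t x))"
  show thesis
  proof
    show "\<nu> x \<noteq> 0" if "x \<in> U" for x
      unfolding \<nu>_def using bicharD(1)[OF c rc[OF that]] t[OF that] by blast
    have "r \<one> = \<one>" using rK[OF one_closed] by (auto simp: K_def)
    thus "\<nu> \<one> = 1" unfolding \<nu>_def using t[OF one_closed] by (simp add: bichar_one[OF c])
    fix s x assume m: "s \<in> U" "x \<in> U"
    note sx = cj_closed[OF m]
    have r: "r (cj s x) = r x" by (simp add: r_def K_cj[OF m])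
    \<comment> \<open>Both elements conjugate r x to the conjugate of x by s: the chosen one, and
      the one obtained through t x.\<close>
    let ?u = "t (cj s x)" and ?v = "s \<otimes> t x"
    have mem: "?u \<in> U" "t x \<in> U" "r x \<in> U" using t[OF sx] t[OF m(2)] rc[OF m(2)] by auto
    have "cj ?u (r x) = cj s x" using t[OF sx] r by simp
    also have "\<dots> = cj s (cj (t x) (r x))" using t[OF m(2)] by simp
    finally have e: "cj ?u (r x) = cj ?v (r x)" using m mem by (simp add: cj_cj)
    have "cj (inv ?u \<otimes> ?v) (r x) = cj (inv ?u) (cj ?u (r x))" unfolding e using m mem by (simp add: cj_cj)
    hence f: "cj (inv ?u \<otimes> ?v) (r x) = r x" using mem by simp
    have "cj (inv ?u \<otimes> ?v) (r x) \<otimes> (inv ?u \<otimes> ?v) = inv ?u \<otimes> ?v \<otimes> r x"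
      using m mem by (simp add: conj_by_def m_assoc)
    hence "inv ?u \<otimes> ?v \<otimes> r x = r x \<otimes> (inv ?u \<otimes> ?v)" unfolding f by simp
    hence "inv ?u \<otimes> ?v \<in> Cent G (r x)" using m mem by (simp add: Cent_def)
    hence "c (r x) (inv ?u \<otimes> ?v) = 1" by (rule triv[OF mem(3)])
    moreover have "c (r x) ?v = c (r x) ?u * c (r x) (inv ?u \<otimes> ?v)"
      using bicharD(3)[OF c mem(1) _ mem(3), of "inv ?u \<otimes> ?v"] m mem by simp
    ultimately have "\<nu> (cj s x) = c (r x) s * c (r x) (t x)"
      unfolding \<nu>_def r using bicharD(3)[OF c m(1) mem(2) mem(3)] by simp
    also have "c (r x) s = c x s"
      using bichar_cj(1)[OF c mem(2,3) m(1)] t[OF m(2)] by simp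
    finally show "\<nu> (cj s x) = c x s * \<nu> x" by (simp add: \<nu>_def)
  qed
qed

text \<open>Symmetry of \<open>\<beta> d\<nu>\<close> requires \<open>\<nu>(g h) = (\<beta>(g, h) / \<beta>(h, g)) \<nu>(h g)\<close>, where \<open>g h\<close> is the conjugate
  of \<open>h g\<close> by \<open>g\<close>; being distinguished makes this consistent on each conjugacy class.\<close>

lemma symmetric_representative:
  assumes \<beta>: "\<beta> \<in> Zi" and dist: "distinguished G (\<beta> :: 'a \<times> 'a \<Rightarrow> 'k::field)"
  obtains \<gamma> where "\<gamma> \<in> Zi" "symm \<gamma>" "coh \<gamma> = coh \<beta>"
proof -
  let ?c = "asym \<beta>"
  note c = bichar_asym[OF \<beta>] and b = Z2invD[OF \<beta>]
  have triv: "?c x t = 1" if "x \<in> U" "t \<in> Cent G x" for x t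
  proof -
    have "t \<in> U" using that(2) by (simp add: Cent_def)
    thus ?thesis using dist[unfolded distinguished_def, rule_format, OF that] that(1) b(2)[of x t] by (simp add: asym_def)
  qed
  obtain \<nu> where n: "\<And>x. x \<in> U \<Longrightarrow> \<nu> x \<noteq> 0" "\<nu> \<one> = 1"
    "\<And>s x. s \<in> U \<Longrightarrow> x \<in> U \<Longrightarrow> \<nu> (cj s x) = ?c x s * \<nu> x"
    using class_function_twist[OF c triv] by blast
  have d: "cobd \<nu> \<in> carrier (Z2 G)" by (rule cobd_Z2) (use n in auto)
  have dinv: "cobd \<nu> (cj t g, cj t h) = cobd \<nu> (g, h)"
    if m: "g \<in> U" "h \<in> U" "t \<in> U" for g h t
  proof -
    \<comment> \<open>Conjugation by t multiplies numerator and denominator of the coboundary by the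
      same factor c(g, t) c(h, t), so it is invariant although \<nu> is not.\<close>
    have "\<nu> (cj t g \<otimes> cj t h) = ?c g t * ?c h t * \<nu> (g \<otimes> h)"
      using n(3)[OF m(3), of "g \<otimes> h"] m bicharD(2)[OF c m(1,2,3)] by (simp add: cj_mult)
    thus ?thesis using m n(3)[OF m(3,1)] n(3)[OF m(3,2)] bicharD(1)[OF c m(1,3)] bicharD(1)[OF c m(2,3)]
      by (simp add: cobd_def)
  qed
  have dz: "cobd \<nu> \<in> Zi"
    using d dinv[of _ _ "inv _"] by (auto simp: Z2inv_def cj_eq')
  let ?g = "restrict (\<lambda>p. \<beta> p * cobd \<nu> p) B"
  have g: "?g \<in> Zi" by (rule Z2inv_mult[OF \<beta> dz])
  have "?g (x, y) = ?g (y, x)" if m: "x \<in> U" "y \<in> U" for x y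
  proof -
    have "\<nu> (x \<otimes> y) = ?c (y \<otimes> x) x * \<nu> (y \<otimes> x)"
      using n(3)[of x "y \<otimes> x"] m by (simp add: conj_by_def m_assoc)
    \<comment> \<open>An antisymmetrisation is 1 at (x, x), so only the factor y of y x
      counts.\<close>
    also have "?c (y \<otimes> x) x = ?c y x"
      using bicharD(2)[OF c m(2,1,1)] b(2)[OF m(1,1)] by (simp add: asym_def)
    finally have "\<nu> (x \<otimes> y) = \<beta> (x, y) / \<beta> (y, x) * \<nu> (y \<otimes> x)" by (simp add: asym_def)
    thus ?thesis using m b(2)[OF m] b(2)[OF m(2,1)] n(1)[of "y \<otimes> x"] n(1)[of "x \<otimes> y"] by (simp add: cobd_def field_simps)
  qed
  hence s: "symm ?g" by (simp add: symm_def)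
  have "restrict (\<lambda>p. ?g p * inverse (\<beta> p)) B = cobd \<nu>"
    using b(2) by (intro ext) (auto simp: cobd_def restrict_def)
  hence "coh ?g = coh \<beta>" unfolding coh_eq_iff[OF g \<beta>] B2_iff using n by auto
  with g s show thesis by (rule that)
qed

lemma symm_distinguished: "symm \<beta> \<Longrightarrow> distinguished G \<beta>"
  by (auto simp: symm_def distinguished_def Cent_def)

text \<open>Distinguished invariant cocycles may be replaced by symmetric ones without changing the
  class, and symmetric ones are distinguished.\<close>

lemma carrier_H2distinv:
  "carrier (H2distinv G) = coh ` {\<beta> \<in> Zi. symm (\<beta> :: 'a \<times> 'a \<Rightarrow> 'k::field)}"
proof -
  have "X \<in> coh ` {\<beta> \<in> Zi. symm \<beta>}" if X: "X \<in> carrier (H2distinv G)" for X :: "('a \<times> 'a \<Rightarrow> 'k) set"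
  proof -
    obtain \<beta> where b: "\<beta> \<in> Zi" "distinguished G \<beta>" "X = coh \<beta>"
      using X by (auto simp: H2distinv_def coh_def)
    obtain \<gamma> where "\<gamma> \<in> Zi" "symm \<gamma>" "coh \<gamma> = coh \<beta>" by (rule symmetric_representative[OF b(1,2)])
    thus ?thesis unfolding b(3) by (intro image_eqI[of _ _ \<gamma>]) simp_all
  qed
  thus ?thesis using symm_distinguished by (auto simp: H2distinv_def coh_def)
qed

lemma H2distinv_mult:
  assumes "\<beta> \<in> Zi" "\<gamma> \<in> Zi"
  shows "coh \<beta> \<otimes>\<^bsub>H2distinv G\<^esub> coh \<gamma> = coh (\<beta> \<otimes>\<^bsub>Z2inv G\<^esub> (\<gamma> :: 'a \<times> 'a \<Rightarrow> 'k::field))"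
  using normal.rcos_sum[OF normal_B2 Z2inv_Z2[OF assms(1)] Z2inv_Z2[OF assms(2)]]
  by (simp add: H2distinv_def H2_def coh_def)

lemma group_symm: "group ((Z2inv G :: ('a \<times> 'a \<Rightarrow> 'k::field) monoid)\<lparr>carrier := {\<beta> \<in> Zi. symm \<beta>}\<rparr>)"
proof -
  interpret Z: comm_group "Z2inv G :: ('a \<times> 'a \<Rightarrow> 'k) monoid" by (rule comm_group_Z2inv)
  have "subgroup {\<beta> \<in> Zi. symm \<beta>} (Z2inv G :: ('a \<times> 'a \<Rightarrow> 'k) monoid)"
  proof (rule Z.subgroupI)
    have "restrict (\<lambda>p. 1 :: 'k) B \<in> {\<beta> \<in> Zi. symm \<beta>}" using Z2inv_one by (simp add: symm_def)
    thus "{\<beta> \<in> Zi. symm (\<beta> :: 'a \<times> 'a \<Rightarrow> 'k)} \<noteq> {}" by blast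
  next
    fix \<beta> \<gamma> :: "'a \<times> 'a \<Rightarrow> 'k"
    assume b: "\<beta> \<in> {\<beta> \<in> Zi. symm \<beta>}" and c: "\<gamma> \<in> {\<beta> \<in> Zi. symm \<beta>}"
    show "\<beta> \<otimes>\<^bsub>Z2inv G\<^esub> \<gamma> \<in> {\<beta> \<in> Zi. symm \<beta>}"
      using b c Z2inv_mult[of \<beta> \<gamma>] by (simp add: symm_def)
  next
    fix \<beta> :: "'a \<times> 'a \<Rightarrow> 'k" assume b: "\<beta> \<in> {\<beta> \<in> Zi. symm \<beta>}"
    have "restrict (\<lambda>p. inverse (\<beta> p)) B \<otimes>\<^bsub>Z2inv G\<^esub> \<beta> = \<one>\<^bsub>Z2inv G\<^esub>"
      using b Z2invD(2)[of \<beta>] unfolding Z2inv_simps by (intro restrict_ext) auto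
    hence "inv\<^bsub>Z2inv G\<^esub> \<beta> = restrict (\<lambda>p. inverse (\<beta> p)) B"
      by (rule Z.inv_equality) (use b Z2inv_inverse in auto)
    thus "inv\<^bsub>Z2inv G\<^esub> \<beta> \<in> {\<beta> \<in> Zi. symm \<beta>}"
      using b Z2inv_inverse[of \<beta>] by (simp add: symm_def)
  qed auto
  thus ?thesis by (rule subgroup.subgroup_is_group) (rule Z.is_group)
qed

text \<open>The group structure is the image of that of the symmetric invariant cocycles under the
  homomorphism \<open>coh\<close>.\<close>

lemma group_H2distinv: "group (H2distinv G :: ('a \<times> 'a \<Rightarrow> 'k::field) set monoid)"
proof -
  let ?S = "(Z2inv G :: ('a \<times> 'a \<Rightarrow> 'k) monoid)\<lparr>carrier := {\<beta> \<in> Zi. symm \<beta>}\<rparr>"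
  interpret S: group ?S by (rule group_symm)
  interpret Z: comm_group "Z2 G :: ('a \<times> 'a \<Rightarrow> 'k) monoid" by (rule comm_group_Z2)
  interpret N: normal "B2 G" "Z2 G :: ('a \<times> 'a \<Rightarrow> 'k) monoid" by (rule normal_B2)
  have h: "coh \<in> hom ?S (H2distinv G)"
    by (rule homI) (simp_all add: carrier_H2distinv H2distinv_mult del: Z2inv_simps)
  have "coh \<one>\<^bsub>Z2inv G\<^esub> = (\<one>\<^bsub>H2distinv G\<^esub> :: ('a \<times> 'a \<Rightarrow> 'k) set)"
    using Z.coset_mult_one[OF N.subset] by (simp add: coh_def H2distinv_def H2_def)
  with S.hom_imp_img_group[OF h] show ?thesis by (simp add: carrier_H2distinv[symmetric])
qed

text \<open>The representative has to be symmetric: for any other invariant one b is nontrivial, and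
  its class in \<open>BLtilde\<close> would not map to the identity of B_alt. By
  \<open>cls_eq_iff\<close> the choice does not matter.\<close>

definition iota :: "('a \<times> 'a \<Rightarrow> 'k::field) set \<Rightarrow> ('a, 'k) dg_class" where
  "iota X = cls (SOME \<beta>. \<beta> \<in> Zi \<and> symm \<beta> \<and> coh \<beta> = X)"

text \<open>The choice of preimage does not matter, since by \<open>to_OutH_fst\<close> the scalars
  can be read off from the coset; see \<open>proj_to_OutH\<close>.\<close>

definition proj :: "('a, 'k::field) dg_class \<Rightarrow> ('a, 'k) dg_aut" where
  "proj X = fst (SOME x. x \<in> BL G \<and> to_OutH G x = X)"

lemma iota_coh:
  assumes "\<beta> \<in> Zi" "symm (\<beta> :: 'a \<times> 'a \<Rightarrow> 'k::field)"
  shows "iota (coh \<beta>) = cls \<beta>"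
proof -
  define \<gamma> where "\<gamma> = (SOME \<gamma>. \<gamma> \<in> Zi \<and> symm \<gamma> \<and> coh \<gamma> = coh \<beta>)"
  have "\<gamma> \<in> Zi \<and> symm \<gamma> \<and> coh \<gamma> = coh \<beta>"
    unfolding \<gamma>_def by (rule someI[of _ \<beta>]) (use assms in simp)
  thus ?thesis unfolding iota_def \<gamma>_def[symmetric] using cls_eq_iff[OF _ _ assms] by blast
qed

lemma proj_to_OutH:
  assumes "x \<in> (BL G :: ('a, 'k::field) dg_pair set)"
  shows "proj (to_OutH G x) = fst x"
proof -
  define y where "y = (SOME y. y \<in> (BL G :: ('a, 'k) dg_pair set) \<and> to_OutH G y = to_OutH G x)"
  have y: "y \<in> BL G \<and> to_OutH G y = to_OutH G x" unfolding y_def by (rule someI[of _ x]) (use assms in simp)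
  have "fst y = fst x"
    using y assms to_OutH_fst[OF bichar_asym bichar_asym] unfolding BL_eq by fastforce
  thus ?thesis by (simp add: proj_def y_def)
qed

lemma proj_cls:
  assumes "\<beta> \<in> Zi"
  shows "proj (cls \<beta>) = (baut (asym \<beta>) :: ('a, 'k::field) dg_aut)"
  unfolding cls_def by (subst proj_to_OutH) (use assms in \<open>auto simp: BL_eq\<close>)

text \<open>All three groups are parametrised by invariant cocycles: the kernel of
  \<open>proj\<close> consists of the classes of symmetric \<beta>, and commutation is inherited
  from the abelian group \<open>Z2inv\<close>.\<close>

lemma central_extension_BLtilde:
  "central_extension (H2distinv G :: ('a \<times> 'a \<Rightarrow> 'k::{alg_closed_field, field_char_0}) set monoid)
     ((OutH G :: ('a, 'k) dg_class monoid)\<lparr>carrier := BLtilde G\<rparr>)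
     (AutD\<lparr>carrier := Balt G\<rparr>) iota proj"
proof -
  interpret Z: comm_group "Z2inv G :: ('a \<times> 'a \<Rightarrow> 'k) monoid" by (rule comm_group_Z2inv)
  let ?E = "(OutH G :: ('a, 'k) dg_class monoid)\<lparr>carrier := BLtilde G\<rparr>"
  let ?Q = "(AutD :: ('a, 'k) dg_aut monoid)\<lparr>carrier := Balt G\<rparr>"
  have sub: "subgroup (Balt G) (AutD :: ('a, 'k) dg_aut monoid)"
  proof -
    have "group (AutD :: ('a, 'k) dg_aut monoid)" by (rule group_Aut)
    from group.incl_subgroup[OF this subgroup_Bsub subgroup_Balt] show ?thesis .
  qed
  have Balt: "baut (asym \<beta>) \<in> Balt G" if "\<beta> \<in> Zi" for \<beta> :: "'a \<times> 'a \<Rightarrow> 'k"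
    unfolding Balt_eq using bichar_asym[OF that] alternating_asym[OF that] by blast
  have pm: "proj (cls \<beta> \<otimes>\<^bsub>OutH G\<^esub> cls \<gamma>) = proj (cls \<beta>) \<circ> proj (cls \<gamma>)"
    if b: "\<beta> \<in> Zi" and c: "\<gamma> \<in> Zi" for \<beta> \<gamma> :: "'a \<times> 'a \<Rightarrow> 'k"
    unfolding cls_mult[OF that] proj_cls[OF b] proj_cls[OF c] proj_cls[OF Z.m_closed[OF that]]
      dg_aut_mult_one[OF bichar_asym[OF b] bichar_asym[OF c]]
    by (rule dg_aut_cong) (simp_all add: asym_def)
  have im: "symm (\<beta> \<otimes>\<^bsub>Z2inv G\<^esub> \<gamma>)" if "symm \<beta>" "symm \<gamma>" for \<beta> \<gamma> :: "'a \<times> 'a \<Rightarrow> 'k"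
    using that by (simp add: symm_def)
  show ?thesis
    unfolding central_extension_def
  proof (intro conjI)
    show "group (H2distinv G :: ('a \<times> 'a \<Rightarrow> 'k) set monoid)" by (rule group_H2distinv)
    show "group ?E" by (rule group_BLtilde)
    show "group ?Q" by (rule subgroup.subgroup_is_group[OF sub group_Aut])
    show "iota \<in> hom (H2distinv G) ?E"
    proof (rule homI)
      fix X Y :: "('a \<times> 'a \<Rightarrow> 'k) set" assume "X \<in> carrier (H2distinv G)" "Y \<in> carrier (H2distinv G)"
      then obtain \<beta> \<gamma> where b: "\<beta> \<in> Zi" "symm \<beta>" "X = coh \<beta>"
        and c: "\<gamma> \<in> Zi" "symm \<gamma>" "Y = coh \<gamma>" unfolding carrier_H2distinv by blast
      show "iota (X \<otimes>\<^bsub>H2distinv G\<^esub> Y) = iota X \<otimes>\<^bsub>?E\<^esub> iota Y"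
        unfolding b(3) c(3) H2distinv_mult[OF b(1) c(1)] iota_coh[OF b(1,2)] iota_coh[OF c(1,2)]
          iota_coh[OF Z.m_closed[OF b(1) c(1)] im[OF b(2) c(2)]] by (simp add: cls_mult b(1) c(1) del: Z2inv_simps)
    qed (auto simp: carrier_H2distinv iota_coh BLtilde_eq)
    show "inj_on iota (carrier (H2distinv G :: ('a \<times> 'a \<Rightarrow> 'k) set monoid))"
      by (rule inj_onI) (auto simp: carrier_H2distinv iota_coh cls_eq_iff)
    show "proj \<in> hom ?E ?Q"
      by (rule homI) (auto simp: BLtilde_eq pm proj_cls Balt)
    show "proj ` carrier ?E = carrier ?Q"
    proof -
      have "proj ` BLtilde G = fst ` (BL G :: ('a, 'k) dg_pair set)"
        unfolding BLtilde_def image_image by (rule image_cong[OF refl proj_to_OutH])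
      thus ?thesis by (simp add: fst_BL_surj)
    qed
    have "iota ` carrier (H2distinv G) = cls ` {\<beta> \<in> Zi. symm (\<beta> :: 'a \<times> 'a \<Rightarrow> 'k)}"
      unfolding carrier_H2distinv image_image by (rule image_cong) (auto simp: iota_coh)
    thus "iota ` carrier (H2distinv G :: ('a \<times> 'a \<Rightarrow> 'k) set monoid) = kernel ?E ?Q proj"
      by (auto simp: kernel_def BLtilde_eq proj_cls asym_one_iff)
    show "\<forall>a\<in>carrier (H2distinv G). \<forall>x\<in>carrier ?E. iota a \<otimes>\<^bsub>?E\<^esub> x = x \<otimes>\<^bsub>?E\<^esub> iota a"
    proof (intro ballI)
      fix a :: "('a \<times> 'a \<Rightarrow> 'k) set" and x assume "a \<in> carrier (H2distinv G)" "x \<in> carrier ?E"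
      then obtain \<beta> \<gamma> where b: "\<beta> \<in> Zi" "symm \<beta>" "a = coh \<beta>"
        and c: "\<gamma> \<in> Zi" "x = cls \<gamma>" unfolding carrier_H2distinv by (auto simp: BLtilde_eq)
      show "iota a \<otimes>\<^bsub>?E\<^esub> x = x \<otimes>\<^bsub>?E\<^esub> iota a"
        by (simp add: b(3) c(2) iota_coh[OF b(1,2)] cls_mult b(1) c(1) Z.m_comm[OF b(1) c(1)] del: Z2inv_simps)
    qed
  qed
qed

end

section \<open>Modules over the double\<close>

lemma scl_simps [simp]:
  "scl a (scl b v) = scl (a * b) (v :: 'i \<Rightarrow> 'k::field)" "scl 1 v = v" "scl 0 v = (\<lambda>_. 0)" "scl a (\<lambda>_. 0) = (\<lambda>_. 0 :: 'k)"
  by (simp_all add: scl_def mult.assoc)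

lemma scl_cancel: "a \<noteq> 0 \<Longrightarrow> scl a u = scl a v \<longleftrightarrow> u = (v :: 'i \<Rightarrow> 'k::field)"
  by (auto simp: scl_def fun_eq_iff)

lemma scl_coords: "v \<in> coords I \<Longrightarrow> scl a v \<in> coords I" for v :: "'i \<Rightarrow> 'k::field"
  by (simp add: coords_def scl_def)

lemma sum_coords: "(\<And>a. a \<in> A \<Longrightarrow> v a \<in> coords I) \<Longrightarrow> (\<lambda>l. \<Sum>a\<in>A. c a * v a l) \<in> coords I"
  for v :: "'a \<Rightarrow> 'i \<Rightarrow> 'k::field"
  by (simp add: coords_def)

lemma linI:
  assumes "\<And>v l. f v l = (\<Sum>i\<in>I. v i * f (ket i) l)" "\<And>i. i \<in> I \<Longrightarrow> f (ket i) \<in> coords J"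
  shows "f \<in> lin I J"
proof -
  have "f = lin_ext I (\<lambda>i. f (ket i))" unfolding lin_ext_def by (intro ext) (rule assms(1))
  thus ?thesis using assms(2) by (simp add: lin_def)
qed

lemma lin_at: "f \<in> lin I J \<Longrightarrow> f v l = (\<Sum>i\<in>I. v i * f (ket i) l)"
  using linE[of f I J v] by simp

lemma lin_sum_maps:
  assumes "\<And>a. a \<in> A \<Longrightarrow> f a \<in> lin I J"
  shows "(\<lambda>v l. \<Sum>a\<in>A. f a v l) \<in> lin I J"
proof (rule linI)
  fix v l
  have "(\<Sum>a\<in>A. f a v l) = (\<Sum>a\<in>A. \<Sum>i\<in>I. v i * f a (ket i) l)"
    by (rule sum.cong[OF refl lin_at[OF assms]])
  also have "\<dots> = (\<Sum>i\<in>I. \<Sum>a\<in>A. v i * f a (ket i) l)" by (rule sum.swap)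
  finally show "(\<Sum>a\<in>A. f a v l) = (\<Sum>i\<in>I. v i * (\<Sum>a\<in>A. f a (ket i) l))" by (simp add: sum_distrib_left)
next
  fix i
  show "(\<lambda>l. \<Sum>a\<in>A. f a (ket i) l) \<in> coords J"
    using sum_coords[of A "\<lambda>a. f a (ket i)" J "\<lambda>_. 1"] lin_coords[OF assms] by simp
qed

lemma lin_scl_map: "f \<in> lin I J \<Longrightarrow> (\<lambda>v. scl a (f v)) \<in> lin I J"
proof (rule linI)
  fix v l assume f: "f \<in> lin I J"
  show "scl a (f v) l = (\<Sum>i\<in>I. v i * scl a (f (ket i)) l)"
    unfolding scl_def lin_at[OF f, of v] by (simp add: sum_distrib_left mult.left_commute)
qed (rule scl_coords[OF lin_coords])

lemma lin_zero_map: "(\<lambda>v l. 0) \<in> lin I J"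
  by (simp add: lin_def lin_ext_def coords_def)

lemma tens_simps [simp]:
  "tens u v (Tens i j) = u i * (v j :: 'k::field)" "tens u v Triv = (0 :: 'k)" "tens u v (Atom a n) = (0 :: 'k)"
  by (simp_all add: tens_def)

lemma tens_scl [simp]:
  "tens (scl a u) v = scl a (tens u v)" "tens u (scl a v) = scl a (tens u v :: _ \<Rightarrow> 'k::field)"
  by (auto simp: tens_def scl_def split: label.splits)

lemma tens_zero [simp]: "tens (\<lambda>_. 0) v = (\<lambda>_. 0)" "tens u (\<lambda>_. 0) = (\<lambda>_. 0 :: 'k::field)"
  by (auto simp: tens_def split: label.splits)

lemma tens_ket: "tens (ket i) (ket j) = (ket (Tens i j) :: _ \<Rightarrow> 'k::field)"
  by (auto simp: tens_def ket_def split: label.splits)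

lemma pairs_image: "pairs I J = (\<lambda>(i, j). Tens i j) ` (I \<times> J)"
  by (auto simp: pairs_def)

lemma Tens_pairs [simp]: "Tens i j \<in> pairs I J \<longleftrightarrow> i \<in> I \<and> j \<in> J"
  by (simp add: pairs_def)

lemma finite_pairs: "finite I \<Longrightarrow> finite J \<Longrightarrow> finite (pairs I J)"
  by (simp add: pairs_image)

lemma sum_pairs: "(\<Sum>p\<in>pairs I J. f p) = (\<Sum>i\<in>I. \<Sum>j\<in>J. f (Tens i j))"
proof -
  have "inj_on (\<lambda>(i, j). Tens i j) (I \<times> J)" by (auto simp: inj_on_def)
  thus ?thesis by (simp add: pairs_image sum.reindex sum.cartesian_product split_def)
qed

lemma tens_coords: "u \<in> coords I \<Longrightarrow> v \<in> coords J \<Longrightarrow> tens u v \<in> coords (pairs I J :: 'g label set)"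
  for u v :: "'g label \<Rightarrow> 'k::field"
  by (auto simp: coords_def tens_def split: label.splits)

lemma lin_ext_pairs:
  "lin_ext (pairs I J) (on_pairs f) (tens u v) = (\<lambda>l. \<Sum>i\<in>I. \<Sum>j\<in>J. u i * v j * (f i j l :: 'k::field))"
  by (simp add: lin_ext_def sum_pairs on_pairs_def)

lemma lin_ext_pairs_lin:
  assumes "finite I" "finite J" "\<And>i j. i \<in> I \<Longrightarrow> j \<in> J \<Longrightarrow> f i j \<in> coords K"
  shows "lin_ext (pairs I J) (on_pairs f) \<in> lin (pairs I J) K"
  by (rule lin_ext_lin) (use assms finite_pairs in \<open>auto simp: pairs_def on_pairs_def\<close>)

lemma tens_expand:
  assumes "f \<in> lin I K" "h \<in> lin J K'"
  shows "tens (f u) (h v) l = (\<Sum>i\<in>I. \<Sum>j\<in>J. u i * v j * tens (f (ket i)) (h (ket j)) l)"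
    "tens (h v) (f u) l = (\<Sum>i\<in>I. \<Sum>j\<in>J. u i * v j * tens (h (ket j)) (f (ket i)) l)"
proof -
  have *: "(\<Sum>i\<in>I. u i * a i) * (\<Sum>j\<in>J. v j * b j) = (\<Sum>i\<in>I. \<Sum>j\<in>J. u i * v j * (a i * b j))" for a b
    by (simp add: sum_product mult_ac)
  have f: "f u x = (\<Sum>i\<in>I. u i * f (ket i) x)" and h: "h v x = (\<Sum>j\<in>J. v j * h (ket j) x)" for x
    using linE[OF assms(1), of u] linE[OF assms(2), of v] by simp_all
  show "tens (f u) (h v) l = (\<Sum>i\<in>I. \<Sum>j\<in>J. u i * v j * tens (f (ket i)) (h (ket j)) l)"
    by (cases l) (simp_all add: f h *)
  show "tens (h v) (f u) l = (\<Sum>i\<in>I. \<Sum>j\<in>J. u i * v j * tens (h (ket j)) (f (ket i)) l)"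
  proof (cases l)
    case (Tens x y)
    have "h v x * f u y = f u y * h v x" by (rule mult.commute)
    also have "\<dots> = (\<Sum>i\<in>I. \<Sum>j\<in>J. u i * v j * (f (ket i) y * h (ket j) x))" unfolding f h * ..
    finally show ?thesis by (simp add: Tens mult_ac)
  qed simp_all
qed

lemma tens_lin:
  assumes f: "f \<in> lin (pairs I J) K" and fin: "finite I" "finite J"
  shows "(\<lambda>v. f (tens u v)) \<in> lin J K" "(\<lambda>u. f (tens u v)) \<in> lin I K"
proof -
  have e: "f (tens u v) l = (\<Sum>i\<in>I. \<Sum>j\<in>J. u i * v j * f (ket (Tens i j)) l)" for u v l
    by (simp add: lin_at[OF f, of "tens u v"] sum_pairs)
  have k1: "f (tens u (ket j)) l = (\<Sum>i\<in>I. u i * f (ket (Tens i j)) l)" if "j \<in> J" for u j l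
    unfolding e by (simp add: mult.assoc sum_distrib_left[symmetric] sum_ket(1)[OF fin(2) that])
  have k2: "f (tens (ket i) v) l = (\<Sum>j\<in>J. v j * f (ket (Tens i j)) l)" if "i \<in> I" for v i l
    unfolding e by (simp add: mult.assoc sum_distrib_left[symmetric] sum_ket(1)[OF fin(1) that])
  show "(\<lambda>v. f (tens u v)) \<in> lin J K"
  proof (rule linI)
    fix v l
    have "f (tens u v) l = (\<Sum>j\<in>J. \<Sum>i\<in>I. u i * v j * f (ket (Tens i j)) l)" unfolding e by (rule sum.swap)
    also have "\<dots> = (\<Sum>j\<in>J. v j * f (tens u (ket j)) l)"
      by (rule sum.cong) (simp_all add: k1 sum_distrib_left mult_ac)
    finally show "f (tens u v) l = (\<Sum>j\<in>J. v j * f (tens u (ket j)) l)" .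
  qed (rule lin_coords[OF f])
  show "(\<lambda>u. f (tens u v)) \<in> lin I K"
  proof (rule linI)
    fix u l
    show "f (tens u v) l = (\<Sum>i\<in>I. u i * f (tens (ket i) v) l)"
      unfolding e[of u v] by (rule sum.cong) (simp_all add: k2 sum_distrib_left mult_ac)
  qed (rule lin_coords[OF f])
qed

text \<open>Spanning is expressed by its use: linear maps that agree on S are equal. In this form it
  passes to tensor products by fixing one factor at a time.\<close>

definition spans :: "'g label set \<Rightarrow> ('g label \<Rightarrow> 'k::field) set \<Rightarrow> bool" where
  "spans I S \<longleftrightarrow> finite I \<and> (\<forall>K::'g label set. \<forall>f\<in>lin I K. \<forall>f'\<in>lin I K. (\<forall>s\<in>S. f s = f' s) \<longrightarrow> f = f')"

lemma spansD:
  assumes "spans I S" "f \<in> lin I K" "f' \<in> lin I K" "\<And>s. s \<in> S \<Longrightarrow> f s = f' s"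
  shows "f = (f' :: ('g label \<Rightarrow> 'k::field) \<Rightarrow> 'g label \<Rightarrow> 'k)"
  using assms unfolding spans_def by blast

lemma spans_pairs:
  assumes S: "spans I S" and T: "spans J T"
  shows "spans (pairs I J) {tens s t | s t. s \<in> S \<and> t \<in> T}"
  unfolding spans_def
proof (intro conjI allI ballI impI)
  have fin: "finite I" "finite J" using assms by (simp_all add: spans_def)
  thus "finite (pairs I J)" by (rule finite_pairs)
  fix K :: "'a label set" and f f' :: "('a label \<Rightarrow> 'b) \<Rightarrow> 'a label \<Rightarrow> 'b"
  assume f: "f \<in> lin (pairs I J) K" and f': "f' \<in> lin (pairs I J) K"
    and eq: "\<forall>s\<in>{tens s t | s t. s \<in> S \<and> t \<in> T}. f s = f' s"
  have "(\<lambda>v. f (tens s v)) = (\<lambda>v. f' (tens s v))" if "s \<in> S" for s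
    by (rule spansD[OF T tens_lin(1)[OF f fin] tens_lin(1)[OF f' fin]]) (use eq that in blast)
  hence "(\<lambda>u. f (tens u v)) = (\<lambda>u. f' (tens u v))" for v
    by (intro spansD[OF S tens_lin(2)[OF f fin] tens_lin(2)[OF f' fin]]) meson
  hence t: "f (tens u v) = f' (tens u v)" for u v by meson
  show "f = f'"
  proof (rule lin_eqI[OF f f'])
    fix p assume "p \<in> pairs I J"
    then obtain i j where "p = Tens i j" unfolding pairs_def by blast
    thus "f (ket p) = f' (ket p)" using t[of "ket i" "ket j"] by (simp add: tens_ket)
  qed
qed

lemma if_one_mult: "(if P then 1 else 0) * x = (if P then x else 0 :: 'k::field)"
  by simp

lemma sum_swap_pairs:
  "(\<Sum>i\<in>I. \<Sum>j\<in>J. u i * v j * (\<Sum>q\<in>Q. s q * T q i j)) = (\<Sum>q\<in>Q. s q * (\<Sum>i\<in>I. \<Sum>j\<in>J. u i * v j * (T q i j :: 'k::field)))"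
proof -
  have "(\<Sum>i\<in>I. \<Sum>j\<in>J. u i * v j * (\<Sum>q\<in>Q. s q * T q i j)) = (\<Sum>i\<in>I. \<Sum>j\<in>J. \<Sum>q\<in>Q. s q * (u i * v j * T q i j))"
    by (simp add: sum_distrib_left mult_ac)
  also have "\<dots> = (\<Sum>i\<in>I. \<Sum>q\<in>Q. \<Sum>j\<in>J. s q * (u i * v j * T q i j))" by (intro sum.cong refl sum.swap)
  also have "\<dots> = (\<Sum>q\<in>Q. \<Sum>i\<in>I. \<Sum>j\<in>J. s q * (u i * v j * T q i j))" by (rule sum.swap)
  finally show ?thesis by (simp add: sum_distrib_left)
qed

section \<open>Homogeneous vectors and the action on tensor products\<close>

context fin_group
begin

abbreviation C :: "(('a, 'k::field) dgmod, ('a, 'k) dgmor) bmcat" where "C \<equiv> DGmod G"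

abbreviation md :: "('a, 'k::field) dgmod \<Rightarrow> bool" where "md \<equiv> is_module (DG G)"

lemma C_simps [simp]:
  "Obj C = {M. md M}" "Idm C M = id_map (labels M)" "Cmp C f g = f \<circ> g"
  "labels (TObj C M M') = pairs (labels M) (labels M')" "act (TObj C M M') p = act2 DD M M' (cop DD p)"
  "Hom C M M' = {f \<in> lin (labels M) (labels M'). \<forall>p\<in>B. f \<circ> act M p = act M' p \<circ> f}"
  by (simp_all add: DGmod_def mod_cat_def)

lemma vact_ket: "p \<in> B \<Longrightarrow> vact DD M (ket p) = (act M p :: ('a label \<Rightarrow> 'k::field) \<Rightarrow> _)"
  by (simp add: vact_def sum_ket(1))

lemma vact_scl_ket: "p \<in> B \<Longrightarrow> vact DD M (scl a (ket p)) = (\<lambda>v. scl a (act M p v :: 'a label \<Rightarrow> 'k::field))"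
  by (simp add: vact_def scl_def mult.assoc sum_distrib_left[symmetric] sum_ket(1))

lemma vact_unt: "vact DD M (unt DD) = (\<lambda>v l. \<Sum>x\<in>U. act M (x, \<one>) v l :: 'k::field)"
  unfolding vact_def basis_DG sum_B
  by (intro ext sum.cong refl) (simp add: unt_DG if_one_mult)

lemma moduleD:
  assumes "md (M :: ('a, 'k::field) dgmod)"
  shows "finite (labels M)"
    "x \<in> U \<Longrightarrow> y \<in> U \<Longrightarrow> act M (x, y) \<in> lin (labels M) (labels M)"
    "(\<lambda>v l. \<Sum>x\<in>U. act M (x, \<one>) v l) = id_map (labels M)"
    "x \<in> U \<Longrightarrow> y \<in> U \<Longrightarrow> x' \<in> U \<Longrightarrow> y' \<in> U \<Longrightarrow>
      act M (x, y) (act M (x', y') v) = (if x = cj y x' then act M (x, y \<otimes> y') v else (\<lambda>_. 0))"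
proof -
  show "finite (labels M)" "x \<in> U \<Longrightarrow> y \<in> U \<Longrightarrow> act M (x, y) \<in> lin (labels M) (labels M)"
    "(\<lambda>v l. \<Sum>x\<in>U. act M (x, \<one>) v l) = id_map (labels M)"
    using assms unfolding is_module_def by (simp_all add: vact_unt)
  assume m: "x \<in> U" "y \<in> U" "x' \<in> U" "y' \<in> U"
  have "act M (x, y) \<circ> act M (x', y') = vact DD M (prd DD (x, y) (x', y'))"
    using assms m unfolding is_module_def by simp
  from fun_cong[OF this, of v] m
  show "act M (x, y) (act M (x', y') v) = (if x = cj y x' then act M (x, y \<otimes> y') v else (\<lambda>_. 0))"
    by (auto simp: prd_DG vact_ket) (simp add: vact_def)
qed

lemma moduleI:
  assumes "finite (labels M)"
    "\<And>x y. x \<in> U \<Longrightarrow> y \<in> U \<Longrightarrow> act M (x, y) \<in> lin (labels M) (labels M)"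
    "(\<lambda>v l. \<Sum>x\<in>U. act M (x, \<one>) v l) = id_map (labels M)"
    "\<And>x y x' y' v. x \<in> U \<Longrightarrow> y \<in> U \<Longrightarrow> x' \<in> U \<Longrightarrow> y' \<in> U \<Longrightarrow>
      act M (x, y) (act M (x', y') v) = (if x = cj y x' then act M (x, y \<otimes> y') v else (\<lambda>_. 0))"
  shows "md (M :: ('a, 'k::field) dgmod)"
  unfolding is_module_def vact_unt basis_DG
proof (intro conjI ballI)
  fix p q :: "'a \<times> 'a" assume "p \<in> B" "q \<in> B"
  thus "act M p \<circ> act M q = vact DD M (prd DD p q)"
    using assms(4) by (cases p; cases q) (auto simp: prd_DG vact_ket fun_eq_iff, simp add: vact_def)
qed (use assms in auto)

text \<open>Membership in the homogeneous component e_g M. In a module the zero vector has every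
  degree.\<close>

definition deg :: "('a, 'k::field) dgmod \<Rightarrow> 'a \<Rightarrow> ('a label \<Rightarrow> 'k) \<Rightarrow> bool" where
  "deg M g u \<longleftrightarrow> g \<in> U \<and> u \<in> coords (labels M) \<and> act M (g, \<one>) u = u"

lemma act_deg:
  assumes "md M" "deg M g (u :: 'a label \<Rightarrow> 'k::field)" "x \<in> U" "t \<in> U"
  shows "act M (x, t) u = (if x = cj t g then act M (cj t g, t) u else (\<lambda>_. 0))"
  using moduleD(4)[OF assms(1) assms(3,4), of g \<one> u] assms(2,4) unfolding deg_def by auto

lemma deg_act:
  assumes "md M" "x \<in> U" "t \<in> U"
  shows "deg M x (act M (x, t) (u :: 'a label \<Rightarrow> 'k::field))"
  using moduleD(4)[OF assms(1) assms(2) one_closed assms(2,3), of u] lin_coords[OF moduleD(2)[OF assms]] assms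
  by (simp add: deg_def)

text \<open>The unit of DG is the sum of all e_x \<times> 1, so every basis vector is the sum of its
  homogeneous components.\<close>

lemma spans_deg:
  assumes "md (M :: ('a, 'k::field) dgmod)"
  shows "spans (labels M) {u. \<exists>g. deg M g u}"
  unfolding spans_def
proof (intro conjI allI ballI impI)
  fix K :: "'a label set" and f f' :: "('a label \<Rightarrow> 'k) \<Rightarrow> 'a label \<Rightarrow> 'k"
  assume f: "f \<in> lin (labels M) K" and f': "f' \<in> lin (labels M) K" and eq: "\<forall>s\<in>{u. \<exists>g. deg M g u}. f s = f' s"
  show "f = f'"
  proof (rule lin_eqI[OF f f'])
    fix i assume i: "i \<in> labels M"
    have "id_map (labels M) (ket i) = (ket i :: _ \<Rightarrow> 'k)"
      by (rule id_map_eq[OF moduleD(1)[OF assms] ket_coords[OF i]])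
    hence k: "ket i = (\<lambda>l. \<Sum>x\<in>U. 1 * act M (x, \<one>) (ket i) l)"
      unfolding moduleD(3)[OF assms, symmetric] by simp
    have "f (act M (x, \<one>) (ket i)) = f' (act M (x, \<one>) (ket i))" if "x \<in> U" for x
      using eq deg_act[OF assms that one_closed] by blast
    thus "f (ket i) = f' (ket i)"
      by (subst (1 2) k, unfold lin_sum[OF f, of "\<lambda>_. 1"] lin_sum[OF f', of "\<lambda>_. 1"]) simp
  qed
qed (rule moduleD(1)[OF assms])

text \<open>On a homogeneous vector only one function label survives for each group label t; the
  hypothesis \<open>z\<close> makes the vanishing terms disappear from the sum.\<close>

lemma sum_act:
  assumes "md M" "deg M g (u :: 'a label \<Rightarrow> 'k::field)" and z: "\<And>p. p \<in> B \<Longrightarrow> F p (\<lambda>_. 0) = (0 :: 'k)"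
  shows "(\<Sum>p\<in>B. F p (act M p u)) = (\<Sum>t\<in>U. F (cj t g, t) (act M (cj t g, t) u))"
proof -
  have "(\<Sum>p\<in>B. F p (act M p u)) = (\<Sum>t\<in>U. \<Sum>x\<in>U. F (x, t) (act M (x, t) u))"
    unfolding sum_B by (rule sum.swap)
  also have "\<dots> = (\<Sum>t\<in>U. \<Sum>x\<in>U. if x = cj t g then F (cj t g, t) (act M (cj t g, t) u) else 0)"
    by (intro sum.cong refl) (use z in \<open>auto simp: act_deg[OF assms(1,2)]\<close>)
  also have "\<dots> = (\<Sum>t\<in>U. F (cj t g, t) (act M (cj t g, t) u))"
    using assms(2) by (intro sum.cong refl) (simp add: deg_def)
  finally show ?thesis .
qed

lemma act2_lin:
  assumes "md M" "md (M' :: ('a, 'k::field) dgmod)"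
  shows "act2 DD M M' \<sigma> \<in> lin (pairs (labels M) (labels M')) (pairs (labels M) (labels M'))"
  unfolding act2_def
proof (rule lin_ext_pairs_lin)
  fix i j
  show "(\<lambda>l. \<Sum>(p, q)\<in>basis DD \<times> basis DD. \<sigma> (p, q) * tens (act M p (ket i)) (act M' q (ket j)) l) \<in>
      coords (pairs (labels M) (labels M'))"
    unfolding split_def
    by (rule sum_coords, rule tens_coords)
      (auto intro: lin_coords[OF moduleD(2)[OF assms(1)]] lin_coords[OF moduleD(2)[OF assms(2)]])
qed (rule moduleD(1)[OF assms(1)], rule moduleD(1)[OF assms(2)])

text \<open>Homogeneity of both vectors shrinks the sum over pairs of basis elements to a sum over
  pairs of group labels.\<close>

lemma act2_tens:
  assumes M: "md M" and M': "md (M' :: ('a, 'k::field) dgmod)" and u: "deg M g u" and v: "deg M' h v"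
  shows "act2 DD M M' \<sigma> (tens u v) = (\<lambda>l. \<Sum>s\<in>U. \<Sum>t\<in>U.
     \<sigma> ((cj s g, s), (cj t h, t)) * tens (act M (cj s g, s) u) (act M' (cj t h, t) v) l)"
proof
  fix l
  have "act2 DD M M' \<sigma> (tens u v) l =
      (\<Sum>r\<in>B \<times> B. \<sigma> r * (\<Sum>i\<in>labels M. \<Sum>j\<in>labels M'. u i * v j * tens (act M (fst r) (ket i)) (act M' (snd r) (ket j)) l))"
    unfolding act2_def lin_ext_pairs basis_DG split_def sum_swap_pairs[symmetric] by simp
  also have "\<dots> = (\<Sum>r\<in>B \<times> B. \<sigma> r * tens (act M (fst r) u) (act M' (snd r) v) l)"
    by (rule sum.cong[OF refl])
      (auto simp: tens_expand(1)[OF moduleD(2)[OF M] moduleD(2)[OF M'], of _ _ _ _ u v])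
  also have "\<dots> = (\<Sum>p\<in>B. \<Sum>q\<in>B. \<sigma> (p, q) * tens (act M p u) (act M' q v) l)"
    by (simp only: sum.cartesian_product) (simp add: split_def)
  also have "\<dots> = (\<Sum>s\<in>U. \<Sum>q\<in>B. \<sigma> ((cj s g, s), q) * tens (act M (cj s g, s) u) (act M' q v) l)"
    by (rule sum_act[OF M u, of "\<lambda>p w. \<Sum>q\<in>B. \<sigma> (p, q) * tens w (act M' q v) l"]) simp
  also have "\<dots> = (\<Sum>s\<in>U. \<Sum>t\<in>U. \<sigma> ((cj s g, s), (cj t h, t)) * tens (act M (cj s g, s) u) (act M' (cj t h, t) v) l)"
    by (intro sum.cong refl sum_act[OF M' v, of "\<lambda>q w. \<sigma> ((_, _), q) * tens _ w l"]) simp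
  finally show "act2 DD M M' \<sigma> (tens u v) l = \<dots>" .
qed

text \<open>The R-matrix selects s = \<one> and t = g: the degree of u acts on v before the factors
  are exchanged.\<close>

lemma braid_tens:
  assumes M: "md M" and M': "md (M' :: ('a, 'k::field) dgmod)" and u: "deg M g u" and v: "deg M' h v"
  shows "Braid C M M' (tens u v) = tens (act M' (cj g h, g) v) u"
proof
  fix l
  have "Braid C M M' (tens u v) l =
      (\<Sum>r\<in>B \<times> B. Rmat G r * (\<Sum>i\<in>labels M. \<Sum>j\<in>labels M'. u i * v j * tens (act M' (snd r) (ket j)) (act M (fst r) (ket i)) l))"
    by (simp add: DGmod_def mod_cat_def lin_ext_pairs split_def sum_swap_pairs)
  also have "\<dots> = (\<Sum>r\<in>B \<times> B. Rmat G r * tens (act M' (snd r) v) (act M (fst r) u) l)"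
    by (rule sum.cong[OF refl])
      (auto simp: tens_expand(2)[OF moduleD(2)[OF M] moduleD(2)[OF M'], of _ _ _ _ v u])
  also have "\<dots> = (\<Sum>p\<in>B. \<Sum>q\<in>B. Rmat G (p, q) * tens (act M' q v) (act M p u) l)"
    by (simp only: sum.cartesian_product) (simp add: split_def)
  also have "\<dots> = (\<Sum>s\<in>U. \<Sum>q\<in>B. Rmat G ((cj s g, s), q) * tens (act M' q v) (act M (cj s g, s) u) l)"
    by (rule sum_act[OF M u, of "\<lambda>p w. \<Sum>q\<in>B. Rmat G (p, q) * tens (act M' q v) w l"]) simp
  also have "\<dots> = (\<Sum>s\<in>U. \<Sum>t\<in>U. Rmat G ((cj s g, s), (cj t h, t)) * tens (act M' (cj t h, t) v) (act M (cj s g, s) u) l)"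
    by (intro sum.cong refl sum_act[OF M' v, of "\<lambda>q w. Rmat G ((_, _), q) * tens w _ l"]) simp
  also have "\<dots> = (\<Sum>s\<in>U. if s = \<one> then \<Sum>t\<in>U. if t = g then tens (act M' (cj t h, t) v) u l else 0 else 0)"
    using u v by (intro sum.cong refl) (auto simp: Rmat_def deg_def if_one_mult)
  also have "\<dots> = tens (act M' (cj g h, g) v) u l" using u by (simp add: deg_def)
  finally show "Braid C M M' (tens u v) l = tens (act M' (cj g h, g) v) u l" .
qed

lemma act2_form:
  assumes "md M" "md (M' :: ('a, 'k::field) dgmod)" "deg M g u" "deg M' h v"
  shows "act2 DD M M' (form \<beta>) (tens u v) = scl (\<beta> (g, h)) (tens u v)"
proof
  fix l
  have gh: "g \<in> U" "h \<in> U" "act M (g, \<one>) u = u" "act M' (h, \<one>) v = v" using assms(3,4) by (auto simp: deg_def)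
  have "act2 DD M M' (form \<beta>) (tens u v) l = (\<Sum>s\<in>U. if s = \<one> then
      \<Sum>t\<in>U. if t = \<one> then \<beta> (g, h) * tens u v l else 0 else 0)"
    unfolding act2_tens[OF assms] using gh
    by (intro sum.cong refl) (auto simp: form_apply ket_def if_one_mult mult.assoc)
  thus "act2 DD M M' (form \<beta>) (tens u v) l = scl (\<beta> (g, h)) (tens u v) l"
    by (simp add: scl_def)
qed

lemma act_TObj:
  assumes "md M" "md (M' :: ('a, 'k::field) dgmod)" "deg M g u" "deg M' h v" "x \<in> U" "y \<in> U"
  shows "act (TObj C M M') (x, y) (tens u v) =
    (if x = cj y (g \<otimes> h) then tens (act M (cj y g, y) u) (act M' (cj y h, y) v) else (\<lambda>_. 0))"
proof
  fix l
  have gh: "g \<in> U" "h \<in> U" using assms(3,4) by (auto simp: deg_def)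
  let ?w = "tens (act M (cj y g, y) u) (act M' (cj y h, y) v) l"
  have "act (TObj C M M') (x, y) (tens u v) l = (\<Sum>s\<in>U. \<Sum>t\<in>U.
      if t = y then if s = y then if x = cj y (g \<otimes> h) then ?w else 0 else 0 else 0)"
    unfolding C_simps act2_tens[OF assms(1-4)] using gh assms(5,6)
    by (intro sum.cong refl) (auto simp: cop_DG cj_mult if_one_mult)
  thus "act (TObj C M M') (x, y) (tens u v) l = (if x = cj y (g \<otimes> h)
      then tens (act M (cj y g, y) u) (act M' (cj y h, y) v) else (\<lambda>_. 0)) l"
    using assms(6) by simp
qed

text \<open>Homogeneous pure tensors span, which reduces naturality, coherence and braiding to
  identities between scalars.\<close>

lemma pairs_eqI:
  assumes "md M" "md (M' :: ('a, 'k::field) dgmod)"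
    "f \<in> lin (pairs (labels M) (labels M')) (K :: 'a label set)" "f' \<in> lin (pairs (labels M) (labels M')) K"
    "\<And>g h u v. deg M g u \<Longrightarrow> deg M' h v \<Longrightarrow> f (tens u v) = f' (tens u v)"
  shows "f = f'"
  by (rule spansD[OF spans_pairs[OF spans_deg[OF assms(1)] spans_deg[OF assms(2)]] assms(3,4)]) (use assms(5) in blast)

lemma degD: "deg M g u \<Longrightarrow> g \<in> U" "deg M g u \<Longrightarrow> u \<in> coords (labels M)" "deg M g u \<Longrightarrow> act M (g, \<one>) u = u"
  by (simp_all add: deg_def)

lemma TObj_lin:
  assumes "md M" "md (M' :: ('a, 'k::field) dgmod)"
  shows "act (TObj C M M') p \<in> lin (pairs (labels M) (labels M')) (pairs (labels M) (labels M'))"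
  using act2_lin[OF assms] by simp

lemma md_TObj:
  assumes M: "md M" and M': "md (M' :: ('a, 'k::field) dgmod)"
  shows "md (TObj C M M')"
proof (rule moduleI)
  note fin = moduleD(1)[OF M] moduleD(1)[OF M']
  show "finite (labels (TObj C M M'))" using fin by (simp add: finite_pairs)
  show "act (TObj C M M') (x, y) \<in> lin (labels (TObj C M M')) (labels (TObj C M M'))" for x y
    using TObj_lin[OF assms] by simp
  show "(\<lambda>v l. \<Sum>x\<in>U. act (TObj C M M') (x, \<one>) v l) = id_map (labels (TObj C M M'))"
  proof (rule pairs_eqI[OF M M'])
    show "(\<lambda>v l. \<Sum>x\<in>U. act (TObj C M M') (x, \<one>) v l) \<in> lin (pairs (labels M) (labels M')) (pairs (labels M) (labels M'))"
      by (rule lin_sum_maps) (rule TObj_lin[OF assms])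
    show "id_map (labels (TObj C M M')) \<in> lin (pairs (labels M) (labels M')) (pairs (labels M) (labels M'))"
      using id_map_lin[OF finite_pairs[OF fin]] by simp
    fix g h u v assume u: "deg M g u" and v: "deg M' h v"
    note gh = degD(1)[OF u] degD(1)[OF v]
    have "(\<Sum>x\<in>U. act (TObj C M M') (x, \<one>) (tens u v) l) = tens u v l" for l
    proof -
      have "(\<Sum>x\<in>U. act (TObj C M M') (x, \<one>) (tens u v) l) = (\<Sum>x\<in>U. if x = g \<otimes> h then tens u v l else 0)"
        by (intro sum.cong refl)
          (simp add: act_TObj[OF M M' u v _ one_closed] gh degD(3)[OF u] degD(3)[OF v] del: C_simps)
      thus ?thesis using gh by simp
    qed
    thus "(\<lambda>l. \<Sum>x\<in>U. act (TObj C M M') (x, \<one>) (tens u v) l) = id_map (labels (TObj C M M')) (tens u v)"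
      using id_map_eq[OF finite_pairs[OF fin] tens_coords[OF degD(2)[OF u] degD(2)[OF v]]] by simp
  qed
  fix x y x' y' w assume m: "x \<in> U" "y \<in> U" "x' \<in> U" "y' \<in> U"
  let ?f = "act (TObj C M M') (x, y) \<circ> act (TObj C M M') (x', y')"
  let ?g = "\<lambda>w. if x = cj y x' then act (TObj C M M') (x, y \<otimes> y') w else (\<lambda>_. 0)"
  have "?f = ?g"
  proof (rule pairs_eqI[OF M M'])
    show "?f \<in> lin (pairs (labels M) (labels M')) (pairs (labels M) (labels M'))"
      by (rule lin_comp) (rule TObj_lin[OF assms])+
    show "?g \<in> lin (pairs (labels M) (labels M')) (pairs (labels M) (labels M'))"
      using TObj_lin[OF assms, of "(x, y \<otimes> y')"] lin_zero_map by (cases "x = cj y x'") (simp_all del: C_simps)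
    fix g h u v assume u: "deg M g u" and v: "deg M' h v"
    note gh = degD(1)[OF u] degD(1)[OF v]
    note d = deg_act[OF M cj_closed[OF m(4) gh(1)] m(4), of u] deg_act[OF M' cj_closed[OF m(4) gh(2)] m(4), of v]
    show "?f (tens u v) = ?g (tens u v)"
    proof (cases "x' = cj y' (g \<otimes> h)")
      case True
      have "?f (tens u v) = act (TObj C M M') (x, y) (tens (act M (cj y' g, y') u) (act M' (cj y' h, y') v))"
        using act_TObj[OF M M' u v m(3,4)] True by (simp del: C_simps)
      also have "\<dots> = (if x = cj y (cj y' g \<otimes> cj y' h) then
          tens (act M (cj y (cj y' g), y \<otimes> y') u) (act M' (cj y (cj y' h), y \<otimes> y') v) else (\<lambda>_. 0))"
        using act_TObj[OF M M' d m(1,2)] m gh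
        by (simp add: moduleD(4)[OF M] moduleD(4)[OF M'] del: C_simps)
      also have "\<dots> = ?g (tens u v)"
        using act_TObj[OF M M' u v m(1) m_closed[OF m(2,4)]] m gh
        by (auto simp: True cj_mult[symmetric] cj_cj simp del: C_simps)
      finally show ?thesis .
    next
      case False
      have "act (TObj C M M') (x', y') (tens u v) = (\<lambda>_. 0)"
        using act_TObj[OF M M' u v m(3,4)] False by (simp del: C_simps)
      moreover have "act (TObj C M M') (x, y \<otimes> y') (tens u v) = (\<lambda>_. 0)" if "x = cj y x'"
        using act_TObj[OF M M' u v m(1) m_closed[OF m(2,4)]] False m gh that
        by (simp add: cj_cj[symmetric] del: C_simps)
      ultimately show ?thesis using lin_zero[OF TObj_lin[OF assms, of "(x, y)"]] by (simp del: C_simps)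
    qed
  qed
  thus "act (TObj C M M') (x, y) (act (TObj C M M') (x', y') w) =
      (if x = cj y x' then act (TObj C M M') (x, y \<otimes> y') w else (\<lambda>_. 0))" by (metis comp_apply)
qed

lemma deg_tens:
  assumes "md M" "md (M' :: ('a, 'k::field) dgmod)" "deg M g u" "deg M' h v"
  shows "deg (TObj C M M') (g \<otimes> h) (tens u v)"
  using act_TObj[OF assms, of "g \<otimes> h" \<one>] degD[OF assms(3)] degD[OF assms(4)]
  by (simp add: deg_def tens_coords del: C_simps(5))

lemma TMor_tens:
  assumes "f \<in> lin (labels M) K" "f' \<in> lin (labels M') (K' :: 'a label set)"
  shows "TMor C M M' f f' (tens u v) = tens (f u) (f' v :: 'a label \<Rightarrow> 'k::field)"
  by (auto simp: DGmod_def mod_cat_def lin_ext_pairs fun_eq_iff tens_expand(1)[OF assms, of u v])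

lemma TMor_lin:
  assumes "md M" "md (M' :: ('a, 'k::field) dgmod)" "f \<in> lin (labels M) K" "f' \<in> lin (labels M') (K' :: 'a label set)"
  shows "TMor C M M' f f' \<in> lin (pairs (labels M) (labels M')) (pairs K K')"
proof -
  have "lin_ext (pairs (labels M) (labels M')) (on_pairs (\<lambda>i j. tens (f (ket i)) (f' (ket j)))) \<in> lin (pairs (labels M) (labels M')) (pairs K K')"
    by (rule lin_ext_pairs_lin[OF moduleD(1)[OF assms(1)] moduleD(1)[OF assms(2)] tens_coords])
      (rule lin_coords[OF assms(3)] lin_coords[OF assms(4)])+
  thus ?thesis by (simp add: DGmod_def mod_cat_def)
qed

lemma deg_hom:
  assumes "f \<in> Hom C M (M' :: ('a, 'k::field) dgmod)" "deg M g u"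
  shows "deg M' g (f u)"
proof -
  have "(f \<circ> act M (g, \<one>)) u = (act M' (g, \<one>) \<circ> f) u" using assms degD(1)[OF assms(2)] by simp
  thus ?thesis using assms lin_coords[of f "labels M" "labels M'" u] by (simp add: deg_def)
qed

text \<open>Composing with a linear inverse on both sides transfers the intertwining property to it,
  so g need only be given as a linear map.\<close>

lemma IsoI:
  assumes M: "md M" and M': "md (M' :: ('a, 'k::field) dgmod)" and f: "f \<in> Hom C M M'" and g: "g \<in> lin (labels M') (labels M)"
    and gf: "g \<circ> f = id_map (labels M)" and fg: "f \<circ> g = id_map (labels M')"
  shows "f \<in> Iso C M M'"
proof -
  have "g \<circ> act M' p = act M p \<circ> g" if p: "p \<in> B" for p
  proof -
    have a: "act M' p \<in> lin (labels M') (labels M')" "act M p \<in> lin (labels M) (labels M)"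
      using moduleD(2)[OF M'] moduleD(2)[OF M] p by auto
    have "g \<circ> act M' p = g \<circ> (act M' p \<circ> id_map (labels M'))" using comp_id_map[OF moduleD(1)[OF M'] a(1)] by simp
    also have "\<dots> = g \<circ> ((act M' p \<circ> f) \<circ> g)" by (simp only: fg[symmetric] comp_assoc)
    also have "act M' p \<circ> f = f \<circ> act M p" using f p by (cases p) simp
    also have "g \<circ> (f \<circ> act M p \<circ> g) = (g \<circ> f) \<circ> act M p \<circ> g" by (simp only: comp_assoc)
    also have "\<dots> = act M p \<circ> g" unfolding gf using id_map_comp[OF moduleD(1)[OF M] a(2)] by simp
    finally show ?thesis .
  qed
  thus ?thesis unfolding Iso_def using assms by auto
qed

lemma IsoD:
  assumes "f \<in> Iso C M (M' :: ('a, 'k::field) dgmod)"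
  obtains g where "md M" "md M'" "f \<in> Hom C M M'" "g \<in> Hom C M' M" "g \<circ> f = id_map (labels M)" "f \<circ> g = id_map (labels M')"
  using assms unfolding Iso_def by auto

lemma Hom_comp:
  assumes "f \<in> Hom C L M" "g \<in> Hom C M (M' :: ('a, 'k::field) dgmod)"
  shows "g \<circ> f \<in> Hom C L M'"
proof -
  have "g \<circ> f \<circ> act L p = act M' p \<circ> (g \<circ> f)" if "p \<in> B" for p
  proof -
    have "g \<circ> f \<circ> act L p = g \<circ> (f \<circ> act L p)" by (simp only: comp_assoc)
    also have "f \<circ> act L p = act M p \<circ> f" using assms(1) that by (cases p) simp
    also have "g \<circ> (act M p \<circ> f) = (g \<circ> act M p) \<circ> f" by (simp only: comp_assoc)
    also have "g \<circ> act M p = act M' p \<circ> g" using assms(2) that by (cases p) simp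
    finally show ?thesis by (simp only: comp_assoc)
  qed
  thus ?thesis using lin_comp[of f "labels L" "labels M" g "labels M'"] assms by simp
qed

lemma Iso_comp:
  assumes "f \<in> Iso C L M" "g \<in> Iso C M (M' :: ('a, 'k::field) dgmod)"
  shows "g \<circ> f \<in> Iso C L M'"
proof -
  obtain f' where f: "md L" "md M" "f \<in> Hom C L M" "f' \<in> Hom C M L" "f' \<circ> f = id_map (labels L)" "f \<circ> f' = id_map (labels M)"
    by (rule IsoD[OF assms(1)])
  obtain g' where g: "md M" "md M'" "g \<in> Hom C M M'" "g' \<in> Hom C M' M" "g' \<circ> g = id_map (labels M)" "g \<circ> g' = id_map (labels M')"
    by (rule IsoD[OF assms(2)])
  have fl: "f \<in> lin (labels L) (labels M)" "f' \<in> lin (labels M) (labels L)" "g \<in> lin (labels M) (labels M')" "g' \<in> lin (labels M') (labels M)"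
    using f(3,4) g(3,4) by auto
  show ?thesis
  proof (rule IsoI[OF f(1) g(2) Hom_comp[OF f(3) g(3)]])
    show "f' \<circ> g' \<in> lin (labels M') (labels L)" by (rule lin_comp[OF fl(4,2)])
    have "f' \<circ> g' \<circ> (g \<circ> f) = f' \<circ> ((g' \<circ> g) \<circ> f)" by (simp only: comp_assoc)
    thus "f' \<circ> g' \<circ> (g \<circ> f) = id_map (labels L)" using id_map_comp[OF moduleD(1)[OF f(2)] fl(1)] by (simp add: g(5) f(5))
    have "g \<circ> f \<circ> (f' \<circ> g') = g \<circ> ((f \<circ> f') \<circ> g')" by (simp only: comp_assoc)
    thus "g \<circ> f \<circ> (f' \<circ> g') = id_map (labels M')" using id_map_comp[OF moduleD(1)[OF f(2)] fl(4)] by (simp add: g(6) f(6))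
  qed
qed

section \<open>The functor of a bicharacter and an invariant cocycle\<close>

abbreviation Fb :: "('a \<Rightarrow> 'a \<Rightarrow> 'k::field) \<Rightarrow> ('a \<times> 'a \<Rightarrow> 'k) \<Rightarrow> (('a, 'k) dgmod, ('a, 'k) dgmor) tfunctor" where
  "Fb c \<beta> \<equiv> Psi G (baut c, form \<beta>)"

lemma Fb_simps [simp]:
  "labels (FObj (Fb c \<beta>) M) = labels M" "FMor (Fb c \<beta>) M M' f = f"
  "FTen (Fb c \<beta>) M M' = act2 DD M M' (form \<beta>)"
  by (simp_all add: Psi_def)

text \<open>The dagger exchanges the arguments: the automorphism scales e_x \<times> y by c(y, x),
  the functor by c(x, y), which is b(x)(y) for c coming from b.\<close>

lemma act_Fb:
  assumes "bichar G c" "x \<in> U" "y \<in> U"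
  shows "act (FObj (Fb c \<beta>) M) (x, y) = (\<lambda>v. scl (c x y) (act M (x, y) v :: 'a label \<Rightarrow> 'k::field))"
  using dagger_dg_aut[OF one_closed assms(1)] dg_aut_ket[OF one_closed bichar_flip[OF assms(1)] assms(2,3)] assms
  by (simp add: Psi_def vact_scl_ket)

lemma md_Fb:
  assumes c: "bichar G c" and M: "md (M :: ('a, 'k::field) dgmod)"
  shows "md (FObj (Fb c \<beta>) M)"
proof (rule moduleI)
  show "finite (labels (FObj (Fb c \<beta>) M))" using moduleD(1)[OF M] by simp
  show "act (FObj (Fb c \<beta>) M) (x, y) \<in> lin (labels (FObj (Fb c \<beta>) M)) (labels (FObj (Fb c \<beta>) M))"
    if "x \<in> U" "y \<in> U" for x y
    using lin_scl_map[OF moduleD(2)[OF M that]] by (simp add: act_Fb[OF c that])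
  have "(\<Sum>x\<in>U. act (FObj (Fb c \<beta>) M) (x, \<one>) v l) = (\<Sum>x\<in>U. act M (x, \<one>) v l)" for v l
    by (rule sum.cong) (simp_all add: act_Fb[OF c] bichar_one[OF c])
  thus "(\<lambda>v l. \<Sum>x\<in>U. act (FObj (Fb c \<beta>) M) (x, \<one>) v l) = id_map (labels (FObj (Fb c \<beta>) M))"
    using moduleD(3)[OF M] by simp
  fix x y x' y' v assume m: "x \<in> U" "y \<in> U" "x' \<in> U" "y' \<in> U"
  have "c (cj y x') (y \<otimes> y') = c (cj y x') y * c x' y'"
    using bicharD(3)[OF c m(2,4), of "cj y x'"] bichar_cj(1)[OF c m(2,3,4)] m by simp
  thus "act (FObj (Fb c \<beta>) M) (x, y) (act (FObj (Fb c \<beta>) M) (x', y') v) =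
      (if x = cj y x' then act (FObj (Fb c \<beta>) M) (x, y \<otimes> y') v else (\<lambda>_. 0))"
    using m by (auto simp: act_Fb[OF c] lin_scl[OF moduleD(2)[OF M]] moduleD(4)[OF M] mult.commute)
qed

lemma deg_Fb:
  assumes "bichar G c" "g \<in> U"
  shows "deg (FObj (Fb c \<beta>) M) g u \<longleftrightarrow> deg M g (u :: 'a label \<Rightarrow> 'k::field)"
  using act_Fb[OF assms one_closed] bichar_one(2)[OF assms] by (simp add: deg_def)

text \<open>Both sides of the intertwining condition are multiplied by the same nonzero scalar, so
  the twist changes no hom space.\<close>

lemma Hom_Fb:
  assumes c: "bichar G c" and M: "md M" and M': "md (M' :: ('a, 'k::field) dgmod)"
  shows "Hom C (FObj (Fb c \<beta>) M) (FObj (Fb c \<beta>) M') = Hom C M M'"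
proof -
  have "f \<circ> act (FObj (Fb c \<beta>) M) (x, y) = act (FObj (Fb c \<beta>) M') (x, y) \<circ> f \<longleftrightarrow> f \<circ> act M (x, y) = act M' (x, y) \<circ> f"
    if f: "f \<in> lin (labels M) (labels M')" and m: "x \<in> U" "y \<in> U" for f x y
    by (subst (1 2) fun_eq_iff) (simp add: act_Fb[OF c m] lin_scl[OF f] scl_cancel[OF bicharD(1)[OF c m]])
  thus ?thesis by auto
qed

text \<open>Two records can describe the same DG-module and still differ in \<open>act\<close> off
  the basis of DG; hence an isomorphism takes the place of an equality.\<close>

lemma id_Iso:
  assumes "md M" "md (M' :: ('a, 'k::field) dgmod)" "labels M = labels M'" "\<And>p. p \<in> B \<Longrightarrow> act M p = act M' p"
  shows "id_map (labels M) \<in> Iso C M M'"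
proof (rule IsoI[OF assms(1,2)])
  note fin = moduleD(1)[OF assms(1)]
  have a: "act M' (x, y) \<in> lin (labels M) (labels M)" if "x \<in> U" "y \<in> U" for x y
    using moduleD(2)[OF assms(2) that] by (simp add: assms(3))
  show "id_map (labels M) \<in> Hom C M M'"
    using id_map_lin[OF fin] assms(3,4) id_map_comp[OF fin a] comp_id_map[OF fin a] by auto
  show "id_map (labels M) \<in> lin (labels M') (labels M)" using id_map_lin[OF fin] by (simp add: assms(3))
qed (use id_map_comp[OF moduleD(1)[OF assms(1)] id_map_lin[OF moduleD(1)[OF assms(1)]]] assms(3) in auto)

lemma md_TUnit: "md (TUnit C :: ('a, 'k::field) dgmod)"
proof (rule moduleI)
  have T: "labels (TUnit C :: ('a, 'k) dgmod) = {Triv}"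
    "act (TUnit C :: ('a, 'k) dgmod) (x, y) = lin_ext {Triv} (\<lambda>l. scl (if x = \<one> then 1 else 0) (ket l))" for x y
    by (simp_all add: DGmod_def mod_cat_def cou_DG)
  show "finite (labels (TUnit C :: ('a, 'k) dgmod))" by (simp add: T)
  show "act (TUnit C :: ('a, 'k) dgmod) (x, y) \<in> lin (labels (TUnit C :: ('a, 'k) dgmod)) (labels (TUnit C :: ('a, 'k) dgmod))" for x y
    unfolding T by (rule lin_ext_lin) (auto simp: coords_def scl_def ket_def)
  show "(\<lambda>v l. \<Sum>x\<in>U. act (TUnit C) (x, \<one>) v l) = (id_map (labels (TUnit C :: ('a, 'k) dgmod)) :: ('a, 'k) dgmor)"
    by (auto simp: T lin_ext_def id_map_def scl_def fun_eq_iff if_one_mult if_distrib[of "\<lambda>x. _ * x"] cong: if_cong)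
  show "act (TUnit C) (x, y) (act (TUnit C) (x', y') v) = (if x = cj y x' then act (TUnit C) (x, y \<otimes> y') v else (\<lambda>_. 0))"
    if "x \<in> U" "y \<in> U" "x' \<in> U" "y' \<in> U" for x y x' y' and v :: "'a label \<Rightarrow> 'k"
    using that by (auto simp: T lin_ext_def scl_def fun_eq_iff ket_def cj_move)
qed

text \<open>The intertwining property combines multiplicativity of c in its first argument with
  invariance of \<beta>; the inverse is the form of 1/\<beta>.\<close>

lemma J_Iso:
  assumes c: "bichar G c" and \<beta>: "\<beta> \<in> Zi" and M: "md M" and M': "md (M' :: ('a, 'k::field) dgmod)"
  shows "act2 DD M M' (form \<beta>) \<in> Iso C (TObj C (FObj (Fb c \<beta>) M) (FObj (Fb c \<beta>) M')) (FObj (Fb c \<beta>) (TObj C M M'))"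
    (is "?J \<in> Iso C ?S ?T")
proof (rule IsoI)
  let ?FM = "FObj (Fb c \<beta>) M" and ?FM' = "FObj (Fb c \<beta>) M'"
  let ?K = "act2 DD M M' (form (\<lambda>p. inverse (\<beta> p)))"
  have FM: "md ?FM" "md ?FM'" by (rule md_Fb[OF c M], rule md_Fb[OF c M'])
  show "md ?S" by (rule md_TObj[OF FM])
  show "md ?T" by (rule md_Fb[OF c md_TObj[OF M M']])
  have fin: "finite (pairs (labels M) (labels M'))" using moduleD(1)[OF M] moduleD(1)[OF M'] by (rule finite_pairs)
  have "?J \<circ> act ?S (x, y) = act ?T (x, y) \<circ> ?J" if m: "x \<in> U" "y \<in> U" for x y
  proof (rule pairs_eqI[OF M M'])
    show "?J \<circ> act ?S (x, y) \<in> lin (pairs (labels M) (labels M')) (pairs (labels M) (labels M'))"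
      by (rule lin_comp[OF TObj_lin[OF FM, unfolded Fb_simps] act2_lin[OF M M']])
    have "act ?T (x, y) \<in> lin (pairs (labels M) (labels M')) (pairs (labels M) (labels M'))"
      using moduleD(2)[OF md_Fb[OF c md_TObj[OF M M']] m] by simp
    thus "act ?T (x, y) \<circ> ?J \<in> lin (pairs (labels M) (labels M')) (pairs (labels M) (labels M'))"
      by (rule lin_comp[OF act2_lin[OF M M']])
    fix g h u v assume u: "deg M g u" and v: "deg M' h v"
    note gh = degD(1)[OF u] degD(1)[OF v]
    note Fu = deg_Fb[OF c gh(1), THEN iffD2, OF u, of \<beta>] and Fv = deg_Fb[OF c gh(2), THEN iffD2, OF v, of \<beta>]
    let ?u = "act M (cj y g, y) u" and ?v = "act M' (cj y h, y) v"
    have d: "deg M (cj y g) ?u" "deg M' (cj y h) ?v"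
      using deg_act[OF M _ m(2), of "cj y g" u] deg_act[OF M' _ m(2), of "cj y h" v] m gh by auto
    have "act ?S (x, y) (tens u v) = (if x = cj y (g \<otimes> h) then scl (c (g \<otimes> h) y) (tens ?u ?v) else (\<lambda>_. 0))"
      using act_TObj[OF FM Fu Fv m] m gh bicharD(2)[OF c gh m(2)]
      by (simp add: act_Fb[OF c] bichar_cj[OF c] mult.commute del: C_simps(5))
    hence l: "(?J \<circ> act ?S (x, y)) (tens u v) =
        (if x = cj y (g \<otimes> h) then scl (c (g \<otimes> h) y * \<beta> (g, h)) (tens ?u ?v) else (\<lambda>_. 0))"
      using m gh Z2invD(6)[OF \<beta> gh m(2)] act2_form[OF M M' d, of \<beta>]
      by (simp add: lin_scl[OF act2_lin[OF M M']] lin_zero[OF act2_lin[OF M M']] del: C_simps(5))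
    have "act ?T (x, y) (scl (\<beta> (g, h)) (tens u v)) =
        (if x = cj y (g \<otimes> h) then scl (c (g \<otimes> h) y * \<beta> (g, h)) (tens ?u ?v) else (\<lambda>_. 0))"
      using act_TObj[OF M M' u v m] m gh
      by (auto simp: act_Fb[OF c] bichar_cj[OF c] lin_scl[OF TObj_lin[OF M M']] mult.commute simp del: C_simps(5))
    thus "(?J \<circ> act ?S (x, y)) (tens u v) = (act ?T (x, y) \<circ> ?J) (tens u v)"
      unfolding l using act2_form[OF M M' u v, of \<beta>] by simp
  qed
  thus "?J \<in> Hom C ?S ?T" using act2_lin[OF M M'] by (auto simp del: C_simps(5))
  show "?K \<in> lin (labels ?T) (labels ?S)" using act2_lin[OF M M'] by simp
  have J: "?J (tens u v) = scl (\<beta> (g, h)) (tens u v)" "?K (tens u v) = scl (inverse (\<beta> (g, h))) (tens u v)" "\<beta> (g, h) \<noteq> 0"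
    if "deg M g u" "deg M' h v" for g h u v
    using act2_form[OF M M' that] Z2invD(2)[OF \<beta> degD(1)[OF that(1)] degD(1)[OF that(2)]] by simp_all
  have inv: "f \<circ> f' = id_map (pairs (labels M) (labels M'))"
    if "f \<in> lin (pairs (labels M) (labels M')) (pairs (labels M) (labels M'))" "f' \<in> lin (pairs (labels M) (labels M')) (pairs (labels M) (labels M'))"
      "\<And>g h u v. deg M g u \<Longrightarrow> deg M' h v \<Longrightarrow> f (f' (tens u v)) = tens u v" for f f'
  proof (rule pairs_eqI[OF M M' lin_comp[OF that(2,1)] id_map_lin[OF fin]])
    fix g h u v assume u: "deg M g u" and v: "deg M' h v"
    show "(f \<circ> f') (tens u v) = id_map (pairs (labels M) (labels M')) (tens u v)"
      using that(3)[OF u v] id_map_eq[OF fin tens_coords[OF degD(2)[OF u] degD(2)[OF v]]] by simp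
  qed
  show "?K \<circ> ?J = id_map (labels ?S)" "?J \<circ> ?K = id_map (labels ?T)"
    using inv[OF act2_lin[OF M M'] act2_lin[OF M M']] J by (simp_all add: lin_scl[OF act2_lin[OF M M']])
qed

lemma assoc_tens:
  assumes "md L" "md M" "md (M' :: ('a, 'k::field) dgmod)"
  shows "u \<in> coords (labels L) \<Longrightarrow> v \<in> coords (labels M) \<Longrightarrow> w \<in> coords (labels M') \<Longrightarrow>
      Assoc C L M M' (tens (tens u v) w) = tens u (tens v w)"
    and "Assoc C L M M' \<in> lin (pairs (pairs (labels L) (labels M)) (labels M')) (pairs (labels L) (pairs (labels M) (labels M')))"
proof -
  note fin = moduleD(1)[OF assms(1)] moduleD(1)[OF assms(2)] moduleD(1)[OF assms(3)]
  have A: "Assoc C L M M' = lin_ext (pairs (pairs (labels L) (labels M)) (labels M'))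
        (on_pairs (\<lambda>l k. on_pairs (\<lambda>i j. ket (Tens i (Tens j k))) l))"
    by (simp add: DGmod_def mod_cat_def)
  show "Assoc C L M M' \<in> lin (pairs (pairs (labels L) (labels M)) (labels M')) (pairs (labels L) (pairs (labels M) (labels M')))"
    unfolding A by (rule lin_ext_pairs_lin[OF finite_pairs[OF fin(1,2)] fin(3)]) (auto simp: pairs_def on_pairs_def intro!: ket_coords)
  assume c: "u \<in> coords (labels L)" "v \<in> coords (labels M)" "w \<in> coords (labels M')"
  show "Assoc C L M M' (tens (tens u v) w) = tens u (tens v w)"
  proof
    fix p
    have "Assoc C L M M' (tens (tens u v) w) p =
        (\<Sum>i\<in>labels L. \<Sum>j\<in>labels M. \<Sum>k\<in>labels M'. u i * v j * w k * ket (Tens i (Tens j k)) p)"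
      unfolding A lin_ext_pairs sum_pairs by (simp add: on_pairs_def)
    also have "\<dots> = tens u (tens v w) p"
    proof (cases "\<exists>a b d. p = Tens a (Tens b d)")
      case True
      then obtain a b d where p: "p = Tens a (Tens b d)" by blast
      have "(\<Sum>i\<in>labels L. \<Sum>j\<in>labels M. \<Sum>k\<in>labels M'. u i * v j * w k * ket (Tens i (Tens j k)) p) =
          (\<Sum>i\<in>labels L. u i * ket i a * (\<Sum>j\<in>labels M. v j * ket j b * (\<Sum>k\<in>labels M'. w k * ket k d)))"
        unfolding p sum_distrib_left by (intro sum.cong refl) (simp add: ket_def)
      also have "\<dots> = u a * (v b * w d)"
        using fun_cong[OF coords_expand[OF fin(1) c(1)], of a] fun_cong[OF coords_expand[OF fin(2) c(2)], of b]
          fun_cong[OF coords_expand[OF fin(3) c(3)], of d]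
        by (simp add: sum_distrib_right[symmetric])
      finally show ?thesis by (simp add: p)
    next
      case False
      hence "tens u (tens v w) p = 0" by (auto simp: tens_def split: label.splits)
      thus ?thesis using False by (simp add: ket_def)
    qed
    finally show "Assoc C L M M' (tens (tens u v) w) p = tens u (tens v w) p" .
  qed
qed

lemma id_deg: "md M \<Longrightarrow> deg M g u \<Longrightarrow> id_map (labels M) u = (u :: 'a label \<Rightarrow> 'k::field)"
  using id_map_eq[OF moduleD(1) degD(2)] by blast

text \<open>Naturality holds because morphisms preserve degrees, and the associativity axiom in
  degrees g, h, k is the cocycle identity of \<beta>.\<close>

lemma monoidal_Fb:
  assumes c: "bichar G c" and \<beta>: "\<beta> \<in> Zi"
  shows "monoidal_functor (C :: (('a, 'k::field) dgmod, ('a, 'k) dgmor) bmcat) (Fb c \<beta>)"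
  unfolding monoidal_functor_def
proof (intro conjI ballI)
  let ?F = "FObj (Fb c \<beta>)"
  show "endofunctor (C :: (('a, 'k) dgmod, ('a, 'k) dgmor) bmcat) (Fb c \<beta>)"
    unfolding endofunctor_def
    using md_Fb[OF c] Hom_Fb[OF c] by (simp del: C_simps(6))
  \<comment> \<open>The unit object lives in degree \<one>, where c(\<one>, y) = 1, so the twist
    leaves its action unchanged.\<close>
  have "act (TUnit C :: ('a, 'k) dgmod) p = act (?F (TUnit C)) p" if "p \<in> B" for p
  proof (cases p)
    case (Pair x y)
    have "lin_ext {Triv} (\<lambda>l. scl (cou DD (x, y)) (ket l)) v = scl (c x y) (lin_ext {Triv} (\<lambda>l. scl (cou DD (x, y)) (ket l)) v)"
      for v :: "'a label \<Rightarrow> 'k"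
      using that bichar_one(1)[OF c, of y] by (auto simp: Pair cou_DG lin_ext_def scl_def)
    thus ?thesis using that act_Fb[OF c, of x y \<beta> "TUnit C"] by (auto simp: Pair DGmod_def mod_cat_def)
  qed
  hence "id_map (labels (TUnit C :: ('a, 'k) dgmod)) \<in> Iso C (TUnit C) (?F (TUnit C) :: ('a, 'k) dgmod)"
    by (intro id_Iso md_TUnit md_Fb[OF c md_TUnit]) simp_all
  thus "Iso C (TUnit C) (?F (TUnit C) :: ('a, 'k) dgmod) \<noteq> {}" by blast
next
  fix M M' :: "('a, 'k) dgmod" assume "M \<in> Obj C" "M' \<in> Obj C"
  thus "FTen (Fb c \<beta>) M M' \<in> Iso C (TObj C (FObj (Fb c \<beta>) M) (FObj (Fb c \<beta>) M')) (FObj (Fb c \<beta>) (TObj C M M'))"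
    using J_Iso[OF c \<beta>] by simp
next
  fix M N' M' N'' :: "('a, 'k) dgmod" and f f'
  assume O: "M \<in> Obj C" "N' \<in> Obj C" "M' \<in> Obj C" "N'' \<in> Obj C" and H: "f \<in> Hom C M N'" "f' \<in> Hom C M' N''"
  have m: "md M" "md N'" "md M'" "md N''" using O by simp_all
  have l: "f \<in> lin (labels M) (labels N')" "f' \<in> lin (labels M') (labels N'')" using H by simp_all
  let ?T = "TMor C M M' f f'"
  note T = TMor_lin[OF m(1,3) l]
  have TF: "TMor C (FObj (Fb c \<beta>) M) (FObj (Fb c \<beta>) M') f f' = ?T" by (simp add: DGmod_def mod_cat_def)
  have "act2 DD N' N'' (form \<beta>) \<circ> ?T = ?T \<circ> act2 DD M M' (form \<beta>)"
  proof (rule pairs_eqI[OF m(1,3) lin_comp[OF T act2_lin[OF m(2,4)]] lin_comp[OF act2_lin[OF m(1,3)] T]])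
    fix g h u v assume d: "deg M g u" "deg M' h v"
    show "(act2 DD N' N'' (form \<beta>) \<circ> ?T) (tens u v) = (?T \<circ> act2 DD M M' (form \<beta>)) (tens u v)"
      using act2_form[OF m(1,3) d] act2_form[OF m(2,4) deg_hom[OF H(1) d(1)] deg_hom[OF H(2) d(2)]]
      by (simp add: TMor_tens[OF l] lin_scl[OF T])
  qed
  thus "Cmp C (FTen (Fb c \<beta>) N' N'') (TMor C (FObj (Fb c \<beta>) M) (FObj (Fb c \<beta>) M') (FMor (Fb c \<beta>) M N' f) (FMor (Fb c \<beta>) M' N'' f')) =
      Cmp C (FMor (Fb c \<beta>) (TObj C M M') (TObj C N' N'') (TMor C M M' f f')) (FTen (Fb c \<beta>) M M')"
    by (simp add: TF)
next
  fix L M D :: "('a, 'k) dgmod" assume O: "L \<in> Obj C" "M \<in> Obj C" "D \<in> Obj C"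
  have m: "md L" "md M" "md D" using O by simp_all
  let ?F = "FObj (Fb c \<beta>)" and ?J = "\<lambda>M M'. act2 DD M M' (form \<beta>)"
  have F: "md (?F L)" "md (?F M)" "md (?F D)" by (rule md_Fb[OF c], rule m)+
  note t = md_TObj[OF m(1,2)] md_TObj[OF m(2,3)]
  note Ft = md_TObj[OF F(1,2)] md_TObj[OF F(2,3)]
  have id: "id_map (labels L) \<in> lin (labels L) (labels L)" "id_map (labels D) \<in> lin (labels D) (labels D)"
    using id_map_lin moduleD(1) m by blast+
  have Fl: "id_map (labels D) \<in> lin (labels (?F D)) (labels D)" "id_map (labels L) \<in> lin (labels (?F L)) (labels L)"
    "?J L M \<in> lin (labels (TObj C (?F L) (?F M))) (pairs (labels L) (labels M))"
    "?J M D \<in> lin (labels (TObj C (?F M) (?F D))) (pairs (labels M) (labels D))"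
    using id act2_lin[OF m(1,2)] act2_lin[OF m(2,3)] by simp_all
  let ?T1 = "TMor C (TObj C (?F L) (?F M)) (?F D) (?J L M) (id_map (labels D))"
  let ?T2 = "TMor C (?F L) (TObj C (?F M) (?F D)) (id_map (labels L)) (?J M D)"
  let ?P = "pairs (pairs (labels L) (labels M)) (labels D)" and ?Q = "pairs (labels L) (pairs (labels M) (labels D))"
  have T1: "?T1 \<in> lin ?P ?P" using TMor_lin[OF Ft(1) F(3) Fl(3,1)] by simp
  have T2: "?T2 \<in> lin ?Q ?Q" using TMor_lin[OF F(1) Ft(2) Fl(2,4)] by simp
  have J1: "?J (TObj C L M) D \<in> lin ?P ?P" using act2_lin[OF t(1) m(3)] by simp
  have J2: "?J L (TObj C M D) \<in> lin ?Q ?Q" using act2_lin[OF m(1) t(2)] by simp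
  note A = assoc_tens(2)[OF m] and A' = assoc_tens(2)[OF F, unfolded Fb_simps]
  have "Assoc C L M D \<circ> (?J (TObj C L M) D \<circ> ?T1) = ?J L (TObj C M D) \<circ> (?T2 \<circ> Assoc C (?F L) (?F M) (?F D))"
  proof (rule spansD[OF spans_pairs[OF spans_pairs[OF spans_deg[OF m(1)] spans_deg[OF m(2)]] spans_deg[OF m(3)]]])
    show "Assoc C L M D \<circ> (?J (TObj C L M) D \<circ> ?T1) \<in> lin ?P ?Q" by (rule lin_comp[OF lin_comp[OF T1 J1] A])
    show "?J L (TObj C M D) \<circ> (?T2 \<circ> Assoc C (?F L) (?F M) (?F D)) \<in> lin ?P ?Q"
      by (rule lin_comp[OF lin_comp[OF A' T2] J2])
    fix s assume "s \<in> {tens s t | s t. s \<in> {tens s t | s t. s \<in> {u. \<exists>g. deg L g u} \<and> t \<in> {u. \<exists>g. deg M g u}} \<and> t \<in> {u. \<exists>g. deg D g u}}"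
    then obtain u v w g h k where s: "s = tens (tens u v) w" and u: "deg L g u" and v: "deg M h v" and w: "deg D k w" by blast
    note gh = degD(1)[OF u] degD(1)[OF v] degD(1)[OF w] and co = degD(2)[OF u] degD(2)[OF v] degD(2)[OF w]
    have "?T1 s = scl (\<beta> (g, h)) s"
      unfolding s TMor_tens[OF Fl(3,1)] by (simp add: act2_form[OF m(1,2) u v] id_deg[OF m(3) w])
    hence "(Assoc C L M D \<circ> (?J (TObj C L M) D \<circ> ?T1)) s = scl (\<beta> (g, h) * \<beta> (g \<otimes> h, k)) (tens u (tens v w))"
      using act2_form[OF t(1) m(3) deg_tens[OF m(1,2) u v] w, of \<beta>] assoc_tens(1)[OF m co]
      by (simp add: s lin_scl[OF J1] lin_scl[OF A])
    also have "\<dots> = scl (\<beta> (h, k) * \<beta> (g, h \<otimes> k)) (tens u (tens v w))" using Z2invD(5)[OF \<beta> gh] by simp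
    also have "\<dots> = (?J L (TObj C M D) \<circ> (?T2 \<circ> Assoc C (?F L) (?F M) (?F D))) s"
    proof -
      have "Assoc C (?F L) (?F M) (?F D) s = tens u (tens v w)" unfolding s by (rule assoc_tens(1)[OF F]) (use co in simp_all)
      moreover have "?T2 (tens u (tens v w)) = scl (\<beta> (h, k)) (tens u (tens v w))"
        unfolding TMor_tens[OF Fl(2,4)] by (simp add: act2_form[OF m(2,3) v w] id_deg[OF m(1) u])
      ultimately show ?thesis
        using act2_form[OF m(1) t(2) u deg_tens[OF m(2,3) v w], of \<beta>] by (simp add: lin_scl[OF J2])
    qed
    finally show "(Assoc C L M D \<circ> (?J (TObj C L M) D \<circ> ?T1)) s = (?J L (TObj C M D) \<circ> (?T2 \<circ> Assoc C (?F L) (?F M) (?F D))) s" .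
  qed
  thus "Cmp C (FMor (Fb c \<beta>) (TObj C (TObj C L M) D) (TObj C L (TObj C M D)) (Assoc C L M D))
      (Cmp C (FTen (Fb c \<beta>) (TObj C L M) D)
        (TMor C (TObj C (FObj (Fb c \<beta>) L) (FObj (Fb c \<beta>) M)) (FObj (Fb c \<beta>) D) (FTen (Fb c \<beta>) L M) (Idm C (FObj (Fb c \<beta>) D)))) =
    Cmp C (FTen (Fb c \<beta>) L (TObj C M D))
      (Cmp C (TMor C (FObj (Fb c \<beta>) L) (TObj C (FObj (Fb c \<beta>) M) (FObj (Fb c \<beta>) D)) (Idm C (FObj (Fb c \<beta>) L)) (FTen (Fb c \<beta>) M D))
        (Assoc C (FObj (Fb c \<beta>) L) (FObj (Fb c \<beta>) M) (FObj (Fb c \<beta>) D)))"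
    by simp
qed

text \<open>Full faithfulness is \<open>Hom_Fb\<close>; twisting by the inverse bicharacter provides
  a preimage of each module up to isomorphism.\<close>

lemma equivalence_Fb:
  assumes c: "bichar G c"
  shows "equivalence (C :: (('a, 'k::field) dgmod, ('a, 'k) dgmor) bmcat) (Fb c \<beta>)"
  unfolding equivalence_def
proof (intro conjI ballI)
  fix M M' :: "('a, 'k) dgmod" assume "M \<in> Obj C" "M' \<in> Obj C"
  hence "Hom C (FObj (Fb c \<beta>) M) (FObj (Fb c \<beta>) M') = Hom C M M'" by (intro Hom_Fb[OF c]) simp_all
  thus "bij_betw (FMor (Fb c \<beta>) M M') (Hom C M M') (Hom C (FObj (Fb c \<beta>) M) (FObj (Fb c \<beta>) M'))"
    by (simp add: bij_betw_def inj_on_def del: C_simps(6))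
next
  fix M :: "('a, 'k) dgmod" assume "M \<in> Obj C"
  hence M: "md M" by simp
  have ci: "bichar G (\<lambda>x y. inverse (c x y))" by (rule bichar_inverse[OF c])
  let ?A = "FObj (Fb (\<lambda>x y. inverse (c x y)) \<beta>) M"
  have A: "md ?A" by (rule md_Fb[OF ci M])
  have "act (FObj (Fb c \<beta>) ?A) p = act M p" if "p \<in> B" for p
    using that bicharD(1)[OF c] by (cases p) (simp add: act_Fb[OF c] act_Fb[OF ci])
  hence "id_map (labels (FObj (Fb c \<beta>) ?A)) \<in> Iso C (FObj (Fb c \<beta>) ?A) M"
    by (intro id_Iso md_Fb[OF c A] M) simp_all
  thus "\<exists>A\<in>Obj C. Iso C (FObj (Fb c \<beta>) A) M \<noteq> {}" using A by auto
qed

section \<open>The braiding condition\<close>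

lemma braid_lin:
  assumes "md M" "md (M' :: ('a, 'k::field) dgmod)"
  shows "Braid C M M' \<in> lin (pairs (labels M) (labels M')) (pairs (labels M') (labels M))"
proof -
  have "lin_ext (pairs (labels M) (labels M')) (on_pairs (\<lambda>i j l.
        \<Sum>(p, q)\<in>basis DD \<times> basis DD. Rmat G (p, q) * tens (act M' q (ket j)) (act M p (ket i)) l)) \<in>
      lin (pairs (labels M) (labels M')) (pairs (labels M') (labels M))"
    unfolding split_def
    by (rule lin_ext_pairs_lin[OF moduleD(1)[OF assms(1)] moduleD(1)[OF assms(2)]], rule sum_coords, rule tens_coords)
      (auto intro: lin_coords[OF moduleD(2)[OF assms(1)]] lin_coords[OF moduleD(2)[OF assms(2)]])
  thus ?thesis by (simp add: DGmod_def mod_cat_def)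
qed

text \<open>In the twisted modules the degree g acts on v with the extra factor c(h, g). The tensor
  structure then contributes \<beta>(g h g^{-1}, g), which is \<beta>(h, g) by invariance under
  g.\<close>

lemma braided_sides:
  assumes c: "bichar G c" and \<beta>: "\<beta> \<in> Zi" and M: "md M" and M': "md (M' :: ('a, 'k::field) dgmod)"
    and u: "deg M g u" and v: "deg M' h v"
  shows "(act2 DD M' M (form \<beta>) \<circ> Braid C (FObj (Fb c \<beta>) M) (FObj (Fb c \<beta>) M')) (tens u v) =
      scl (c h g * \<beta> (h, g)) (tens (act M' (cj g h, g) v) u)"
    "(Braid C M M' \<circ> act2 DD M M' (form \<beta>)) (tens u v) = scl (\<beta> (g, h)) (tens (act M' (cj g h, g) v) u)"
proof -
  note gh = degD(1)[OF u] degD(1)[OF v]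
  have F: "md (FObj (Fb c \<beta>) M)" "md (FObj (Fb c \<beta>) M')" by (rule md_Fb[OF c], rule M M')+
  note Fu = deg_Fb[OF c gh(1), THEN iffD2, OF u, of \<beta>] and Fv = deg_Fb[OF c gh(2), THEN iffD2, OF v, of \<beta>]
  have "\<beta> (cj g h, g) = \<beta> (h, g)" using Z2invD(6)[OF \<beta> gh(2,1,1)] gh by (simp add: conj_by_def m_assoc)
  thus "(act2 DD M' M (form \<beta>) \<circ> Braid C (FObj (Fb c \<beta>) M) (FObj (Fb c \<beta>) M')) (tens u v) =
      scl (c h g * \<beta> (h, g)) (tens (act M' (cj g h, g) v) u)"
    using gh act2_form[OF M' M deg_act[OF M' cj_closed[OF gh] gh(1)] u]
    by (simp add: braid_tens[OF F Fu Fv] act_Fb[OF c] bichar_cj[OF c] lin_scl[OF act2_lin[OF M' M]])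
  show "(Braid C M M' \<circ> act2 DD M M' (form \<beta>)) (tens u v) = scl (\<beta> (g, h)) (tens (act M' (cj g h, g) v) u)"
    by (simp add: act2_form[OF M M' u v] lin_scl[OF braid_lin[OF M M']] braid_tens[OF M M' u v])
qed

text \<open>The module \<open>k\<^sup>G\<close> contains nonzero homogeneous vectors of every degree on which \<open>G\<close> acts
  invertibly, so it detects a failure of the braiding condition.\<close>

definition fun_mod :: "('a, 'k::field) dgmod" where
  "fun_mod = \<lparr>labels = {Atom x 0 | x. x \<in> U},
     act = (\<lambda>(x, y). lin_ext {Atom x 0 | x. x \<in> U} (\<lambda>l. case l of
        Atom z n \<Rightarrow> if x = cj y z then ket (Atom x 0) else (\<lambda>_. 0) | _ \<Rightarrow> (\<lambda>_. 0)))\<rparr>"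

lemma fun_mod_labels: "labels (fun_mod :: ('a, 'k::field) dgmod) = (\<lambda>x. Atom x 0) ` U"
  by (auto simp: fun_mod_def)

lemma fun_mod_act:
  assumes "z \<in> U"
  shows "act fun_mod (x, y) (ket (Atom z 0)) = (if x = cj y z then ket (Atom x 0) else (\<lambda>_. 0 :: 'k::field))"
proof -
  have "{Atom x 0 | x. x \<in> U} = (\<lambda>x. Atom x 0) ` U" by auto
  hence "finite {Atom x 0 | x. x \<in> U}" by simp
  thus ?thesis using assms by (simp add: fun_mod_def)
qed

lemma fun_mod_lin:
  assumes "x \<in> U" "y \<in> U"
  shows "act fun_mod (x, y) \<in> lin (labels (fun_mod :: ('a, 'k::field) dgmod)) (labels (fun_mod :: ('a, 'k) dgmod))"
proof -
  have L: "{Atom x 0 | x. x \<in> U} = (\<lambda>x. Atom x 0) ` U" by auto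
  show ?thesis unfolding fun_mod_def hmodule.simps prod.case L
    by (rule lin_ext_lin) (use assms in \<open>auto simp: coords_def ket_def\<close>)
qed

lemma md_fun_mod: "md (fun_mod :: ('a, 'k::field) dgmod)"
proof (rule moduleI)
  let ?L = "labels (fun_mod :: ('a, 'k) dgmod)"
  show fin: "finite ?L" by (simp add: fun_mod_labels)
  show "act fun_mod (x, y) \<in> lin ?L ?L" if "x \<in> U" "y \<in> U" for x y by (rule fun_mod_lin[OF that])
  show "(\<lambda>v l. \<Sum>x\<in>U. act fun_mod (x, \<one>) v l) = (id_map ?L :: ('a, 'k) dgmor)"
  proof (rule lin_eqI[OF lin_sum_maps id_map_lin[OF fin]])
    fix i assume i: "i \<in> ?L"
    then obtain z where z: "z \<in> U" "i = Atom z 0" unfolding fun_mod_labels by blast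
    have "(\<Sum>x\<in>U. act fun_mod (x, \<one>) (ket i) l) = (\<Sum>x\<in>U. if x = z then ket i l else (0 :: 'k))" for l
      by (rule sum.cong) (use z in \<open>simp_all add: fun_mod_act\<close>)
    thus "(\<lambda>l. \<Sum>x\<in>U. act fun_mod (x, \<one>) (ket i) l) = id_map ?L (ket i :: 'a label \<Rightarrow> 'k)"
      using z(1) id_map_eq[OF fin ket_coords[OF i], where 'b='k] by simp
  qed (rule fun_mod_lin, simp_all)
  fix x y x' y' and v :: "'a label \<Rightarrow> 'k"
  assume m: "x \<in> U" "y \<in> U" "x' \<in> U" "y' \<in> U"
  have "act fun_mod (x, y) \<circ> act fun_mod (x', y') = (\<lambda>v :: 'a label \<Rightarrow> 'k. if x = cj y x' then act fun_mod (x, y \<otimes> y') v else (\<lambda>_. 0))"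
  proof (rule lin_eqI[OF lin_comp[OF fun_mod_lin[OF m(3,4)] fun_mod_lin[OF m(1,2)]]])
    show "(\<lambda>v. if x = cj y x' then act fun_mod (x, y \<otimes> y') v else (\<lambda>_. 0)) \<in> lin ?L ?L"
      using fun_mod_lin[OF m(1) m_closed[OF m(2,4)]] lin_zero_map by (cases "x = cj y x'") simp_all
    fix i assume "i \<in> ?L"
    then obtain z where z: "z \<in> U" "i = Atom z 0" unfolding fun_mod_labels by blast
    show "(act fun_mod (x, y) \<circ> act fun_mod (x', y')) (ket i) = (if x = cj y x' then act fun_mod (x, y \<otimes> y') (ket i) else (\<lambda>_. 0 :: 'k))"
      using z m lin_zero[OF fun_mod_lin[OF m(1,2)]] by (auto simp: fun_mod_act cj_cj[symmetric])
  qed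
  from fun_cong[OF this, of v]
  show "act fun_mod (x, y) (act fun_mod (x', y') v) = (if x = cj y x' then act fun_mod (x, y \<otimes> y') v else (\<lambda>_. 0))"
    by simp
qed

lemma braided_Fb_iff:
  assumes c: "bichar G c" and \<beta>: "\<beta> \<in> Zi"
  shows "braided (C :: (('a, 'k::field) dgmod, ('a, 'k) dgmor) bmcat) (Fb c \<beta>) \<longleftrightarrow>
    (\<forall>g\<in>U. \<forall>h\<in>U. c h g * \<beta> (h, g) = \<beta> (g, h))" (is "?b \<longleftrightarrow> ?e")
proof
  assume b: ?b
  show ?e
  proof (intro ballI)
    fix g h assume m: "g \<in> U" "h \<in> U"
    let ?u = "ket (Atom g 0) :: 'a label \<Rightarrow> 'k" and ?v = "ket (Atom h 0) :: 'a label \<Rightarrow> 'k"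
    have d: "deg fun_mod g ?u" "deg fun_mod h ?v"
      using m by (simp_all add: deg_def fun_mod_act fun_mod_labels ket_coords)
    have "act2 DD fun_mod fun_mod (form \<beta>) \<circ> Braid C (FObj (Fb c \<beta>) fun_mod) (FObj (Fb c \<beta>) fun_mod) =
        Braid C fun_mod fun_mod \<circ> act2 DD fun_mod (fun_mod :: ('a, 'k) dgmod) (form \<beta>)"
      using b[unfolded braided_def, rule_format, of fun_mod fun_mod] by (simp add: md_fun_mod)
    hence "scl (c h g * \<beta> (h, g)) (tens (act fun_mod (cj g h, g) ?v) ?u) = scl (\<beta> (g, h)) (tens (act fun_mod (cj g h, g) ?v) ?u)"
      using braided_sides[OF c \<beta> md_fun_mod md_fun_mod d] by simp
    hence "scl (c h g * \<beta> (h, g)) (ket (Tens (Atom (cj g h) 0) (Atom g 0)) :: 'a label \<Rightarrow> 'k) =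
        scl (\<beta> (g, h)) (ket (Tens (Atom (cj g h) 0) (Atom g 0)))"
      using m by (simp add: fun_mod_act tens_ket)
    from fun_cong[OF this, of "Tens (Atom (cj g h) 0) (Atom g 0)"] show "c h g * \<beta> (h, g) = \<beta> (g, h)"
      by (simp add: scl_def ket_def)
  qed
next
  assume e: ?e
  have "act2 DD M' M (form \<beta>) \<circ> Braid C (FObj (Fb c \<beta>) M) (FObj (Fb c \<beta>) M') = Braid C M M' \<circ> act2 DD M M' (form \<beta>)"
    if M: "md M" and M': "md M'" for M M' :: "('a, 'k) dgmod"
  proof (rule pairs_eqI[OF M M'])
    show "act2 DD M' M (form \<beta>) \<circ> Braid C (FObj (Fb c \<beta>) M) (FObj (Fb c \<beta>) M') \<in> lin (pairs (labels M) (labels M')) (pairs (labels M') (labels M))"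
      by (rule lin_comp[OF braid_lin[OF md_Fb[OF c M] md_Fb[OF c M'], unfolded Fb_simps] act2_lin[OF M' M]])
    show "Braid C M M' \<circ> act2 DD M M' (form \<beta>) \<in> lin (pairs (labels M) (labels M')) (pairs (labels M') (labels M))"
      by (rule lin_comp[OF act2_lin[OF M M'] braid_lin[OF M M']])
    fix g h u v assume d: "deg M g u" "deg M' h v"
    show "(act2 DD M' M (form \<beta>) \<circ> Braid C (FObj (Fb c \<beta>) M) (FObj (Fb c \<beta>) M')) (tens u v) =
        (Braid C M M' \<circ> act2 DD M M' (form \<beta>)) (tens u v)"
      using e degD(1)[OF d(1)] degD(1)[OF d(2)] unfolding braided_sides[OF c \<beta> M M' d] by simp
  qed
  thus ?b by (simp add: braided_def)
qed

lemma BL_braided: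
  "BL G = {x \<in> Bsub G \<times> Zhat G. braided_autoequivalence (C :: (('a, 'k::field) dgmod, ('a, 'k) dgmor) bmcat) (Psi G x)}"
    (is "_ = ?R")
proof (intro equalityI subsetI)
  fix x assume x: "x \<in> (BL G :: ('a, 'k) dg_pair set)"
  then obtain \<beta> where b: "\<beta> \<in> Zi" "x = (baut (asym \<beta>), form \<beta>)" unfolding BL_eq by blast
  note c = bichar_asym[OF b(1)]
  have "braided C (Fb (asym \<beta>) \<beta>)"
    unfolding braided_Fb_iff[OF c b(1)] using Z2invD(2)[OF b(1)] by (simp add: asym_def)
  hence "braided_autoequivalence C (Psi G x)"
    unfolding braided_autoequivalence_def b(2) using monoidal_Fb[OF c b(1)] equivalence_Fb[OF c] by blast
  thus "x \<in> ?R" using x BL_subset by blast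
next
  fix x assume x: "x \<in> ?R"
  then obtain c \<beta> where b: "bichar G c" "\<beta> \<in> Zi" "x = (baut c, form \<beta>)"
    using BZ_cases[of x] by blast
  have "braided C (Fb c \<beta>)" using x unfolding b(3) braided_autoequivalence_def by blast
  hence e: "c h g * \<beta> (h, g) = \<beta> (g, h)" if "g \<in> U" "h \<in> U" for g h
    using that unfolding braided_Fb_iff[OF b(1,2)] by blast
  \<comment> \<open>Divided by \<beta>(h, g), the braiding condition says that c is
    \<open>asym \<beta>\<close>.\<close>
  have "baut c = baut (asym \<beta>)"
  proof (rule dg_aut_cong)
    fix h g assume "h \<in> U" "g \<in> U"
    thus "c h g = asym \<beta> h g" using e[of g h] Z2invD(2)[OF b(2), of h g] by (simp add: asym_def field_simps)
  qed simp
  thus "x \<in> BL G" unfolding BL_eq b(3) using b(2) by blast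
qed

end

lemma (in fin_group) Hom_act:
  assumes "f \<in> Hom C M (M' :: ('a, 'k::field) dgmod)" "p \<in> B"
  shows "f (act M p w) = act M' p (f w)"
proof -
  have "f \<circ> act M p = act M' p \<circ> f" using assms by (cases p) simp
  from fun_cong[OF this, of w] show ?thesis by simp
qed

lemma (in fin_group) Iso_TMor:
  assumes "\<theta> \<in> Iso C M N1" "\<zeta> \<in> Iso C M' (N2 :: ('a, 'k::field) dgmod)"
  shows "TMor C M M' \<theta> \<zeta> \<in> Iso C (TObj C M M') (TObj C N1 N2)"
proof -
  obtain \<theta>' where t: "md M" "md N1" "\<theta> \<in> Hom C M N1" "\<theta>' \<in> Hom C N1 M" "\<theta>' \<circ> \<theta> = id_map (labels M)" "\<theta> \<circ> \<theta>' = id_map (labels N1)"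
    by (rule IsoD[OF assms(1)])
  obtain \<zeta>' where z: "md M'" "md N2" "\<zeta> \<in> Hom C M' N2" "\<zeta>' \<in> Hom C N2 M'" "\<zeta>' \<circ> \<zeta> = id_map (labels M')" "\<zeta> \<circ> \<zeta>' = id_map (labels N2)"
    by (rule IsoD[OF assms(2)])
  have l: "\<theta> \<in> lin (labels M) (labels N1)" "\<theta>' \<in> lin (labels N1) (labels M)" "\<zeta> \<in> lin (labels M') (labels N2)" "\<zeta>' \<in> lin (labels N2) (labels M')"
    using t(3,4) z(3,4) by simp_all
  let ?T = "TMor C M M' \<theta> \<zeta>" and ?T' = "TMor C N1 N2 \<theta>' \<zeta>'"
  note T = TMor_lin[OF t(1) z(1) l(1,3)] and T' = TMor_lin[OF t(2) z(2) l(2,4)]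
  note eq = TMor_tens[OF l(1,3)] TMor_tens[OF l(2,4)]
  note fin = finite_pairs[OF moduleD(1)[OF t(1)] moduleD(1)[OF z(1)]] finite_pairs[OF moduleD(1)[OF t(2)] moduleD(1)[OF z(2)]]
  show ?thesis
  proof (rule IsoI[OF md_TObj[OF t(1) z(1)] md_TObj[OF t(2) z(2)]])
    have "?T \<circ> act (TObj C M M') (x, y) = act (TObj C N1 N2) (x, y) \<circ> ?T" if m: "x \<in> U" "y \<in> U" for x y
    proof (rule pairs_eqI[OF t(1) z(1) lin_comp[OF TObj_lin[OF t(1) z(1)] T] lin_comp[OF T TObj_lin[OF t(2) z(2)]]])
      fix g h u v assume d: "deg M g u" "deg M' h v"
      have "\<theta> (act M p w) = act N1 p (\<theta> w)" "\<zeta> (act M' p w) = act N2 p (\<zeta> w)" if "p \<in> B" for p w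
        using Hom_act[OF t(3) that] Hom_act[OF z(3) that] by simp_all
      thus "(?T \<circ> act (TObj C M M') (x, y)) (tens u v) = (act (TObj C N1 N2) (x, y) \<circ> ?T) (tens u v)"
        using act_TObj[OF t(1) z(1) d m] act_TObj[OF t(2) z(2) deg_hom[OF t(3) d(1)] deg_hom[OF z(3) d(2)] m]
          degD(1)[OF d(1)] degD(1)[OF d(2)] m lin_zero[OF T]
        by (simp add: eq del: C_simps(5))
    qed
    thus "?T \<in> Hom C (TObj C M M') (TObj C N1 N2)" using T by (auto simp del: C_simps(5))
    show "?T' \<in> lin (labels (TObj C N1 N2)) (labels (TObj C M M'))" using T' by simp
    have "?T' \<circ> ?T = id_map (pairs (labels M) (labels M'))"
    proof (rule pairs_eqI[OF t(1) z(1) lin_comp[OF T T'] id_map_lin[OF fin(1)]])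
      fix g h u v assume d: "deg M g u" "deg M' h v"
      show "(?T' \<circ> ?T) (tens u v) = id_map (pairs (labels M) (labels M')) (tens u v)"
        using fun_cong[OF t(5), of u] fun_cong[OF z(5), of v] id_deg[OF t(1) d(1)] id_deg[OF z(1) d(2)]
          id_map_eq[OF fin(1) tens_coords[OF degD(2)[OF d(1)] degD(2)[OF d(2)]]] by (simp add: eq)
    qed
    thus "?T' \<circ> ?T = id_map (labels (TObj C M M'))" by simp
    have "?T \<circ> ?T' = id_map (pairs (labels N1) (labels N2))"
    proof (rule pairs_eqI[OF t(2) z(2) lin_comp[OF T' T] id_map_lin[OF fin(2)]])
      fix g h u v assume d: "deg N1 g u" "deg N2 h v"
      show "(?T \<circ> ?T') (tens u v) = id_map (pairs (labels N1) (labels N2)) (tens u v)"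
        using fun_cong[OF t(6), of u] fun_cong[OF z(6), of v] id_deg[OF t(2) d(1)] id_deg[OF z(2) d(2)]
          id_map_eq[OF fin(2) tens_coords[OF degD(2)[OF d(1)] degD(2)[OF d(2)]]] by (simp add: eq)
    qed
    thus "?T \<circ> ?T' = id_map (labels (TObj C N1 N2))" by simp
  qed
qed

section \<open>Simple objects\<close>

text \<open>The representation axioms are recorded directly, so that the twist of \<rho> by the
  character c(g, -) can be verified as another instance.\<close>

locale simple_object = fin_group G for G (structure) +
  fixes g :: 'a and d :: nat and \<rho> :: "'a \<Rightarrow> (nat \<Rightarrow> 'k::field) \<Rightarrow> nat \<Rightarrow> 'k" and S :: "'a set"
  assumes g: "g \<in> U" and S: "coset_reps G (Cent G g) S"
    and \<rho>_lin: "\<And>t. t \<in> Cent G g \<Longrightarrow> \<rho> t \<in> lin {..<d} {..<d}"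
    and \<rho>_one: "\<rho> \<one> = id_map {..<d}"
    and \<rho>_mult: "\<And>s t. s \<in> Cent G g \<Longrightarrow> t \<in> Cent G g \<Longrightarrow> \<rho> (s \<otimes> t) = \<rho> s \<circ> \<rho> t"
begin

abbreviation "W \<equiv> itens G g d \<rho> S"
abbreviation "L \<equiv> {Atom s j | s j. s \<in> S \<and> j < d}"
abbreviation "V \<equiv> simple_obj G g d \<rho> S"

lemma Cent_iff: "t \<in> Cent G g \<longleftrightarrow> t \<in> U \<and> cj t g = g"
proof (cases "t \<in> U")
  case True
  hence "t \<otimes> g = cj t g \<otimes> t" using g by (simp add: conj_by_def m_assoc)
  thus ?thesis using True g by (simp add: Cent_def)
qed (simp add: Cent_def)

lemma Cent_mult:
  assumes "y \<in> U" "e \<in> Cent G g"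
  shows "cj (y \<otimes> e) g = cj y g" "y \<otimes> e \<in> Cent G g \<longleftrightarrow> y \<in> Cent G g"
  using assms g by (auto simp: Cent_iff cj_cj[symmetric])

lemma S_in: "s \<in> S \<Longrightarrow> s \<in> U"
  using S by (auto simp: coset_reps_def)

lemma S_rep:
  assumes "y \<in> U"
  obtains s e where "s \<in> S" "e \<in> Cent G g" "y = s \<otimes> e" "s \<in> U" "e \<in> U"
proof -
  obtain s where s: "s \<in> S" "inv s \<otimes> y \<in> Cent G g" using S assms unfolding coset_reps_def by blast
  have "y = s \<otimes> (inv s \<otimes> y)" using S_in[OF s(1)] assms by simp
  thus thesis using that[OF s] S_in[OF s(1)] assms by simp
qed

lemma S_uniq:
  assumes "s \<in> S" "s' \<in> S"
  shows "inv s \<otimes> s' \<in> Cent G g \<longleftrightarrow> s = s'"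
proof
  assume "inv s \<otimes> s' \<in> Cent G g"
  moreover have "inv s' \<otimes> s' \<in> Cent G g" using S_in[OF assms(2)] g by (simp add: Cent_iff)
  ultimately show "s = s'" using S assms S_in[OF assms(2)] unfolding coset_reps_def by blast
qed (use S_in[OF assms(2)] g in \<open>simp add: Cent_iff\<close>)

lemma finite_L: "finite L"
proof -
  have "L = (\<lambda>(s, j). Atom s j) ` (S \<times> {..<d})" by auto
  moreover have "finite S" using S fin finite_subset unfolding coset_reps_def by blast
  ultimately show ?thesis by simp
qed

lemma W_lin: "W y \<in> lin {..<d} L"
proof (rule linI)
  fix w l show "W y w l = (\<Sum>j<d. w j * W y (ket j) l)"
  proof (cases l)
    case (Atom s j)
    thus ?thesis using lin_at[OF \<rho>_lin, of "inv s \<otimes> y" w j] by (auto simp: itens_def)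
  qed (simp_all add: itens_def)
qed (auto simp: itens_def coords_def split: label.splits)

text \<open>The defining relation of the tensor product over the group algebra of the centraliser,
  recovered in the basis given by coset representatives.\<close>

lemma W_mult:
  assumes "y \<in> U" "e \<in> Cent G g"
  shows "W (y \<otimes> e) w = W y (\<rho> e w)"
proof
  fix l
  have "inv s \<otimes> (y \<otimes> e) = inv s \<otimes> y \<otimes> e" if "s \<in> S" for s
    using S_in[OF that] assms by (simp add: m_assoc Cent_def)
  thus "W (y \<otimes> e) w l = W y (\<rho> e w) l"
    using Cent_mult(2)[OF _ assms(2)] \<rho>_mult[OF _ assms(2)] S_in assms(1)
    by (auto simp: itens_def split: label.splits)
qed

lemma W_ket:
  assumes s: "s \<in> S" and j: "j < d" shows "W s (ket j) = ket (Atom s j)"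
proof
  fix l
  have "\<rho> \<one> (ket j) = ket j" unfolding \<rho>_one by (rule id_map_eq) (use j in \<open>simp_all add: ket_coords\<close>)
  thus "W s (ket j) l = ket (Atom s j) l"
    using S_uniq[OF _ s] S_in[OF s] s j by (auto simp: itens_def ket_def split: label.splits)
qed

lemma act_lin: "act V (h, t) \<in> lin L L"
  unfolding simple_obj_def hmodule.simps prod.case
  by (rule lin_ext_lin[OF finite_L]) (auto simp: itens_def coords_def split: label.splits)

lemma act_W:
  assumes "h \<in> U" "t \<in> U" "y \<in> U"
  shows "act V (h, t) (W y w) = (if h = cj (t \<otimes> y) g then W (t \<otimes> y) w else (\<lambda>_. 0))"
proof -
  \<comment> \<open>The definition gives the action on s \<otimes> w_j for representatives s only.
    For a general y = s e the factor e is moved into the representation.\<close>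
  obtain s e where s: "s \<in> S" "e \<in> Cent G g" "y = s \<otimes> e" "s \<in> U" "e \<in> U" by (rule S_rep[OF assms(3)])
  have "act V (h, t) \<circ> W s = (\<lambda>w. if h = cj (t \<otimes> s) g then W (t \<otimes> s) w else (\<lambda>_. 0))"
  proof (rule lin_eqI[OF lin_comp[OF W_lin act_lin]])
    show "(\<lambda>w. if h = cj (t \<otimes> s) g then W (t \<otimes> s) w else (\<lambda>_. 0)) \<in> lin {..<d} L"
      using W_lin lin_zero_map by (cases "h = cj (t \<otimes> s) g") simp_all
    fix j assume "j \<in> {..<d}"
    thus "(act V (h, t) \<circ> W s) (ket j) = (if h = cj (t \<otimes> s) g then W (t \<otimes> s) (ket j) else (\<lambda>_. 0))"
      using s(1) by (auto simp: W_ket simple_obj_def finite_L)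
  qed
  from fun_cong[OF this, of "\<rho> e w"] show ?thesis
    using W_mult[OF s(4,2)] W_mult[OF m_closed[OF assms(2) s(4)] s(2)] Cent_mult(1)[OF m_closed[OF assms(2) s(4)] s(2)]
    by (simp add: s(3) m_assoc[OF assms(2) s(4,5)])
qed

lemma L_eqI:
  assumes "f \<in> lin L K" "f' \<in> lin L K'" "\<And>s j. s \<in> S \<Longrightarrow> j < d \<Longrightarrow> f (W s (ket j)) = f' (W s (ket j))"
  shows "f = f'"
  by (rule lin_eqI[OF assms(1,2)]) (use assms(3) in \<open>auto simp: W_ket\<close>)

lemma labels_V: "labels V = L"
  by (simp add: simple_obj_def)

lemma md_V: "md V"
proof (rule moduleI)
  show "finite (labels V)" "act V (x, y) \<in> lin (labels V) (labels V)" for x y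
    using finite_L act_lin by (simp_all add: labels_V)
  have "(\<lambda>v l. \<Sum>x\<in>U. act V (x, \<one>) v l) = id_map L"
  proof (rule L_eqI[OF lin_sum_maps id_map_lin[OF finite_L]])
    fix s j assume s: "s \<in> S" "j < d"
    have "(\<Sum>x\<in>U. act V (x, \<one>) (W s (ket j)) l) = (\<Sum>x\<in>U. if x = cj s g then W s (ket j) l else 0)" for l
      by (rule sum.cong) (use S_in[OF s(1)] act_W in simp_all)
    thus "(\<lambda>l. \<Sum>x\<in>U. act V (x, \<one>) (W s (ket j)) l) = id_map L (W s (ket j))"
      using S_in[OF s(1)] g id_map_eq[OF finite_L lin_coords[OF W_lin]] by simp
  qed (rule act_lin)
  thus "(\<lambda>v l. \<Sum>x\<in>U. act V (x, \<one>) v l) = id_map (labels V)" by (simp add: labels_V)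
  fix x y x' y' v assume m: "x \<in> U" "y \<in> U" "x' \<in> U" "y' \<in> U"
  have "act V (x, y) \<circ> act V (x', y') = (\<lambda>v. if x = cj y x' then act V (x, y \<otimes> y') v else (\<lambda>_. 0))"
  proof (rule L_eqI[OF lin_comp[OF act_lin act_lin]])
    show "(\<lambda>v. if x = cj y x' then act V (x, y \<otimes> y') v else (\<lambda>_. 0)) \<in> lin L L"
      using act_lin lin_zero_map by (cases "x = cj y x'") simp_all
    fix s j assume s: "s \<in> S" "j < d"
    show "(act V (x, y) \<circ> act V (x', y')) (W s (ket j)) = (if x = cj y x' then act V (x, y \<otimes> y') (W s (ket j)) else (\<lambda>_. 0))"
      using m S_in[OF s(1)] g lin_zero[OF act_lin] by (auto simp: act_W cj_cj[symmetric] m_assoc)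
  qed
  from fun_cong[OF this, of v] show "act V (x, y) (act V (x', y') v) = (if x = cj y x' then act V (x, y \<otimes> y') v else (\<lambda>_. 0))"
    by simp
qed

lemma deg_W: "y \<in> U \<Longrightarrow> deg V (cj y g) (W y w)"
  using g lin_coords[OF W_lin] by (simp add: deg_def labels_V act_W)

end

context fin_group
begin

section \<open>Twisting simple objects by a bicharacter\<close>

lemma irrep_simple_object:
  assumes "g \<in> U" "irrep G (Cent G g) d \<rho>" "coset_reps G (Cent G g) S"
  shows "simple_object G g d (\<rho> :: 'a \<Rightarrow> (nat \<Rightarrow> 'k::field) \<Rightarrow> nat \<Rightarrow> 'k) S"
  by unfold_locales (use assms in \<open>auto simp: irrep_def\<close>)

lemma twist_simple_object:
  assumes c: "bichar G c" and "simple_object G g d (\<rho> :: 'a \<Rightarrow> (nat \<Rightarrow> 'k::field) \<Rightarrow> nat \<Rightarrow> 'k) S"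
  shows "simple_object G g d (\<lambda>t v. scl (c g t) (\<rho> t v)) S"
proof -
  interpret simple_object G g d \<rho> S by fact
  show ?thesis
  proof unfold_locales
    show "g \<in> U" "coset_reps G (Cent G g) S" by (rule g, rule S)
    show "(\<lambda>v. scl (c g t) (\<rho> t v)) \<in> lin {..<d} {..<d}" if "t \<in> Cent G g" for t by (rule lin_scl_map[OF \<rho>_lin[OF that]])
    show "(\<lambda>v. scl (c g \<one>) (\<rho> \<one> v)) = id_map {..<d}" by (simp add: bichar_one[OF c g] \<rho>_one)
    fix s t assume st: "s \<in> Cent G g" "t \<in> Cent G g"
    hence m: "s \<in> U" "t \<in> U" by (simp_all add: Cent_def)
    show "(\<lambda>v. scl (c g (s \<otimes> t)) (\<rho> (s \<otimes> t) v)) = (\<lambda>v. scl (c g s) (\<rho> s v)) \<circ> (\<lambda>v. scl (c g t) (\<rho> t v))"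
      by (simp add: fun_eq_iff[of _ "_ \<circ> _"] \<rho>_mult[OF st] lin_scl[OF \<rho>_lin[OF st(1)]] bicharD(3)[OF c m g])
  qed
qed

text \<open>The two objects have the same labels, but moving e out of s e produces \<rho>(e) in one
  and c(g, e) \<rho>(e) in the other. The diagonal map with entries c(g, s) compensates, since c(g,
  s e) = c(g, s) c(g, e).\<close>

lemma twist_Iso:
  assumes c: "bichar G c" and "simple_object G g d (\<rho> :: 'a \<Rightarrow> (nat \<Rightarrow> 'k::field) \<Rightarrow> nat \<Rightarrow> 'k) S"
  defines "\<rho>b \<equiv> (\<lambda>t v. scl (c g t) (\<rho> t v))"
  obtains \<theta> where "\<theta> \<in> Iso C (simple_obj G g d \<rho>b S) (FObj (Fb c \<beta>) (simple_obj G g d \<rho> S))"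
    "\<And>y v. y \<in> U \<Longrightarrow> \<theta> (itens G g d \<rho>b S y v) = scl (c g y) (itens G g d \<rho> S y v)"
proof -
  interpret X: simple_object G g d \<rho> S by fact
  interpret Xb: simple_object G g d \<rho>b S unfolding \<rho>b_def by (rule twist_simple_object[OF c X.simple_object_axioms])
  define D where "D = (\<lambda>f. lin_ext X.L (\<lambda>l. scl (case l of Atom s j \<Rightarrow> f s | _ \<Rightarrow> 0) (ket l)) :: ('a, 'k) dgmor)"
  have D_lin: "D f \<in> lin X.L X.L" for f
    unfolding D_def by (rule lin_ext_lin[OF X.finite_L]) (rule scl_coords[OF ket_coords])
  have D_ket: "D f (ket (Atom s j)) = scl (f s) (ket (Atom s j))" if "s \<in> S" "j < d" for f s j
    unfolding D_def using that by (subst lin_ext_ket[OF X.finite_L]) auto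
  let ?\<theta> = "D (c g)"
  have \<theta>: "?\<theta> (Xb.W y v) = scl (c g y) (X.W y v)" if y: "y \<in> U" for y v
  proof -
    obtain s e where s: "s \<in> S" "e \<in> Cent G g" "y = s \<otimes> e" "s \<in> U" "e \<in> U" by (rule X.S_rep[OF y])
    have "?\<theta> \<circ> Xb.W s = (\<lambda>v. scl (c g s) (X.W s v))"
      by (rule lin_eqI[OF lin_comp[OF Xb.W_lin D_lin] lin_scl_map[OF X.W_lin]])
        (use s(1) in \<open>simp add: X.W_ket Xb.W_ket D_ket\<close>)
    from fun_cong[OF this, of "\<rho>b e v"] have "?\<theta> (Xb.W s (\<rho>b e v)) = scl (c g s) (X.W s (\<rho>b e v))" by simp
    thus ?thesis
      using Xb.W_mult[OF s(4,2)] X.W_mult[OF s(4,2)] bicharD(3)[OF c s(4,5) X.g]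
      by (simp add: s(3) \<rho>b_def lin_scl[OF X.W_lin])
  qed
  have L: "Xb.L = X.L" by simp
  have "?\<theta> \<in> Iso C Xb.V (FObj (Fb c \<beta>) X.V)"
  proof (rule IsoI[OF Xb.md_V md_Fb[OF c X.md_V]])
    have "?\<theta> \<circ> act Xb.V (x, t) = act (FObj (Fb c \<beta>) X.V) (x, t) \<circ> ?\<theta>" if m: "x \<in> U" "t \<in> U" for x t
    proof (rule Xb.L_eqI[OF lin_comp[OF Xb.act_lin D_lin]])
      have "act (FObj (Fb c \<beta>) X.V) (x, t) \<in> lin X.L X.L"
        unfolding act_Fb[OF c m] by (rule lin_scl_map[OF X.act_lin])
      thus "act (FObj (Fb c \<beta>) X.V) (x, t) \<circ> ?\<theta> \<in> lin X.L X.L" by (rule lin_comp[OF D_lin])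
      fix s j assume s: "s \<in> S" "j < d"
      note s' = X.S_in[OF s(1)]
      \<comment> \<open>The degree reached is a conjugate of g, so the twisted action of t
        contributes just c(g, t).\<close>
      have "c (cj (t \<otimes> s) g) t * c g s = c g (t \<otimes> s)"
        using bichar_cj(1)[OF c m_closed[OF m(2) s'] X.g m(2)] bicharD(3)[OF c m(2) s' X.g] by simp
      thus "(?\<theta> \<circ> act Xb.V (x, t)) (Xb.W s (ket j)) = (act (FObj (Fb c \<beta>) X.V) (x, t) \<circ> ?\<theta>) (Xb.W s (ket j))"
        using m s' by (auto simp: \<theta> Xb.act_W X.act_W act_Fb[OF c] lin_zero[OF D_lin] lin_scl[OF X.act_lin])
    qed
    thus "?\<theta> \<in> Hom C Xb.V (FObj (Fb c \<beta>) X.V)" using D_lin by (auto simp: X.labels_V Xb.labels_V)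
    show "D (\<lambda>s. inverse (c g s)) \<in> lin (labels (FObj (Fb c \<beta>) X.V)) (labels Xb.V)"
      using D_lin by (simp add: X.labels_V Xb.labels_V)
    have inv: "D f \<circ> D f' = id_map X.L" if "\<And>s. s \<in> S \<Longrightarrow> f' s * f s = 1" for f f'
    proof (rule lin_eqI[OF lin_comp[OF D_lin D_lin] id_map_lin[OF X.finite_L]])
      fix i assume i: "i \<in> X.L"
      then obtain s j where "s \<in> S" "j < d" "i = Atom s j" by blast
      thus "(D f \<circ> D f') (ket i) = id_map X.L (ket i)"
        using that id_map_eq[OF X.finite_L ket_coords[OF i], where 'b='k] by (simp add: D_ket lin_scl[OF D_lin])
    qed
    show "D (\<lambda>s. inverse (c g s)) \<circ> ?\<theta> = id_map (labels Xb.V)" "?\<theta> \<circ> D (\<lambda>s. inverse (c g s)) = id_map (labels (FObj (Fb c \<beta>) X.V))"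
      using bicharD(1)[OF c X.g X.S_in] by (simp_all add: X.labels_V Xb.labels_V inv)
  qed
  thus thesis using \<theta> by (rule that)
qed

text \<open>Vectors s \<otimes> v are homogeneous of degree s g s^{-1}, which gives the scalar. The
  maps \<theta> and \<zeta> of \<open>twist_Iso\<close> make precise in which sense the functor
  sends a simple object to its twist.\<close>

lemma Psi_simple:
  fixes \<rho> :: "'a \<Rightarrow> (nat \<Rightarrow> 'k::field) \<Rightarrow> nat \<Rightarrow> 'k" and \<chi> :: "'a \<Rightarrow> (nat \<Rightarrow> 'k) \<Rightarrow> nat \<Rightarrow> 'k"
  assumes c: "bichar G c" and \<beta>: "\<beta> \<in> Zi"
    and "simple_object G g d \<rho> S" "simple_object G h e \<chi> T"
  defines "\<rho>b \<equiv> (\<lambda>t v. scl (c g t) (\<rho> t v))" and "\<chi>b \<equiv> (\<lambda>t v. scl (c h t) (\<chi> t v))"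
  defines "M \<equiv> simple_obj G g d \<rho> S" and "Mb \<equiv> simple_obj G g d \<rho>b S"
    and "M' \<equiv> simple_obj G h e \<chi> T" and "Mb' \<equiv> simple_obj G h e \<chi>b T"
  shows "s \<in> S \<Longrightarrow> r \<in> T \<Longrightarrow> FTen (Fb c \<beta>) M M' (tens (itens G g d \<rho> S s v) (itens G h e \<chi> T r w)) =
      scl (\<beta> (cj s g, cj r h)) (tens (itens G g d \<rho> S s v) (itens G h e \<chi> T r w))"
    "\<exists>\<theta>\<in>Iso C Mb (FObj (Fb c \<beta>) M). \<exists>\<zeta>\<in>Iso C Mb' (FObj (Fb c \<beta>) M').
      (\<forall>y\<in>U. \<forall>v\<in>coords {..<d}. \<theta> (itens G g d \<rho>b S y v) = scl (c g y) (itens G g d \<rho> S y v)) \<and>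
      (\<forall>y\<in>U. \<forall>w\<in>coords {..<e}. \<zeta> (itens G h e \<chi>b T y w) = scl (c h y) (itens G h e \<chi> T y w)) \<and>
      (let K = Cmp C (FTen (Fb c \<beta>) M M') (TMor C Mb Mb' \<theta> \<zeta>) in
        K \<in> Iso C (TObj C Mb Mb') (FObj (Fb c \<beta>) (TObj C M M')) \<and>
        (\<forall>s\<in>S. \<forall>r\<in>T. \<forall>v\<in>coords {..<d}. \<forall>w\<in>coords {..<e}. \<forall>x\<in>coords (labels Mb). \<forall>y\<in>coords (labels Mb').
          \<theta> x = itens G g d \<rho> S s v \<and> \<zeta> y = itens G h e \<chi> T r w \<longrightarrow>
          K (tens x y) = scl (\<beta> (cj s g, cj r h)) (tens (itens G g d \<rho> S s v) (itens G h e \<chi> T r w))))" (is ?ex)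
proof -
  interpret X: simple_object G g d \<rho> S by fact
  interpret P: simple_object G h e \<chi> T by fact
  note md = X.md_V[folded M_def] P.md_V[folded M'_def]
  have J: "act2 DD M M' (form \<beta>) (tens (X.W s v) (P.W r w)) = scl (\<beta> (cj s g, cj r h)) (tens (X.W s v) (P.W r w))"
    if "s \<in> S" "r \<in> T" for s r v w
    by (rule act2_form[OF md X.deg_W[folded M_def] P.deg_W[folded M'_def]]) (rule X.S_in[OF that(1)], rule P.S_in[OF that(2)])
  show "FTen (Fb c \<beta>) M M' (tens (X.W s v) (P.W r w)) = scl (\<beta> (cj s g, cj r h)) (tens (X.W s v) (P.W r w))"
    if "s \<in> S" "r \<in> T" using J[OF that] by simp
  obtain \<theta> where \<theta>: "\<theta> \<in> Iso C Mb (FObj (Fb c \<beta>) M)"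
    "\<And>y v. y \<in> U \<Longrightarrow> \<theta> (itens G g d \<rho>b S y v) = scl (c g y) (itens G g d \<rho> S y v)"
    by (rule twist_Iso[OF c X.simple_object_axioms, of \<beta>, folded \<rho>b_def, folded M_def Mb_def]) blast
  obtain \<zeta> where \<zeta>: "\<zeta> \<in> Iso C Mb' (FObj (Fb c \<beta>) M')"
    "\<And>y v. y \<in> U \<Longrightarrow> \<zeta> (itens G h e \<chi>b T y v) = scl (c h y) (itens G h e \<chi> T y v)"
    by (rule twist_Iso[OF c P.simple_object_axioms, of \<beta>, folded \<chi>b_def, folded M'_def Mb'_def]) blast
  have l: "\<theta> \<in> lin (labels Mb) (labels M)" "\<zeta> \<in> lin (labels Mb') (labels M')" using \<theta>(1) \<zeta>(1) by (auto simp: Iso_def)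
  have "act2 DD M M' (form \<beta>) \<circ> TMor C Mb Mb' \<theta> \<zeta> \<in> Iso C (TObj C Mb Mb') (FObj (Fb c \<beta>) (TObj C M M'))"
    by (rule Iso_comp[OF Iso_TMor[OF \<theta>(1) \<zeta>(1)] J_Iso[OF c \<beta> md]])
  moreover have "(act2 DD M M' (form \<beta>) \<circ> TMor C Mb Mb' \<theta> \<zeta>) (tens x y) =
      scl (\<beta> (cj s g, cj r h)) (tens (X.W s v) (P.W r w))"
    if "s \<in> S" "r \<in> T" "\<theta> x = X.W s v" "\<zeta> y = P.W r w" for s r v w x y
    using J[OF that(1,2)] that(3,4) by (simp add: TMor_tens[OF l])
  ultimately show ?ex
    using \<theta> \<zeta> by (intro bexI[of _ \<theta>] bexI[of _ \<zeta>]) (auto simp: Let_def)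
qed

end

theorem proposition4p9:
  fixes G :: "('g, 'm) monoid_scheme"
  assumes "group G" and "finite (carrier G)"
  shows "let
      Hm = (Hom_ab G :: ('g set \<Rightarrow> 'g set \<Rightarrow> 'k :: {alg_closed_field, field_char_0}) monoid);
      Zi = (Z2inv G :: ('g \<times> 'g \<Rightarrow> 'k) monoid);
      A = (Aut_Hopf (DG G) :: ('g, 'k) dg_aut monoid);
      AZ = (AutZ G :: (('g, 'k) dg_aut \<times> ('g, 'k) dg_form) monoid);
      OH = (OutH G :: (('g, 'k) dg_aut set \<times> ('g, 'k) dg_form set) monoid);
      C = (DGmod G :: (('g, 'k) dgmod, ('g, 'k) dgmor) bmcat)
    in
    \<comment> \<open>(i)\<close>
    (subgroup (Bsub G) A \<and>
     aut_of G \<in> iso Hm (A\<lparr>carrier := Bsub G\<rparr>) \<and>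
     subgroup (Bsub G \<times> Zhat G) AZ \<and>
     (\<lambda>(b, \<beta>). (aut_of G b, form_of G \<beta>)) \<in>
       iso (Hm \<times>\<times> Zi) (AZ\<lparr>carrier := Bsub G \<times> Zhat G\<rparr>) \<and>
     (\<forall>b \<in> carrier Hm. \<forall>\<beta> \<in> carrier Zi.
       let F = Psi G (aut_of G b, form_of G \<beta>) in
       monoidal_functor C F \<and>
       (\<forall>g \<in> carrier G. \<forall>h \<in> carrier G. \<forall>d \<rho> S e \<chi> T.
         irrep G (Cent G g) d \<rho> \<and> coset_reps G (Cent G g) S \<and>
         irrep G (Cent G h) e \<chi> \<and> coset_reps G (Cent G h) T \<longrightarrow>
         (let \<rho>b = (\<lambda>t v. scl (ev G b g t) (\<rho> t v));
              \<chi>b = (\<lambda>t v. scl (ev G b h t) (\<chi> t v));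
              M = simple_obj G g d \<rho> S; Mb = simple_obj G g d \<rho>b S;
              N = simple_obj G h e \<chi> T; Nb = simple_obj G h e \<chi>b T
          in
          (\<forall>s \<in> S. \<forall>r \<in> T. \<forall>v \<in> coords {..<d}. \<forall>w \<in> coords {..<e}.
             FTen F M N (tens (itens G g d \<rho> S s v) (itens G h e \<chi> T r w)) =
             scl (\<beta> (conj_by G s g, conj_by G r h))
               (tens (itens G g d \<rho> S s v) (itens G h e \<chi> T r w))) \<and>
          (\<exists>\<theta> \<in> Iso C Mb (FObj F M). \<exists>\<zeta> \<in> Iso C Nb (FObj F N).
             (\<forall>y \<in> carrier G. \<forall>v \<in> coords {..<d}.
                \<theta> (itens G g d \<rho>b S y v) = scl (ev G b g y) (itens G g d \<rho> S y v)) \<and>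
             (\<forall>y \<in> carrier G. \<forall>w \<in> coords {..<e}.
                \<zeta> (itens G h e \<chi>b T y w) = scl (ev G b h y) (itens G h e \<chi> T y w)) \<and>
             (let K = Cmp C (FTen F M N) (TMor C Mb Nb \<theta> \<zeta>) in
                K \<in> Iso C (TObj C Mb Nb) (FObj F (TObj C M N)) \<and>
                (\<forall>s \<in> S. \<forall>r \<in> T. \<forall>v \<in> coords {..<d}. \<forall>w \<in> coords {..<e}.
                 \<forall>x \<in> coords (labels Mb). \<forall>y \<in> coords (labels Nb).
                   \<theta> x = itens G g d \<rho> S s v \<and> \<zeta> y = itens G h e \<chi> T r w \<longrightarrow>
                   K (tens x y) = scl (\<beta> (conj_by G s g, conj_by G r h))
                     (tens (itens G g d \<rho> S s v) (itens G h e \<chi> T r w))))))))) \<and>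
    \<comment> \<open>(ii)\<close>
    (subgroup (BL G) (AZ\<lparr>carrier := Bsub G \<times> Zhat G\<rparr>) \<and>
     BL G = {x \<in> Bsub G \<times> Zhat G. braided_autoequivalence C (Psi G x)}) \<and>
    \<comment> \<open>(iii)\<close>
    (subgroup (Balt G) (A\<lparr>carrier := Bsub G\<rparr>) \<and>
     A\<lparr>carrier := Balt G\<rparr> \<cong> ext_square (dual_group (Gab G) :: ('g set \<Rightarrow> 'k) monoid) \<and>
     fst \<in> hom (AZ\<lparr>carrier := BL G\<rparr>) (A\<lparr>carrier := Balt G\<rparr>) \<and>
     fst ` carrier (AZ\<lparr>carrier := BL G\<rparr>) = Balt G) \<and>
    \<comment> \<open>(iv)\<close>
    (subgroup (BLtilde G) OH \<and>
     (\<exists>\<iota> \<pi>.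
       central_extension (H2distinv G :: ('g \<times> 'g \<Rightarrow> 'k) set monoid)
         (OH\<lparr>carrier := BLtilde G\<rparr>) (A\<lparr>carrier := Balt G\<rparr>) \<iota> \<pi> \<and>
       (\<forall>\<beta> \<in> carrier Zi. (\<one>\<^bsub>A\<^esub>, form_of G \<beta>) \<in> BL G \<longrightarrow>
          \<iota> (B2 G #>\<^bsub>Z2 G\<^esub> \<beta>) = to_OutH G (\<one>\<^bsub>A\<^esub>, form_of G \<beta>)) \<and>
       (\<forall>x \<in> BL G. \<pi> (to_OutH G x) = fst x)))"
proof -
  interpret fin_group G by (rule fin_group.intro[OF assms(1)]) (unfold_locales, rule assms(2))
  note simples = Psi_simple[OF bichar_ev _ irrep_simple_object irrep_simple_object, folded aut_of_eq, unfolded Let_def]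
  show ?thesis
    unfolding Let_def
  proof (intro conjI ballI allI impI, goal_cases)
    case 1 show ?case by (rule subgroup_Bsub)
  next
    case 2 show ?case by (rule aut_of_iso)
  next
    case 3 show ?case by (rule subgroup_BZ)
  next
    case 4 show ?case by (rule BZ_iso)
  next
    case (5 b \<beta>) thus ?case unfolding aut_of_eq by (intro monoidal_Fb bichar_ev)
  next
    case (6 b \<beta> g h d \<rho> S e \<chi> T s r v w) thus ?case by (elim conjE) (rule simples(1))
  next
    case (7 b \<beta> g h d \<rho> S e \<chi> T) thus ?case by (elim conjE) (rule simples(2))
  next
    case 8 show ?case by (rule subgroup_BL)
  next
    case 9 show ?case by (rule BL_braided)
  next
    case 10 show ?case by (rule subgroup_Balt)
  next
    case 11 show ?case by (rule Balt_iso_ext_square)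
  next
    case 12 show ?case by (rule fst_BL_hom)
  next
    case 13 show ?case using fst_BL_surj by simp
  next
    case 14 show ?case by (rule subgroup_BLtilde)
  next
    case 15
    have "iota (B2 G #>\<^bsub>Z2 G\<^esub> \<beta>) = to_OutH G (\<one>\<^bsub>Aut_Hopf (DG G)\<^esub>, form_of G \<beta>)"
      if "\<beta> \<in> carrier (Z2inv G)" "(\<one>\<^bsub>Aut_Hopf (DG G)\<^esub>, form_of G \<beta>) \<in> BL G" for \<beta> :: "'g \<times> 'g \<Rightarrow> 'k"
    proof -
      \<comment> \<open>A pair in \<open>BL\<close> with trivial first component has symmetric
        \<beta>, so \<open>iota\<close> can be evaluated at \<beta> itself.\<close>
      have s: "symm \<beta>" by (rule symm_BL) (use that in simp_all)
      show ?thesis using iota_coh[OF that(1) s] cls_symm[OF that(1) s] by (simp add: coh_def)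
    qed
    thus ?case using central_extension_BLtilde proj_to_OutH
      by (intro exI[of _ iota] exI[of _ proj] conjI ballI impI) simp_all
  qed
qed

end
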